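(* Let $(X,d)$ be an unbounded uniform metric space, let $b\in\partial X$ be a fixed base point, write $|x|:=d(b,x)$, and let $\rho:(0,\infty)\to(0,\infty)$ be a Borel measurable function with $\int_0^\infty\rho(t)\,dt<\infty$. Assume that (A) there is a constant $C_A$ such that $\rho(r)\le C_A\,\rho(s)$ whenever $0<r\le 2s+1$ and $0<s\le 2r+1$; and (B) there is a positive constant $C_B$ such that $\int_r^\infty\rho(t)\,dt\le C_B(r+1)\rho(r)$ for every $r>0$. Let $d_\rho$ be the sphericalized metric on $X$. Then the following hold. (a) The space $(X,d_\rho)$ is bounded; the completion of $X$ with respect to $d_\rho$ adds to the completion of $X$ with respect to $d$ exactly one point (called $\infty$); and $(X,d_\rho)$ is a uniform space. (b) Let $(X,d)$ be equipped with a doubling measure $\mu$, let $\sigma>0$, and let $\mu_\rho$ be given by $\mu_\rho(A)=\int_A\rho(|x|)^\sigma\,d\mu(x)$. Suppose that $\rho$ also satisfies (C) there is a positive constant $C_C$ such that $\int_{X\setminus B(b,r)}\rho(|x|)^\sigma\,d\mu(x)\le C_C\,\rho(r)^\sigma\,\mu(B(b,r+1))$ for every $r>0$. Then $\mu_\rho$ is doubling in the space $(X,d_\rho)$. (c) Let $1\le p<\infty$, let $(X,d)$ be equipped with a doubling measure $\mu$ such that $(X,d,\mu)$ supports a $p$-Poincaré inequality, let $\sigma>0$, and let $\mu_\rho$ be as in (b). Suppose that $\rho$ is also lower semicontinuous and satisfies (C). Then $(X,d_\rho,\mu_\rho)$ supports a $p$-Poincaré inequality.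
   Context: For a metric space $(Z,d_Z)$, $\overline Z^{d_Z}$ denotes its metric completion and $\partial Z=\overline Z^{d_Z}\setminus Z$. In particular $\partial X=\overline X^d\setminus X$; the metric $d$ is extended to $\overline X^d$. $B(x,r)=\{y\in X: d(x,y)<r\}$ for $x\in\overline X^d$, $r>0$. A curve is a continuous map $\gamma$ from a compact interval into the space (its image is also denoted $\gamma$); $\ell_{d_Z}(\gamma)$ is its length with respect to $d_Z$ (supremum of $\sum_j d_Z(\gamma(t_{j-1}),\gamma(t_j))$ over partitions), and $\gamma$ is rectifiable if its length is finite. For a nonnegative Borel function $g$ and a rectifiable $\gamma$, $\int_\gamma g\,ds=\int_0^{\ell(\gamma)}g(\gamma_d(u))\,du$, where $\gamma_d$ is the arc-length parametrization. Uniform space: for $C_U\ge1$, a curve $\gamma:[s,u]\to\overline Z^{d_Z}$ connecting $x$ to $y$ is $C_U$-uniform in $(Z,d_Z)$ if (i) $\ell_{d_Z}(\gamma)\le C_U d_Z(x,y)$ and (ii) for every $t\in[s,u]$, $\min\{\ell_{d_Z}(\gamma|_{[s,t]}),\ell_{d_Z}(\gamma|_{[t,u]})\}\le C_U\inf_{w\in\partial Z}d_Z(\gamma(t),w)$. $(Z,d_Z)$ is uniform if it is locally compact, not complete, and there is a constant $C_U\ge1$ such that any two points of $Z$ can be connected by a curve in $Z$ that is $C_U$-uniform in $(Z,d_Z)$. Sphericalized metric: $d_\rho(x,y)=\inf_\gamma\int_\gamma\rho(|\cdot|)\,ds$, the infimum being over all curves in $X$ that are rectifiable with respect to $d$ and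 have end points $x,y\in X$; the path integral is with respect to $d$. The assertion on completions means that, with points of completions identified with equivalence classes of Cauchy sequences in $X$, $\overline X^d$ is naturally a subset of $\overline X^{d_\rho}$ and $\overline X^{d_\rho}\setminus\overline X^d$ contains exactly one point. Measures: $\mu$ is Borel regular, and doubling means there is $C_\mu>1$ with $0<\mu(B(x,2r))\le C_\mu\,\mu(B(x,r))<\infty$ for all $x\in X$, $r>0$. Doubling of $\mu_\rho$ in $(X,d_\rho)$ is the same with balls $B_\rho(x,r)=\{y\in X:d_\rho(x,y)<r\}$. Upper gradient: a nonnegative Borel function $g$ on $(Z,d_Z)$ is an upper gradient of an extended real-valued $u$ if $|u(\gamma(t))-u(\gamma(s))|\le\int_\gamma g\,ds_Z$ for each non-constant compact rectifiable curve $\gamma:[s,t]\to Z$ (where $\int_\gamma g\,ds_Z=\infty$ is required if $|u|$ is infinite at an end point); $ds_Z$ is arc length with respect to $d_Z$. $p$-Poincaré inequality: $(Z,d_Z,\mu_Z)$ supports one if there exist $C_P>0$, $\lambda\ge1$ such that for every ball $B=B_Z(z,r)$, $z\in Z$, $r>0$, with $\lambda B=B_Z(z,\lambda r)$ and $u_B=\frac1{\mu_Z(B)}\int_Bu\,d\mu_Z$, $$\frac1{\mu_Z(B)}\int_B|u-u_B|\,d\mu_Z\le C_P\,r\left(\frac1{\mu_Z(\lambda B)}\int_{\lambda B}g^p\,d\mu_Z\right)^{1/p}$$ whenever $u\in L^1(\lambda B)$ and $g$ is an upper gradient of $u$ in $\lambda B$. *)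

theory Defs
  imports "HOL-Analysis.Analysis"
begin

text \<open>
  Since two metrics on the same set are compared throughout, metric spaces are given by a carrier
  and a distance function, as in the locale \<^locale>\<open>Metric_space\<close>.
\<close>

section \<open>Metric completion\<close>

definition cauchy_rel :: "'a set \<Rightarrow> ('a \<Rightarrow> 'a \<Rightarrow> real) \<Rightarrow> ((nat \<Rightarrow> 'a) \<times> (nat \<Rightarrow> 'a)) set" where
  "cauchy_rel Z d = {(s, t). Metric_space.MCauchy Z d s \<and> Metric_space.MCauchy Z d t \<and>
     (\<lambda>n. d (s n) (t n)) \<longlonglongrightarrow> 0}"

definition completion :: "'a set \<Rightarrow> ('a \<Rightarrow> 'a \<Rightarrow> real) \<Rightarrow> (nat \<Rightarrow> 'a) set set" where
  "completion Z d = {s. Metric_space.MCauchy Z d s} // cauchy_rel Z d"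

definition embed :: "'a set \<Rightarrow> ('a \<Rightarrow> 'a \<Rightarrow> real) \<Rightarrow> 'a \<Rightarrow> (nat \<Rightarrow> 'a) set" where
  "embed Z d x = cauchy_rel Z d `` {\<lambda>_. x}"

text \<open>The extension of \<open>d\<close> to the completion; the limit does not depend on the representatives.\<close>

definition cdist :: "('a \<Rightarrow> 'a \<Rightarrow> real) \<Rightarrow> (nat \<Rightarrow> 'a) set \<Rightarrow> (nat \<Rightarrow> 'a) set \<Rightarrow> real" where
  "cdist d S T = lim (\<lambda>n. d ((SOME s. s \<in> S) n) ((SOME t. t \<in> T) n))"

definition boundary :: "'a set \<Rightarrow> ('a \<Rightarrow> 'a \<Rightarrow> real) \<Rightarrow> (nat \<Rightarrow> 'a) set set" where
  "boundary Z d = completion Z d - embed Z d ` Z"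

text \<open>
  The first two conjuncts say that the natural map from the completion with respect to \<open>d\<close> to the
  completion with respect to \<open>d'\<close>, which sends the \<open>d\<close>-class of a sequence to its \<open>d'\<close>-class,
  is well defined and injective; the third says that it misses exactly one point.
\<close>

definition completion_adds_one_point ::
    "'a set \<Rightarrow> ('a \<Rightarrow> 'a \<Rightarrow> real) \<Rightarrow> ('a \<Rightarrow> 'a \<Rightarrow> real) \<Rightarrow> bool" where
  "completion_adds_one_point Z d d' \<longleftrightarrow>
     (\<forall>s. Metric_space.MCauchy Z d s \<longrightarrow> Metric_space.MCauchy Z d' s) \<and>
     (\<forall>s t. Metric_space.MCauchy Z d s \<longrightarrow> Metric_space.MCauchy Z d t \<longrightarrow>
        ((s, t) \<in> cauchy_rel Z d \<longleftrightarrow> (s, t) \<in> cauchy_rel Z d')) \<and>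
     (\<exists>\<omega>. completion Z d' - (\<lambda>S. cauchy_rel Z d' `` S) ` completion Z d = {\<omega>})"

section \<open>Curves, length and path integrals\<close>

definition curve :: "'a set \<Rightarrow> ('a \<Rightarrow> 'a \<Rightarrow> real) \<Rightarrow> real \<Rightarrow> real \<Rightarrow> (real \<Rightarrow> 'a) \<Rightarrow> bool" where
  "curve Z d a b \<gamma> \<longleftrightarrow> a \<le> b \<and>
     continuous_map (top_of_set {a..b}) (Metric_space.mtopology Z d) \<gamma>"

definition curve_length :: "('a \<Rightarrow> 'a \<Rightarrow> real) \<Rightarrow> (real \<Rightarrow> 'a) \<Rightarrow> real \<Rightarrow> real \<Rightarrow> ennreal" where
  "curve_length d \<gamma> a b =
     Sup {ennreal (\<Sum>j<n. d (\<gamma> (t j)) (\<gamma> (t (Suc j)))) | (n::nat) (t::nat \<Rightarrow> real).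
            t 0 = a \<and> t n = b \<and> (\<forall>j<n. t j \<le> t (Suc j))}"

definition rectifiable_curve ::
    "'a set \<Rightarrow> ('a \<Rightarrow> 'a \<Rightarrow> real) \<Rightarrow> real \<Rightarrow> real \<Rightarrow> (real \<Rightarrow> 'a) \<Rightarrow> bool" where
  "rectifiable_curve Z d a b \<gamma> \<longleftrightarrow> curve Z d a b \<gamma> \<and> curve_length d \<gamma> a b < \<infinity>"

text \<open>
  The choice of \<open>t\<close> is immaterial: the curve is constant between two parameters with the same
  value of the length function.
\<close>

definition arc_length_param ::
    "('a \<Rightarrow> 'a \<Rightarrow> real) \<Rightarrow> (real \<Rightarrow> 'a) \<Rightarrow> real \<Rightarrow> real \<Rightarrow> real \<Rightarrow> 'a" where
  "arc_length_param d \<gamma> a b u = \<gamma> (SOME t. t \<in> {a..b} \<and> curve_length d \<gamma> a t = ennreal u)"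

definition path_integral ::
    "('a \<Rightarrow> 'a \<Rightarrow> real) \<Rightarrow> (real \<Rightarrow> 'a) \<Rightarrow> real \<Rightarrow> real \<Rightarrow> ('a \<Rightarrow> ennreal) \<Rightarrow> ennreal" where
  "path_integral d \<gamma> a b g =
     (\<integral>\<^sup>+u\<in>{0..enn2real (curve_length d \<gamma> a b)}. g (arc_length_param d \<gamma> a b u) \<partial>lborel)"

section \<open>Uniform spaces\<close>

definition uniform_curve ::
    "'a set \<Rightarrow> ('a \<Rightarrow> 'a \<Rightarrow> real) \<Rightarrow> real \<Rightarrow> real \<Rightarrow> real \<Rightarrow> (real \<Rightarrow> 'a) \<Rightarrow> bool" where
  "uniform_curve Z d C a b \<gamma> \<longleftrightarrow> curve Z d a b \<gamma> \<and>
     curve_length d \<gamma> a b \<le> ennreal (C * d (\<gamma> a) (\<gamma> b)) \<and>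
     (\<forall>t\<in>{a..b}. min (curve_length d \<gamma> a t) (curve_length d \<gamma> t b)
        \<le> ennreal (C * (INF w\<in>boundary Z d. cdist d (embed Z d (\<gamma> t)) w)))"

definition uniform_space :: "'a set \<Rightarrow> ('a \<Rightarrow> 'a \<Rightarrow> real) \<Rightarrow> bool" where
  "uniform_space Z d \<longleftrightarrow> Metric_space Z d \<and>
     locally_compact_space (Metric_space.mtopology Z d) \<and>
     \<not> Metric_space.mcomplete Z d \<and>
     (\<exists>C\<ge>1. \<forall>x\<in>Z. \<forall>y\<in>Z. \<exists>a b \<gamma>. uniform_curve Z d C a b \<gamma> \<and> \<gamma> a = x \<and> \<gamma> b = y)"

section \<open>Sphericalization\<close>

definition base_norm ::
    "'a set \<Rightarrow> ('a \<Rightarrow> 'a \<Rightarrow> real) \<Rightarrow> (nat \<Rightarrow> 'a) set \<Rightarrow> 'a \<Rightarrow> real" where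
  "base_norm X d b x = cdist d b (embed X d x)"

definition base_ball ::
    "'a set \<Rightarrow> ('a \<Rightarrow> 'a \<Rightarrow> real) \<Rightarrow> (nat \<Rightarrow> 'a) set \<Rightarrow> real \<Rightarrow> 'a set" where
  "base_ball X d b r = {y \<in> X. base_norm X d b y < r}"

text \<open>
  An infinite infimum would be turned into \<open>0\<close> by \<^const>\<open>enn2real\<close>. This is detected by the
  separation axiom whenever the result is asserted to be a metric on \<open>X\<close>.
\<close>

definition sph_dist ::
    "'a set \<Rightarrow> ('a \<Rightarrow> 'a \<Rightarrow> real) \<Rightarrow> (nat \<Rightarrow> 'a) set \<Rightarrow> (real \<Rightarrow> real) \<Rightarrow> 'a \<Rightarrow> 'a \<Rightarrow> real" where
  "sph_dist X d b \<rho> x y = enn2real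
     (Inf {path_integral d \<gamma> s u (\<lambda>z. ennreal (\<rho> (base_norm X d b z))) | \<gamma> s u.
             rectifiable_curve X d s u \<gamma> \<and> \<gamma> s = x \<and> \<gamma> u = y})"

definition sph_measure :: "'a set \<Rightarrow> ('a \<Rightarrow> 'a \<Rightarrow> real) \<Rightarrow> (nat \<Rightarrow> 'a) set \<Rightarrow> (real \<Rightarrow> real) \<Rightarrow>
    real \<Rightarrow> 'a measure \<Rightarrow> 'a measure" where
  "sph_measure X d b \<rho> \<sigma> \<mu> = density \<mu> (\<lambda>x. ennreal (\<rho> (base_norm X d b x) powr \<sigma>))"

definition tail_condition :: "'a set \<Rightarrow> ('a \<Rightarrow> 'a \<Rightarrow> real) \<Rightarrow> (nat \<Rightarrow> 'a) set \<Rightarrow> (real \<Rightarrow> real) \<Rightarrow>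
    real \<Rightarrow> 'a measure \<Rightarrow> bool" where
  "tail_condition X d b \<rho> \<sigma> \<mu> \<longleftrightarrow> (\<exists>C>0. \<forall>r>0.
     (\<integral>\<^sup>+x\<in>X - base_ball X d b r. ennreal (\<rho> (base_norm X d b x) powr \<sigma>) \<partial>\<mu>)
       \<le> ennreal (C * \<rho> r powr \<sigma>) * emeasure \<mu> (base_ball X d b (r + 1)))"

definition lower_semicontinuous_on :: "real set \<Rightarrow> (real \<Rightarrow> real) \<Rightarrow> bool" where
  "lower_semicontinuous_on S f \<longleftrightarrow> (\<forall>t\<in>S. \<forall>c<f t. \<forall>\<^sub>F s in at t within S. c < f s)"

section \<open>Measures and Poincare inequalities\<close>

definition metric_borel :: "'a set \<Rightarrow> ('a \<Rightarrow> 'a \<Rightarrow> real) \<Rightarrow> 'a measure" where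
  "metric_borel Z d = sigma Z {U. openin (Metric_space.mtopology Z d) U}"

text \<open>
  The sigma-algebra may be any one between the Borel sets and the Caratheodory-measurable sets of a
  Borel regular outer measure.
\<close>

definition borel_regular_measure :: "'a set \<Rightarrow> ('a \<Rightarrow> 'a \<Rightarrow> real) \<Rightarrow> 'a measure \<Rightarrow> bool" where
  "borel_regular_measure Z d \<mu> \<longleftrightarrow> space \<mu> = Z \<and> sets (metric_borel Z d) \<subseteq> sets \<mu> \<and>
     (\<forall>A\<in>sets \<mu>. \<exists>B\<in>sets (metric_borel Z d). A \<subseteq> B \<and> emeasure \<mu> B = emeasure \<mu> A)"

definition doubling :: "'a set \<Rightarrow> ('a \<Rightarrow> 'a \<Rightarrow> real) \<Rightarrow> 'a measure \<Rightarrow> bool" where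
  "doubling Z d \<mu> \<longleftrightarrow> (\<exists>C>1. \<forall>x\<in>Z. \<forall>r>0.
     0 < emeasure \<mu> (Metric_space.mball Z d x (2 * r)) \<and>
     emeasure \<mu> (Metric_space.mball Z d x (2 * r))
       \<le> ennreal C * emeasure \<mu> (Metric_space.mball Z d x r) \<and>
     ennreal C * emeasure \<mu> (Metric_space.mball Z d x r) < \<infinity>)"

definition upper_gradient ::
    "'a set \<Rightarrow> ('a \<Rightarrow> 'a \<Rightarrow> real) \<Rightarrow> ('a \<Rightarrow> ereal) \<Rightarrow> ('a \<Rightarrow> ennreal) \<Rightarrow> bool" where
  "upper_gradient Z d u g \<longleftrightarrow> g \<in> borel_measurable (metric_borel Z d) \<and>
     (\<forall>a b \<gamma>. rectifiable_curve Z d a b \<gamma> \<and> \<not> \<gamma> constant_on {a..b} \<longrightarrow>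
        (if \<bar>u (\<gamma> a)\<bar> = \<infinity> \<or> \<bar>u (\<gamma> b)\<bar> = \<infinity> then path_integral d \<gamma> a b g = \<infinity>
         else e2ennreal \<bar>u (\<gamma> b) - u (\<gamma> a)\<bar> \<le> path_integral d \<gamma> a b g))"

text \<open>Powers of \<open>[0, \<infinity>]\<close>-valued quantities; only used for positive exponents.\<close>

definition enn_powr :: "ennreal \<Rightarrow> real \<Rightarrow> ennreal" where
  "enn_powr x a = (if x = \<infinity> then \<infinity> else ennreal (enn2real x powr a))"

definition L1_on :: "'a measure \<Rightarrow> 'a set \<Rightarrow> ('a \<Rightarrow> ereal) \<Rightarrow> bool" where
  "L1_on \<mu> A u \<longleftrightarrow> u \<in> borel_measurable (restrict_space \<mu> A) \<and>
     (\<integral>\<^sup>+x\<in>A. e2ennreal \<bar>u x\<bar> \<partial>\<mu>) < \<infinity>"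

text \<open>For \<open>u \<in> L\<^sup>1\<close> the set where \<open>u\<close> is infinite is null, so it does not affect the mean.\<close>

definition mean_value :: "'a measure \<Rightarrow> 'a set \<Rightarrow> ('a \<Rightarrow> ereal) \<Rightarrow> real" where
  "mean_value \<mu> B u = (LINT x:B|\<mu>. real_of_ereal (u x)) / measure \<mu> B"

definition supports_poincare ::
    "'a set \<Rightarrow> ('a \<Rightarrow> 'a \<Rightarrow> real) \<Rightarrow> 'a measure \<Rightarrow> real \<Rightarrow> bool" where
  "supports_poincare Z d \<mu> p \<longleftrightarrow> (\<exists>C>0. \<exists>\<Lambda>\<ge>1. \<forall>z\<in>Z. \<forall>r>0. \<forall>u g.
     (let B = Metric_space.mball Z d z r; \<Lambda>B = Metric_space.mball Z d z (\<Lambda> * r) in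
        L1_on \<mu> \<Lambda>B u \<and> upper_gradient \<Lambda>B d u g \<longrightarrow>
        (\<integral>\<^sup>+x\<in>B. e2ennreal \<bar>u x - ereal (mean_value \<mu> B u)\<bar> \<partial>\<mu>) / emeasure \<mu> B
          \<le> ennreal (C * r) *
             enn_powr ((\<integral>\<^sup>+x\<in>\<Lambda>B. enn_powr (g x) p \<partial>\<mu>) / emeasure \<mu> \<Lambda>B) (1 / p)))"

end

theory Submission
  imports Defs "HOL-Probability.Distribution_Functions"
begin

text \<open>
  Write \<open>N x = 1 + d(b,x)\<close> and \<open>\<kappa> s = s * \<rho> s\<close>. Condition (A) says that the weight is essentially
  constant where \<open>N\<close> is comparable to a constant, and condition (B) that the integral of \<open>\<rho>\<close> over
  \<open>{s..}\<close> is at most a multiple of \<open>\<kappa> s\<close>. From this it follows that \<open>\<kappa>\<close> is almost decreasing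
  (\<open>kappa_almost_decreasing\<close>) and even decays logarithmically (\<open>kappa_log_decay\<close>). In particular
  the weight is bounded.

  Everything rests on a two-sided estimate of the new distance (\<open>wdist_lower\<close>, \<open>wdist_upper\<close>): up
  to constants, the distance of \<open>x\<close> and \<open>y\<close> is
  \<open>\<rho> (N x) * min (d x y) (N x) + \<rho> (N y) * min (d x y) (N y)\<close>. The lower bound holds since every
  curve starting at \<open>x\<close> has to pass through a region around \<open>x\<close> in which the weight is essentially
  constant. For the upper bound one uses a uniform curve from \<open>x\<close> to \<open>y\<close>. As it moves away from
  the boundary, and hence from \<open>b\<close>, \<open>N\<close> grows in proportion to the length passed in the first
  half, so that the path integral is essentially an integral of \<open>\<rho>\<close> over an interval.

  (a) The estimate shows that the new metric has the same topology, and that a Cauchy sequence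
  for it is a Cauchy sequence for \<open>d\<close> unless \<open>N\<close> tends to infinity along it. Since points with
  \<open>N x \<ge> S\<close> have distance at most a multiple of \<open>\<kappa> S\<close> from each other and \<open>\<kappa>\<close> tends to \<open>0\<close>, all
  sequences of the second kind represent one point, at distance comparable to \<open>\<kappa> (N x)\<close> from \<open>x\<close>.
  Uniform curves for \<open>d\<close> are uniform for the new metric, too (\<open>wint_quasi_geodesic\<close>,
  \<open>ucurve_cone\<close>).

  (b) A ball with centre \<open>x\<close> and radius \<open>r\<close> small compared with \<open>\<kappa> (N x)\<close> is comparable to the
  \<open>d\<close>-ball of radius \<open>r / \<rho> (N x)\<close>, on which the density of the new measure is essentially
  constant, so that doubling is inherited. A large ball contains a \<open>d\<close>-ball of radius comparable
  to \<open>N z\<close> around some point \<open>z\<close> such that all points of the doubled ball are at least about as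
  far out as \<open>z\<close> (\<open>large_ball_corkscrew\<close>). By (C), the set of all these points has measure
  comparable to that of the \<open>d\<close>-ball.

  (c) Since the new arc length satisfies \<open>ds' \<le> \<rho> ds\<close>, an upper gradient \<open>g\<close> for the new metric
  gives the upper gradient \<open>g * \<rho>\<close> for \<open>d\<close> (\<open>upper_gradient_transfer\<close>). So the Poincare inequality
  for \<open>d\<close> yields the one for small balls. Chains of small balls give an inequality on the annuli
  where \<open>N\<close> is comparable to \<open>S\<close> (\<open>annulus_poincare\<close>), and a summation over dyadic annuli one on
  the sets \<open>{x. S \<le> N x}\<close> (\<open>tail_poincare\<close>), where the almost monotonicity of \<open>\<kappa>\<close> and (C)
  bound the contributions of the annuli, and the bounded overlap of slightly larger annuli bounds their sum. Large balls are contained in such sets of comparable measure. The means of \<open>u\<close> are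
  replaced by arbitrary constants throughout, as this changes the oscillation at most by a factor
  of two (\<open>dev_mean_le\<close>).
\<close>

section \<open>Arc length\<close>

lemma partition_mono:
  fixes t :: "nat \<Rightarrow> real"
  assumes "\<And>j. j < n \<Longrightarrow> t j \<le> t (Suc j)" "i \<le> j" "j \<le> n"
  shows "t i \<le> t j"
  using assms(2,3)
proof (induction j rule: dec_induct)
  case (step k) then show ?case using assms(1)[of k] by auto
qed simp

lemma sum_lessThan_add: "sum f {..<n + m} = sum f {..<n} + (\<Sum>j<m. f (n + j))"
  for f :: "nat \<Rightarrow> real"
  by (induction m) auto

lemma curve_length_least:
  assumes "\<And>t n. \<lbrakk>t 0 = a; t n = b; \<And>j. j < n \<Longrightarrow> t j \<le> t (Suc j)\<rbrakk> \<Longrightarrow>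
     ennreal (\<Sum>j<n. d (\<gamma> (t j)) (\<gamma> (t (Suc j)))) \<le> C"
  shows "curve_length d \<gamma> a b \<le> C"
  unfolding curve_length_def by (rule Sup_least) (use assms in blast)

context Metric_space
begin

lemma curve_length_upper:
  assumes "t 0 = a" "t n = b" "\<And>j. j < n \<Longrightarrow> t j \<le> t (Suc j)"
  shows "ennreal (\<Sum>j<n. d (\<gamma> (t j)) (\<gamma> (t (Suc j)))) \<le> curve_length d \<gamma> a b"
  unfolding curve_length_def by (rule Sup_upper) (use assms in blast)

lemma dist_le_curve_length:
  assumes "a \<le> b" shows "ennreal (d (\<gamma> a) (\<gamma> b)) \<le> curve_length d \<gamma> a b"
  using curve_length_upper[of "\<lambda>j. if j = 0 then a else b" a 1 b \<gamma>] assms by auto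

text \<open>
  Subadditivity is obtained without inserting \<open>b\<close> into a given partition: the
  truncations of the partition at \<open>b\<close> from above and from below are themselves partitions.
\<close>

lemma curve_length_add:
  assumes ab: "a \<le> b" and bc: "b \<le> c" and g: "\<And>t. t \<in> {a..c} \<Longrightarrow> \<gamma> t \<in> M"
  shows "curve_length d \<gamma> a c = curve_length d \<gamma> a b + curve_length d \<gamma> b c"
proof (rule antisym)
  show "curve_length d \<gamma> a c \<le> curve_length d \<gamma> a b + curve_length d \<gamma> b c"
  proof (rule curve_length_least)
    fix t and n :: nat assume t: "t 0 = a" "t n = c" "\<And>j. j < n \<Longrightarrow> t j \<le> t (Suc j)"
    note m = partition_mono[of n t, OF t(3)]
    have tin: "t j \<in> {a..c}" if "j \<le> n" for j using m[of 0 j] m[of j n] t that by auto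
    let ?p = "\<lambda>j. min (t j) b" and ?q = "\<lambda>j. max (t j) b"
    have le: "d (\<gamma> (t j)) (\<gamma> (t (Suc j))) \<le> d (\<gamma> (?p j)) (\<gamma> (?p (Suc j))) + d (\<gamma> (?q j)) (\<gamma> (?q (Suc j)))"
      if j: "j < n" for j
    proof -
      have *: "\<gamma> (t j) \<in> M" "\<gamma> (t (Suc j)) \<in> M" "\<gamma> b \<in> M"
        using tin[of j] tin[of "Suc j"] j g ab bc by auto
      show ?thesis
        using triangle[OF *(1) *(3) *(2)] t(3)[OF j] * 
        by (auto simp: min_def max_def)
    qed
    have "(\<Sum>j<n. d (\<gamma> (t j)) (\<gamma> (t (Suc j)))) \<le>
        (\<Sum>j<n. d (\<gamma> (?p j)) (\<gamma> (?p (Suc j)))) + (\<Sum>j<n. d (\<gamma> (?q j)) (\<gamma> (?q (Suc j))))"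
      unfolding sum.distrib[symmetric] by (intro sum_mono) (use le in auto)
    then have "ennreal (\<Sum>j<n. d (\<gamma> (t j)) (\<gamma> (t (Suc j)))) \<le>
        ennreal (\<Sum>j<n. d (\<gamma> (?p j)) (\<gamma> (?p (Suc j)))) + ennreal (\<Sum>j<n. d (\<gamma> (?q j)) (\<gamma> (?q (Suc j))))"
      by (subst ennreal_plus[symmetric]) (auto intro!: sum_nonneg ennreal_leI)
    also have "\<dots> \<le> curve_length d \<gamma> a b + curve_length d \<gamma> b c"
      by (intro add_mono curve_length_upper) (use t ab bc in \<open>auto simp: min_def max_def intro: order_trans\<close>)
    finally show "ennreal (\<Sum>j<n. d (\<gamma> (t j)) (\<gamma> (t (Suc j)))) \<le> curve_length d \<gamma> a b + curve_length d \<gamma> b c" .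
  qed
next
  define P where "P a b = {(n::nat, t::nat \<Rightarrow> real). t 0 = a \<and> t n = b \<and> (\<forall>j<n. t j \<le> t (Suc j))}" for a b
  define S where "S = (\<lambda>(n::nat, t::nat \<Rightarrow> real). ennreal (\<Sum>j<n. d (\<gamma> (t j)) (\<gamma> (t (Suc j)))))"
  have L: "curve_length d \<gamma> a b = (SUP x\<in>P a b. S x)" for a b
    unfolding curve_length_def P_def S_def by (rule arg_cong[of _ _ Sup]) (auto simp: image_def)
  have ne: "P a b \<noteq> {}" if "a \<le> b" for a b
    unfolding P_def using that by (auto intro!: exI[of _ "1::nat"] exI[of _ "\<lambda>j::nat. if j = 0 then a else b"])
  have key: "S x + S y \<le> curve_length d \<gamma> a c" if xy: "x \<in> P a b" "y \<in> P b c" for x y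
  proof -
    obtain n t where x: "x = (n, t)" by force
    obtain m s where y: "y = (m, s)" by force
    have t: "t 0 = a" "t n = b" "\<forall>j<n. t j \<le> t (Suc j)" using xy x by (auto simp: P_def)
    have s: "s 0 = b" "s m = c" "\<forall>j<m. s j \<le> s (Suc j)" using xy y by (auto simp: P_def)
    let ?r = "\<lambda>j. if j \<le> n then t j else s (j - n)"
    have "(\<Sum>j<n+m. d (\<gamma> (?r j)) (\<gamma> (?r (Suc j)))) =
       (\<Sum>j<n. d (\<gamma> (?r j)) (\<gamma> (?r (Suc j)))) + (\<Sum>j<m. d (\<gamma> (?r (n+j))) (\<gamma> (?r (Suc (n+j)))))"
      using sum_lessThan_add[of "\<lambda>j. d (\<gamma> (?r j)) (\<gamma> (?r (Suc j)))" n m] by simp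
    also have "(\<Sum>j<n. d (\<gamma> (?r j)) (\<gamma> (?r (Suc j)))) = (\<Sum>j<n. d (\<gamma> (t j)) (\<gamma> (t (Suc j))))"
      by (intro sum.cong) auto
    also have "(\<Sum>j<m. d (\<gamma> (?r (n+j))) (\<gamma> (?r (Suc (n+j))))) = (\<Sum>j<m. d (\<gamma> (s j)) (\<gamma> (s (Suc j))))"
    proof (intro sum.cong refl)
      fix j
      have 1: "?r (n+j) = s j" using s t by (cases "j = 0") auto
      have 2: "?r (Suc (n+j)) = s (Suc j)" by auto
      show "d (\<gamma> (?r (n+j))) (\<gamma> (?r (Suc (n+j)))) = d (\<gamma> (s j)) (\<gamma> (s (Suc j)))"
        unfolding 1 2 ..
    qed
    finally have e: "(\<Sum>j<n+m. d (\<gamma> (?r j)) (\<gamma> (?r (Suc j)))) =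
       (\<Sum>j<n. d (\<gamma> (t j)) (\<gamma> (t (Suc j)))) + (\<Sum>j<m. d (\<gamma> (s j)) (\<gamma> (s (Suc j))))" .
    have r: "?r j \<le> ?r (Suc j)" if "j < n + m" for j
    proof -
      consider "j < n" | "j = n" | "j > n" by linarith
      then show ?thesis
      proof cases
        case 2
        then have "0 < m" using that by simp
        then have "s 0 \<le> s (Suc 0)" using s by auto
        then show ?thesis using s(1) t(2) 2 by simp
      next
        case 3 then have "Suc j - n = Suc (j - n)" "j - n < m" using that by auto
        then show ?thesis using s 3 by auto
      qed (use t in auto)
    qed
    have "ennreal (\<Sum>j<n+m. d (\<gamma> (?r j)) (\<gamma> (?r (Suc j)))) \<le> curve_length d \<gamma> a c"
      by (intro curve_length_upper r) (use s t in auto)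
    then show ?thesis unfolding x y S_def e by (subst (asm) ennreal_plus) (auto intro: sum_nonneg)
  qed
  have "(SUP x\<in>P a b. S x) + S y \<le> curve_length d \<gamma> a c" if "y \<in> P b c" for y
    unfolding ennreal_SUP_add_left[OF ne[OF ab], symmetric] by (intro SUP_least key that)
  then have "curve_length d \<gamma> a b + S y \<le> curve_length d \<gamma> a c" if "y \<in> P b c" for y
    unfolding L[of a b] using that .
  then have "(SUP y\<in>P b c. curve_length d \<gamma> a b + S y) \<le> curve_length d \<gamma> a c"
    by (intro SUP_least)
  then show "curve_length d \<gamma> a b + curve_length d \<gamma> b c \<le> curve_length d \<gamma> a c"
    unfolding L[of b c] using ennreal_SUP_add_right[OF ne[OF bc], of "curve_length d \<gamma> a b" S] by argo
qed

lemma curve_length_mono: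
  assumes "a \<le> a'" "a' \<le> b'" "b' \<le> b" and g: "\<And>t. t \<in> {a..b} \<Longrightarrow> \<gamma> t \<in> M"
  shows "curve_length d \<gamma> a' b' \<le> curve_length d \<gamma> a b"
proof -
  have e1: "curve_length d \<gamma> a b = curve_length d \<gamma> a a' + curve_length d \<gamma> a' b"
    by (rule curve_length_add) (use assms in auto)
  have e2: "curve_length d \<gamma> a' b = curve_length d \<gamma> a' b' + curve_length d \<gamma> b' b"
    by (rule curve_length_add) (use assms in auto)
  show ?thesis unfolding e1 e2 by (intro add_increasing add_increasing2) simp_all
qed

lemma curve_length_refl: "\<gamma> a \<in> M \<Longrightarrow> curve_length d \<gamma> a a = 0"
proof -
  assume g: "\<gamma> a \<in> M"
  have "curve_length d \<gamma> a a \<le> 0"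
  proof (rule curve_length_least)
    fix t and n :: nat assume t: "t 0 = a" "t n = a" "\<And>j. j < n \<Longrightarrow> t j \<le> t (Suc j)"
    note m = partition_mono[of n t, OF t(3)]
    have "t j = a" if "j \<le> n" for j using m[of 0 j] m[of j n] t that by auto
    then show "ennreal (\<Sum>j<n. d (\<gamma> (t j)) (\<gamma> (t (Suc j)))) \<le> 0" using g by simp
  qed
  then show ?thesis by simp
qed

lemma curve_in: "curve M d a b \<gamma> \<Longrightarrow> t \<in> {a..b} \<Longrightarrow> \<gamma> t \<in> M"
  unfolding curve_def using continuous_map_image_subset_topspace by fastforce

lemma curve_dist_continuous:
  assumes "curve M d a b \<gamma>" and "continuous_on S p" "continuous_on S q" "p ` S \<subseteq> {a..b}" "q ` S \<subseteq> {a..b}"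
  shows "continuous_on S (\<lambda>t. d (\<gamma> (p t)) (\<gamma> (q t)))"
proof -
  have c: "continuous_map (top_of_set {a..b}) mtopology \<gamma>" using assms by (simp add: curve_def)
  have "continuous_map (top_of_set S) mtopology (\<lambda>t. \<gamma> (p t))"
    using continuous_map_compose[OF _ c, of "top_of_set S" p] assms(2,4) by (simp add: o_def image_subset_iff_funcset)
  moreover have "continuous_map (top_of_set S) mtopology (\<lambda>t. \<gamma> (q t))"
    using continuous_map_compose[OF _ c, of "top_of_set S" q] assms(3,5) by (simp add: o_def image_subset_iff_funcset)
  ultimately have "continuous_map (top_of_set S) euclideanreal (\<lambda>t. d (\<gamma> (p t)) (\<gamma> (q t)))"
    using continuous_map_mdist[of "top_of_set S" "metric (M, d)" "\<lambda>t. \<gamma> (p t)" "\<lambda>t. \<gamma> (q t)"] by simp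
  then show ?thesis by simp
qed

text \<open>
  The length function is lower semicontinuous as a supremum of continuous functions. Since the
  same holds for the length of the remaining part of the curve, it is also upper semicontinuous.
\<close>

lemma continuous_on_curve_length:
  assumes r: "rectifiable_curve M d a b \<gamma>"
  shows "continuous_on {a..b} (\<lambda>t. enn2real (curve_length d \<gamma> a t))"
proof -
  have c: "curve M d a b \<gamma>" and fin: "curve_length d \<gamma> a b < \<infinity>" and ab: "a \<le> b"
    using r by (auto simp: rectifiable_curve_def curve_def)
  note g = curve_in[OF c]
  define L where "L t = curve_length d \<gamma> a t" for t
  define R where "R t = curve_length d \<gamma> t b" for t
  have add: "L t + R t = L b" if "t \<in> {a..b}" for t
    unfolding L_def R_def using curve_length_add[of a t b \<gamma>] that g by auto
  have Lfin: "L t < \<infinity>" "R t < \<infinity>" if "t \<in> {a..b}" for t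
  proof -
    have "L t + R t < \<infinity>" using add[OF that] fin unfolding L_def[symmetric] by simp
    then show "L t < \<infinity>" "R t < \<infinity>" by simp_all
  qed
  have ennL: "ennreal (enn2real (L t)) = L t" "ennreal (enn2real (R t)) = R t" if "t \<in> {a..b}" for t
    using Lfin[OF that] by auto
  have addr: "enn2real (L t) + enn2real (R t) = enn2real (L b)" if "t \<in> {a..b}" for t
    using add[OF that] Lfin[OF that] by (metis enn2real_plus infinity_ennreal_def)
  have lscL: "\<forall>\<^sub>F t in at t0 within {a..b}. c < enn2real (L t)"
    if t0: "t0 \<in> {a..b}" and lt: "c < enn2real (L t0)" for t0 c
  proof (cases "c < 0")
    case True then show ?thesis by (intro always_eventually allI order.strict_trans2[OF _ enn2real_nonneg])
  next
    case False
    then have "ennreal c < L t0" using lt ennL[OF t0] by (metis ennreal_lessI lt le_less_trans not_less)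
    then obtain n t where t: "t 0 = a" "t n = t0" "\<And>j. j < n \<Longrightarrow> t j \<le> t (Suc j)"
      and less: "ennreal c < ennreal (\<Sum>j<n. d (\<gamma> (t j)) (\<gamma> (t (Suc j))))"
      unfolding L_def curve_length_def less_Sup_iff by blast
    have tin: "t j \<in> {a..t0}" if "j \<le> n" for j
      using partition_mono[of n t 0 j] partition_mono[of n t j n] t that by auto
    define f where "f s = (\<Sum>j<n. d (\<gamma> (min (t j) s)) (\<gamma> (min (t (Suc j)) s)))" for s
    have "continuous_on {a..b} f"
      unfolding f_def
    proof (intro continuous_on_sum curve_dist_continuous[OF c] continuous_intros)
      fix j assume "j \<in> {..<n}"
      then show "(\<lambda>s. min (t j) s) ` {a..b} \<subseteq> {a..b}" "(\<lambda>s. min (t (Suc j)) s) ` {a..b} \<subseteq> {a..b}"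
        using tin[of j] tin[of "Suc j"] by auto
    qed
    then have "(f \<longlongrightarrow> f t0) (at t0 within {a..b})" using t0 by (simp add: continuous_on_def)
    moreover have "f t0 = (\<Sum>j<n. d (\<gamma> (t j)) (\<gamma> (t (Suc j))))"
      unfolding f_def
    proof (intro sum.cong refl)
      fix j assume "j \<in> {..<n}"
      then have "min (t j) t0 = t j" "min (t (Suc j)) t0 = t (Suc j)" using tin[of j] tin[of "Suc j"] by auto
      then show "d (\<gamma> (min (t j) t0)) (\<gamma> (min (t (Suc j)) t0)) = d (\<gamma> (t j)) (\<gamma> (t (Suc j)))" by simp
    qed
    then have "c < f t0" using less False by (simp add: ennreal_less_iff)
    ultimately have "\<forall>\<^sub>F s in at t0 within {a..b}. c < f s" by (rule order_tendstoD)
    moreover have le: "f s \<le> enn2real (L s)" if s: "s \<in> {a..b}" for s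
    proof -
      have "ennreal (f s) \<le> curve_length d \<gamma> a (min t0 s)"
        unfolding f_def by (intro curve_length_upper) (use s t t0 in \<open>auto simp: min_def intro: order_trans\<close>)
      also have "\<dots> \<le> L s" unfolding L_def by (intro curve_length_mono) (use s t0 g in auto)
      finally show ?thesis using ennL(1)[OF s] by (metis enn2real_nonneg ennreal_le_iff)
    qed
    ultimately show ?thesis
      unfolding eventually_at_filter by (elim eventually_mono) (meson le order.strict_trans2)
  qed
  have lscR: "\<forall>\<^sub>F t in at t0 within {a..b}. c < enn2real (R t)"
    if t0: "t0 \<in> {a..b}" and lt: "c < enn2real (R t0)" for t0 c
  proof (cases "c < 0")
    case True then show ?thesis by (intro always_eventually allI order.strict_trans2[OF _ enn2real_nonneg])
  next
    case False
    then have "ennreal c < R t0" using lt ennL[OF t0] by (metis ennreal_lessI lt le_less_trans not_less)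
    then obtain n t where t: "t 0 = t0" "t n = b" "\<And>j. j < n \<Longrightarrow> t j \<le> t (Suc j)"
      and less: "ennreal c < ennreal (\<Sum>j<n. d (\<gamma> (t j)) (\<gamma> (t (Suc j))))"
      unfolding R_def curve_length_def less_Sup_iff by blast
    have tin: "t j \<in> {t0..b}" if "j \<le> n" for j
      using partition_mono[of n t 0 j] partition_mono[of n t j n] t that by auto
    define f where "f s = (\<Sum>j<n. d (\<gamma> (max (t j) s)) (\<gamma> (max (t (Suc j)) s)))" for s
    have "continuous_on {a..b} f"
      unfolding f_def
    proof (intro continuous_on_sum curve_dist_continuous[OF c] continuous_intros)
      fix j assume "j \<in> {..<n}"
      then show "(\<lambda>s. max (t j) s) ` {a..b} \<subseteq> {a..b}" "(\<lambda>s. max (t (Suc j)) s) ` {a..b} \<subseteq> {a..b}"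
        using tin[of j] tin[of "Suc j"] by auto
    qed
    then have "(f \<longlongrightarrow> f t0) (at t0 within {a..b})" using t0 by (simp add: continuous_on_def)
    moreover have "f t0 = (\<Sum>j<n. d (\<gamma> (t j)) (\<gamma> (t (Suc j))))"
      unfolding f_def
    proof (intro sum.cong refl)
      fix j assume "j \<in> {..<n}"
      then have "max (t j) t0 = t j" "max (t (Suc j)) t0 = t (Suc j)" using tin[of j] tin[of "Suc j"] by auto
      then show "d (\<gamma> (max (t j) t0)) (\<gamma> (max (t (Suc j)) t0)) = d (\<gamma> (t j)) (\<gamma> (t (Suc j)))" by simp
    qed
    then have "c < f t0" using less False by (simp add: ennreal_less_iff)
    ultimately have "\<forall>\<^sub>F s in at t0 within {a..b}. c < f s" by (rule order_tendstoD)
    moreover have le: "f s \<le> enn2real (R s)" if s: "s \<in> {a..b}" for s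
    proof -
      have "ennreal (f s) \<le> curve_length d \<gamma> (max t0 s) b"
        unfolding f_def by (intro curve_length_upper) (use s t t0 in \<open>auto simp: max_def intro: order_trans\<close>)
      also have "\<dots> \<le> R s" unfolding R_def by (intro curve_length_mono) (use s t0 g in auto)
      finally show ?thesis using ennL(2)[OF s] by (metis enn2real_nonneg ennreal_le_iff)
    qed
    ultimately show ?thesis
      unfolding eventually_at_filter by (elim eventually_mono) (meson le order.strict_trans2)
  qed
  have "((\<lambda>t. enn2real (L t)) \<longlongrightarrow> enn2real (L t0)) (at t0 within {a..b})" if t0: "t0 \<in> {a..b}" for t0
  proof (rule order_tendstoI)
    fix c assume "enn2real (L t0) < c"
    then have "enn2real (L b) - c < enn2real (R t0)" using addr[OF t0] by simp
    from lscR[OF t0 this] show "\<forall>\<^sub>F t in at t0 within {a..b}. enn2real (L t) < c"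
      unfolding eventually_at_filter by (rule eventually_mono) (use addr in force)
  qed (use lscL t0 in auto)
  then show ?thesis by (simp add: continuous_on_def L_def)
qed

lemma curve_length_diff:
  assumes r: "rectifiable_curve M d a b \<gamma>" and st: "a \<le> s" "s \<le> t" "t \<le> b"
  shows "curve_length d \<gamma> s t =
    ennreal (enn2real (curve_length d \<gamma> a t) - enn2real (curve_length d \<gamma> a s))"
    and "d (\<gamma> s) (\<gamma> t) \<le> enn2real (curve_length d \<gamma> a t) - enn2real (curve_length d \<gamma> a s)"
proof -
  have c: "curve M d a b \<gamma>" and fin: "curve_length d \<gamma> a b < \<infinity>"
    using r by (auto simp: rectifiable_curve_def)
  note g = curve_in[OF c]
  have e: "curve_length d \<gamma> a t = curve_length d \<gamma> a s + curve_length d \<gamma> s t"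
    by (rule curve_length_add) (use st g in auto)
  have "curve_length d \<gamma> a t \<le> curve_length d \<gamma> a b"
    by (rule curve_length_mono) (use st g in auto)
  then have f: "curve_length d \<gamma> a t < top" using fin by auto
  then have f2: "curve_length d \<gamma> a s < top" "curve_length d \<gamma> s t < top" unfolding e by simp_all
  have e2: "enn2real (curve_length d \<gamma> a t) - enn2real (curve_length d \<gamma> a s) = enn2real (curve_length d \<gamma> s t)"
    unfolding e using f2 by (simp add: enn2real_plus)
  show e3: "curve_length d \<gamma> s t =
    ennreal (enn2real (curve_length d \<gamma> a t) - enn2real (curve_length d \<gamma> a s))"
    unfolding e2 using f2 by simp
  show "d (\<gamma> s) (\<gamma> t) \<le> enn2real (curve_length d \<gamma> a t) - enn2real (curve_length d \<gamma> a s)"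
    unfolding e2 using dist_le_curve_length[OF st(2), of \<gamma>] f2
    by (metis enn2real_nonneg ennreal_enn2real ennreal_le_iff)
qed

text \<open>
  This consequence of parametrization by arc length is all that the estimates need, and it is
  easily checked for restrictions, reversals and concatenations.
\<close>

definition lip_curve :: "real \<Rightarrow> (real \<Rightarrow> 'a) \<Rightarrow> bool" where
  "lip_curve l \<eta> \<longleftrightarrow> 0 \<le> l \<and> (\<forall>u\<in>{0..l}. \<eta> u \<in> M) \<and> (\<forall>u\<in>{0..l}. \<forall>v\<in>{0..l}. d (\<eta> u) (\<eta> v) \<le> \<bar>u - v\<bar>)"

lemma lip_curveD:
  assumes "lip_curve l \<eta>" "0 \<le> u" "u \<le> l"
  shows "\<eta> u \<in> M" "0 \<le> v \<Longrightarrow> v \<le> l \<Longrightarrow> d (\<eta> u) (\<eta> v) \<le> \<bar>u - v\<bar>"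
  using assms by (auto simp: lip_curve_def)

lemma ex_curve_length_eq:
  assumes r: "rectifiable_curve M d a b \<gamma>" and u: "0 \<le> u" "u \<le> enn2real (curve_length d \<gamma> a b)"
  shows "\<exists>t. t \<in> {a..b} \<and> curve_length d \<gamma> a t = ennreal u"
proof -
  have c: "curve M d a b \<gamma>" and fin: "curve_length d \<gamma> a b < \<infinity>" and ab: "a \<le> b"
    using r by (auto simp: rectifiable_curve_def curve_def)
  have "\<exists>t\<ge>a. t \<le> b \<and> enn2real (curve_length d \<gamma> a t) = u"
    by (rule IVT'[OF _ u(2) ab continuous_on_curve_length[OF r]])
      (use u curve_in[OF c, of a] ab in \<open>simp add: curve_length_refl\<close>)
  then obtain t where t: "t \<in> {a..b}" "enn2real (curve_length d \<gamma> a t) = u" by auto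
  have "curve_length d \<gamma> a t \<le> curve_length d \<gamma> a b"
    by (rule curve_length_mono) (use t curve_in[OF c] in auto)
  then have "curve_length d \<gamma> a t < top" using fin by auto
  then show ?thesis using t by auto
qed

lemma arc_length_param_eq:
  assumes r: "rectifiable_curve M d a b \<gamma>" and t: "t \<in> {a..b}" and e: "curve_length d \<gamma> a t = ennreal u" and "0 \<le> u"
  shows "arc_length_param d \<gamma> a b u = \<gamma> t"
proof -
  define s where "s = (SOME t. t \<in> {a..b} \<and> curve_length d \<gamma> a t = ennreal u)"
  have s: "s \<in> {a..b}" "curve_length d \<gamma> a s = ennreal u"
    unfolding s_def using someI[of "\<lambda>t. t \<in> {a..b} \<and> curve_length d \<gamma> a t = ennreal u" t] t e by auto
  have g: "\<gamma> s \<in> M" "\<gamma> t \<in> M" using r s t curve_in by (auto simp: rectifiable_curve_def)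
  have "d (\<gamma> s) (\<gamma> t) \<le> 0"
  proof (cases "s \<le> t")
    case True then show ?thesis using curve_length_diff(2)[OF r, of s t] s t e by auto
  next
    case False then show ?thesis using curve_length_diff(2)[OF r, of t s] s t e by (auto simp: commute)
  qed
  then have "\<gamma> s = \<gamma> t" using g nonneg[of "\<gamma> s" "\<gamma> t"] zero by (metis antisym)
  then show ?thesis by (simp add: arc_length_param_def s_def)
qed

text \<open>
  The part of the curve between two parameters is at least as long as its chord, so that the
  arc-length parametrization is 1-Lipschitz.
\<close>

lemma arc_length_param:
  assumes r: "rectifiable_curve M d a b \<gamma>"
  shows "t \<in> {a..b} \<Longrightarrow> arc_length_param d \<gamma> a b (enn2real (curve_length d \<gamma> a t)) = \<gamma> t"
    and "arc_length_param d \<gamma> a b 0 = \<gamma> a"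
    and "arc_length_param d \<gamma> a b (enn2real (curve_length d \<gamma> a b)) = \<gamma> b"
    and "lip_curve (enn2real (curve_length d \<gamma> a b)) (arc_length_param d \<gamma> a b)"
proof -
  have c: "curve M d a b \<gamma>" and fin: "curve_length d \<gamma> a b < \<infinity>" and ab: "a \<le> b"
    using r by (auto simp: rectifiable_curve_def curve_def)
  show 1: "arc_length_param d \<gamma> a b (enn2real (curve_length d \<gamma> a t)) = \<gamma> t" if t: "t \<in> {a..b}" for t
  proof (rule arc_length_param_eq[OF r t])
    have "curve_length d \<gamma> a t \<le> curve_length d \<gamma> a b"
      by (rule curve_length_mono) (use t curve_in[OF c] in auto)
    then have "curve_length d \<gamma> a t < top" using fin by auto
    then show "curve_length d \<gamma> a t = ennreal (enn2real (curve_length d \<gamma> a t))" by simp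
  qed simp
  show "arc_length_param d \<gamma> a b 0 = \<gamma> a"
    using 1[of a] ab curve_in[OF c, of a] by (simp add: curve_length_refl)
  show "arc_length_param d \<gamma> a b (enn2real (curve_length d \<gamma> a b)) = \<gamma> b" using 1[of b] ab by simp
  have *: "\<exists>t\<in>{a..b}. arc_length_param d \<gamma> a b u = \<gamma> t \<and> enn2real (curve_length d \<gamma> a t) = u"
    if "u \<in> {0..enn2real (curve_length d \<gamma> a b)}" for u
    using ex_curve_length_eq[OF r, of u] that 1 by (metis atLeastAtMost_iff enn2real_ennreal)
  show "lip_curve (enn2real (curve_length d \<gamma> a b)) (arc_length_param d \<gamma> a b)"
    unfolding lip_curve_def
  proof (intro conjI ballI)
    fix u v assume u: "u \<in> {0..enn2real (curve_length d \<gamma> a b)}" and v: "v \<in> {0..enn2real (curve_length d \<gamma> a b)}"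
    obtain s t where s: "s \<in> {a..b}" "arc_length_param d \<gamma> a b u = \<gamma> s" "enn2real (curve_length d \<gamma> a s) = u"
      and t: "t \<in> {a..b}" "arc_length_param d \<gamma> a b v = \<gamma> t" "enn2real (curve_length d \<gamma> a t) = v"
      using *[OF u] *[OF v] by blast
    show "arc_length_param d \<gamma> a b u \<in> M" using s curve_in[OF c] by simp
    show "d (arc_length_param d \<gamma> a b u) (arc_length_param d \<gamma> a b v) \<le> \<bar>u - v\<bar>"
    proof (cases "s \<le> t")
      case True then show ?thesis using curve_length_diff(2)[OF r, of s t] s t by auto
    next
      case False then show ?thesis using curve_length_diff(2)[OF r, of t s] s t by (auto simp: commute)
    qed
  qed simp
qed

lemma lip_curve_length:
  assumes "lip_curve l \<eta>" "0 \<le> u" "u \<le> v" "v \<le> l"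
  shows "curve_length d \<eta> u v \<le> ennreal (v - u)"
proof (rule curve_length_least)
  fix t and n :: nat assume t: "t 0 = u" "t n = v" "\<And>j. j < n \<Longrightarrow> t j \<le> t (Suc j)"
  have tin: "t j \<in> {0..l}" if "j \<le> n" for j
    using partition_mono[of n t 0 j] partition_mono[of n t j n] t that assms by auto
  have "(\<Sum>j<n. d (\<eta> (t j)) (\<eta> (t (Suc j)))) \<le> (\<Sum>j<n. t (Suc j) - t j)"
  proof (intro sum_mono)
    fix j assume "j \<in> {..<n}"
    then have "d (\<eta> (t j)) (\<eta> (t (Suc j))) \<le> \<bar>t j - t (Suc j)\<bar>" "t j \<le> t (Suc j)"
      using tin[of j] tin[of "Suc j"] lip_curveD(2)[OF assms(1), of "t j" "t (Suc j)"] t(3)[of j] by auto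
    then show "d (\<eta> (t j)) (\<eta> (t (Suc j))) \<le> t (Suc j) - t j" by simp
  qed
  also have "\<dots> = v - u" using sum_lessThan_telescope[of t n] t by simp
  finally show "ennreal (\<Sum>j<n. d (\<eta> (t j)) (\<eta> (t (Suc j)))) \<le> ennreal (v - u)" by (rule ennreal_leI)
qed

lemma lip_curve_continuous:
  assumes "lip_curve l \<eta>"
  shows "continuous_map (top_of_set {0..l}) mtopology \<eta>"
  unfolding continuous_map_to_metric
proof (intro ballI allI impI)
  fix x and e :: real assume x: "x \<in> topspace (top_of_set {0..l})" and e: "0 < e"
  show "\<exists>U. openin (top_of_set {0..l}) U \<and> x \<in> U \<and> (\<forall>y\<in>U. \<eta> y \<in> mball (\<eta> x) e)"
  proof (intro exI conjI ballI)
    show "openin (top_of_set {0..l}) ({0..l} \<inter> ball x e)" by (intro openin_open_Int) simp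
    show "x \<in> {0..l} \<inter> ball x e" using x e by simp
    fix y assume "y \<in> {0..l} \<inter> ball x e"
    then show "\<eta> y \<in> mball (\<eta> x) e"
      using lip_curveD(1)[OF assms, of x] lip_curveD(1)[OF assms, of y] lip_curveD(2)[OF assms, of x y] x
      by (auto simp: dist_real_def)
  qed
qed

lemma lip_curve_rectifiable:
  assumes "lip_curve l \<eta>" shows "rectifiable_curve M d 0 l \<eta>"
proof -
  have l: "0 \<le> l" using assms by (simp add: lip_curve_def)
  then show ?thesis
    using lip_curve_continuous[OF assms] lip_curve_length[OF assms, of 0 l]
    by (auto simp: rectifiable_curve_def curve_def intro: le_less_trans)
qed

end

section \<open>Change of variables for monotone functions\<close>

text \<open>
  The difference of the two distribution functions is nondecreasing and right continuous, hence
  the distribution function of a measure \<open>\<iota>\<close>. Then \<open>\<nu>\<close> and \<open>\<iota> + \<kappa>\<close> agree on half-open intervals,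
  and, being finite, on all Borel sets.
\<close>

lemma finite_borel_measure_le_on_Ioc:
  assumes fin: "finite_borel_measure \<nu>" "finite_borel_measure \<kappa>"
    and cont: "\<And>x. continuous (at_right x) (\<lambda>x. cdf \<nu> x - cdf \<kappa> x)"
    and le: "\<And>x y. x < y \<Longrightarrow> measure \<kappa> {x<..y} \<le> measure \<nu> {x<..y}"
    and A: "A \<in> sets borel"
  shows "emeasure \<kappa> A \<le> emeasure \<nu> A"
proof -
  interpret N: finite_borel_measure \<nu> by fact
  interpret K: finite_borel_measure \<kappa> by fact
  define F where "F x = cdf \<nu> x - cdf \<kappa> x" for x
  have mono: "F x \<le> F y" if "x \<le> y" for x y
  proof (cases "x = y")
    case False
    then have "x < y" using that by simp
    then show ?thesis using le[of x y] N.cdf_diff_eq[of x y] K.cdf_diff_eq[of x y] unfolding F_def by linarith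
  qed simp
  define \<iota> where "\<iota> = interval_measure F"
  have [simp]: "sets \<iota> = sets borel" "space \<iota> = UNIV" by (auto simp: \<iota>_def)
  have [simp]: "sets \<nu> = sets borel" "space \<nu> = UNIV" "sets \<kappa> = sets borel" "space \<kappa> = UNIV"
    using N.M_is_borel K.M_is_borel N.borel_UNIV K.borel_UNIV by auto
  have Ioc: "emeasure \<nu> {x<..y} = emeasure \<iota> {x<..y} + emeasure \<kappa> {x<..y}" for x y
  proof (cases "x < y")
    case True
    have "emeasure \<iota> {x<..y} = ennreal (F y - F x)"
      unfolding \<iota>_def using True mono cont by (subst emeasure_interval_measure_Ioc) (auto simp: F_def[abs_def])
    moreover have "F y - F x = measure \<nu> {x<..y} - measure \<kappa> {x<..y}"
      using N.cdf_diff_eq[OF True] K.cdf_diff_eq[OF True] by (simp add: F_def)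
    ultimately show ?thesis
      using le[OF True] by (simp add: N.emeasure_eq_measure K.emeasure_eq_measure ennreal_plus[symmetric] del: ennreal_plus)
  qed simp
  have lim: "(\<lambda>n. emeasure N {-real n<..real n}) \<longlonglongrightarrow> emeasure N UNIV" if "sets N = sets borel" for N :: "real measure"
  proof -
    have "(\<lambda>n. emeasure N {-real n<..real n}) \<longlonglongrightarrow> emeasure N (\<Union>n. {-real n<..real n})"
      by (rule Lim_emeasure_incseq) (auto simp: incseq_def that)
    then show ?thesis by (simp add: UN_Ioc_eq_UNIV)
  qed
  have "(\<lambda>n. emeasure \<nu> {-real n<..real n}) \<longlonglongrightarrow> emeasure \<iota> UNIV + emeasure \<kappa> UNIV"
    unfolding Ioc by (intro tendsto_add lim) simp_all
  then have tot: "emeasure \<nu> UNIV = emeasure \<iota> UNIV + emeasure \<kappa> UNIV"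
    using lim[of \<nu>] LIMSEQ_unique by fastforce
  have "A \<in> sigma_sets UNIV (range (\<lambda>(a, b). {a<..b::real}))"
    using A by (simp add: borel_sigma_sets_Ioc)
  then have "emeasure \<nu> A = emeasure \<iota> A + emeasure \<kappa> A"
  proof (rule sigma_sets_induct_disjoint[rotated 2])
    show "Int_stable (range (\<lambda>(a, b). {a<..b::real}))"
    proof (rule Int_stableI)
      fix a b :: "real set" assume "a \<in> range (\<lambda>(a, b). {a<..b})" "b \<in> range (\<lambda>(a, b). {a<..b})"
      then obtain p q r s where "a = {p<..q}" "b = {r<..s}" by auto
      then have "a \<inter> b = {max p r<..min q s}" by auto
      then show "a \<inter> b \<in> range (\<lambda>(a, b). {a<..b})" by (auto intro!: image_eqI[of _ _ "(max p r, min q s)"])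
    qed
    fix A assume "A \<in> range (\<lambda>(a, b). {a<..b::real})"
    then show "emeasure \<nu> A = emeasure \<iota> A + emeasure \<kappa> A" using Ioc by auto
  next
    fix A assume "A \<in> sigma_sets UNIV (range (\<lambda>(a, b). {a<..b::real}))"
      and e: "emeasure \<nu> A = emeasure \<iota> A + emeasure \<kappa> A"
    then have A: "A \<in> sets borel" by (simp add: borel_sigma_sets_Ioc)
    have sp: "emeasure N UNIV = emeasure N (UNIV - A) + emeasure N A" if "sets N = sets borel" for N :: "real measure"
      using plus_emeasure[of "UNIV - A" N A] A that by (simp add: Compl_eq_Diff_UNIV[symmetric])
    have "emeasure \<nu> (UNIV - A) + emeasure \<nu> A = (emeasure \<iota> (UNIV - A) + emeasure \<kappa> (UNIV - A)) + emeasure \<nu> A"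
      using tot unfolding sp[of \<nu>, simplified] sp[of \<iota>, simplified] sp[of \<kappa>, simplified] e by (simp add: ac_simps)
    then show "emeasure \<nu> (UNIV - A) = emeasure \<iota> (UNIV - A) + emeasure \<kappa> (UNIV - A)"
      using N.emeasure_finite[of A] ennreal_add_left_cancel by (auto simp: add.commute)
  next
    fix A :: "nat \<Rightarrow> real set" assume dis: "disjoint_family A"
      and sub: "range A \<subseteq> sigma_sets UNIV (range (\<lambda>(a, b). {a<..b::real}))"
      and e: "\<And>i. emeasure \<nu> (A i) = emeasure \<iota> (A i) + emeasure \<kappa> (A i)"
    have sub: "range A \<subseteq> sets borel" using sub by (simp add: borel_sigma_sets_Ioc)
    have s: "emeasure N (\<Union>i. A i) = (\<Sum>i. emeasure N (A i))" if "sets N = sets borel" for N :: "real measure"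
      using suminf_emeasure[of A N] sub dis that by simp
    show "emeasure \<nu> (\<Union>i. A i) = emeasure \<iota> (\<Union>i. A i) + emeasure \<kappa> (\<Union>i. A i)"
      by (simp add: s e suminf_add)
  qed auto
  then show ?thesis by (simp add: add_increasing)
qed

text \<open>
  By the last assumption, the image under \<open>\<phi>\<close> of the measure with density \<open>f\<close> gives to each
  interval in \<open>{0..\<phi> l}\<close> at least its length. So this image dominates Lebesgue measure, and the
  claim follows by integrating \<open>g\<close>.
\<close>

lemma nn_integral_change_of_variables_le:
  fixes \<phi> :: "real \<Rightarrow> real" and f g :: "real \<Rightarrow> ennreal"
  assumes l: "0 \<le> l" and mono: "\<And>u v. \<lbrakk>0 \<le> u; u \<le> v; v \<le> l\<rbrakk> \<Longrightarrow> \<phi> u \<le> \<phi> v"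
    and cont: "continuous_on {0..l} \<phi>" and \<phi>0: "\<phi> 0 = 0"
    and f[measurable]: "(\<lambda>u. f u * indicator {0..l} u) \<in> borel_measurable borel"
    and g[measurable]: "(\<lambda>v. g v * indicator {0..\<phi> l} v) \<in> borel_measurable borel"
    and fin: "(\<integral>\<^sup>+u\<in>{0..l}. f u \<partial>lborel) < \<infinity>"
    and le: "\<And>u v. \<lbrakk>0 \<le> u; u \<le> v; v \<le> l\<rbrakk> \<Longrightarrow> ennreal (\<phi> v - \<phi> u) \<le> (\<integral>\<^sup>+x\<in>{u..v}. f x \<partial>lborel)"
  shows "(\<integral>\<^sup>+v\<in>{0..\<phi> l}. g v \<partial>lborel) \<le> (\<integral>\<^sup>+u\<in>{0..l}. g (\<phi> u) * f u \<partial>lborel)"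
proof -
  define F where "F u = f u * indicator {0..l} u" for u
  have [measurable]: "F \<in> borel_measurable borel" using f by (simp add: F_def[abs_def])
  define \<psi> where "\<psi> u = \<phi> (max 0 (min u l))" for u
  have "mono \<psi>" unfolding mono_def \<psi>_def using l by (auto intro!: mono)
  then have [measurable]: "\<psi> \<in> borel_measurable borel" by (rule borel_measurable_mono)
  define L where "L = \<phi> l"
  have L: "0 \<le> L" using mono[of 0 l] l \<phi>0 by (simp add: L_def)
  define \<nu> where "\<nu> = distr (density lborel F) borel \<psi>"
  define \<kappa> where "\<kappa> = density lborel (indicator {0..L})"
  have em\<nu>: "emeasure \<nu> A = (\<integral>\<^sup>+u. F u * indicator A (\<psi> u) \<partial>lborel)" if [measurable]: "A \<in> sets borel" for A
  proof -
    have "emeasure \<nu> A = (\<integral>\<^sup>+u. F u * indicator (\<psi> -` A \<inter> space lborel) u \<partial>lborel)"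
      unfolding \<nu>_def using measurable_sets_borel[of \<psi> borel A]
      by (subst emeasure_distr) (auto simp: emeasure_density)
    then show ?thesis by (simp add: indicator_def)
  qed
  have em\<kappa>: "emeasure \<kappa> A = emeasure lborel ({0..L} \<inter> A)" if [measurable]: "A \<in> sets borel" for A
    unfolding \<kappa>_def by (simp add: emeasure_density indicator_inter_arith[symmetric] Int_commute)
  have "emeasure \<nu> UNIV < \<infinity>" using fin by (simp add: em\<nu> F_def)
  then have N: "finite_borel_measure \<nu>"
    by (auto simp: \<nu>_def finite_borel_measure_def finite_borel_measure_axioms_def intro!: finite_measureI)
  have "emeasure \<kappa> UNIV < \<infinity>" by (simp add: em\<kappa> L)
  then have K: "finite_borel_measure \<kappa>"
    by (auto simp: \<kappa>_def finite_borel_measure_def finite_borel_measure_axioms_def intro!: finite_measureI)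
  interpret N: finite_borel_measure \<nu> by fact
  interpret K: finite_borel_measure \<kappa> by fact
  have le': "measure \<kappa> {x<..y} \<le> measure \<nu> {x<..y}" if "x < y" for x y
  proof -
    have "emeasure \<kappa> {x<..y} \<le> emeasure \<nu> {x<..y}"
    proof (cases "max x 0 < min y L")
      case False
      then have "{0..L} \<inter> {x<..y} \<subseteq> {L, 0}" by auto
      then have "emeasure lborel ({0..L} \<inter> {x<..y}) \<le> emeasure lborel {L, 0}"
        by (rule emeasure_mono) simp
      also have "\<dots> = 0" by (intro emeasure_lborel_countable) simp
      finally show ?thesis by (simp add: em\<kappa>)
    next
      case True
      define x0 where "x0 = max x 0"
      define y0 where "y0 = min y L"
      have xy: "0 \<le> x0" "x0 < y0" "y0 \<le> L" using True by (auto simp: x0_def y0_def)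
      \<comment> \<open>The last parameter with value \<open>x0\<close>: later parameters have values strictly above \<open>x0\<close>.\<close>
      define S where "S = {0..l} \<inter> \<phi> -` {x0}"
      have "\<exists>u\<ge>0. u \<le> l \<and> \<phi> u = x0"
        by (rule IVT'[OF _ _ l cont]) (use xy \<phi>0 L_def in auto)
      then have "S \<noteq> {}" by (auto simp: S_def)
      moreover have "compact S"
        unfolding compact_eq_bounded_closed S_def
        using continuous_closed_preimage[OF cont closed_atLeastAtMost closed_singleton[of x0]]
        by (intro conjI bounded_subset[OF bounded_closed_interval[of 0 l]]) (simp_all, blast?)
      ultimately obtain u0 where u0: "u0 \<in> S" "\<And>u. u \<in> S \<Longrightarrow> u \<le> u0"
        using continuous_attains_sup[of S "\<lambda>x. x"] by auto
      have "\<exists>u\<ge>0. u \<le> l \<and> \<phi> u = y0"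
        by (rule IVT'[OF _ _ l cont]) (use xy \<phi>0 L_def in auto)
      then obtain v0 where v0: "0 \<le> v0" "v0 \<le> l" "\<phi> v0 = y0" by auto
      have u0': "0 \<le> u0" "u0 \<le> l" "\<phi> u0 = x0" using u0(1) by (auto simp: S_def)
      have uv: "u0 \<le> v0" using mono[of v0 u0] u0' v0 xy by (cases "u0 \<le> v0") auto
      have *: "F u * indicator {u0..v0} u \<le> F u * indicator {x<..y} (\<psi> u)" if "u \<noteq> u0" for u
      proof (cases "u \<in> {u0..v0}")
        case True
        then have u: "u0 < u" "u \<le> v0" using that by auto
        then have p: "\<psi> u = \<phi> u" using u0' v0 by (simp add: \<psi>_def)
        have "\<phi> u0 \<le> \<phi> u" "\<phi> u \<le> \<phi> v0" using mono u u0' v0 by auto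
        moreover have "\<phi> u \<noteq> x0" using u0(2)[of u] u u0' v0 by (auto simp: S_def)
        ultimately have "\<psi> u \<in> {x<..y}" using p u0' v0 by (auto simp: x0_def y0_def)
        then show ?thesis by (simp add: indicator_def)
      qed simp
      have "emeasure \<kappa> {x<..y} \<le> emeasure lborel {x0..y0}"
        unfolding em\<kappa>[of "{x<..y}", simplified] by (intro emeasure_mono) (auto simp: x0_def y0_def)
      also have "\<dots> = ennreal (\<phi> v0 - \<phi> u0)" using xy u0' v0 by simp
      also have "\<dots> \<le> (\<integral>\<^sup>+x\<in>{u0..v0}. f x \<partial>lborel)" by (rule le) (use u0' v0 uv in auto)
      also have "\<dots> = (\<integral>\<^sup>+u. F u * indicator {u0..v0} u \<partial>lborel)"
        by (intro nn_integral_cong) (use u0' v0 in \<open>auto simp: F_def indicator_def\<close>)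
      also have "\<dots> \<le> (\<integral>\<^sup>+u. F u * indicator {x<..y} (\<psi> u) \<partial>lborel)"
        by (intro nn_integral_mono_AE eventually_mono[OF AE_lborel_singleton[of u0]] *)
      also have "\<dots> = emeasure \<nu> {x<..y}" by (simp add: em\<nu>)
      finally show ?thesis .
    qed
    then show ?thesis by (simp add: N.emeasure_eq_measure K.emeasure_eq_measure)
  qed
  have "\<kappa> \<le> \<nu>"
  proof (subst le_measure)
    show "sets \<kappa> = sets \<nu>" by (simp add: \<kappa>_def \<nu>_def)
    show "\<forall>A\<in>sets \<kappa>. emeasure \<kappa> A \<le> emeasure \<nu> A"
    proof
      fix A assume "A \<in> sets \<kappa>"
      then have "A \<in> sets borel" by (simp add: \<kappa>_def)
      then show "emeasure \<kappa> A \<le> emeasure \<nu> A"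
        by (intro finite_borel_measure_le_on_Ioc[OF N K] le')
          (intro continuous_diff N.cdf_is_right_cont K.cdf_is_right_cont)
    qed
  qed
  have "(\<integral>\<^sup>+v\<in>{0..\<phi> l}. g v \<partial>lborel) = (\<integral>\<^sup>+v. g v * indicator {0..L} v \<partial>\<kappa>)"
    unfolding \<kappa>_def using g by (subst nn_integral_density) (auto simp: L_def indicator_def intro!: nn_integral_cong)
  also have "\<dots> \<le> (\<integral>\<^sup>+v. g v * indicator {0..L} v \<partial>\<nu>)"
    by (rule nn_integral_mono_measure[OF _ \<open>\<kappa> \<le> \<nu>\<close>]) (simp add: \<kappa>_def \<nu>_def)
  also have "\<dots> = (\<integral>\<^sup>+u. F u * (g (\<psi> u) * indicator {0..L} (\<psi> u)) \<partial>lborel)"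
    unfolding \<nu>_def using g by (subst nn_integral_distr) (auto simp: L_def nn_integral_density)
  also have "\<dots> \<le> (\<integral>\<^sup>+u\<in>{0..l}. g (\<phi> u) * f u \<partial>lborel)"
    by (intro nn_integral_mono) (auto simp: F_def \<psi>_def indicator_def ac_simps split: if_splits)
  finally show ?thesis .
qed

section \<open>Conformal change of a length metric\<close>

context Metric_space
begin

lemma lip_curve_measurable:
  fixes w :: "'a \<Rightarrow> ennreal"
  assumes "lip_curve l \<eta>" and w: "w \<in> borel_measurable (metric_borel M d)"
  shows "(\<lambda>u. w (\<eta> u) * indicator {0..l} u) \<in> borel_measurable borel"
proof -
  have "\<eta> \<in> measurable (restrict_space borel {0..l}) (metric_borel M d)"
    unfolding metric_borel_def
  proof (rule measurable_measure_of)
    show "{U. openin mtopology U} \<subseteq> Pow M" using openin_subset by fastforce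
    show "\<eta> \<in> space (restrict_space borel {0..l}) \<rightarrow> M"
      using lip_curveD(1)[OF assms(1)] by (auto simp: space_restrict_space)
    fix U assume "U \<in> {U. openin mtopology U}"
    then have "openin (top_of_set {0..l}) {x \<in> topspace (top_of_set {0..l}). \<eta> x \<in> U}"
      using openin_continuous_map_preimage[OF lip_curve_continuous[OF assms(1)]] by blast
    moreover have "{x \<in> topspace (top_of_set {0..l}). \<eta> x \<in> U} = \<eta> -` U \<inter> {0..l}" by auto
    ultimately obtain T where "open T" "\<eta> -` U \<inter> {0..l} = {0..l} \<inter> T" by (auto simp: openin_open)
    then show "\<eta> -` U \<inter> space (restrict_space borel {0..l}) \<in> sets (restrict_space borel {0..l})"
      by (auto simp: space_restrict_space sets_restrict_space)
  qed
  from measurable_compose[OF this w] show ?thesis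
    by (subst (asm) borel_measurable_restrict_space_iff_ennreal) auto
qed

lemma lip_curve_measurable_sub:
  fixes w :: "'a \<Rightarrow> ennreal"
  assumes "lip_curve l \<eta>" and w: "w \<in> borel_measurable (metric_borel M d)" and "0 \<le> u" "v \<le> l"
  shows "(\<lambda>x. w (\<eta> x) * indicator {u..v} x) \<in> borel_measurable borel"
proof -
  have "(\<lambda>x. (w (\<eta> x) * indicator {0..l} x) * indicator {u..v} x) \<in> borel_measurable borel"
    using lip_curve_measurable[OF assms(1,2)] by measurable
  also have "(\<lambda>x. (w (\<eta> x) * indicator {0..l} x) * indicator {u..v} x) = (\<lambda>x. w (\<eta> x) * indicator {u..v} x)"
    using assms(3,4) by (auto simp: indicator_def)
  finally show ?thesis .
qed

lemma lip_curve_sub: "lip_curve l \<eta> \<Longrightarrow> 0 \<le> u \<Longrightarrow> u \<le> v \<Longrightarrow> v \<le> l \<Longrightarrow> lip_curve (v - u) (\<lambda>x. \<eta> (u + x))"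
  unfolding lip_curve_def by (auto, smt (verit) atLeastAtMost_iff)

lemma lip_curve_rev: "lip_curve l \<eta> \<Longrightarrow> lip_curve l (\<lambda>x. \<eta> (l - x))"
  unfolding lip_curve_def by (auto, smt (verit) atLeastAtMost_iff)

lemma lip_curve_sub_integral:
  fixes w :: "'a \<Rightarrow> ennreal"
  assumes "lip_curve l \<eta>" and w: "w \<in> borel_measurable (metric_borel M d)" and "0 \<le> u" "v \<le> l"
  shows "(\<integral>\<^sup>+x\<in>{0..v - u}. w (\<eta> (u + x)) \<partial>lborel) = (\<integral>\<^sup>+x\<in>{u..v}. w (\<eta> x) \<partial>lborel)"
  using nn_integral_real_affine[OF lip_curve_measurable_sub[OF assms], of 1 u]
  by (auto simp: indicator_def intro!: nn_integral_cong)

lemma lip_curve_rev_integral: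
  fixes w :: "'a \<Rightarrow> ennreal"
  assumes "lip_curve l \<eta>" and w: "w \<in> borel_measurable (metric_borel M d)" and "0 \<le> u" "v \<le> l"
  shows "(\<integral>\<^sup>+x\<in>{l-v..l-u}. w (\<eta> (l - x)) \<partial>lborel) = (\<integral>\<^sup>+x\<in>{u..v}. w (\<eta> x) \<partial>lborel)"
  using nn_integral_real_affine[OF lip_curve_measurable_sub[OF assms], of "-1" l]
  by (auto simp: indicator_def intro!: nn_integral_cong)

end

text \<open>
  Let \<open>\<phi>\<close> map the arc-length parameter for \<open>d\<close> to the one for \<open>d'\<close>. By assumption its increments
  are at most the integrals of \<open>w\<close> along the curve, that is \<open>ds' \<le> w ds\<close>, and the claim is a
  change of variables. The bound \<open>K\<close> makes \<open>\<phi>\<close> Lipschitz, hence continuous.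
\<close>

lemma path_integral_density_le:
  fixes w g :: "'a \<Rightarrow> ennreal"
  assumes M: "Metric_space M d" "Metric_space M d'"
    and r: "rectifiable_curve M d a b \<gamma>" and r': "rectifiable_curve M d' a b \<gamma>"
    and w: "w \<in> borel_measurable (metric_borel M d)" and K: "\<And>x. x \<in> M \<Longrightarrow> w x \<le> ennreal K" "0 \<le> K"
    and g: "g \<in> borel_measurable (metric_borel M d')"
    and le: "\<And>s t. \<lbrakk>a \<le> s; s \<le> t; t \<le> b\<rbrakk> \<Longrightarrow> curve_length d' \<gamma> s t \<le>
       (\<integral>\<^sup>+u\<in>{enn2real (curve_length d \<gamma> a s)..enn2real (curve_length d \<gamma> a t)}. w (arc_length_param d \<gamma> a b u) \<partial>lborel)"
  shows "path_integral d' \<gamma> a b g \<le> path_integral d \<gamma> a b (\<lambda>x. g x * w x)"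
proof -
  interpret A: Metric_space M d by fact
  interpret B: Metric_space M d' by fact
  have ab: "a \<le> b" using r by (simp add: rectifiable_curve_def curve_def)
  have cu: "curve M d a b \<gamma>" using r by (simp add: rectifiable_curve_def)
  define L where "L t = enn2real (curve_length d \<gamma> a t)" for t
  define Q where "Q t = enn2real (curve_length d' \<gamma> a t)" for t
  define \<eta> where "\<eta> = arc_length_param d \<gamma> a b"
  define \<zeta> where "\<zeta> = arc_length_param d' \<gamma> a b"
  \<comment> \<open>The parameter chosen in the definition of \<open>arc_length_param\<close>; thus \<open>\<eta> u = \<gamma> (\<tau> u)\<close> holds by definition.\<close>
  define \<tau> where "\<tau> u = (SOME t. t \<in> {a..b} \<and> curve_length d \<gamma> a t = ennreal u)" for u
  define \<phi> where "\<phi> u = Q (\<tau> u)" for u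
  have \<tau>: "\<tau> u \<in> {a..b}" "L (\<tau> u) = u" if "0 \<le> u" "u \<le> L b" for u
    using someI_ex[OF A.ex_curve_length_eq[OF r that[unfolded L_def]]] that unfolding \<tau>_def[symmetric]
    by (auto simp: L_def)
  have Ldiff: "L s \<le> L t" if "a \<le> s" "s \<le> t" "t \<le> b" for s t
    using A.curve_length_diff(2)[OF r that] A.nonneg[of "\<gamma> s" "\<gamma> t"] unfolding L_def[symmetric] by linarith
  have Qdiff: "Q s \<le> Q t" "curve_length d' \<gamma> s t = ennreal (Q t - Q s)" if "a \<le> s" "s \<le> t" "t \<le> b" for s t
    using B.curve_length_diff(1)[OF r' that] order_trans[OF B.nonneg B.curve_length_diff(2)[OF r' that]]
    unfolding Q_def[symmetric] by auto
  have lipA: "A.lip_curve (L b) \<eta>" using A.arc_length_param(4)[OF r] by (simp add: \<eta>_def L_def)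
  have lipB: "B.lip_curve (Q b) \<zeta>" using B.arc_length_param(4)[OF r'] by (simp add: \<zeta>_def Q_def)
  have Lb: "0 \<le> L b" by (simp add: L_def)
  have Qle: "ennreal (Q t - Q s) \<le> (\<integral>\<^sup>+u\<in>{L s..L t}. w (\<eta> u) \<partial>lborel)" if "a \<le> s" "s \<le> t" "t \<le> b" for s t
    using le[OF that] Qdiff(2)[OF that] by (simp add: L_def \<eta>_def)
  have bnd: "(\<integral>\<^sup>+u\<in>{p..q}. w (\<eta> u) \<partial>lborel) \<le> ennreal (K * (q - p))" if "0 \<le> p" "p \<le> q" "q \<le> L b" for p q
  proof -
    have "(\<integral>\<^sup>+u\<in>{p..q}. w (\<eta> u) \<partial>lborel) \<le> (\<integral>\<^sup>+u. ennreal K * indicator {p..q} u \<partial>lborel)"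
      using that A.lip_curveD(1)[OF lipA] K by (intro nn_integral_mono) (auto simp: indicator_def)
    also have "\<dots> = ennreal (K * (q - p))"
      using that K by (simp add: nn_integral_cmult ennreal_mult)
    finally show ?thesis .
  qed
  have Q_eqL: "Q s = Q t" if "s \<in> {a..b}" "t \<in> {a..b}" "L s = L t" for s t
  proof -
    have *: "Q s = Q t" if "a \<le> s" "s \<le> t" "t \<le> b" "L s = L t" for s t
    proof -
      have "ennreal (Q t - Q s) \<le> ennreal (K * 0)"
        using order_trans[OF Qle[OF that(1-3)] bnd[of "L s" "L t"]] that(4) Ldiff[OF order_refl that(1)] 
          Ldiff[of t b] that by (simp add: L_def)
      then show ?thesis using Qdiff(1)[OF that(1-3)] by (simp add: ennreal_le_iff2)
    qed
    show ?thesis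
    proof (cases "s \<le> t")
      case True then show ?thesis by (intro *) (use that in auto)
    next
      case False then show ?thesis by (intro *[symmetric]) (use that in auto)
    qed
  qed
  have tmono: "\<tau> u \<le> \<tau> v" if "0 \<le> u" "u < v" "v \<le> L b" for u v
  proof (rule ccontr)
    assume "\<not> \<tau> u \<le> \<tau> v"
    then have "L (\<tau> v) \<le> L (\<tau> u)" using \<tau>[of u] \<tau>[of v] that by (intro Ldiff) auto
    then show False using \<tau>(2)[of u] \<tau>(2)[of v] that by simp
  qed
  have \<phi>m: "\<phi> u \<le> \<phi> v" "ennreal (\<phi> v - \<phi> u) \<le> (\<integral>\<^sup>+x\<in>{u..v}. w (\<eta> x) \<partial>lborel)"
    if "0 \<le> u" "u \<le> v" "v \<le> L b" for u v
  proof -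
    have t: "\<tau> u \<le> \<tau> v" using tmono[of u v] that by (cases "u = v") auto
    have "\<tau> u \<in> {a..b}" "\<tau> v \<in> {a..b}" "L (\<tau> u) = u" "L (\<tau> v) = v" using \<tau>[of u] \<tau>[of v] that by auto
    then show "\<phi> u \<le> \<phi> v" "ennreal (\<phi> v - \<phi> u) \<le> (\<integral>\<^sup>+x\<in>{u..v}. w (\<eta> x) \<partial>lborel)"
      using Qdiff(1)[of "\<tau> u" "\<tau> v"] Qle[of "\<tau> u" "\<tau> v"] t by (auto simp: \<phi>_def)
  qed
  have \<phi>lip: "\<bar>\<phi> u - \<phi> v\<bar> \<le> K * \<bar>u - v\<bar>" if "u \<in> {0..L b}" "v \<in> {0..L b}" for u v
  proof -
    have *: "\<phi> v - \<phi> u \<le> K * (v - u)" if "0 \<le> u" "u \<le> v" "v \<le> L b" for u v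
      using order_trans[OF \<phi>m(2)[OF that] bnd[OF that]] that K by (subst (asm) ennreal_le_iff) auto
    show ?thesis using *[of u v] *[of v u] \<phi>m(1)[of u v] \<phi>m(1)[of v u] that by (cases "u \<le> v") (auto simp: abs_if)
  qed
  have cont: "continuous_on {0..L b} \<phi>"
    by (rule lipschitz_on_continuous_on[of K]) (use \<phi>lip K in \<open>auto simp: lipschitz_on_def dist_real_def\<close>)
  have La: "L a = 0" "Q a = 0"
    using A.curve_in[OF cu, of a] ab by (auto simp: L_def Q_def A.curve_length_refl B.curve_length_refl)
  have \<phi>0: "\<phi> 0 = 0" using Q_eqL[of "\<tau> 0" a] \<tau>[of 0] La Lb ab by (auto simp: \<phi>_def)
  have \<phi>l: "\<phi> (L b) = Q b" using Q_eqL[of "\<tau> (L b)" b] \<tau>[of "L b"] Lb ab by (auto simp: \<phi>_def)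
  have \<zeta>\<phi>: "\<zeta> (\<phi> u) = \<eta> u" if u: "u \<in> {0..L b}" for u
  proof -
    have "\<zeta> (\<phi> u) = \<gamma> (\<tau> u)" using B.arc_length_param(1)[OF r', of "\<tau> u"] \<tau>[of u] u by (simp add: \<zeta>_def \<phi>_def Q_def)
    then show ?thesis by (simp add: \<eta>_def arc_length_param_def \<tau>_def)
  qed
  have "path_integral d' \<gamma> a b g = (\<integral>\<^sup>+v\<in>{0..\<phi> (L b)}. g (\<zeta> v) \<partial>lborel)"
    by (simp add: path_integral_def \<phi>l Q_def \<zeta>_def)
  also have "\<dots> \<le> (\<integral>\<^sup>+u\<in>{0..L b}. g (\<zeta> (\<phi> u)) * w (\<eta> u) \<partial>lborel)"
  proof (rule nn_integral_change_of_variables_le[OF Lb \<phi>m(1) cont \<phi>0 _ _ _ \<phi>m(2)])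
    show "(\<lambda>u. w (\<eta> u) * indicator {0..L b} u) \<in> borel_measurable borel"
      by (rule A.lip_curve_measurable[OF lipA w])
    show "(\<lambda>v. g (\<zeta> v) * indicator {0..\<phi> (L b)} v) \<in> borel_measurable borel"
      unfolding \<phi>l by (rule B.lip_curve_measurable[OF lipB g])
    show "(\<integral>\<^sup>+u\<in>{0..L b}. w (\<eta> u) \<partial>lborel) < \<infinity>"
      using bnd[of 0 "L b"] Lb by (auto intro: le_less_trans)
  qed
  also have "\<dots> = path_integral d \<gamma> a b (\<lambda>x. g x * w x)"
    unfolding path_integral_def L_def[symmetric] \<eta>_def[symmetric]
    by (intro nn_integral_cong) (auto simp: indicator_def \<zeta>\<phi>)
  finally show ?thesis .
qed

text \<open>
  The bound \<open>K\<close> makes the weighted length of rectifiable curves finite. As any two points are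
  connected by such a curve, the infimum in the definition of the weighted distance is finite as
  well.
\<close>

locale weighted_metric = Metric_space +
  fixes w :: "'a \<Rightarrow> real" and K :: real
  assumes w_measurable: "(\<lambda>x. ennreal (w x)) \<in> borel_measurable (metric_borel M d)"
    and w_pos: "\<And>x. x \<in> M \<Longrightarrow> 0 < w x"
    and w_le: "\<And>x. x \<in> M \<Longrightarrow> w x \<le> K" and K_nonneg: "0 \<le> K"
    and lip_connected: "\<And>x y. x \<in> M \<Longrightarrow> y \<in> M \<Longrightarrow> \<exists>l \<eta>. lip_curve l \<eta> \<and> \<eta> 0 = x \<and> \<eta> l = y"
begin

definition wdist :: "'a \<Rightarrow> 'a \<Rightarrow> real" where
  "wdist x y = enn2real (Inf {path_integral d \<gamma> s u (\<lambda>z. ennreal (w z)) | \<gamma> s u.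
     rectifiable_curve M d s u \<gamma> \<and> \<gamma> s = x \<and> \<gamma> u = y})"

definition wint :: "(real \<Rightarrow> 'a) \<Rightarrow> real \<Rightarrow> real \<Rightarrow> ennreal" where
  "wint \<eta> u v = (\<integral>\<^sup>+x\<in>{u..v}. ennreal (w (\<eta> x)) \<partial>lborel)"

lemma wint_le:
  assumes "lip_curve l \<eta>" "0 \<le> p" "p \<le> q" "q \<le> l"
  shows "wint \<eta> p q \<le> ennreal (K * (q - p))"
proof -
  have "wint \<eta> p q \<le> (\<integral>\<^sup>+u. ennreal K * indicator {p..q} u \<partial>lborel)"
    unfolding wint_def using assms lip_curveD(1)[OF assms(1)] w_le
    by (intro nn_integral_mono) (auto simp: indicator_def intro!: ennreal_leI)
  also have "\<dots> = ennreal (K * (q - p))"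
    using assms K_nonneg by (simp add: nn_integral_cmult ennreal_mult)
  finally show ?thesis .
qed

lemma wint_sub:
  assumes "lip_curve l \<eta>" "0 \<le> u" "v \<le> l"
  shows "wint (\<lambda>x. \<eta> (u + x)) 0 (v - u) = wint \<eta> u v"
  unfolding wint_def by (rule lip_curve_sub_integral[OF assms(1) w_measurable assms(2,3)])

lemma wint_rev:
  assumes "lip_curve l \<eta>" "0 \<le> u" "v \<le> l"
  shows "wint (\<lambda>x. \<eta> (l - x)) (l - v) (l - u) = wint \<eta> u v"
  unfolding wint_def by (rule lip_curve_rev_integral[OF assms(1) w_measurable assms(2,3)])

lemma wint_add:
  assumes "lip_curve l \<eta>" "0 \<le> p" "p \<le> q" "q \<le> r" "r \<le> l"
  shows "wint \<eta> p r = wint \<eta> p q + wint \<eta> q r"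
proof -
  have [measurable]: "(\<lambda>x. ennreal (w (\<eta> x)) * indicator {p..q} x) \<in> borel_measurable borel"
      "(\<lambda>x. ennreal (w (\<eta> x)) * indicator {q..r} x) \<in> borel_measurable borel"
    by (rule lip_curve_measurable_sub[OF assms(1) w_measurable]; use assms in simp)+
  have "wint \<eta> p q + wint \<eta> q r = (\<integral>\<^sup>+x. ennreal (w (\<eta> x)) * indicator {p..q} x + ennreal (w (\<eta> x)) * indicator {q..r} x \<partial>lborel)"
    unfolding wint_def by (rule nn_integral_add[symmetric]) auto
  also have "\<dots> = wint \<eta> p r"
    unfolding wint_def
    by (intro nn_integral_cong_AE eventually_mono[OF AE_lborel_singleton[of q]])
      (use assms in \<open>auto simp: indicator_def\<close>)
  finally show ?thesis ..
qed

lemma wint_mono: "p' \<le> p \<Longrightarrow> q \<le> q' \<Longrightarrow> wint \<eta> p q \<le> wint \<eta> p' q'"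
  unfolding wint_def by (intro nn_integral_mono) (auto simp: indicator_def)

lemma path_integral_arc:
  "path_integral d \<gamma> a b (\<lambda>z. ennreal (w z)) =
     wint (arc_length_param d \<gamma> a b) 0 (enn2real (curve_length d \<gamma> a b))"
  by (simp add: path_integral_def wint_def)

text \<open>
  A curve moving with speed at most one takes at least as much time as its arc-length
  parametrization.
\<close>

lemma path_integral_lip_le:
  assumes \<eta>: "lip_curve l \<eta>"
  shows "path_integral d \<eta> 0 l (\<lambda>z. ennreal (w z)) \<le> wint \<eta> 0 l"
proof -
  note r = lip_curve_rectifiable[OF \<eta>]
  define \<phi> where "\<phi> u = enn2real (curve_length d \<eta> 0 u)" for u
  have l: "0 \<le> l" using \<eta> by (simp add: lip_curve_def)
  have \<phi>d: "\<phi> u \<le> \<phi> v" "\<phi> v - \<phi> u \<le> v - u" if "0 \<le> u" "u \<le> v" "v \<le> l" for u v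
    using curve_length_diff(1)[OF r that] order_trans[OF nonneg curve_length_diff(2)[OF r that]] lip_curve_length[OF \<eta> that] that
    unfolding \<phi>_def[symmetric] by auto
  have "path_integral d \<eta> 0 l (\<lambda>z. ennreal (w z)) = (\<integral>\<^sup>+v\<in>{0..\<phi> l}. ennreal (w (arc_length_param d \<eta> 0 l v)) \<partial>lborel)"
    by (simp add: path_integral_def \<phi>_def)
  also have "\<dots> \<le> (\<integral>\<^sup>+u\<in>{0..l}. ennreal (w (arc_length_param d \<eta> 0 l (\<phi> u))) * 1 \<partial>lborel)"
  proof (rule nn_integral_change_of_variables_le[OF l \<phi>d(1)])
    show "continuous_on {0..l} \<phi>" unfolding \<phi>_def by (rule continuous_on_curve_length[OF r])
    show "\<phi> 0 = 0" using lip_curveD(1)[OF \<eta>, of 0] l by (simp add: \<phi>_def curve_length_refl)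
    show "(\<lambda>v. ennreal (w (arc_length_param d \<eta> 0 l v)) * indicator {0..\<phi> l} v) \<in> borel_measurable borel"
      unfolding \<phi>_def by (rule lip_curve_measurable[OF arc_length_param(4)[OF r] w_measurable])
    fix u v :: real assume "0 \<le> u" "u \<le> v" "v \<le> l"
    then show "ennreal (\<phi> v - \<phi> u) \<le> (\<integral>\<^sup>+x\<in>{u..v}. 1 \<partial>lborel)"
      using \<phi>d(2) by (simp add: ennreal_leI)
  qed (use l in simp_all)
  also have "\<dots> = wint \<eta> 0 l"
    unfolding wint_def by (intro nn_integral_cong) (auto simp: indicator_def \<phi>_def arc_length_param(1)[OF r])
  finally show ?thesis .
qed

abbreviation Iw where
  "Iw x y \<equiv> Inf {path_integral d \<gamma> s u (\<lambda>z. ennreal (w z)) | \<gamma> s u.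
     rectifiable_curve M d s u \<gamma> \<and> \<gamma> s = x \<and> \<gamma> u = y}"

lemma Iw_le: "lip_curve l \<eta> \<Longrightarrow> Iw (\<eta> 0) (\<eta> l) \<le> wint \<eta> 0 l"
  by (rule order_trans[OF Inf_lower path_integral_lip_le]) (use lip_curve_rectifiable in blast)

lemma ennreal_wdist:
  assumes "x \<in> M" "y \<in> M" shows "ennreal (wdist x y) = Iw x y"
proof -
  obtain l \<eta> where \<eta>: "lip_curve l \<eta>" "\<eta> 0 = x" "\<eta> l = y" using lip_connected assms by blast
  have "Iw x y \<le> ennreal (K * (l - 0))"
    using order_trans[OF Iw_le[OF \<eta>(1)] wint_le[OF \<eta>(1), of 0 l]] \<eta> by (auto simp: lip_curve_def)
  then have "Iw x y < top" using le_less_trans by fastforce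
  then show ?thesis by (simp add: wdist_def)
qed

lemma wdist_nonneg: "0 \<le> wdist x y" by (simp add: wdist_def)

lemma wdist_le_wint:
  assumes "lip_curve l \<eta>" "0 \<le> u" "u \<le> v" "v \<le> l"
  shows "ennreal (wdist (\<eta> u) (\<eta> v)) \<le> wint \<eta> u v"
  using Iw_le[OF lip_curve_sub[OF assms]] wint_sub[OF assms(1,2,4)] lip_curveD(1)[OF assms(1)] assms
  by (subst ennreal_wdist) auto

lemma wdist_approx:
  assumes "x \<in> M" "y \<in> M" "wdist x y < c"
  obtains l \<eta> where "lip_curve l \<eta>" "\<eta> 0 = x" "\<eta> l = y" "wint \<eta> 0 l < ennreal c"
proof -
  have "Iw x y < ennreal c"
    unfolding ennreal_wdist[OF assms(1,2), symmetric] using assms(3) wdist_nonneg[of x y]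
    by (simp add: ennreal_less_iff)
  then obtain \<gamma> s u where *: "rectifiable_curve M d s u \<gamma>" "\<gamma> s = x" "\<gamma> u = y"
    "path_integral d \<gamma> s u (\<lambda>z. ennreal (w z)) < ennreal c" unfolding Inf_less_iff by blast
  show ?thesis
    by (rule that[OF arc_length_param(4)[OF *(1)]])
      (use arc_length_param(2,3)[OF *(1)] * in \<open>auto simp: path_integral_arc\<close>)
qed

lemma wdist_commute: "x \<in> M \<Longrightarrow> y \<in> M \<Longrightarrow> wdist x y = wdist y x"
proof (rule antisym)
  have *: "wdist x y \<le> wdist y x" if xy: "x \<in> M" "y \<in> M" for x y
  proof (rule ccontr)
    assume "\<not> wdist x y \<le> wdist y x"
    then have "wdist y x < wdist x y" by simp
    then obtain l \<eta> where \<eta>: "lip_curve l \<eta>" "\<eta> 0 = y" "\<eta> l = x" "wint \<eta> 0 l < ennreal (wdist x y)"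
      by (rule wdist_approx[OF xy(2,1)])
    then have "ennreal (wdist x y) \<le> wint \<eta> 0 l"
      using wdist_le_wint[OF lip_curve_rev[OF \<eta>(1)], of 0 l] wint_rev[OF \<eta>(1), of 0 l] by (auto simp: lip_curve_def)
    then show False using \<eta>(4) by simp
  qed
  show "x \<in> M \<Longrightarrow> y \<in> M \<Longrightarrow> wdist x y \<le> wdist y x" "x \<in> M \<Longrightarrow> y \<in> M \<Longrightarrow> wdist y x \<le> wdist x y"
    using * by auto
qed

lemma lip_curve_append:
  assumes a: "lip_curve l \<eta>" and b: "lip_curve m \<zeta>" and eq: "\<eta> l = \<zeta> 0"
  shows "lip_curve (l + m) (\<lambda>u. if u \<le> l then \<eta> u else \<zeta> (u - l))" (is "lip_curve _ ?\<xi>")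
proof -
  have l: "0 \<le> l" "0 \<le> m" using a b by (auto simp: lip_curve_def)
  have mem: "?\<xi> u \<in> M" if "u \<in> {0..l+m}" for u
    using that lip_curveD(1)[OF a] lip_curveD(1)[OF b] by auto
  have *: "d (?\<xi> u) (?\<xi> v) \<le> v - u" if "0 \<le> u" "u \<le> v" "v \<le> l + m" for u v
  proof -
    consider "v \<le> l" | "l < u" | "u \<le> l" "l < v" by linarith
    then show ?thesis
    proof cases
      case 1 then show ?thesis using lip_curveD(2)[OF a, of u v] that by auto
    next
      case 2 then show ?thesis using lip_curveD(2)[OF b, of "u - l" "v - l"] that by auto
    next
      case 3
      have "d (\<eta> u) (\<zeta> (v - l)) \<le> d (\<eta> u) (\<eta> l) + d (\<zeta> 0) (\<zeta> (v - l))"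
        unfolding eq[symmetric] 
        by (rule triangle) (use 3 that l lip_curveD(1)[OF a] lip_curveD(1)[OF b] in auto)
      then show ?thesis using 3 that l lip_curveD(2)[OF a, of u l] lip_curveD(2)[OF b, of 0 "v - l"] by auto
    qed
  qed
  show ?thesis unfolding lip_curve_def
  proof (intro conjI ballI)
    fix u v assume "u \<in> {0..l+m}" "v \<in> {0..l+m}"
    then show "d (?\<xi> u) (?\<xi> v) \<le> \<bar>u - v\<bar>"
      using *[of u v] *[of v u] commute[of "?\<xi> u" "?\<xi> v"] by (cases "u \<le> v") auto
  qed (use l mem in auto)
qed

lemma wdist_triangle:
  assumes "x \<in> M" "y \<in> M" "z \<in> M" shows "wdist x z \<le> wdist x y + wdist y z"
proof (rule field_le_epsilon)
  fix e :: real assume e: "0 < e"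
  obtain l \<eta> where \<eta>: "lip_curve l \<eta>" "\<eta> 0 = x" "\<eta> l = y" "wint \<eta> 0 l < ennreal (wdist x y + e/2)"
    by (rule wdist_approx[OF assms(1,2), of "wdist x y + e/2"]) (use e in auto)
  obtain m \<zeta> where \<zeta>: "lip_curve m \<zeta>" "\<zeta> 0 = y" "\<zeta> m = z" "wint \<zeta> 0 m < ennreal (wdist y z + e/2)"
    by (rule wdist_approx[OF assms(2,3), of "wdist y z + e/2"]) (use e in auto)
  let ?\<xi> = "\<lambda>u. if u \<le> l then \<eta> u else \<zeta> (u - l)"
  have l: "0 \<le> l" "0 \<le> m" using \<eta> \<zeta> by (auto simp: lip_curve_def)
  have \<xi>: "lip_curve (l + m) ?\<xi>" by (rule lip_curve_append) (use \<eta> \<zeta> in auto)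
  have ends: "?\<xi> 0 = x" "?\<xi> (l + m) = z" using l \<eta> \<zeta> by auto
  have "ennreal (wdist x z) \<le> wint ?\<xi> 0 (l + m)"
    using wdist_le_wint[OF \<xi>, of 0 "l + m"] l unfolding ends by auto
  also have "\<dots> = wint ?\<xi> 0 l + wint ?\<xi> l (l + m)" by (rule wint_add[OF \<xi>]) (use l in auto)
  also have "wint ?\<xi> 0 l = wint \<eta> 0 l"
    unfolding wint_def by (intro nn_integral_cong) (auto simp: indicator_def)
  also have "wint ?\<xi> l (l + m) = wint (\<lambda>x. ?\<xi> (l + x)) 0 m" using wint_sub[OF \<xi>, of l "l + m"] l by auto
  also have "\<dots> = wint \<zeta> 0 m"
    unfolding wint_def by (intro nn_integral_cong) (use \<eta> \<zeta> in \<open>auto simp: indicator_def\<close>)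
  also have "wint \<eta> 0 l + wint \<zeta> 0 m \<le> ennreal (wdist x y + e/2) + ennreal (wdist y z + e/2)"
    using \<eta> \<zeta> by (intro add_mono) auto
  also have "\<dots> = ennreal (wdist x y + wdist y z + e)"
    using e wdist_nonneg by (subst ennreal_plus[symmetric]) (auto intro!: add_nonneg_nonneg)
  finally show "wdist x z \<le> wdist x y + wdist y z + e"
    using e wdist_nonneg by (subst (asm) ennreal_le_iff) (auto intro!: add_nonneg_nonneg)
qed

text \<open>
  The distance of two consecutive points of a partition is at most the integral of \<open>w\<close> over the
  piece of the curve between them, and these integrals add up.
\<close>

lemma curve_length_wdist_le:
  assumes r: "rectifiable_curve M d a b \<gamma>" and st: "a \<le> s" "s \<le> t" "t \<le> b"
  shows "curve_length wdist \<gamma> s t \<le> wint (arc_length_param d \<gamma> a b)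
    (enn2real (curve_length d \<gamma> a s)) (enn2real (curve_length d \<gamma> a t))"
proof (rule curve_length_least)
  fix n and p :: "nat \<Rightarrow> real" assume p': "p 0 = s" "p n = t" "\<And>j. j < n \<Longrightarrow> p j \<le> p (Suc j)"
  then have p: "s = p 0" "t = p n" "\<forall>j<n. p j \<le> p (Suc j)" by auto
  define L where "L t = enn2real (curve_length d \<gamma> a t)" for t
  define \<eta> where "\<eta> = arc_length_param d \<gamma> a b"
  have lip: "lip_curve (L b) \<eta>" using arc_length_param(4)[OF r] by (simp add: L_def \<eta>_def)
  have Lm: "L s \<le> L t" if "a \<le> s" "s \<le> t" "t \<le> b" for s t
    using order_trans[OF nonneg[of "\<gamma> s" "\<gamma> t"] curve_length_diff(2)[OF r that]] by (simp add: L_def)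
  have pin: "a \<le> p j" "p j \<le> b" if "j \<le> n" for j
    using partition_mono[of n p 0 j] partition_mono[of n p j n] p st that by auto
  have \<eta>L: "\<eta> (L t) = \<gamma> t" if "a \<le> t" "t \<le> b" for t
    using arc_length_param(1)[OF r, of t] that by (simp add: \<eta>_def L_def)
  have L0: "0 \<le> L t" for t by (simp add: L_def)
  have "ennreal (\<Sum>j<m. wdist (\<gamma> (p j)) (\<gamma> (p (Suc j)))) \<le> wint \<eta> (L (p 0)) (L (p m))" if "m \<le> n" for m
    using that
  proof (induction m)
    case (Suc m)
    have o: "L (p 0) \<le> L (p m)" "L (p m) \<le> L (p (Suc m))" "L (p (Suc m)) \<le> L b"
      using Lm[of "p 0" "p m"] Lm[of "p m" "p (Suc m)"] Lm[of "p (Suc m)" b] partition_mono[of n p 0 m] pin p(3) Suc.prems by auto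
    have "ennreal (\<Sum>j<Suc m. wdist (\<gamma> (p j)) (\<gamma> (p (Suc j)))) =
       ennreal (\<Sum>j<m. wdist (\<gamma> (p j)) (\<gamma> (p (Suc j)))) + ennreal (wdist (\<eta> (L (p m))) (\<eta> (L (p (Suc m)))))"
      using \<eta>L[of "p m"] \<eta>L[of "p (Suc m)"] pin Suc.prems by (simp add: ennreal_plus wdist_nonneg sum_nonneg)
    also have "\<dots> \<le> wint \<eta> (L (p 0)) (L (p m)) + wint \<eta> (L (p m)) (L (p (Suc m)))"
      by (intro add_mono Suc.IH wdist_le_wint[OF lip]) (use Suc.prems o L0 in auto)
    also have "\<dots> = wint \<eta> (L (p 0)) (L (p (Suc m)))"
      by (rule wint_add[OF lip, symmetric]) (use o L0 in auto)
    finally show ?case .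
  qed simp
  from this[of n] show "ennreal (\<Sum>j<n. wdist (\<gamma> (p j)) (\<gamma> (p (Suc j))))
     \<le> wint (arc_length_param d \<gamma> a b) (enn2real (curve_length d \<gamma> a s)) (enn2real (curve_length d \<gamma> a t))"
    by (simp add: \<eta>_def L_def p)
qed

lemma lip_curve_length_wdist_le:
  assumes \<eta>: "lip_curve l \<eta>" and st: "0 \<le> s" "s \<le> t" "t \<le> l"
  shows "curve_length wdist \<eta> s t \<le> wint \<eta> s t"
  unfolding curve_length_def
proof (rule Sup_least, clarify)
  fix n and p :: "nat \<Rightarrow> real" assume p: "s = p 0" "t = p n" "\<forall>j<n. p j \<le> p (Suc j)"
  have pin: "0 \<le> p j" "p j \<le> l" if "j \<le> n" for j
    using partition_mono[of n p 0 j] partition_mono[of n p j n] p st that by auto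
  have "ennreal (\<Sum>j<m. wdist (\<eta> (p j)) (\<eta> (p (Suc j)))) \<le> wint \<eta> (p 0) (p m)" if "m \<le> n" for m
    using that
  proof (induction m)
    case (Suc m)
    have "ennreal (\<Sum>j<Suc m. wdist (\<eta> (p j)) (\<eta> (p (Suc j)))) =
       ennreal (\<Sum>j<m. wdist (\<eta> (p j)) (\<eta> (p (Suc j)))) + ennreal (wdist (\<eta> (p m)) (\<eta> (p (Suc m))))"
      by (simp add: ennreal_plus wdist_nonneg sum_nonneg)
    also have "\<dots> \<le> wint \<eta> (p 0) (p m) + wint \<eta> (p m) (p (Suc m))"
      by (intro add_mono Suc.IH wdist_le_wint[OF \<eta>]) (use Suc.prems pin p in auto)
    also have "\<dots> = wint \<eta> (p 0) (p (Suc m))"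
      by (rule wint_add[OF \<eta>, symmetric]) (use pin p Suc.prems partition_mono[of n p 0 m] in auto)
    finally show ?case .
  qed simp
  from this[of n] show "ennreal (\<Sum>j<n. wdist (\<eta> (p j)) (\<eta> (p (Suc j)))) \<le> wint \<eta> (p 0) (p n)" by simp
qed

end

section \<open>Distances in the completion\<close>

context Metric_space
begin

lemma cauchy_rel_iff: "(s, t) \<in> cauchy_rel M d \<longleftrightarrow> MCauchy s \<and> MCauchy t \<and> (\<lambda>n. d (s n) (t n)) \<longlonglongrightarrow> 0"
  by (simp add: cauchy_rel_def)

lemma MCauchy_in: "MCauchy s \<Longrightarrow> s n \<in> M"
  by (auto simp: MCauchy_def)

lemma equiv_cauchy_rel: "equiv {s. MCauchy s} (cauchy_rel M d)"
proof (rule equivI)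
  show "cauchy_rel M d \<subseteq> {s. MCauchy s} \<times> {s. MCauchy s}" by (auto simp: cauchy_rel_iff)
  show "refl_on {s. MCauchy s} (cauchy_rel M d)"
    by (auto simp: refl_on_def cauchy_rel_iff MCauchy_in)
  show "sym (cauchy_rel M d)" by (auto simp: sym_def cauchy_rel_iff commute)
  show "trans (cauchy_rel M d)"
  proof (rule transI)
    fix s t u assume st: "(s, t) \<in> cauchy_rel M d" "(t, u) \<in> cauchy_rel M d"
    then have "(\<lambda>n. d (s n) (t n) + d (t n) (u n)) \<longlonglongrightarrow> 0 + 0"
      by (intro tendsto_add) (auto simp: cauchy_rel_iff)
    then have "(\<lambda>n. d (s n) (t n) + d (t n) (u n)) \<longlonglongrightarrow> 0" by simp
    then have "(\<lambda>n. d (s n) (u n)) \<longlonglongrightarrow> 0"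
      by (rule Lim_null_comparison[rotated])
        (use st in \<open>auto simp: cauchy_rel_iff intro!: always_eventually triangle MCauchy_in\<close>)
    then show "(s, u) \<in> cauchy_rel M d" using st by (simp add: cauchy_rel_iff)
  qed
qed

text \<open>The representative that is chosen in the definition of \<open>cdist\<close>.\<close>

definition crep :: "(nat \<Rightarrow> 'a) set \<Rightarrow> nat \<Rightarrow> 'a" where "crep S = (SOME s. s \<in> S)"

lemma crep:
  assumes "S \<in> completion M d"
  shows "crep S \<in> S" "MCauchy (crep S)" "S = cauchy_rel M d `` {crep S}"
proof -
  obtain s where s: "MCauchy s" "S = cauchy_rel M d `` {s}"
    using assms by (auto simp: completion_def quotient_def)
  have "s \<in> S" using s equiv_class_self[OF equiv_cauchy_rel] by auto
  then show 1: "crep S \<in> S" unfolding crep_def by (rule someI[of "\<lambda>s. s \<in> S"])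
  then show "MCauchy (crep S)" using s by (auto simp: cauchy_rel_iff)
  have "(s, crep S) \<in> cauchy_rel M d" using 1 s(2) by blast
  from equiv_class_eq[OF equiv_cauchy_rel this] show "S = cauchy_rel M d `` {crep S}"
    by (subst s(2))
qed

lemma completion_mem:
  assumes "S \<in> completion M d" "s \<in> S"
  shows "MCauchy s" "(s, crep S) \<in> cauchy_rel M d"
proof -
  have "(crep S, s) \<in> cauchy_rel M d" using crep(3)[OF assms(1)] assms(2) by blast
  then show "MCauchy s" "(s, crep S) \<in> cauchy_rel M d" by (auto simp: cauchy_rel_iff commute)
qed

lemma class_in_completion: "MCauchy s \<Longrightarrow> cauchy_rel M d `` {s} \<in> completion M d"
  by (auto simp: completion_def quotientI)

lemma class_self: "MCauchy s \<Longrightarrow> s \<in> cauchy_rel M d `` {s}"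
  using equiv_class_self[OF equiv_cauchy_rel] by auto

lemma embed_in_completion: "x \<in> M \<Longrightarrow> embed M d x \<in> completion M d"
  unfolding embed_def by (rule class_in_completion) simp

lemma const_in_embed: "x \<in> M \<Longrightarrow> (\<lambda>_. x) \<in> embed M d x"
  unfolding embed_def by (rule class_self) simp

lemma dist_quadrilateral:
  assumes "x \<in> M" "y \<in> M" "x' \<in> M" "y' \<in> M"
  shows "\<bar>d x y - d x' y'\<bar> \<le> d x x' + d y y'"
proof -
  have "d x y \<le> d x x' + (d x' y' + d y' y)"
    using triangle[of x x' y] triangle[of x' y' y] assms by auto
  moreover have "d x' y' \<le> d x' x + (d x y + d y y')"
    using triangle[of x' x y'] triangle[of x y y'] assms by auto
  ultimately show ?thesis using commute[of x x'] commute[of y y'] by linarith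
qed

lemma MCauchy_dist_convergent:
  assumes "MCauchy s" "MCauchy t"
  shows "convergent (\<lambda>n. d (s n) (t n))"
proof (intro Cauchy_convergent metric_CauchyI)
  fix e :: real assume e: "e > 0"
  obtain N1 where N1: "\<And>n m. N1 \<le> n \<Longrightarrow> N1 \<le> m \<Longrightarrow> d (s n) (s m) < e/2"
    using assms(1) e unfolding MCauchy_def by (meson half_gt_zero)
  obtain N2 where N2: "\<And>n m. N2 \<le> n \<Longrightarrow> N2 \<le> m \<Longrightarrow> d (t n) (t m) < e/2"
    using assms(2) e unfolding MCauchy_def by (meson half_gt_zero)
  have "dist (d (s m) (t m)) (d (s n) (t n)) < e" if "max N1 N2 \<le> m" "max N1 N2 \<le> n" for m n
    using dist_quadrilateral[of "s m" "t m" "s n" "t n"] MCauchy_in assms N1[of m n] N2[of m n] that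
    by (auto simp: dist_real_def)
  then show "\<exists>M. \<forall>m\<ge>M. \<forall>n\<ge>M. dist (d (s m) (t m)) (d (s n) (t n)) < e" by blast
qed

text \<open>Another choice of representatives changes the distances by a null sequence.\<close>

lemma cdist_limit:
  assumes S: "S \<in> completion M d" "s \<in> S" and T: "T \<in> completion M d" "t \<in> T"
  shows "(\<lambda>n. d (s n) (t n)) \<longlonglongrightarrow> cdist d S T"
proof -
  let ?s = "crep S" and ?t = "crep T"
  have l: "(\<lambda>n. d (?s n) (?t n)) \<longlonglongrightarrow> cdist d S T"
    using MCauchy_dist_convergent[OF crep(2)[OF S(1)] crep(2)[OF T(1)]]
    unfolding cdist_def crep_def[symmetric] by (simp add: convergent_LIMSEQ_iff)
  note c = completion_mem[OF S] completion_mem[OF T]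
  have "(\<lambda>n. d (s n) (?s n) + d (t n) (?t n)) \<longlonglongrightarrow> 0 + 0"
    using c by (intro tendsto_add) (auto simp: cauchy_rel_iff)
  then have *: "(\<lambda>n. d (s n) (?s n) + d (t n) (?t n)) \<longlonglongrightarrow> 0" by simp
  have "\<bar>d (s n) (t n) - d (?s n) (?t n)\<bar> \<le> d (s n) (?s n) + d (t n) (?t n)" for n
    by (intro dist_quadrilateral MCauchy_in c crep(2)[OF S(1)] crep(2)[OF T(1)])
  then have "(\<lambda>n. d (s n) (t n) - d (?s n) (?t n)) \<longlonglongrightarrow> 0"
    by (intro Lim_null_comparison[OF _ *] always_eventually) simp
  from tendsto_add[OF this l] show ?thesis by simp
qed

lemma cdist_embed_limit:
  assumes "x \<in> M" "T \<in> completion M d" "t \<in> T"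
  shows "(\<lambda>n. d x (t n)) \<longlonglongrightarrow> cdist d (embed M d x) T"
  using cdist_limit[OF embed_in_completion const_in_embed assms(2,3)] assms(1) by simp

lemma cdist_embed_nonneg: "x \<in> M \<Longrightarrow> T \<in> completion M d \<Longrightarrow> 0 \<le> cdist d (embed M d x) T"
  by (rule LIMSEQ_le_const[OF cdist_embed_limit[OF _ _ crep(1)]]) auto

lemma boundary_not_limit:
  assumes "W \<in> boundary M d" "s \<in> W" "x \<in> M"
  shows "\<not> (\<lambda>n. d x (s n)) \<longlonglongrightarrow> 0"
proof
  assume l: "(\<lambda>n. d x (s n)) \<longlonglongrightarrow> 0"
  have W: "W \<in> completion M d" using assms by (simp add: boundary_def)
  have "(\<lambda>_. x, s) \<in> cauchy_rel M d"
    using l completion_mem(1)[OF W assms(2)] assms(3) by (simp add: cauchy_rel_iff)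
  moreover have "W = cauchy_rel M d `` {s}"
    using crep(3)[OF W] equiv_class_eq[OF equiv_cauchy_rel completion_mem(2)[OF W assms(2)]] by (rule trans[OF _ sym])
  ultimately have "W = embed M d x"
    unfolding embed_def using equiv_class_eq[OF equiv_cauchy_rel, of "\<lambda>_. x" s] by simp
  then show False using assms by (auto simp: boundary_def)
qed

end

section \<open>The setting\<close>

locale sphericalization = Metric_space X d for X :: "'a set" and d +
  fixes b :: "(nat \<Rightarrow> 'a) set" and \<rho> :: "real \<Rightarrow> real" and CU CA CB :: real
  assumes CU: "1 \<le> CU"
    and uniform: "\<And>x y. x \<in> X \<Longrightarrow> y \<in> X \<Longrightarrow> \<exists>a b \<gamma>. uniform_curve X d CU a b \<gamma> \<and> \<gamma> a = x \<and> \<gamma> b = y"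
    and locally_compact: "locally_compact_space mtopology"
    and unbounded: "\<not> mbounded X"
    and base: "b \<in> boundary X d"
    and rho_pos: "\<And>t. t > 0 \<Longrightarrow> \<rho> t > 0"
    and rho_borel: "\<rho> \<in> borel_measurable (restrict_space borel {0<..})"
    and rho_int: "set_integrable lborel {0<..} \<rho>"
    and CA: "1 \<le> CA" "\<And>r s. \<lbrakk>0 < r; r \<le> 2 * s + 1; 0 < s; s \<le> 2 * r + 1\<rbrakk> \<Longrightarrow> \<rho> r \<le> CA * \<rho> s"
    and CB: "0 < CB" "\<And>r. r > 0 \<Longrightarrow> (LBINT t:{r<..}. \<rho> t) \<le> CB * (r + 1) * \<rho> r"
begin

definition nrm :: "'a \<Rightarrow> real" where "nrm x = base_norm X d b x"

text \<open>
  Condition (A) compares the values of \<open>\<rho>\<close> at \<open>r\<close> and \<open>s\<close> if their ratio is bounded up to additive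
  constants. For \<open>r + 1\<close> and \<open>s + 1\<close> this means a bounded ratio, so the estimates are stated in terms
  of \<open>N\<close> instead of \<open>nrm\<close>.
\<close>

definition N :: "'a \<Rightarrow> real" where "N x = 1 + nrm x"

definition bdist :: "'a \<Rightarrow> real" where "bdist x = (INF w\<in>boundary X d. cdist d (embed X d x) w)"

text \<open>
  Up to constants, \<open>\<kappa> s\<close> is the distance in the new metric from a point \<open>x\<close> with \<open>N x = s\<close> to the
  point at infinity: it is the weight at \<open>x\<close> times the distance from \<open>x\<close> at which the weight
  begins to decrease essentially.
\<close>

definition \<kappa> :: "real \<Rightarrow> real" where "\<kappa> s = s * \<rho> s"

lemma b_completion: "b \<in> completion X d" using base by (simp add: boundary_def)

lemma nrm_limit: "x \<in> X \<Longrightarrow> (\<lambda>n. d (crep b n) x) \<longlonglongrightarrow> nrm x"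
  unfolding nrm_def base_norm_def
  using cdist_limit[OF b_completion crep(1)[OF b_completion] embed_in_completion const_in_embed] by simp

lemma crep_b_in: "crep b n \<in> X"
  using crep(2)[OF b_completion] MCauchy_in by simp

lemma nrm_lip: "x \<in> X \<Longrightarrow> y \<in> X \<Longrightarrow> nrm x - nrm y \<le> d x y"
proof -
  assume xy: "x \<in> X" "y \<in> X"
  have "nrm x \<le> nrm y + d x y"
    by (rule LIMSEQ_le[OF nrm_limit[OF xy(1)] tendsto_add[OF nrm_limit[OF xy(2)] tendsto_const]])
      (use triangle'[OF crep_b_in xy(2,1)] in auto)
  then show ?thesis by simp
qed

lemma dist_le_nrm:
  assumes "x \<in> X" "y \<in> X" shows "d x y \<le> nrm x + nrm y"
  by (rule LIMSEQ_le_const[OF tendsto_add[OF nrm_limit[OF assms(1)] nrm_limit[OF assms(2)]]])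
    (use triangle''[OF assms(1) crep_b_in assms(2)] in auto)

lemma nrm_pos: "x \<in> X \<Longrightarrow> 0 < nrm x"
proof -
  assume x: "x \<in> X"
  have "0 \<le> nrm x" by (rule LIMSEQ_le_const[OF nrm_limit[OF x]]) auto
  moreover have "nrm x \<noteq> 0"
    using boundary_not_limit[OF base crep(1)[OF b_completion] x] nrm_limit[OF x] by (auto simp: commute)
  ultimately show ?thesis by simp
qed

lemma N_gt1: "x \<in> X \<Longrightarrow> 1 < N x" using nrm_pos by (simp add: N_def)

lemma N_lip: "x \<in> X \<Longrightarrow> y \<in> X \<Longrightarrow> N x \<le> N y + d x y"
  using nrm_lip[of x y] by (simp add: N_def)

lemma dist_le_N: "x \<in> X \<Longrightarrow> y \<in> X \<Longrightarrow> d x y \<le> N x + N y"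
  using dist_le_nrm[of x y] by (simp add: N_def)

lemma bdist_bdd: "x \<in> X \<Longrightarrow> bdd_below ((\<lambda>w. cdist d (embed X d x) w) ` boundary X d)"
  by (rule bdd_belowI[of _ 0]) (auto simp: boundary_def intro: cdist_embed_nonneg)

lemma bdist_le: "x \<in> X \<Longrightarrow> w \<in> boundary X d \<Longrightarrow> bdist x \<le> cdist d (embed X d x) w"
  unfolding bdist_def by (intro cINF_lower bdist_bdd)

lemma bdist_nonneg: "x \<in> X \<Longrightarrow> 0 \<le> bdist x"
  unfolding bdist_def by (intro cINF_greatest) (use base in \<open>auto simp: boundary_def intro: cdist_embed_nonneg\<close>)

lemma bdist_le_nrm: "x \<in> X \<Longrightarrow> bdist x \<le> nrm x"
proof -
  assume x: "x \<in> X"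
  have "cdist d (embed X d x) b = nrm x"
    using LIMSEQ_unique[OF cdist_embed_limit[OF x b_completion crep(1)[OF b_completion]]] nrm_limit[OF x]
    by (simp add: commute)
  then show ?thesis using bdist_le[OF x base] by simp
qed

subsection \<open>The weight function\<close>

lemma rho_comp1: "\<lbrakk>1 \<le> s; 1 \<le> t; s \<le> 2 * t; t \<le> 2 * s\<rbrakk> \<Longrightarrow> \<rho> s \<le> CA * \<rho> t"
  by (rule CA(2)) auto

lemma rho_nrm_comp:
  assumes "x \<in> X" shows "\<rho> (nrm x) \<le> CA * \<rho> (N x)" "\<rho> (N x) \<le> CA * \<rho> (nrm x)"
  using nrm_pos[OF assms] by (auto simp: N_def intro!: CA(2))

text \<open>Comparisons at ratio two are iterated.\<close>

lemma rho_comp: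
  assumes K: "1 \<le> K"
  obtains C where "1 \<le> C" "\<And>s t. \<lbrakk>1 \<le> s; 1 \<le> t; s \<le> K * t; t \<le> K * s\<rbrakk> \<Longrightarrow> \<rho> s \<le> C * \<rho> t"
proof -
  obtain k where k: "K \<le> 2 ^ k" using real_arch_pow[of 2 K] by (auto intro: less_imp_le)
  have up: "\<rho> s \<le> CA ^ k * \<rho> t \<and> \<rho> t \<le> CA ^ k * \<rho> s" if "1 \<le> s" "s \<le> t" "t \<le> 2 ^ k * s" for s t k
    using that
  proof (induction k arbitrary: t)
    case (Suc k)
    show ?case
    proof (cases "t \<le> 2 ^ k * s")
      case True
      have "\<rho> s \<le> CA ^ k * \<rho> t" "\<rho> t \<le> CA ^ k * \<rho> s" using Suc.IH[of t] Suc.prems True by auto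
      moreover have "CA ^ k * \<rho> t \<le> CA ^ Suc k * \<rho> t" "CA ^ k * \<rho> s \<le> CA ^ Suc k * \<rho> s"
        using CA(1) rho_pos[of t] rho_pos[of s] Suc.prems by (auto intro!: mult_right_mono power_increasing)
      ultimately show ?thesis by linarith
    next
      case False
      define u where "u = max s (t / 2)"
      have u: "s \<le> u" "u \<le> 2 ^ k * s" using Suc.prems False one_le_power[of "2::real" k]
        by (auto simp: u_def)
      have u2: "u \<le> t" "t \<le> 2 * u" using Suc.prems by (auto simp: u_def)
      have 1: "\<rho> s \<le> CA ^ k * \<rho> u" "\<rho> u \<le> CA ^ k * \<rho> s" using Suc.IH[of u] Suc.prems u by auto
      have 2: "\<rho> u \<le> CA * \<rho> t" "\<rho> t \<le> CA * \<rho> u" using u u2 Suc.prems by (auto intro!: rho_comp1)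
      have "CA ^ k * \<rho> u \<le> CA ^ k * (CA * \<rho> t)" using 2 CA(1) by (intro mult_left_mono) auto
      moreover have "CA * \<rho> u \<le> CA * (CA ^ k * \<rho> s)" using 1 CA(1) by (intro mult_left_mono) auto
      ultimately show ?thesis using 1 2 by (auto simp: mult.assoc mult.commute mult.left_commute)
    qed
  qed auto
  show ?thesis
  proof (rule that[of "CA ^ k"])
    show "1 \<le> CA ^ k" using CA(1) by simp
    fix s t assume st: "1 \<le> s" "1 \<le> t" "s \<le> K * t" "t \<le> K * s"
    have "K * t \<le> 2 ^ k * t" "K * s \<le> 2 ^ k * s" using k st by (auto intro!: mult_right_mono)
    then have "t \<le> 2 ^ k * s" "s \<le> 2 ^ k * t" using st by linarith+
    then show "\<rho> s \<le> CA ^ k * \<rho> t" using up[of s t k] up[of t s k] st by linarith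
  qed
qed

lemma rho_measurable: "(\<lambda>t. ennreal (\<rho> t) * indicator {0<..} t) \<in> borel_measurable borel"
  using rho_borel by (subst borel_measurable_restrict_space_iff_ennreal[symmetric]) auto

lemma rho_measurable_sub: "0 < p \<Longrightarrow> (\<lambda>t. ennreal (\<rho> t) * indicator {p..q} t) \<in> borel_measurable borel"
proof -
  assume "0 < p"
  then have "(\<lambda>t. ennreal (\<rho> t) * indicator {p..q} t) = (\<lambda>t. (ennreal (\<rho> t) * indicator {0<..} t) * indicator {p..q} t)"
    by (auto simp: indicator_def)
  then show ?thesis using rho_measurable by simp
qed

lemma rho_tail:
  assumes "1 \<le> s" shows "(\<integral>\<^sup>+t\<in>{s..}. ennreal (\<rho> t) \<partial>lborel) \<le> ennreal (2 * CB * \<kappa> s)"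
proof -
  have si: "set_integrable lborel {s<..} \<rho>"
    by (rule set_integrable_subset[OF rho_int]) (use assms in auto)
  have "(\<integral>\<^sup>+t\<in>{s..}. ennreal (\<rho> t) \<partial>lborel) = (\<integral>\<^sup>+t. ennreal (indicator {s<..} t *\<^sub>R \<rho> t) \<partial>lborel)"
    by (intro nn_integral_cong_AE eventually_mono[OF AE_lborel_singleton[of s]])
      (auto simp: indicator_def)
  also have "\<dots> = ennreal (LBINT t:{s<..}. \<rho> t)"
    unfolding set_lebesgue_integral_def using si rho_pos assms
    by (intro nn_integral_eq_integral) (auto simp: set_integrable_def indicator_def intro!: AE_I2 less_imp_le)
  also have "\<dots> \<le> ennreal (CB * (s + 1) * \<rho> s)" using CB(2)[of s] assms by (intro ennreal_leI) auto
  also have "\<dots> \<le> ennreal (2 * CB * \<kappa> s)"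
  proof (rule ennreal_leI)
    have "(s + 1) * (CB * \<rho> s) \<le> (2 * s) * (CB * \<rho> s)"
      using assms CB(1) rho_pos[of s] by (intro mult_right_mono) auto
    then show "CB * (s + 1) * \<rho> s \<le> 2 * CB * \<kappa> s" by (simp add: \<kappa>_def algebra_simps)
  qed
  finally show ?thesis .
qed

lemma kappa_pos: "1 \<le> s \<Longrightarrow> 0 < \<kappa> s" using rho_pos[of s] by (simp add: \<kappa>_def)

text \<open>
  For \<open>t \<le> 2 * s\<close> the function \<open>\<rho>\<close> is essentially constant on the interval; otherwise the whole
  tail is bounded by \<open>\<kappa> s\<close>.
\<close>

lemma rho_integral_le:
  assumes "1 \<le> s" "s \<le> t"
  shows "(\<integral>\<^sup>+u\<in>{s..t}. ennreal (\<rho> u) \<partial>lborel) \<le> ennreal ((CA + 2 * CB) * \<rho> s * min (t - s) s)"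
proof (cases "t - s \<le> s")
  case True
  have "(\<integral>\<^sup>+u\<in>{s..t}. ennreal (\<rho> u) \<partial>lborel) \<le> (\<integral>\<^sup>+u. ennreal (CA * \<rho> s) * indicator {s..t} u \<partial>lborel)"
    using assms True by (intro nn_integral_mono) (auto simp: indicator_def intro!: ennreal_leI rho_comp1)
  also have "\<dots> = ennreal (CA * \<rho> s * (t - s))"
    using assms CA(1) rho_pos[of s] by (simp add: nn_integral_cmult ennreal_mult)
  also have "\<dots> \<le> ennreal ((CA + 2 * CB) * \<rho> s * min (t - s) s)"
    using assms True CB(1) rho_pos[of s] by (intro ennreal_leI) (auto intro!: mult_right_mono)
  finally show ?thesis .
next
  case False
  have "(\<integral>\<^sup>+u\<in>{s..t}. ennreal (\<rho> u) \<partial>lborel) \<le> (\<integral>\<^sup>+u\<in>{s..}. ennreal (\<rho> u) \<partial>lborel)"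
    by (intro nn_integral_mono) (auto simp: indicator_def)
  also have "\<dots> \<le> ennreal (2 * CB * \<kappa> s)" by (rule rho_tail) fact
  also have "\<dots> \<le> ennreal ((CA + 2 * CB) * \<rho> s * min (t - s) s)"
    using assms False CA(1) rho_pos[of s] by (intro ennreal_leI) (auto simp: \<kappa>_def intro!: mult_right_mono)
  finally show ?thesis .
qed

text \<open>
  For \<open>t \<ge> 2 * s\<close>, the integral of \<open>\<rho>\<close> over \<open>{t/2..t}\<close> is comparable to \<open>\<kappa> t\<close>, and it is a part
  of the tail beyond \<open>s\<close>, which is at most a multiple of \<open>\<kappa> s\<close>.
\<close>

lemma kappa_almost_decreasing:
  assumes K: "1 \<le> K"
  obtains C where "1 \<le> C" "\<And>s t. \<lbrakk>1 \<le> s; 1 \<le> t; s \<le> K * t\<rbrakk> \<Longrightarrow> \<kappa> t \<le> C * \<kappa> s"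
proof -
  obtain C0 where C0: "1 \<le> C0" "\<And>s t. \<lbrakk>1 \<le> s; 1 \<le> t; s \<le> (K + 2) * t; t \<le> (K + 2) * s\<rbrakk> \<Longrightarrow> \<rho> s \<le> C0 * \<rho> t"
    using rho_comp[of "K + 2"] K by auto
  define C where "C = max (C0 * (K + 2)) (4 * CA * CB)"
  show ?thesis
  proof (rule that[of C])
    have "1 * 1 \<le> C0 * (K + 2)" using C0(1) K by (intro mult_mono) auto
    then show "1 \<le> C" by (simp add: C_def)
    fix s t assume st: "1 \<le> s" "1 \<le> t" "s \<le> K * t"
    have Ct: "s \<le> (K + 2) * t" using st by (simp add: distrib_right)
    show "\<kappa> t \<le> C * \<kappa> s"
    proof (cases "t \<le> 2 * s")
      case True
      moreover have "2 * s \<le> (K + 2) * s" using K st by (intro mult_right_mono) auto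
      ultimately have "t \<le> (K + 2) * s" by linarith
      then have "\<rho> t \<le> C0 * \<rho> s" "t \<le> (K + 2) * s" using C0(2)[of t s] st Ct by auto
      then have "t * \<rho> t \<le> ((K + 2) * s) * (C0 * \<rho> s)"
        using st K rho_pos[of t] by (intro mult_mono) auto
      also have "\<dots> = (C0 * (K + 2)) * \<kappa> s" by (simp add: \<kappa>_def)
      also have "\<dots> \<le> C * \<kappa> s" using kappa_pos[OF st(1)] by (intro mult_right_mono) (auto simp: C_def)
      finally show ?thesis by (simp add: \<kappa>_def)
    next
      case False
      have "ennreal (\<rho> t / CA * (t / 2)) = (\<integral>\<^sup>+u. ennreal (\<rho> t / CA) * indicator {t/2..t} u \<partial>lborel)"
        using st rho_pos[of t] CA(1) by (subst nn_integral_cmult) (simp_all add: ennreal_mult[symmetric])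
      also have "\<dots> \<le> (\<integral>\<^sup>+u\<in>{s..}. ennreal (\<rho> u) \<partial>lborel)"
      proof (intro nn_integral_mono)
        fix u
        have "\<rho> t \<le> CA * \<rho> u" if "u \<in> {t/2..t}" using that False st by (intro rho_comp1) auto
        then show "ennreal (\<rho> t / CA) * indicator {t/2..t} u \<le> ennreal (\<rho> u) * indicator {s..} u"
          using False CA(1) by (auto simp: indicator_def divide_le_eq mult.commute intro!: ennreal_leI)
      qed
      also have "\<dots> \<le> ennreal (2 * CB * \<kappa> s)" by (rule rho_tail) fact
      finally have "\<rho> t / CA * (t / 2) \<le> 2 * CB * \<kappa> s"
        using CB(1) kappa_pos[OF st(1)] by (subst (asm) ennreal_le_iff) auto
      then have "\<kappa> t \<le> (4 * CA * CB) * \<kappa> s" using CA(1) by (simp add: \<kappa>_def field_simps)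
      also have "\<dots> \<le> C * \<kappa> s" using kappa_pos[OF st(1)] by (intro mult_right_mono) (auto simp: C_def)
      finally show ?thesis .
    qed
  qed
qed

text \<open>
  Since \<open>\<kappa>\<close> is almost decreasing, \<open>\<rho> u \<ge> \<kappa> t / (C * u)\<close> on \<open>{s..t}\<close>, and integrating
  this gives logarithmic decay.
\<close>

lemma kappa_log_decay:
  obtains C where "1 \<le> C" "\<And>s t. \<lbrakk>1 \<le> s; s \<le> t\<rbrakk> \<Longrightarrow> \<kappa> t * ln (t / s) \<le> C * \<kappa> s"
proof -
  obtain C0 where C0: "1 \<le> C0" "\<And>s t. \<lbrakk>1 \<le> s; 1 \<le> t; s \<le> 1 * t\<rbrakk> \<Longrightarrow> \<kappa> t \<le> C0 * \<kappa> s"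
    using kappa_almost_decreasing[of 1] by auto
  show ?thesis
  proof (rule that[of "max 1 (2 * CB * C0)"])
    fix s t :: real assume st: "1 \<le> s" "s \<le> t"
    define c where "c = \<kappa> t / C0"
    have c: "0 < c" using kappa_pos[of t] st C0(1) by (simp add: c_def)
    have "((\<lambda>u. c / u) has_integral (c * ln t - c * ln s)) {s..t}"
    proof (rule fundamental_theorem_of_calculus[OF st(2)])
      fix x assume "x \<in> {s..t}"
      then show "((\<lambda>u. c * ln u) has_vector_derivative c / x) (at x within {s..t})"
        using st by (auto intro!: derivative_eq_intros simp flip: has_real_derivative_iff_has_vector_derivative)
    qed
    then have "(\<integral>\<^sup>+u\<in>{s..t}. ennreal (c / u) \<partial>lborel) = ennreal (c * ln t - c * ln s)"
      by (intro nn_integral_has_integral_lebesgue'[unfolded nn_integral_completion])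
        (use st c in auto)
    then have "ennreal (c * ln t - c * ln s) = (\<integral>\<^sup>+u\<in>{s..t}. ennreal (c / u) \<partial>lborel)" ..
    also have "\<dots> \<le> (\<integral>\<^sup>+u\<in>{s..}. ennreal (\<rho> u) \<partial>lborel)"
    proof (intro nn_integral_mono)
      fix u
      have "c / u \<le> \<rho> u" if "u \<in> {s..t}"
        using C0(2)[of u t] that st C0(1) by (simp add: c_def \<kappa>_def field_simps)
      then show "ennreal (c / u) * indicator {s..t} u \<le> ennreal (\<rho> u) * indicator {s..} u"
        by (auto simp: indicator_def intro!: ennreal_leI)
    qed
    also have "\<dots> \<le> ennreal (2 * CB * \<kappa> s)" by (rule rho_tail) fact
    finally have "c * ln t - c * ln s \<le> 2 * CB * \<kappa> s"
      using CB(1) kappa_pos[OF st(1)] by (subst (asm) ennreal_le_iff) auto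
    then have "\<kappa> t * ln (t / s) \<le> 2 * CB * C0 * \<kappa> s"
      using st C0(1) by (simp add: c_def ln_div field_simps)
    also have "\<dots> \<le> max 1 (2 * CB * C0) * \<kappa> s"
      using kappa_pos[OF st(1)] by (intro mult_right_mono) auto
    finally show "\<kappa> t * ln (t / s) \<le> max 1 (2 * CB * C0) * \<kappa> s" .
  qed simp
qed

text \<open>
  Far from \<open>b\<close> the bound holds since \<open>\<rho> \<le> \<kappa>\<close> on \<open>{1..}\<close> and \<open>\<kappa>\<close> is almost decreasing. Near \<open>b\<close> it
  holds since condition (A) compares \<open>\<rho> (nrm x)\<close> to \<open>\<rho> (N x)\<close> however small \<open>nrm x\<close> is.
\<close>

lemma rho_bounded: obtains C where "1 \<le> C" "\<And>x. x \<in> X \<Longrightarrow> \<rho> (nrm x) \<le> C"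
proof -
  obtain C0 where C0: "1 \<le> C0" "\<And>s t. \<lbrakk>1 \<le> s; 1 \<le> t; s \<le> 1 * t\<rbrakk> \<Longrightarrow> \<kappa> t \<le> C0 * \<kappa> s"
    using kappa_almost_decreasing[of 1] by auto
  show ?thesis
  proof (rule that[of "max 1 (CA * (C0 * \<kappa> 1))"])
    fix x assume x: "x \<in> X"
    have "\<rho> (N x) \<le> \<kappa> (N x)"
      using N_gt1[OF x] rho_pos[of "N x"] mult_right_mono[of 1 "N x" "\<rho> (N x)"] by (simp add: \<kappa>_def)
    also have "\<dots> \<le> C0 * \<kappa> 1" using N_gt1[OF x] by (intro C0(2)) auto
    finally have "CA * \<rho> (N x) \<le> CA * (C0 * \<kappa> 1)" using CA(1) by (intro mult_left_mono) auto
    then show "\<rho> (nrm x) \<le> max 1 (CA * (C0 * \<kappa> 1))" using rho_nrm_comp(1)[OF x] by simp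
  qed simp
qed

section \<open>The sphericalized metric\<close>

lemma space_metric_borel: "space (metric_borel X d) = X"
  unfolding metric_borel_def by (rule space_measure_of) (use openin_subset in fastforce)

lemma open_in_metric_borel: "openin mtopology U \<Longrightarrow> U \<in> sets (metric_borel X d)"
  unfolding metric_borel_def
  by (subst sets_measure_of) (use openin_subset in \<open>fastforce intro: sigma_sets.Basic\<close>)+

lemma nrm_borel: "nrm \<in> borel_measurable (metric_borel X d)"
  unfolding borel_measurable_iff_greater space_metric_borel
proof
  fix a
  have "openin mtopology {x \<in> X. a < nrm x}"
    unfolding openin_mtopology
  proof (intro conjI allI impI)
    fix x assume x: "x \<in> {x \<in> X. a < nrm x}"
    have "mball x (nrm x - a) \<subseteq> {x \<in> X. a < nrm x}"
    proof
      fix y assume "y \<in> mball x (nrm x - a)"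
      then show "y \<in> {x \<in> X. a < nrm x}" using nrm_lip[of x y] by auto
    qed
    then show "\<exists>r>0. mball x r \<subseteq> {x \<in> X. a < nrm x}"
      using x by (intro exI[of _ "nrm x - a"]) auto
  qed auto
  then show "{x \<in> X. a < nrm x} \<in> sets (metric_borel X d)" by (rule open_in_metric_borel)
qed

lemma N_borel: "N \<in> borel_measurable (metric_borel X d)"
  unfolding N_def[abs_def] using nrm_borel by simp

text \<open>
  The locale of weighted metrics has a bound for the weight as a parameter, so a bound is given a
  name.
\<close>

definition Kw :: real where "Kw = (SOME C. 1 \<le> C \<and> (\<forall>x\<in>X. \<rho> (nrm x) \<le> C))"

lemma Kw: "1 \<le> Kw" "x \<in> X \<Longrightarrow> \<rho> (nrm x) \<le> Kw"
proof -
  obtain C where "1 \<le> C" "\<And>x. x \<in> X \<Longrightarrow> \<rho> (nrm x) \<le> C" by (rule rho_bounded) blast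
  then have "\<exists>C. 1 \<le> C \<and> (\<forall>x\<in>X. \<rho> (nrm x) \<le> C)" by blast
  from someI_ex[OF this] show "1 \<le> Kw" "x \<in> X \<Longrightarrow> \<rho> (nrm x) \<le> Kw" by (auto simp: Kw_def)
qed

text \<open>
  In a 1-Lipschitz parametrization the parameters bound the lengths of the pieces of the curve,
  so that the conditions for a uniform curve can be imposed on the parameters.
\<close>

definition ucurve :: "real \<Rightarrow> (real \<Rightarrow> 'a) \<Rightarrow> bool" where
  "ucurve l \<eta> \<longleftrightarrow> lip_curve l \<eta> \<and> l \<le> CU * d (\<eta> 0) (\<eta> l) \<and> (\<forall>u\<in>{0..l}. min u (l - u) \<le> CU * bdist (\<eta> u))"

lemma ucurve_exists:
  assumes "x \<in> X" "y \<in> X"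
  obtains l \<eta> where "ucurve l \<eta>" "\<eta> 0 = x" "\<eta> l = y"
proof -
  obtain a e \<gamma> where u: "uniform_curve X d CU a e \<gamma>" and ends: "\<gamma> a = x" "\<gamma> e = y"
    using uniform[OF assms] by blast
  have c: "curve X d a e \<gamma>" and len: "curve_length d \<gamma> a e \<le> ennreal (CU * d x y)"
    and uc: "\<And>t. t \<in> {a..e} \<Longrightarrow> min (curve_length d \<gamma> a t) (curve_length d \<gamma> t e) \<le> ennreal (CU * bdist (\<gamma> t))"
    using u ends by (auto simp: uniform_curve_def bdist_def)
  have "curve_length d \<gamma> a e < \<infinity>" using len by (auto intro: le_less_trans)
  then have r: "rectifiable_curve X d a e \<gamma>" using c by (simp add: rectifiable_curve_def)
  have ae: "a \<le> e" using c by (simp add: curve_def)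
  define L where "L t = enn2real (curve_length d \<gamma> a t)" for t
  define \<eta> where "\<eta> = arc_length_param d \<gamma> a e"
  note arc = arc_length_param[OF r, folded L_def \<eta>_def]
  have nn: "0 \<le> CU * d x y" using CU by simp
  have "L e \<le> CU * d x y" unfolding L_def using enn2real_mono[OF len] nn by simp
  moreover have "min u (L e - u) \<le> CU * bdist (\<eta> u)" if u: "u \<in> {0..L e}" for u
  proof -
    obtain t where t: "t \<in> {a..e}" "curve_length d \<gamma> a t = ennreal u"
      using ex_curve_length_eq[OF r, of u] u by (auto simp: L_def)
    have Lt: "L t = u" using t u by (simp add: L_def)
    have te: "curve_length d \<gamma> t e = ennreal (L e - u)"
      using curve_length_diff(1)[OF r, of t e] t Lt unfolding L_def[symmetric] by simp
    have "\<eta> u = \<gamma> t" using arc(1)[OF t(1)] Lt by simp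
    then have "ennreal (min u (L e - u)) \<le> ennreal (CU * bdist (\<eta> u))"
      using uc[OF t(1)] u unfolding t te by (auto simp: min_def ennreal_le_iff2 split: if_splits)
    moreover have "0 \<le> CU * bdist (\<eta> u)"
      using CU bdist_nonneg[OF lip_curveD(1)[OF arc(4)]] u by simp
    ultimately show ?thesis by simp
  qed
  ultimately have "ucurve (L e) \<eta>" unfolding ucurve_def using arc ends by simp
  then show ?thesis using that arc ends by blast
qed

lemma rho_nrm_borel: "(\<lambda>x. ennreal (\<rho> (nrm x))) \<in> borel_measurable (metric_borel X d)"
proof -
  have "(\<lambda>x. ennreal (\<rho> (nrm x)) * indicator {0<..} (nrm x)) \<in> borel_measurable (metric_borel X d)"
    using measurable_compose[OF nrm_borel rho_measurable] .
  then show ?thesis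
    by (rule measurable_cong[THEN iffD1, rotated]) (auto simp: space_metric_borel nrm_pos)
qed

sublocale weighted_metric X d "\<lambda>x. \<rho> (nrm x)" Kw
proof unfold_locales
  show "\<exists>l \<eta>. lip_curve l \<eta> \<and> \<eta> 0 = x \<and> \<eta> l = y" if "x \<in> X" "y \<in> X" for x y
    using ucurve_exists[OF that] by (metis ucurve_def)
qed (use Kw rho_nrm_borel rho_pos nrm_pos in auto)

lemma sph_dist_eq: "sph_dist X d b \<rho> = wdist"
proof (intro ext)
  show "sph_dist X d b \<rho> x y = wdist x y" for x y
    unfolding wdist_def sph_dist_def unfolding nrm_def ..
qed

lemma ucurve_lip: "ucurve l \<eta> \<Longrightarrow> lip_curve l \<eta>"
  by (simp add: ucurve_def)

lemma ucurveD: "ucurve l \<eta> \<Longrightarrow> 0 \<le> u \<Longrightarrow> u \<le> l \<Longrightarrow> min u (l - u) \<le> CU * bdist (\<eta> u)"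
  unfolding ucurve_def atLeastAtMost_iff Ball_def by blast

lemma ucurve_rev: "ucurve l \<eta> \<Longrightarrow> ucurve l (\<lambda>u. \<eta> (l - u))"
proof -
  assume u: "ucurve l \<eta>"
  have "min v (l - v) \<le> CU * bdist (\<eta> (l - v))" if "v \<in> {0..l}" for v
  proof -
    have "min (l - v) (l - (l - v)) \<le> CU * bdist (\<eta> (l - v))" using that by (intro ucurveD[OF u]) auto
    then show ?thesis by (simp add: min.commute)
  qed
  then show ?thesis using u lip_curve_rev[of l \<eta>] commute[of "\<eta> 0" "\<eta> l"] by (simp add: ucurve_def)
qed

text \<open>
  A uniform curve stays away from the boundary, in particular from \<open>b\<close>, in proportion to the
  length passed. Along its first half, \<open>N\<close> is therefore comparable to its value at the initial
  point plus this length.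
\<close>

lemma ucurve_N:
  assumes "ucurve l \<eta>" "0 \<le> u" "u \<le> l / 2"
  shows "N (\<eta> 0) + u \<le> (1 + 2 * CU) * N (\<eta> u)" "N (\<eta> u) \<le> N (\<eta> 0) + u"
    "u \<le> CU * bdist (\<eta> u)" "u \<le> CU * N (\<eta> u)"
proof -
  have lip: "lip_curve l \<eta>" using assms by (simp add: ucurve_def)
  have m: "\<eta> 0 \<in> X" "\<eta> u \<in> X" using lip_curveD(1)[OF lip] assms by auto
  have dd: "d (\<eta> 0) (\<eta> u) \<le> u" "d (\<eta> u) (\<eta> 0) \<le> u" using lip_curveD(2)[OF lip, of 0 u] assms commute by auto
  show "N (\<eta> u) \<le> N (\<eta> 0) + u" using N_lip[OF m(2,1)] dd by simp
  have "min u (l - u) \<le> CU * bdist (\<eta> u)" using assms by (intro ucurveD) auto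
  moreover have "min u (l - u) = u" using assms by auto
  ultimately show 1: "u \<le> CU * bdist (\<eta> u)" by simp
  have "CU * bdist (\<eta> u) \<le> CU * N (\<eta> u)"
    using CU bdist_le_nrm[OF m(2)] by (intro mult_left_mono) (auto simp: N_def)
  then show 2: "u \<le> CU * N (\<eta> u)" using 1 by simp
  show "N (\<eta> 0) + u \<le> (1 + 2 * CU) * N (\<eta> u)"
    using N_lip[OF m] dd 2 by (simp add: distrib_right)
qed

text \<open>
  The weight at \<open>\<eta> v\<close> is comparable to \<open>\<rho> (N (\<eta> 0) + v)\<close>. Hence the path integral over a piece of
  the first half of a uniform curve is essentially an integral of \<open>\<rho>\<close> over an interval.
\<close>

lemma wint_half:
  obtains C where "1 \<le> C" "\<And>l \<eta> p q. \<lbrakk>ucurve l \<eta>; 0 \<le> p; p \<le> q; q \<le> l / 2\<rbrakk> \<Longrightarrow>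
     wint \<eta> p q \<le> ennreal (C * \<rho> (N (\<eta> 0) + p) * min (q - p) (N (\<eta> 0) + p))"
proof -
  obtain C0 where C0: "1 \<le> C0"
    "\<And>s t. \<lbrakk>1 \<le> s; 1 \<le> t; s \<le> (1 + 2 * CU) * t; t \<le> (1 + 2 * CU) * s\<rbrakk> \<Longrightarrow> \<rho> s \<le> C0 * \<rho> t"
    using rho_comp[of "1 + 2 * CU"] CU by auto
  have c1: "1 \<le> CA * C0" using CA(1) C0(1) mult_mono[of 1 CA 1 C0] by simp
  show ?thesis
  proof (rule that[of "CA * C0 * (CA + 2 * CB)"])
    have "1 * 1 \<le> CA * C0 * (CA + 2 * CB)" using c1 CA(1) CB(1) by (intro mult_mono) auto
    then show "1 \<le> CA * C0 * (CA + 2 * CB)" by simp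
    fix l \<eta> p q assume u: "ucurve l \<eta>" "0 \<le> p" "p \<le> q" "q \<le> l / 2"
    have lip: "lip_curve l \<eta>" using u by (simp add: ucurve_def)
    define x where "x = \<eta> 0"
    have x: "x \<in> X" using lip_curveD(1)[OF lip, of 0] u by (auto simp: x_def)
    have Nx: "1 < N x" by (rule N_gt1[OF x])
    have pt: "\<rho> (nrm (\<eta> v)) \<le> CA * C0 * \<rho> (N x + v)" if v: "v \<in> {p..q}" for v
    proof -
      have m: "\<eta> v \<in> X" using lip_curveD(1)[OF lip, of v] v u by auto
      note n = ucurve_N[OF u(1), of v, folded x_def]
      have "N (\<eta> v) \<le> (1 + 2 * CU) * (N x + v)"
      proof -
        have "1 * (N x + v) \<le> (1 + 2 * CU) * (N x + v)" using CU Nx v u by (intro mult_right_mono) auto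
        then show ?thesis using n(2) v u by auto
      qed
      then have "\<rho> (N (\<eta> v)) \<le> C0 * \<rho> (N x + v)"
        using n(1) v u N_gt1[OF m] Nx by (intro C0(2)) auto
      then have "CA * \<rho> (N (\<eta> v)) \<le> CA * (C0 * \<rho> (N x + v))" using CA(1) by (intro mult_left_mono) auto
      then show ?thesis using rho_nrm_comp(1)[OF m] by simp
    qed
    have "wint \<eta> p q \<le> (\<integral>\<^sup>+v. ennreal (CA * C0) * (ennreal (\<rho> (N x + v)) * indicator {p..q} v) \<partial>lborel)"
      unfolding wint_def using pt c1 rho_pos Nx u
      by (intro nn_integral_mono) (auto simp: indicator_def ennreal_mult[symmetric] less_imp_le intro!: ennreal_leI)
    also have "\<dots> = (\<integral>\<^sup>+v. ennreal (CA * C0) * (ennreal (\<rho> (N x + 1 * v)) * indicator {N x + p..N x + q} (N x + 1 * v)) \<partial>lborel)"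
      by (intro nn_integral_cong) (auto simp: indicator_def)
    also have "\<dots> = (\<integral>\<^sup>+t. ennreal (CA * C0) * (ennreal (\<rho> t) * indicator {N x + p..N x + q} t) \<partial>lborel)"
      using nn_integral_real_affine[of "\<lambda>t. ennreal (CA * C0) * (ennreal (\<rho> t) * indicator {N x + p..N x + q} t)" 1 "N x"]
        rho_measurable_sub[of "N x + p" "N x + q"] Nx u by simp
    also have "\<dots> = ennreal (CA * C0) * (\<integral>\<^sup>+t\<in>{N x + p..N x + q}. ennreal (\<rho> t) \<partial>lborel)"
      using rho_measurable_sub[of "N x + p" "N x + q"] Nx u by (subst nn_integral_cmult) auto
    also have "\<dots> \<le> ennreal (CA * C0) * ennreal ((CA + 2 * CB) * \<rho> (N x + p) * min (N x + q - (N x + p)) (N x + p))"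
      using u Nx by (intro mult_left_mono rho_integral_le) auto
    also have "\<dots> = ennreal (CA * C0 * (CA + 2 * CB) * \<rho> (N (\<eta> 0) + p) * min (q - p) (N (\<eta> 0) + p))"
      using c1 rho_pos[of "N x + p"] Nx u CA CB
      by (subst ennreal_mult[symmetric]) (auto simp: x_def mult.assoc intro!: mult_nonneg_nonneg)
    finally show "wint \<eta> p q \<le> \<dots>" .
  qed
qed

lemma wint_split:
  assumes "ucurve l \<eta>" "0 \<le> u" "u \<le> l/2"
  shows "wint \<eta> u l = wint \<eta> u (l/2) + wint (\<lambda>v. \<eta> (l - v)) 0 (l/2)"
proof -
  have l: "lip_curve l \<eta>" using assms by (simp add: ucurve_def)
  show ?thesis using wint_add[OF l, of u "l/2" l] wint_rev[OF l, of "l/2" l] assms by simp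
qed

text \<open>
  The two halves of the curve are estimated separately, each one starting from its end point.
\<close>

lemma wint_ucurve_le:
  obtains C where "1 \<le> C" "\<And>l \<eta>. ucurve l \<eta> \<Longrightarrow> wint \<eta> 0 l \<le>
    ennreal (C * (\<rho> (N (\<eta> 0)) * min (d (\<eta> 0) (\<eta> l)) (N (\<eta> 0)) + \<rho> (N (\<eta> l)) * min (d (\<eta> 0) (\<eta> l)) (N (\<eta> l))))"
proof -
  obtain C where C: "1 \<le> C" "\<And>l \<eta> p q. \<lbrakk>ucurve l \<eta>; 0 \<le> p; p \<le> q; q \<le> l / 2\<rbrakk> \<Longrightarrow>
     wint \<eta> p q \<le> ennreal (C * \<rho> (N (\<eta> 0) + p) * min (q - p) (N (\<eta> 0) + p))"
    by (rule wint_half) blast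
  show ?thesis
  proof (rule that[of "C * CU"])
    have "1 * 1 \<le> C * CU" using C(1) CU by (intro mult_mono) auto
    then show "1 \<le> C * CU" by simp
    fix l \<eta> assume u: "ucurve l \<eta>"
    have lip: "lip_curve l \<eta>" using u by (simp add: ucurve_def)
    have l: "0 \<le> l" using lip by (simp add: lip_curve_def)
    define x where "x = \<eta> 0" define y where "y = \<eta> l"
    have xy: "x \<in> X" "y \<in> X" using lip_curveD(1)[OF lip] l by (auto simp: x_def y_def)
    have le: "min (l/2 - 0) (N z + 0) \<le> CU * min (d x y) (N z)" if "z \<in> X" for z
    proof -
      have "l \<le> CU * d x y" using u by (simp add: ucurve_def x_def y_def)
      moreover have "1 * N z \<le> CU * N z" using CU N_gt1[OF that] by (intro mult_right_mono) auto
      ultimately show ?thesis using l by (auto simp: min_def)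
    qed
    have hx: "C * \<rho> (N z + 0) * min (l/2 - 0) (N z + 0) \<le> C * CU * (\<rho> (N z) * min (d x y) (N z))" if "z \<in> X" for z
    proof -
      have "C * \<rho> (N z) * min (l/2 - 0) (N z + 0) \<le> C * \<rho> (N z) * (CU * min (d x y) (N z))"
        using C(1) rho_pos[of "N z"] N_gt1[OF that] le[OF that] by (intro mult_left_mono) auto
      then show ?thesis by (simp add: algebra_simps)
    qed
    have nn: "0 \<le> C * CU * (\<rho> (N z) * min (d x y) (N z))" if "z \<in> X" for z
      using C(1) CU rho_pos[of "N z"] N_gt1[OF that] by (intro mult_nonneg_nonneg) auto
    have "wint \<eta> 0 l = wint \<eta> 0 (l/2) + wint (\<lambda>v. \<eta> (l - v)) 0 (l/2)"
      using wint_split[OF u, of 0] l by simp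
    also have "\<dots> \<le> ennreal (C * CU * (\<rho> (N x) * min (d x y) (N x))) + ennreal (C * CU * (\<rho> (N y) * min (d x y) (N y)))"
    proof (rule add_mono)
      show "wint \<eta> 0 (l/2) \<le> ennreal (C * CU * (\<rho> (N x) * min (d x y) (N x)))"
        using C(2)[OF u, of 0 "l/2"] ennreal_leI[OF hx[OF xy(1)]] l unfolding x_def by (auto intro: order_trans)
      show "wint (\<lambda>v. \<eta> (l - v)) 0 (l/2) \<le> ennreal (C * CU * (\<rho> (N y) * min (d x y) (N y)))"
        using C(2)[OF ucurve_rev[OF u], of 0 "l/2"] ennreal_leI[OF hx[OF xy(2)]] l unfolding y_def by (auto intro: order_trans)
    qed
    also have "\<dots> = ennreal (C * CU * (\<rho> (N x) * min (d x y) (N x) + \<rho> (N y) * min (d x y) (N y)))"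
      using nn[OF xy(1)] nn[OF xy(2)] by (subst ennreal_plus[symmetric]) (auto simp: distrib_left)
    finally show "wint \<eta> 0 l \<le> ennreal (C * CU * (\<rho> (N (\<eta> 0)) * min (d (\<eta> 0) (\<eta> l)) (N (\<eta> 0)) + \<rho> (N (\<eta> l)) * min (d (\<eta> 0) (\<eta> l)) (N (\<eta> l))))"
      by (simp add: x_def y_def)
  qed
qed

text \<open>
  A curve from \<open>x\<close> to \<open>y\<close> spends at least length \<open>min (d x y) (N x / 2)\<close> in the region where the
  weight is comparable to its value at \<open>x\<close>.
\<close>

lemma wdist_lower:
  assumes "x \<in> X" "y \<in> X"
  shows "\<rho> (N x) * min (d x y) (N x) \<le> 2 * CA\<^sup>2 * wdist x y"
proof (rule ccontr)
  assume neg: "\<not> \<rho> (N x) * min (d x y) (N x) \<le> 2 * CA\<^sup>2 * wdist x y"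
  define c where "c = \<rho> (N x) * min (d x y) (N x) / (2 * CA\<^sup>2)"
  have "0 < CA\<^sup>2" using CA(1) by simp
  then have "wdist x y < c" using neg unfolding c_def by (simp add: less_divide_eq mult.commute)
  then obtain l \<eta> where \<eta>: "lip_curve l \<eta>" "\<eta> 0 = x" "\<eta> l = y" "wint \<eta> 0 l < ennreal c"
    by (rule wdist_approx[OF assms])
  have l: "0 \<le> l" using \<eta> by (simp add: lip_curve_def)
  have dl: "d x y \<le> l" using lip_curveD(2)[OF \<eta>(1), of 0 l] \<eta> l by simp
  have Nx: "1 < N x" by (rule N_gt1[OF assms(1)])
  define m where "m = min l (N x / 2)"
  have m: "0 \<le> m" "m \<le> l" using l Nx by (auto simp: m_def)
  have pt: "\<rho> (N x) / CA\<^sup>2 \<le> \<rho> (nrm (\<eta> u))" if u: "u \<in> {0..m}" for u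
  proof -
    have z: "\<eta> u \<in> X" using lip_curveD(1)[OF \<eta>(1), of u] u m by auto
    have "d x (\<eta> u) \<le> u" using lip_curveD(2)[OF \<eta>(1), of 0 u] u m \<eta> by auto
    then have "N x \<le> N (\<eta> u) + N x / 2" "N (\<eta> u) \<le> N x + N x / 2"
      using N_lip[OF assms(1) z] N_lip[OF z assms(1)] u commute[of x "\<eta> u"] by (auto simp: m_def)
    then have "\<rho> (N x) \<le> CA * \<rho> (N (\<eta> u))" using Nx N_gt1[OF z] by (intro rho_comp1) auto
    also have "\<dots> \<le> CA * (CA * \<rho> (nrm (\<eta> u)))" using rho_nrm_comp[OF z] CA(1) by (intro mult_left_mono) auto
    finally show ?thesis using CA(1) by (simp add: divide_le_eq power2_eq_square mult.assoc mult.commute mult.left_commute)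
  qed
  have nn: "0 \<le> \<rho> (N x) / CA\<^sup>2" using rho_pos[of "N x"] Nx by auto
  have "c \<le> \<rho> (N x) / CA\<^sup>2 * m"
  proof -
    have "min (d x y) (N x) \<le> 2 * m" using dl l Nx by (auto simp: m_def min_def)
    from mult_left_mono[OF this nn] show ?thesis using CA(1) by (simp add: c_def field_simps)
  qed
  then have "ennreal c \<le> ennreal (\<rho> (N x) / CA\<^sup>2 * m)" by (rule ennreal_leI)
  also have "\<dots> = (\<integral>\<^sup>+u. ennreal (\<rho> (N x) / CA\<^sup>2) * indicator {0..m} u \<partial>lborel)"
    using nn m by (subst nn_integral_cmult) (simp_all add: ennreal_mult[symmetric])
  also have "\<dots> \<le> wint \<eta> 0 m"
    unfolding wint_def using pt by (intro nn_integral_mono) (auto simp: indicator_def intro!: ennreal_leI)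
  also have "\<dots> \<le> wint \<eta> 0 l" by (rule wint_mono) (use m in auto)
  finally show False using \<eta>(4) by simp
qed

lemma wdist_zero_iff:
  assumes "x \<in> X" "y \<in> X" shows "wdist x y = 0 \<longleftrightarrow> x = y"
proof
  assume "wdist x y = 0"
  then have "\<rho> (N x) * min (d x y) (N x) \<le> 0" using wdist_lower[OF assms] by simp
  then have "min (d x y) (N x) \<le> 0" using rho_pos[of "N x"] N_gt1[OF assms(1)] by (simp add: mult_le_0_iff)
  then have "d x y \<le> 0" using N_gt1[OF assms(1)] by (auto simp: min_le_iff_disj)
  then have "d x y = 0" using nonneg[of x y] by linarith
  then show "x = y" using assms by simp
next
  assume "x = y"
  have "lip_curve 0 (\<lambda>_. x)" using assms by (simp add: lip_curve_def)
  then have "ennreal (wdist x x) \<le> ennreal (Kw * (0 - 0))"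
    using order_trans[OF wdist_le_wint wint_le, of 0 "\<lambda>_. x" 0 0] by simp
  then show "wdist x y = 0" using \<open>x = y\<close> wdist_nonneg[of x x] by (simp add: ennreal_le_iff2)
qed

text \<open>
  The locale \<open>Metric_space\<close> asks for symmetry also outside of the carrier. There the infimum is
  taken over the empty set, and the resulting value \<open>\<infinity>\<close> is turned into \<open>0\<close>.
\<close>

lemma wdist_outside:
  assumes "x \<notin> X \<or> y \<notin> X" shows "wdist x y = 0"
proof -
  have e: "{path_integral d \<gamma> s u (\<lambda>z. ennreal (\<rho> (nrm z))) |\<gamma> s u.
      rectifiable_curve X d s u \<gamma> \<and> \<gamma> s = x \<and> \<gamma> u = y} = {}"
    using assms curve_in by (auto simp: rectifiable_curve_def curve_def)
  show ?thesis unfolding wdist_def e by simp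
qed

sublocale sph: Metric_space X wdist
proof
  show "wdist x y = wdist y x" for x y
    using wdist_commute[of x y] wdist_outside[of x y] wdist_outside[of y x] by (cases "x \<in> X \<and> y \<in> X") auto
qed (use wdist_nonneg wdist_zero_iff wdist_triangle in auto)

lemma wdist_upper:
  obtains C where "1 \<le> C" "\<And>x y. \<lbrakk>x \<in> X; y \<in> X\<rbrakk> \<Longrightarrow>
     wdist x y \<le> C * (\<rho> (N x) * min (d x y) (N x) + \<rho> (N y) * min (d x y) (N y))"
proof -
  obtain C where C: "1 \<le> C" "\<And>l \<eta>. ucurve l \<eta> \<Longrightarrow> wint \<eta> 0 l \<le>
    ennreal (C * (\<rho> (N (\<eta> 0)) * min (d (\<eta> 0) (\<eta> l)) (N (\<eta> 0)) + \<rho> (N (\<eta> l)) * min (d (\<eta> 0) (\<eta> l)) (N (\<eta> l))))"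
    by (rule wint_ucurve_le) blast
  show ?thesis
  proof (rule that[OF C(1)])
    fix x y assume xy: "x \<in> X" "y \<in> X"
    obtain l \<eta> where \<eta>: "ucurve l \<eta>" "\<eta> 0 = x" "\<eta> l = y" using ucurve_exists[OF xy] .
    have l: "0 \<le> l" using ucurve_lip[OF \<eta>(1)] by (simp add: lip_curve_def)
    have nn: "0 \<le> \<rho> (N z) * min (d x y) (N z)" if "z \<in> X" for z
      using rho_pos[of "N z"] N_gt1[OF that] by (intro mult_nonneg_nonneg) auto
    have "ennreal (wdist x y) \<le> wint \<eta> 0 l"
      using wdist_le_wint[OF ucurve_lip[OF \<eta>(1)], of 0 l] l \<eta> by simp
    also note C(2)[OF \<eta>(1), unfolded \<eta>(2,3)]
    finally show "wdist x y \<le> C * (\<rho> (N x) * min (d x y) (N x) + \<rho> (N y) * min (d x y) (N y))"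
      using nn[OF xy(1)] nn[OF xy(2)] C(1) by (subst (asm) ennreal_le_iff) auto
  qed
qed

text \<open>
  Both terms of the upper bound for the distance are at most \<open>\<kappa>\<close> at the respective end point, and
  \<open>\<kappa>\<close> is almost decreasing. Thus points far from \<open>b\<close> are close to each other.
\<close>

lemma wdist_le_kappa:
  obtains C where "1 \<le> C" "\<And>S x y. \<lbrakk>x \<in> X; y \<in> X; 1 \<le> S; S \<le> N x; S \<le> N y\<rbrakk> \<Longrightarrow> wdist x y \<le> C * \<kappa> S"
proof -
  obtain C where C: "1 \<le> C" "\<And>x y. \<lbrakk>x \<in> X; y \<in> X\<rbrakk> \<Longrightarrow>
     wdist x y \<le> C * (\<rho> (N x) * min (d x y) (N x) + \<rho> (N y) * min (d x y) (N y))"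
    by (rule wdist_upper) blast
  obtain C0 where C0: "1 \<le> C0" "\<And>s t. \<lbrakk>1 \<le> s; 1 \<le> t; s \<le> 1 * t\<rbrakk> \<Longrightarrow> \<kappa> t \<le> C0 * \<kappa> s"
    using kappa_almost_decreasing[of 1] by auto
  show ?thesis
  proof (rule that[of "2 * C * C0"])
    have "1 * 1 \<le> C * C0" using C(1) C0(1) by (intro mult_mono) auto
    then show "1 \<le> 2 * C * C0" by simp
    fix S x y assume a: "x \<in> X" "y \<in> X" "1 \<le> S" "S \<le> N x" "S \<le> N y"
    have *: "\<rho> (N z) * min (d x y) (N z) \<le> C0 * \<kappa> S" if "z \<in> X" "S \<le> N z" for z
    proof -
      have "\<rho> (N z) * min (d x y) (N z) \<le> \<rho> (N z) * N z"
        using rho_pos[of "N z"] N_gt1[OF that(1)] by (intro mult_left_mono) auto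
      also have "\<dots> = \<kappa> (N z)" by (simp add: \<kappa>_def)
      also have "\<dots> \<le> C0 * \<kappa> S" using C0(2)[of S "N z"] a(3) that by auto
      finally show ?thesis .
    qed
    have "wdist x y \<le> C * (\<rho> (N x) * min (d x y) (N x) + \<rho> (N y) * min (d x y) (N y))"
      by (rule C(2)) (use a in auto)
    also have "\<dots> \<le> C * (C0 * \<kappa> S + C0 * \<kappa> S)"
      using C(1) a by (intro mult_left_mono add_mono *) auto
    finally show "wdist x y \<le> 2 * C * C0 * \<kappa> S" by (simp add: algebra_simps)
  qed
qed

lemma wdist_near:
  obtains C where "1 \<le> C" "\<And>x y. \<lbrakk>x \<in> X; y \<in> X; d x y \<le> N x / 2\<rbrakk> \<Longrightarrow> wdist x y \<le> C * \<rho> (N x) * d x y"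
proof -
  obtain C where C: "1 \<le> C" "\<And>x y. \<lbrakk>x \<in> X; y \<in> X\<rbrakk> \<Longrightarrow>
     wdist x y \<le> C * (\<rho> (N x) * min (d x y) (N x) + \<rho> (N y) * min (d x y) (N y))"
    by (rule wdist_upper) blast
  show ?thesis
  proof (rule that[of "C * (1 + CA)"])
    have "1 * 1 \<le> C * (1 + CA)" using C(1) CA(1) by (intro mult_mono) auto
    then show "1 \<le> C * (1 + CA)" by simp
    fix x y assume a: "x \<in> X" "y \<in> X" "d x y \<le> N x / 2"
    have n: "N x \<le> N y + d x y" "N y \<le> N x + d x y" using N_lip[of x y] N_lip[of y x] a commute[of x y] by auto
    have ry: "\<rho> (N y) \<le> CA * \<rho> (N x)"
      using n a N_gt1[of x] N_gt1[of y] by (intro rho_comp1) auto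
    have h1: "\<rho> (N x) * min (d x y) (N x) \<le> \<rho> (N x) * d x y"
      using rho_pos[of "N x"] N_gt1[of x] a by (intro mult_left_mono) auto
    have h2: "\<rho> (N y) * min (d x y) (N y) \<le> CA * \<rho> (N x) * d x y"
      using rho_pos[of "N y"] N_gt1[of y] N_gt1[of x] rho_pos[of "N x"] CA(1) ry a by (intro mult_mono) auto
    have "C * (\<rho> (N x) * min (d x y) (N x) + \<rho> (N y) * min (d x y) (N y)) \<le> C * (\<rho> (N x) * d x y + CA * \<rho> (N x) * d x y)"
      using C(1) by (intro mult_left_mono[OF add_mono[OF h1 h2]]) auto
    then show "wdist x y \<le> C * (1 + CA) * \<rho> (N x) * d x y"
      using C(2)[OF a(1,2)] by (simp add: algebra_simps)
  qed
qed

lemma wdist_le_dist: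
  assumes "x \<in> X" "y \<in> X" shows "wdist x y \<le> Kw * CU * d x y"
proof -
  obtain l \<eta> where \<eta>: "ucurve l \<eta>" "\<eta> 0 = x" "\<eta> l = y" using ucurve_exists[OF assms] .
  have l: "0 \<le> l" "l \<le> CU * d x y" using \<eta> by (auto simp: lip_curve_def ucurve_def)
  have "ennreal (wdist x y) \<le> ennreal (Kw * (l - 0))"
    using order_trans[OF wdist_le_wint wint_le, OF ucurve_lip[OF \<eta>(1)], of 0 l] ucurve_lip[OF \<eta>(1)] l \<eta> by simp
  then have "wdist x y \<le> Kw * l" using Kw(1) l by (subst (asm) ennreal_le_iff) auto
  also have "\<dots> \<le> Kw * (CU * d x y)" using l Kw(1) by (intro mult_left_mono) auto
  finally show ?thesis by simp
qed

lemma wdist_bounded: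
  obtains C where "0 < C" "\<And>x y. \<lbrakk>x \<in> X; y \<in> X\<rbrakk> \<Longrightarrow> wdist x y \<le> C * \<kappa> 1"
proof -
  obtain C where C: "1 \<le> C" "\<And>S x y. \<lbrakk>x \<in> X; y \<in> X; 1 \<le> S; S \<le> N x; S \<le> N y\<rbrakk> \<Longrightarrow> wdist x y \<le> C * \<kappa> S"
    by (rule wdist_le_kappa) blast
  show ?thesis
  proof (rule that[of C])
    show "0 < C" using C(1) by simp
    show "wdist x y \<le> C * \<kappa> 1" if "x \<in> X" "y \<in> X" for x y
      by (rule C(2)) (use that N_gt1[of x] N_gt1[of y] in auto)
  qed
qed

lemma X_nonempty: "X \<noteq> {}" using crep_b_in by auto

lemma sph_bounded: "sph.mbounded X"
proof -
  obtain x where x: "x \<in> X" using X_nonempty by auto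
  obtain C where C: "0 < C" "\<And>x y. \<lbrakk>x \<in> X; y \<in> X\<rbrakk> \<Longrightarrow> wdist x y \<le> C * \<kappa> 1"
    by (rule wdist_bounded) blast
  have "X \<subseteq> sph.mcball x (C * \<kappa> 1)" using x C by auto
  then show ?thesis unfolding sph.mbounded_def by blast
qed

lemma dist_le_wdist:
  assumes "x \<in> X" "y \<in> X" "0 < e" "2 * CA\<^sup>2 * wdist x y < \<rho> (N x) * min e (N x)"
  shows "d x y < e"
proof (rule ccontr)
  assume "\<not> d x y < e"
  then have "\<rho> (N x) * min e (N x) \<le> \<rho> (N x) * min (d x y) (N x)"
    using rho_pos[of "N x"] N_gt1[OF assms(1)] by (intro mult_left_mono) auto
  then show False using wdist_lower[OF assms(1,2)] assms(4) by simp
qed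

text \<open>
  The identity is Lipschitz from \<open>d\<close> to the new metric since the weight is bounded. Its inverse
  is continuous since the lower bound for the distance controls \<open>d\<close> near each point.
\<close>

lemma sph_topology: "sph.mtopology = mtopology"
proof (rule topology_eq[THEN iffD2], intro allI iffI)
  fix U assume U: "openin sph.mtopology U"
  show "openin mtopology U"
    unfolding openin_mtopology
  proof (intro conjI allI impI)
    show "U \<subseteq> X" using U by (simp add: sph.openin_mtopology)
    fix x assume x: "x \<in> U"
    then obtain r where r: "r > 0" "sph.mball x r \<subseteq> U" using U by (auto simp: sph.openin_mtopology)
    have k: "0 < Kw * CU" using Kw(1) CU by simp
    have "mball x (r / (Kw * CU)) \<subseteq> sph.mball x r"
    proof
      fix y assume "y \<in> mball x (r / (Kw * CU))"
      then have y: "x \<in> X" "y \<in> X" "d x y < r / (Kw * CU)" by auto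
      then have "Kw * CU * d x y < r" using k by (simp add: less_divide_eq mult.commute)
      then show "y \<in> sph.mball x r" using wdist_le_dist[OF y(1,2)] y by simp
    qed
    then show "\<exists>r>0. mball x r \<subseteq> U" using r k by (intro exI[of _ "r / (Kw * CU)"]) auto
  qed
next
  fix U assume U: "openin mtopology U"
  show "openin sph.mtopology U"
    unfolding sph.openin_mtopology
  proof (intro conjI allI impI)
    show sub: "U \<subseteq> X" using U by (simp add: openin_mtopology)
    fix x assume x: "x \<in> U"
    then obtain r where r: "r > 0" "mball x r \<subseteq> U" using U by (auto simp: openin_mtopology)
    have xX: "x \<in> X" using x sub by auto
    define q where "q = \<rho> (N x) * min r (N x) / (2 * CA\<^sup>2)"
    have q: "0 < q" using rho_pos[of "N x"] N_gt1[OF xX] r CA(1) by (auto simp: q_def)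
    have "sph.mball x q \<subseteq> mball x r"
    proof
      fix y assume "y \<in> sph.mball x q"
      then have y: "y \<in> X" "wdist x y < q" by auto
      then have "2 * CA\<^sup>2 * wdist x y < \<rho> (N x) * min r (N x)"
        using CA(1) by (simp add: q_def less_divide_eq mult.commute)
      then show "y \<in> mball x r" using dist_le_wdist[OF xX y(1) r(1)] y xX by simp
    qed
    then show "\<exists>r>0. sph.mball x r \<subseteq> U" using r q by (intro exI[of _ q]) auto
  qed
qed

section \<open>The completion of the sphericalized space\<close>

text \<open>The logarithmic decay of \<open>\<kappa>\<close> makes it tend to \<open>0\<close>.\<close>

lemma kappa_small:
  assumes "0 < e" obtains S where "1 \<le> S" "\<And>s. S \<le> s \<Longrightarrow> \<kappa> s < e"
proof -
  obtain C where C: "1 \<le> C" "\<And>s t. \<lbrakk>1 \<le> s; s \<le> t\<rbrakk> \<Longrightarrow> \<kappa> t * ln (t / s) \<le> C * \<kappa> s"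
    by (rule kappa_log_decay) blast
  define m where "m = C * \<kappa> 1 / e + 1"
  have m: "0 < m" using C(1) kappa_pos[of 1] assms by (auto simp: m_def intro!: add_pos_pos divide_pos_pos mult_pos_pos)
  show ?thesis
  proof (rule that[of "exp m"])
    show "1 \<le> exp m" using m by simp
    fix s assume s: "exp m \<le> s"
    have s1: "1 \<le> s" using s m by (smt (verit) one_le_exp_iff)
    have "m \<le> ln s" using s s1 by (simp add: ln_ge_iff)
    then have "\<kappa> s * m \<le> \<kappa> s * ln s" using kappa_pos[OF s1] by (intro mult_left_mono) auto
    also have "\<dots> \<le> C * \<kappa> 1" using C(2)[of 1 s] s1 by simp
    also have "\<dots> < e * m" using assms by (simp add: m_def distrib_left)
    finally show "\<kappa> s < e" using m by (metis mult_less_cancel_right_disj mult.commute not_less_iff_gr_or_eq)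
  qed
qed

lemma rho_lower_on_bounded:
  assumes "1 \<le> M"
  obtains c where "0 < c" "\<And>x. \<lbrakk>x \<in> X; N x \<le> M\<rbrakk> \<Longrightarrow> c \<le> \<rho> (N x)"
proof -
  obtain C where C: "1 \<le> C" "\<And>s t. \<lbrakk>1 \<le> s; 1 \<le> t; s \<le> M * t; t \<le> M * s\<rbrakk> \<Longrightarrow> \<rho> s \<le> C * \<rho> t"
    using rho_comp[OF assms] by blast
  show ?thesis
  proof (rule that[of "\<rho> 1 / C"])
    show "0 < \<rho> 1 / C" using rho_pos[of 1] C(1) by simp
    fix x assume x: "x \<in> X" "N x \<le> M"
    have "1 * 1 \<le> M * N x" using N_gt1[OF x(1)] assms by (intro mult_mono) auto
    then have "\<rho> 1 \<le> C * \<rho> (N x)" using x N_gt1[OF x(1)] by (intro C(2)) auto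
    then show "\<rho> 1 / C \<le> \<rho> (N x)" using C(1) by (simp add: divide_le_eq mult.commute)
  qed
qed

text \<open>
  On a bounded set the weight is bounded below, so that there the lower bound for the distance is
  uniform.
\<close>

lemma dist_small_on_bounded:
  assumes "1 \<le> M" "0 < e"
  obtains q where "0 < q" "\<And>x y. \<lbrakk>x \<in> X; y \<in> X; N x \<le> M; wdist x y < q\<rbrakk> \<Longrightarrow> d x y < e"
proof -
  obtain c where c: "0 < c" "\<And>x. \<lbrakk>x \<in> X; N x \<le> M\<rbrakk> \<Longrightarrow> c \<le> \<rho> (N x)"
    by (rule rho_lower_on_bounded[OF assms(1)]) blast
  show ?thesis
  proof (rule that[of "c * min e 1 / (2 * CA\<^sup>2)"])
    show "0 < c * min e 1 / (2 * CA\<^sup>2)" using c assms CA(1) by simp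
    fix x y assume a: "x \<in> X" "y \<in> X" "N x \<le> M" "wdist x y < c * min e 1 / (2 * CA\<^sup>2)"
    have "2 * CA\<^sup>2 * wdist x y < c * min e 1" using a CA(1) by (simp add: less_divide_eq mult.commute)
    also have "\<dots> \<le> \<rho> (N x) * min e (N x)"
      using c a N_gt1[OF a(1)] assms rho_pos[of "N x"] by (intro mult_mono) auto
    finally show "d x y < e" by (rule dist_le_wdist[OF a(1,2) assms(2)])
  qed
qed

lemma MCauchy_N_bounded:
  assumes "MCauchy s" obtains M where "1 \<le> M" "\<And>n. N (s n) \<le> M"
proof -
  obtain m where m: "\<And>n n'. m \<le> n \<Longrightarrow> m \<le> n' \<Longrightarrow> d (s n) (s n') < 1"
    using assms unfolding MCauchy_def by (meson zero_less_one)
  have in_X: "s n \<in> X" for n using MCauchy_in[OF assms] .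
  define M where "M = Max (N ` s ` {..m}) + 1"
  have le: "N (s n) \<le> Max (N ` s ` {..m})" if "n \<le> m" for n using that by (intro Max_ge) auto
  have "N (s n) \<le> M" for n
  proof (cases "n \<le> m")
    case True then show ?thesis unfolding M_def using le[OF True] by linarith
  next
    case False
    then have "d (s n) (s m) < 1" by (intro m) auto
    then show ?thesis unfolding M_def using le[of m] N_lip[OF in_X in_X, of n m] by linarith
  qed
  moreover have "1 \<le> M" unfolding M_def using le[OF le0] N_gt1[OF in_X, of 0] by linarith
  ultimately show ?thesis using that by blast
qed

lemma MCauchy_imp_sph_MCauchy: "MCauchy s \<Longrightarrow> sph.MCauchy s"
  unfolding MCauchy_def sph.MCauchy_def
proof (intro conjI allI impI)
  fix e :: real assume s: "range s \<subseteq> X \<and> (\<forall>e>0. \<exists>m. \<forall>n n'. m \<le> n \<longrightarrow> m \<le> n' \<longrightarrow> d (s n) (s n') < e)" and e: "0 < e"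
  have k: "0 < Kw * CU" using Kw(1) CU by simp
  have "0 < e / (Kw * CU)" using e k by simp
  then obtain m where m: "\<And>n n'. m \<le> n \<Longrightarrow> m \<le> n' \<Longrightarrow> d (s n) (s n') < e / (Kw * CU)"
    using s by blast
  have "wdist (s n) (s n') < e" if "m \<le> n" "m \<le> n'" for n n'
  proof -
    have "Kw * CU * d (s n) (s n') < e" using m[OF that] k by (simp add: less_divide_eq mult.commute)
    then show ?thesis using wdist_le_dist[of "s n" "s n'"] s by (auto simp: subset_iff)
  qed
  then show "\<exists>m. \<forall>n n'. m \<le> n \<longrightarrow> m \<le> n' \<longrightarrow> wdist (s n) (s n') < e" by blast
qed auto

lemma cauchy_rel_sph_iff:
  assumes "MCauchy s" "MCauchy t"
  shows "(s, t) \<in> cauchy_rel X d \<longleftrightarrow> (s, t) \<in> cauchy_rel X wdist"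
proof -
  have in_X: "s n \<in> X" "t n \<in> X" for n using MCauchy_in assms by auto
  have "(\<lambda>n. d (s n) (t n)) \<longlonglongrightarrow> 0 \<longleftrightarrow> (\<lambda>n. wdist (s n) (t n)) \<longlonglongrightarrow> 0"
  proof
    assume "(\<lambda>n. d (s n) (t n)) \<longlonglongrightarrow> 0"
    then have "(\<lambda>n. Kw * CU * d (s n) (t n)) \<longlonglongrightarrow> 0" by (rule tendsto_mult_right_zero)
    then show "(\<lambda>n. wdist (s n) (t n)) \<longlonglongrightarrow> 0"
      by (rule Lim_null_comparison[rotated]) (use wdist_le_dist[OF in_X] in \<open>auto intro!: always_eventually\<close>)
  next
    assume l: "(\<lambda>n. wdist (s n) (t n)) \<longlonglongrightarrow> 0"
    obtain M where M: "1 \<le> M" "\<And>n. N (s n) \<le> M" using MCauchy_N_bounded[OF assms(1)] by blast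
    show "(\<lambda>n. d (s n) (t n)) \<longlonglongrightarrow> 0"
    proof (rule order_tendstoI)
      fix e :: real assume "0 < e"
      then obtain q where q: "0 < q" "\<And>x y. \<lbrakk>x \<in> X; y \<in> X; N x \<le> M; wdist x y < q\<rbrakk> \<Longrightarrow> d x y < e"
        using dist_small_on_bounded[OF M(1)] by blast
      show "\<forall>\<^sub>F n in sequentially. d (s n) (t n) < e"
        using order_tendstoD(2)[OF l q(1)] by (rule eventually_mono) (use q(2) in_X M in auto)
    qed (auto intro!: always_eventually intro: less_le_trans)
  qed
  then show ?thesis
    using assms MCauchy_imp_sph_MCauchy by (simp add: cauchy_rel_iff sph.cauchy_rel_iff)
qed

text \<open>
  If \<open>N\<close> is bounded along a subsequence, then the lower bound for the distance, applied at late
  elements of this subsequence, shows that all later elements of the sequence are close with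
  respect to \<open>d\<close> as well.
\<close>

lemma sph_MCauchy_cases:
  assumes s: "sph.MCauchy s"
  shows "MCauchy s \<or> filterlim (\<lambda>n. N (s n)) at_top sequentially"
proof (rule disjCI)
  assume "\<not> filterlim (\<lambda>n. N (s n)) at_top sequentially"
  then obtain Z where "\<not> (\<forall>\<^sub>F n in sequentially. Z \<le> N (s n))" by (auto simp: filterlim_at_top)
  then have fr: "\<And>m. \<exists>n\<ge>m. N (s n) < Z" by (auto simp: eventually_sequentially not_le)
  define M where "M = max 1 Z"
  have in_X: "s n \<in> X" for n using sph.MCauchy_in[OF s] .
  show "MCauchy s"
    unfolding MCauchy_def
  proof (intro conjI allI impI)
    fix e :: real assume "0 < e"
    then obtain q where q: "0 < q" "\<And>x y. \<lbrakk>x \<in> X; y \<in> X; N x \<le> M; wdist x y < q\<rbrakk> \<Longrightarrow> d x y < e / 2"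
      using dist_small_on_bounded[of M "e/2"] by (auto simp: M_def)
    obtain m where m: "\<And>n n'. m \<le> n \<Longrightarrow> m \<le> n' \<Longrightarrow> wdist (s n) (s n') < q"
      using s q(1) unfolding sph.MCauchy_def by blast
    obtain k where k: "m \<le> k" "N (s k) < Z" using fr by blast
    have "d (s n) (s n') < e" if "m \<le> n" "m \<le> n'" for n n'
    proof -
      have "d (s k) (s n) < e/2" "d (s k) (s n') < e/2"
        using q(2)[OF in_X in_X _ m] k that by (auto simp: M_def)
      then show ?thesis using triangle''[OF in_X[of n] in_X[of k] in_X[of n']] by simp
    qed
    then show "\<exists>m. \<forall>n n'. m \<le> n \<longrightarrow> m \<le> n' \<longrightarrow> d (s n) (s n') < e" by blast
  qed (use in_X in auto)
qed

text \<open>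
  Points with \<open>N x \<ge> S\<close> are within a multiple of \<open>\<kappa> S\<close> of each other, and \<open>\<kappa>\<close> tends to \<open>0\<close>.
\<close>

lemma wdist_at_infinity:
  assumes "range s \<subseteq> X" "filterlim (\<lambda>n. N (s n)) at_top sequentially"
    and "range t \<subseteq> X" "filterlim (\<lambda>n. N (t n)) at_top sequentially" and e: "0 < e"
  shows "\<exists>m. \<forall>n\<ge>m. \<forall>n'\<ge>m. wdist (s n) (t n') < e"
proof -
  obtain C where C: "1 \<le> C" "\<And>S x y. \<lbrakk>x \<in> X; y \<in> X; 1 \<le> S; S \<le> N x; S \<le> N y\<rbrakk> \<Longrightarrow> wdist x y \<le> C * \<kappa> S"
    by (rule wdist_le_kappa) blast
  have "0 < e / C" using e C(1) by simp
  then obtain S where S: "1 \<le> S" "\<And>s. S \<le> s \<Longrightarrow> \<kappa> s < e / C" by (rule kappa_small) blast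
  have "\<forall>\<^sub>F n in sequentially. S \<le> N (s n) \<and> S \<le> N (t n)"
    using assms by (intro eventually_conj) (auto simp: filterlim_at_top)
  then obtain m where m: "\<And>n. m \<le> n \<Longrightarrow> S \<le> N (s n) \<and> S \<le> N (t n)" by (auto simp: eventually_sequentially)
  have "wdist (s n) (t n') < e" if "m \<le> n" "m \<le> n'" for n n'
  proof -
    have "wdist (s n) (t n') \<le> C * \<kappa> S" using m that S(1) assms by (intro C(2)) auto
    also have "\<dots> < e" using S(2)[of S] C(1) by (simp add: less_divide_eq mult.commute)
    finally show ?thesis .
  qed
  then show ?thesis by blast
qed

lemma N_unbounded: "\<exists>x\<in>X. Z < N x"
proof (rule ccontr)
  assume "\<not> ?thesis"
  then have le: "N x \<le> Z" if "x \<in> X" for x using that by (auto simp: not_less)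
  obtain x where x: "x \<in> X" using X_nonempty by auto
  have "X \<subseteq> mcball x (Z + Z)"
  proof
    fix y assume "y \<in> X"
    then show "y \<in> mcball x (Z + Z)" using x le[of x] le[of y] dist_le_N[of x y] by simp
  qed
  then show False using unbounded mbounded_def by blast
qed

text \<open>
  Any two sequences along which \<open>N\<close> tends to infinity are equivalent, and they are not equivalent
  to Cauchy sequences with respect to \<open>d\<close>, along which \<open>N\<close> is bounded. By the alternative for
  Cauchy sequences, their class is the only additional point.
\<close>

lemma completion_sph: "completion_adds_one_point X d wdist"
  unfolding completion_adds_one_point_def
proof (intro conjI allI impI)
  obtain s where s: "\<And>n. s n \<in> X" "\<And>n. real n < N (s n)" 
  proof -
    have "\<forall>n. \<exists>x. x \<in> X \<and> real n < N x" using N_unbounded by blast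
    then show ?thesis using that by metis
  qed
  have inf: "filterlim (\<lambda>n. N (s n)) at_top sequentially"
    by (rule filterlim_at_top_mono[OF filterlim_real_sequentially]) (use s in \<open>auto intro!: always_eventually less_imp_le\<close>)
  have range: "range s \<subseteq> X" using s by auto
  have sC: "sph.MCauchy s"
    using wdist_at_infinity[OF range inf range inf] range unfolding sph.MCauchy_def by blast
  have not_close: "(s, t) \<notin> cauchy_rel X wdist" if t: "MCauchy t" for t
  proof
    assume "(s, t) \<in> cauchy_rel X wdist"
    then have l: "(\<lambda>n. wdist (s n) (t n)) \<longlonglongrightarrow> 0" by (simp add: sph.cauchy_rel_iff)
    obtain M where M: "1 \<le> M" "\<And>n. N (t n) \<le> M" using MCauchy_N_bounded[OF t] by blast
    obtain q where q: "0 < q" "\<And>x y. \<lbrakk>x \<in> X; y \<in> X; N x \<le> M; wdist x y < q\<rbrakk> \<Longrightarrow> d x y < 1"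
      using dist_small_on_bounded[OF M(1), of 1] by auto
    have "\<forall>\<^sub>F n in sequentially. wdist (s n) (t n) < q \<and> M + 1 \<le> N (s n)"
      using order_tendstoD(2)[OF l q(1)] inf by (intro eventually_conj) (auto simp: filterlim_at_top)
    then obtain n where n: "wdist (s n) (t n) < q" "M + 1 \<le> N (s n)" using eventually_happens' sequentially_bot by blast
    have tX: "t n \<in> X" using MCauchy_in[OF t] .
    have "d (t n) (s n) < 1" by (rule q(2)) (use tX s M n sph.commute in auto)
    then show False using N_lip[OF s(1)[of n] tX] n M(2)[of n] commute[of "s n" "t n"] by simp
  qed
  have img: "cauchy_rel X wdist `` (cauchy_rel X d `` {t}) = cauchy_rel X wdist `` {t}" if t: "MCauchy t" for t
  proof (intro set_eqI iffI)
    fix u assume "u \<in> cauchy_rel X wdist `` (cauchy_rel X d `` {t})"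
    then obtain v where v: "(t, v) \<in> cauchy_rel X d" "(v, u) \<in> cauchy_rel X wdist" by auto
    then have "(t, v) \<in> cauchy_rel X wdist" using cauchy_rel_sph_iff[of t v] by (simp add: cauchy_rel_iff)
    then have "(t, u) \<in> cauchy_rel X wdist"
      using v(2) sph.equiv_cauchy_rel unfolding equiv_def trans_def by blast
    then show "u \<in> cauchy_rel X wdist `` {t}" by simp
  next
    fix u assume "u \<in> cauchy_rel X wdist `` {t}"
    then show "u \<in> cauchy_rel X wdist `` (cauchy_rel X d `` {t})" using class_self[OF t] by blast
  qed
  let ?w = "cauchy_rel X wdist `` {s}"
  have "completion X wdist - (\<lambda>S. cauchy_rel X wdist `` S) ` completion X d = {?w}"
  proof (intro set_eqI iffI)
    fix W assume W: "W \<in> completion X wdist - (\<lambda>S. cauchy_rel X wdist `` S) ` completion X d"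
    then obtain t where t: "sph.MCauchy t" "W = cauchy_rel X wdist `` {t}"
      by (auto simp: completion_def quotient_def)
    have "\<not> MCauchy t"
    proof
      assume "MCauchy t"
      from img[OF this] class_in_completion[OF this] t(2) W show False by (metis DiffD2 imageI)
    qed
    then have ti: "filterlim (\<lambda>n. N (t n)) at_top sequentially" using sph_MCauchy_cases[OF t(1)] by blast
    have tr: "range t \<subseteq> X" using sph.MCauchy_in[OF t(1)] by auto
    have "(\<lambda>n. wdist (t n) (s n)) \<longlonglongrightarrow> 0"
    proof (rule order_tendstoI)
      fix e :: real assume "0 < e"
      from wdist_at_infinity[OF tr ti range inf this]
      show "\<forall>\<^sub>F n in sequentially. wdist (t n) (s n) < e" by (auto simp: eventually_sequentially)
    qed (auto intro!: always_eventually less_le_trans[OF _ wdist_nonneg])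
    then have "(t, s) \<in> cauchy_rel X wdist" using t(1) sC by (simp add: sph.cauchy_rel_iff)
    then show "W \<in> {?w}" using equiv_class_eq[OF sph.equiv_cauchy_rel] t(2) by simp
  next
    fix W assume "W \<in> {?w}"
    then have W: "W = ?w" by simp
    have "W \<noteq> cauchy_rel X wdist `` S" if S: "S \<in> completion X d" for S
    proof
      assume eq: "W = cauchy_rel X wdist `` S"
      note c = crep[OF S]
      have "W = cauchy_rel X wdist `` {crep S}" using eq img[OF c(2)] c(3) by metis
      then have "s \<in> cauchy_rel X wdist `` {crep S}" using W sph.class_self[OF sC] by simp
      then have "(s, crep S) \<in> cauchy_rel X wdist" using sph.equiv_cauchy_rel unfolding equiv_def sym_def by blast
      then show False using not_close[OF c(2)] by simp
    qed
    then show "W \<in> completion X wdist - (\<lambda>S. cauchy_rel X wdist `` S) ` completion X d"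
      using W sph.class_in_completion[OF sC] by blast
  qed
  then show "\<exists>\<omega>. completion X wdist - (\<lambda>S. cauchy_rel X wdist `` S) ` completion X d = {\<omega>}" by blast
qed (use MCauchy_imp_sph_MCauchy cauchy_rel_sph_iff in auto)

section \<open>Uniformity of the sphericalized space\<close>

text \<open>
  Each of the two terms that bound the path integral along a uniform curve is at most a multiple
  of the distance of its end points, by the lower bound applied at the respective end point.
\<close>

lemma wint_quasi_geodesic:
  obtains C where "1 \<le> C" "\<And>l \<eta>. ucurve l \<eta> \<Longrightarrow> wint \<eta> 0 l \<le> ennreal (C * wdist (\<eta> 0) (\<eta> l))"
proof -
  obtain C where C: "1 \<le> C" "\<And>l \<eta>. ucurve l \<eta> \<Longrightarrow> wint \<eta> 0 l \<le>
    ennreal (C * (\<rho> (N (\<eta> 0)) * min (d (\<eta> 0) (\<eta> l)) (N (\<eta> 0)) + \<rho> (N (\<eta> l)) * min (d (\<eta> 0) (\<eta> l)) (N (\<eta> l))))"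
    by (rule wint_ucurve_le) blast
  show ?thesis
  proof (rule that[of "4 * CA\<^sup>2 * C"])
    have "1 \<le> CA\<^sup>2" using CA(1) by simp
    then have "1 * 1 \<le> (4 * CA\<^sup>2) * C" using C(1) by (intro mult_mono) auto
    then show "1 \<le> 4 * CA\<^sup>2 * C" by simp
    fix l \<eta> assume u: "ucurve l \<eta>"
    have l: "0 \<le> l" using ucurve_lip[OF u] by (simp add: lip_curve_def)
    have m: "\<eta> 0 \<in> X" "\<eta> l \<in> X" using lip_curveD(1)[OF ucurve_lip[OF u]] l by auto
    have "\<rho> (N (\<eta> 0)) * min (d (\<eta> 0) (\<eta> l)) (N (\<eta> 0)) + \<rho> (N (\<eta> l)) * min (d (\<eta> 0) (\<eta> l)) (N (\<eta> l))
      \<le> 2 * CA\<^sup>2 * wdist (\<eta> 0) (\<eta> l) + 2 * CA\<^sup>2 * wdist (\<eta> 0) (\<eta> l)"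
      using wdist_lower[OF m] wdist_lower[OF m(2,1)] by (intro add_mono) (auto simp: commute sph.commute)
    from mult_left_mono[OF this, of C] C(1)
    have "C * (\<rho> (N (\<eta> 0)) * min (d (\<eta> 0) (\<eta> l)) (N (\<eta> 0)) + \<rho> (N (\<eta> l)) * min (d (\<eta> 0) (\<eta> l)) (N (\<eta> l)))
      \<le> 4 * CA\<^sup>2 * C * wdist (\<eta> 0) (\<eta> l)" by (simp add: algebra_simps)
    from order_trans[OF C(2)[OF u] ennreal_leI[OF this]]
    show "wint \<eta> 0 l \<le> ennreal (4 * CA\<^sup>2 * C * wdist (\<eta> 0) (\<eta> l))" .
  qed
qed

text \<open>
  Let the curve go from \<open>x\<close> to \<open>y\<close>. For \<open>u \<le> CU * N x\<close> the weight is essentially constant up to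
  \<open>\<eta> u\<close>, so the initial piece inherits its bound from \<open>d\<close>. Otherwise the distance of \<open>\<eta> u\<close> to the
  boundary is comparable to \<open>N (\<eta> u)\<close>, so that a multiple of \<open>\<kappa> (N (\<eta> u))\<close> is a sufficient bound
  for the final piece. The final piece consists of the rest of the first half, which contributes
  at most a multiple of \<open>\<kappa> (N x + u)\<close>, and of the second half, which contributes at most a
  multiple of \<open>\<kappa> (N y)\<close>.
\<close>

lemma ucurve_cone_first_half:
  obtains C where "1 \<le> C" "\<And>l \<eta> u. \<lbrakk>ucurve l \<eta>; 0 \<le> u; u \<le> l / 2\<rbrakk> \<Longrightarrow>
    min (wint \<eta> 0 u) (wint \<eta> u l) \<le> ennreal (C * (\<rho> (N (\<eta> u)) * bdist (\<eta> u)))"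
proof -
  obtain C where C: "1 \<le> C" "\<And>l \<eta> p q. \<lbrakk>ucurve l \<eta>; 0 \<le> p; p \<le> q; q \<le> l / 2\<rbrakk> \<Longrightarrow>
     wint \<eta> p q \<le> ennreal (C * \<rho> (N (\<eta> 0) + p) * min (q - p) (N (\<eta> 0) + p))"
    by (rule wint_half) blast
  obtain C0 where C0: "1 \<le> C0"
    "\<And>s t. \<lbrakk>1 \<le> s; 1 \<le> t; s \<le> (1 + 2 * CU) * t; t \<le> (1 + 2 * CU) * s\<rbrakk> \<Longrightarrow> \<rho> s \<le> C0 * \<rho> t"
    using rho_comp[of "1 + 2 * CU"] CU by auto
  obtain C1 where C1: "1 \<le> C1" "\<And>s t. \<lbrakk>1 \<le> s; 1 \<le> t; s \<le> (2 * CU) * t\<rbrakk> \<Longrightarrow> \<kappa> t \<le> C1 * \<kappa> s"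
    using kappa_almost_decreasing[of "2 * CU"] CU by auto
  define D where "D = max (C * (C0 * CU)) (2 * C * C1 * (2 * CU))"
  show ?thesis
  proof (rule that[of D])
    have "1 * (1 * 1) \<le> C * (C0 * CU)" using C(1) C0(1) CU by (intro mult_mono) auto
    then show "1 \<le> D" by (simp add: D_def)
    fix l \<eta> u assume uc: "ucurve l \<eta>" and u: "0 \<le> u" "u \<le> l / 2"
    have lip: "lip_curve l \<eta>" by (rule ucurve_lip[OF uc])
    define x where "x = \<eta> 0" define y where "y = \<eta> l" define z where "z = \<eta> u"
    have mem: "x \<in> X" "y \<in> X" "z \<in> X" using lip_curveD(1)[OF lip] u by (auto simp: x_def y_def z_def)
    note Ngt = N_gt1[OF mem(1)] N_gt1[OF mem(2)] N_gt1[OF mem(3)]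
    note n = ucurve_N[OF uc u, folded x_def z_def]
    have bz: "0 \<le> bdist z" by (rule bdist_nonneg[OF mem(3)])
    have rz: "0 < \<rho> (N z)" "0 < \<rho> (N x)" using rho_pos Ngt by auto
    have goal: "min (wint \<eta> 0 u) (wint \<eta> u l) \<le> ennreal (D * (\<rho> (N z) * bdist z))"
    proof (cases "u \<le> CU * N x")
      case True
      have "N x \<le> (1 + 2 * CU) * N z" using n(1) u by simp
      moreover have "N z \<le> (1 + 2 * CU) * N x"
      proof -
        have "CU * N x \<le> 2 * CU * N x" using CU Ngt by simp
        then show ?thesis using n(2) True by (simp add: distrib_right)
      qed
      ultimately have "\<rho> (N x) \<le> C0 * \<rho> (N z)" using Ngt by (intro C0(2)) auto
      then have "\<rho> (N x) * min (u - 0) (N x + 0) \<le> (C0 * \<rho> (N z)) * (CU * bdist z)"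
        using n(3) rz C0(1) bz CU u Ngt by (intro mult_mono) auto
      then have "C * (\<rho> (N x) * min (u - 0) (N x + 0)) \<le> C * ((C0 * \<rho> (N z)) * (CU * bdist z))"
        using C(1) by (intro mult_left_mono) auto
      also have "\<dots> = (C * (C0 * CU)) * (\<rho> (N z) * bdist z)" by (simp add: algebra_simps)
      also have "\<dots> \<le> D * (\<rho> (N z) * bdist z)" using rz bz by (intro mult_right_mono) (auto simp: D_def)
      finally have "C * \<rho> (N x + 0) * min (u - 0) (N x + 0) \<le> D * (\<rho> (N z) * bdist z)" by (simp add: mult.assoc)
      from order_trans[OF C(2)[OF uc, of 0 u, folded x_def] ennreal_leI[OF this]] u
      show ?thesis by (simp add: min.coboundedI1)
    next
      case False
      have CUx: "1 * N x \<le> CU * N x" using CU Ngt by (intro mult_right_mono) auto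
      then have ux: "N x < u" using False by simp
      have "2 * u \<le> CU * d x y" using uc u by (simp add: ucurve_def x_def y_def)
      also have "\<dots> \<le> CU * (N x + N y)" using CU dist_le_N[OF mem(1,2)] by (intro mult_left_mono) auto
      finally have uy: "u < CU * N y" using False by (simp add: distrib_left)
      have Nz: "N z \<le> 2 * u" using n(2) ux by simp
      have k1: "\<kappa> (N x + u) \<le> C1 * \<kappa> (N z)"
      proof (rule C1(2))
        have "1 * (N x + u) \<le> 2 * CU * (N x + u)" using CU Ngt u by (intro mult_right_mono) auto
        then show "N z \<le> 2 * CU * (N x + u)" using n(2) by simp
      qed (use Ngt u in auto)
      have k2: "\<kappa> (N y) \<le> C1 * \<kappa> (N z)" by (rule C1(2)) (use Ngt Nz uy in auto)
      have kz: "\<kappa> (N z) \<le> (2 * CU) * (\<rho> (N z) * bdist z)"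
      proof -
        have "N z \<le> 2 * (CU * bdist z)" using Nz n(3) by simp
        then have "N z * \<rho> (N z) \<le> 2 * (CU * bdist z) * \<rho> (N z)" using rz by (intro mult_right_mono) auto
        then show ?thesis by (simp add: \<kappa>_def algebra_simps)
      qed
      have l: "0 \<le> l" using u by simp
      have w1: "wint \<eta> u (l/2) \<le> ennreal (C * (C1 * \<kappa> (N z)))"
      proof (rule order_trans[OF C(2)[OF uc u(1,2) order_refl] ennreal_leI])
        have "\<rho> (N x + u) * min (l/2 - u) (N x + u) \<le> \<rho> (N x + u) * (N x + u)"
          using rho_pos[of "N x + u"] Ngt u by (intro mult_left_mono) auto
        also have "\<dots> = \<kappa> (N x + u)" by (simp add: \<kappa>_def)
        also note k1
        finally show "C * \<rho> (N (\<eta> 0) + u) * min (l/2 - u) (N (\<eta> 0) + u) \<le> C * (C1 * \<kappa> (N z))"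
          using C(1) by (simp add: x_def mult.assoc)
      qed
      have w2: "wint (\<lambda>v. \<eta> (l - v)) 0 (l/2) \<le> ennreal (C * (C1 * \<kappa> (N z)))"
      proof (rule order_trans[OF C(2)[OF ucurve_rev[OF uc], of 0 "l/2"] ennreal_leI])
        have "\<rho> (N y) * min (l/2) (N y) \<le> \<rho> (N y) * N y"
          using rho_pos[of "N y"] Ngt by (intro mult_left_mono) auto
        also have "\<dots> = \<kappa> (N y)" by (simp add: \<kappa>_def)
        also note k2
        finally show "C * \<rho> (N (\<eta> (l - 0)) + 0) * min (l/2 - 0) (N (\<eta> (l - 0)) + 0) \<le> C * (C1 * \<kappa> (N z))"
          using C(1) by (simp add: y_def mult.assoc)
      qed (use l in auto)
      have nn: "0 \<le> C * (C1 * \<kappa> (N z))" using C(1) C1(1) kappa_pos[of "N z"] Ngt by auto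
      have "wint \<eta> u l \<le> ennreal (C * (C1 * \<kappa> (N z))) + ennreal (C * (C1 * \<kappa> (N z)))"
        unfolding wint_split[OF uc u] by (intro add_mono w1 w2)
      also have "\<dots> = ennreal (2 * C * C1 * \<kappa> (N z))" using nn by (subst ennreal_plus[symmetric]) (auto simp: mult_ac)
      also have "\<dots> \<le> ennreal (D * (\<rho> (N z) * bdist z))"
      proof (rule ennreal_leI)
        have "2 * C * C1 * \<kappa> (N z) \<le> 2 * C * C1 * ((2 * CU) * (\<rho> (N z) * bdist z))"
          using kz C(1) C1(1) by (intro mult_left_mono) auto
        also have "\<dots> = (2 * C * C1 * (2 * CU)) * (\<rho> (N z) * bdist z)" by simp
        also have "\<dots> \<le> D * (\<rho> (N z) * bdist z)" using rz bz by (intro mult_right_mono) (auto simp: D_def)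
        finally show "2 * C * C1 * \<kappa> (N z) \<le> D * (\<rho> (N z) * bdist z)" .
      qed
      finally show ?thesis by (simp add: min.coboundedI2)
    qed
    show "min (wint \<eta> 0 u) (wint \<eta> u l) \<le> ennreal (D * (\<rho> (N (\<eta> u)) * bdist (\<eta> u)))"
      using goal by (simp add: z_def)
  qed
qed

lemma ucurve_cone:
  obtains C where "1 \<le> C" "\<And>l \<eta> u. \<lbrakk>ucurve l \<eta>; 0 \<le> u; u \<le> l\<rbrakk> \<Longrightarrow>
    min (wint \<eta> 0 u) (wint \<eta> u l) \<le> ennreal (C * (\<rho> (N (\<eta> u)) * bdist (\<eta> u)))"
proof -
  obtain C where C: "1 \<le> C" "\<And>l \<eta> u. \<lbrakk>ucurve l \<eta>; 0 \<le> u; u \<le> l / 2\<rbrakk> \<Longrightarrow>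
    min (wint \<eta> 0 u) (wint \<eta> u l) \<le> ennreal (C * (\<rho> (N (\<eta> u)) * bdist (\<eta> u)))"
    by (rule ucurve_cone_first_half) blast
  show ?thesis
  proof (rule that[OF C(1)])
    fix l \<eta> u assume u: "ucurve l \<eta>" "0 \<le> u" "u \<le> l"
    note lip = ucurve_lip[OF u(1)]
    show "min (wint \<eta> 0 u) (wint \<eta> u l) \<le> ennreal (C * (\<rho> (N (\<eta> u)) * bdist (\<eta> u)))"
    proof (cases "u \<le> l / 2")
      case True then show ?thesis using C(2) u by blast
    next
      case False
      have "wint (\<lambda>v. \<eta> (l - v)) 0 (l - u) = wint \<eta> u l" "wint (\<lambda>v. \<eta> (l - v)) (l - u) l = wint \<eta> 0 u"
        using wint_rev[OF lip, of u l] wint_rev[OF lip, of 0 u] u by auto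
      then show ?thesis using C(2)[OF ucurve_rev[OF u(1)], of "l - u"] u False by (simp add: min.commute)
    qed
  qed
qed

lemma class_of_b_in_sph_boundary: "cauchy_rel X wdist `` {crep b} \<in> boundary X wdist"
proof -
  note cb = crep[OF b_completion]
  have sC: "sph.MCauchy (crep b)" by (rule MCauchy_imp_sph_MCauchy[OF cb(2)])
  have "cauchy_rel X wdist `` {crep b} \<noteq> embed X wdist x" if x: "x \<in> X" for x
  proof
    assume "cauchy_rel X wdist `` {crep b} = embed X wdist x"
    then have "(crep b, \<lambda>_. x) \<in> cauchy_rel X wdist" using sph.const_in_embed[OF x] by blast
    then have "(crep b, \<lambda>_. x) \<in> cauchy_rel X d" using cauchy_rel_sph_iff[OF cb(2)] x by simp
    then have "(\<lambda>n. d x (crep b n)) \<longlonglongrightarrow> 0" by (simp add: cauchy_rel_iff commute)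
    then show False using boundary_not_limit[OF base cb(1) x] by simp
  qed
  then show ?thesis using sph.class_in_completion[OF sC] by (auto simp: boundary_def)
qed

lemma sph_not_complete: "\<not> sph.mcomplete"
proof
  assume "sph.mcomplete"
  then obtain x where "limitin sph.mtopology (crep b) x sequentially"
    using MCauchy_imp_sph_MCauchy[OF crep(2)[OF b_completion]] unfolding sph.mcomplete_def by blast
  then have "limitin mtopology (crep b) x sequentially" by (simp only: sph_topology)
  then have "x \<in> X" "(\<lambda>n. d (crep b n) x) \<longlonglongrightarrow> 0" by (auto simp: limitin_metric_dist_null)
  then show False using boundary_not_limit[OF base crep(1)[OF b_completion], of x] by (simp add: commute)
qed

text \<open>
  A boundary point for the new metric is represented by a Cauchy sequence for \<open>d\<close>, whose class is
  a boundary point for \<open>d\<close>, or by a sequence that tends to infinity. In both cases the lower bound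
  for the distance passes to the limit.
\<close>

lemma bdist_le_sph_boundary:
  assumes z: "z \<in> X" and W: "W \<in> boundary X wdist"
  shows "\<rho> (N z) * bdist z \<le> 2 * CA\<^sup>2 * cdist wdist (embed X wdist z) W"
proof -
  have Wc: "W \<in> completion X wdist" using W by (simp add: boundary_def)
  define s where "s = sph.crep W"
  note cs = sph.crep[OF Wc, folded s_def]
  have in_X: "s n \<in> X" for n using sph.MCauchy_in[OF cs(2)] .
  have lim: "(\<lambda>n. wdist z (s n)) \<longlonglongrightarrow> cdist wdist (embed X wdist z) W"
    by (rule sph.cdist_embed_limit[OF z Wc cs(1)])
  have rz: "0 < \<rho> (N z)" using rho_pos N_gt1[OF z] by auto
  have bN: "bdist z \<le> N z" using bdist_le_nrm[OF z] by (simp add: N_def)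
  consider "MCauchy s" | "filterlim (\<lambda>n. N (s n)) at_top sequentially" using sph_MCauchy_cases[OF cs(2)] by blast
  then show ?thesis
  proof cases
    case 1
    define V where "V = cauchy_rel X d `` {s}"
    have V: "V \<in> completion X d" "s \<in> V" using class_in_completion[OF 1] class_self[OF 1] by (auto simp: V_def)
    have "V \<noteq> embed X d x" if x: "x \<in> X" for x
    proof
      assume "V = embed X d x"
      then have "(s, \<lambda>_. x) \<in> cauchy_rel X d" using const_in_embed[OF x] by (auto simp: V_def)
      then have "(s, \<lambda>_. x) \<in> cauchy_rel X wdist" using cauchy_rel_sph_iff[OF 1] x by simp
      then have "(\<lambda>n. wdist x (s n)) \<longlonglongrightarrow> 0" by (simp add: sph.cauchy_rel_iff sph.commute)
      then show False using sph.boundary_not_limit[OF W cs(1) x] by simp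
    qed
    then have Vb: "V \<in> boundary X d" using V by (auto simp: boundary_def)
    have "(\<lambda>n. \<rho> (N z) * min (d z (s n)) (N z)) \<longlonglongrightarrow> \<rho> (N z) * min (cdist d (embed X d z) V) (N z)"
      by (intro tendsto_intros cdist_embed_limit[OF z V])
    moreover have "(\<lambda>n. 2 * CA\<^sup>2 * wdist z (s n)) \<longlonglongrightarrow> 2 * CA\<^sup>2 * cdist wdist (embed X wdist z) W"
      by (intro tendsto_intros lim)
    ultimately have "\<rho> (N z) * min (cdist d (embed X d z) V) (N z) \<le> 2 * CA\<^sup>2 * cdist wdist (embed X wdist z) W"
      by (rule LIMSEQ_le) (use wdist_lower[OF z in_X] in auto)
    moreover have "\<rho> (N z) * bdist z \<le> \<rho> (N z) * min (cdist d (embed X d z) V) (N z)"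
      using rz bdist_le[OF z Vb] bN by (intro mult_left_mono) auto
    ultimately show ?thesis by simp
  next
    case 2
    have "\<forall>\<^sub>F n in sequentially. 2 * N z \<le> N (s n)" using 2 by (simp add: filterlim_at_top)
    then have "\<forall>\<^sub>F n in sequentially. \<rho> (N z) * bdist z \<le> 2 * CA\<^sup>2 * wdist z (s n)"
    proof (rule eventually_mono)
      fix n assume n: "2 * N z \<le> N (s n)"
      have "N z \<le> d z (s n)" using n N_lip[OF in_X[of n] z] by (simp add: commute)
      then have "\<rho> (N z) * bdist z \<le> \<rho> (N z) * min (d z (s n)) (N z)"
        using rz bN by (intro mult_left_mono) auto
      then show "\<rho> (N z) * bdist z \<le> 2 * CA\<^sup>2 * wdist z (s n)" using wdist_lower[OF z in_X[of n]] by simp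
    qed
    moreover have "(\<lambda>n. 2 * CA\<^sup>2 * wdist z (s n)) \<longlonglongrightarrow> 2 * CA\<^sup>2 * cdist wdist (embed X wdist z) W"
      by (intro tendsto_intros lim)
    ultimately show ?thesis by (intro tendsto_lowerbound) auto
  qed
qed

text \<open>
  The uniform curves for \<open>d\<close> are uniform for the new metric: their new length is comparable to
  the distance of their end points, and by the cone condition the shorter of the pieces before and after \<open>\<eta> u\<close>
  is bounded by a multiple of \<open>\<rho> (N (\<eta> u)) * bdist (\<eta> u)\<close>, hence by the new distance to the boundary.
\<close>

lemma sph_uniform: "uniform_space X wdist"
proof -
  obtain C1 where C1: "1 \<le> C1" "\<And>l \<eta>. ucurve l \<eta> \<Longrightarrow> wint \<eta> 0 l \<le> ennreal (C1 * wdist (\<eta> 0) (\<eta> l))"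
    by (rule wint_quasi_geodesic) blast
  obtain C2 where C2: "1 \<le> C2" "\<And>l \<eta> u. \<lbrakk>ucurve l \<eta>; 0 \<le> u; u \<le> l\<rbrakk> \<Longrightarrow>
    min (wint \<eta> 0 u) (wint \<eta> u l) \<le> ennreal (C2 * (\<rho> (N (\<eta> u)) * bdist (\<eta> u)))"
    by (rule ucurve_cone) blast
  define C where "C = max C1 (C2 * (2 * CA\<^sup>2))"
  have ex: "\<exists>a e \<gamma>. uniform_curve X wdist C a e \<gamma> \<and> \<gamma> a = x \<and> \<gamma> e = y" if xy: "x \<in> X" "y \<in> X" for x y
  proof -
    obtain l \<eta> where \<eta>: "ucurve l \<eta>" "\<eta> 0 = x" "\<eta> l = y" using ucurve_exists[OF xy] .
    note lip = ucurve_lip[OF \<eta>(1)]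
    have l: "0 \<le> l" using lip by (simp add: lip_curve_def)
    have "curve X wdist 0 l \<eta>"
      using lip_curve_continuous[OF lip] l by (simp add: curve_def sph_topology)
    moreover have "curve_length wdist \<eta> 0 l \<le> ennreal (C * wdist (\<eta> 0) (\<eta> l))"
    proof -
      have "curve_length wdist \<eta> 0 l \<le> ennreal (C1 * wdist (\<eta> 0) (\<eta> l))"
        using order_trans[OF lip_curve_length_wdist_le[OF lip, of 0 l] C1(2)[OF \<eta>(1)]] l by simp
      also have "\<dots> \<le> ennreal (C * wdist (\<eta> 0) (\<eta> l))"
        by (intro ennreal_leI mult_right_mono) (auto simp: C_def)
      finally show ?thesis .
    qed
    moreover have "min (curve_length wdist \<eta> 0 t) (curve_length wdist \<eta> t l)
        \<le> ennreal (C * (INF w\<in>boundary X wdist. cdist wdist (embed X wdist (\<eta> t)) w))" if t: "t \<in> {0..l}" for t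
    proof -
      have z: "\<eta> t \<in> X" using lip_curveD(1)[OF lip] t by auto
      let ?I = "INF w\<in>boundary X wdist. cdist wdist (embed X wdist (\<eta> t)) w"
      have I: "\<rho> (N (\<eta> t)) * bdist (\<eta> t) / (2 * CA\<^sup>2) \<le> ?I"
      proof (rule cINF_greatest)
        show "boundary X wdist \<noteq> {}" using class_of_b_in_sph_boundary by auto
        fix W assume "W \<in> boundary X wdist"
        from bdist_le_sph_boundary[OF z this] CA(1)
        show "\<rho> (N (\<eta> t)) * bdist (\<eta> t) / (2 * CA\<^sup>2) \<le> cdist wdist (embed X wdist (\<eta> t)) W"
          by (simp add: divide_le_eq mult.commute)
      qed
      have I0: "0 \<le> ?I"
        using order_trans[OF _ I] rho_pos[of "N (\<eta> t)"] N_gt1[OF z] bdist_nonneg[OF z] by simp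
      have "\<rho> (N (\<eta> t)) * bdist (\<eta> t) \<le> 2 * CA\<^sup>2 * ?I" using I CA(1) by (simp add: divide_le_eq mult.commute)
      then have "C2 * (\<rho> (N (\<eta> t)) * bdist (\<eta> t)) \<le> C2 * (2 * CA\<^sup>2 * ?I)" using C2(1) by (intro mult_left_mono) auto
      also have "\<dots> = (C2 * (2 * CA\<^sup>2)) * ?I" by simp
      also have "\<dots> \<le> C * ?I" using I0 by (intro mult_right_mono) (auto simp: C_def)
      finally have le: "C2 * (\<rho> (N (\<eta> t)) * bdist (\<eta> t)) \<le> C * ?I" .
      have "min (curve_length wdist \<eta> 0 t) (curve_length wdist \<eta> t l) \<le> min (wint \<eta> 0 t) (wint \<eta> t l)"
        using t by (intro min.mono lip_curve_length_wdist_le[OF lip]) auto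
      also have "\<dots> \<le> ennreal (C2 * (\<rho> (N (\<eta> t)) * bdist (\<eta> t)))" using t by (intro C2(2)[OF \<eta>(1)]) auto
      also have "\<dots> \<le> ennreal (C * ?I)" by (rule ennreal_leI[OF le])
      finally show ?thesis .
    qed
    ultimately have "uniform_curve X wdist C 0 l \<eta>" unfolding uniform_curve_def by blast
    then show ?thesis using \<eta> by blast
  qed
  have "1 \<le> C" using C1(1) by (simp add: C_def)
  then show ?thesis
    unfolding uniform_space_def using sph.Metric_space_axioms locally_compact sph_not_complete ex sph_topology
    by (metis (no_types, lifting))
qed

section \<open>Balls of the sphericalized metric\<close>

lemma nrm_crep_small: assumes "0 < e" shows "\<exists>x\<in>X. nrm x < e"
proof -
  have C: "MCauchy (crep b)" by (rule crep(2)[OF b_completion])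
  have "0 < e / 2" using assms by simp
  then obtain m where m: "\<And>n n'. m \<le> n \<Longrightarrow> m \<le> n' \<Longrightarrow> d (crep b n) (crep b n') < e / 2"
    using C unfolding MCauchy_def by blast
  have "nrm (crep b m) \<le> e / 2"
    by (rule LIMSEQ_le_const2[OF nrm_limit[OF crep_b_in]]) (use m in \<open>auto intro!: exI[of _ m] less_imp_le\<close>)
  then show ?thesis using crep_b_in assms by (intro bexI[of _ "crep b m"]) auto
qed

text \<open>
  Near \<open>b\<close> the values of \<open>N\<close> approach \<open>1\<close>, \<open>N\<close> is unbounded, and it is continuous along the
  curves that connect points of the space.
\<close>

lemma N_attains:
  assumes "1 < s" obtains x where "x \<in> X" "N x = s"
proof -
  obtain x where x: "x \<in> X" "nrm x < s - 1" using nrm_crep_small[of "s - 1"] assms by auto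
  obtain y where y: "y \<in> X" "s < N y" using N_unbounded by blast
  obtain l \<eta> where \<eta>: "lip_curve l \<eta>" "\<eta> 0 = x" "\<eta> l = y" using lip_connected[OF x(1) y(1)] by blast
  have l: "0 \<le> l" using \<eta> by (simp add: lip_curve_def)
  have "\<bar>N (\<eta> u) - N (\<eta> v)\<bar> \<le> 1 * \<bar>u - v\<bar>" if "u \<in> {0..l}" "v \<in> {0..l}" for u v
    using lip_curveD(1)[OF \<eta>(1), of u] lip_curveD(2)[OF \<eta>(1), of u v] lip_curveD(1)[OF \<eta>(1), of v] that
      N_lip[of "\<eta> u" "\<eta> v"] N_lip[of "\<eta> v" "\<eta> u"] commute[of "\<eta> u" "\<eta> v"] by (auto simp: abs_le_iff)
  then have "continuous_on {0..l} (\<lambda>u. N (\<eta> u))"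
    by (intro lipschitz_on_continuous_on[of 1]) (auto simp: lipschitz_on_def dist_real_def)
  then obtain u where u: "0 \<le> u" "u \<le> l" "N (\<eta> u) = s"
    using IVT'[of "\<lambda>u. N (\<eta> u)" 0 s l] x y l \<eta> by (auto simp: N_def)
  show ?thesis by (rule that[of "\<eta> u"]) (use u lip_curveD(1)[OF \<eta>(1)] in auto)
qed

lemma sph_ball_subset:
  assumes "x \<in> X" "0 < r" "2 * CA\<^sup>2 * r \<le> \<kappa> (N x)"
  shows "sph.mball x r \<subseteq> mball x (2 * CA\<^sup>2 * r / \<rho> (N x))"
proof
  fix y assume "y \<in> sph.mball x r"
  then have y: "y \<in> X" "wdist x y < r" by auto
  have rx: "0 < \<rho> (N x)" using rho_pos[of "N x"] N_gt1[OF assms(1)] by auto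
  have le: "2 * CA\<^sup>2 * r / \<rho> (N x) \<le> N x" using assms(3) rx by (simp add: divide_le_eq \<kappa>_def)
  have "d x y < 2 * CA\<^sup>2 * r / \<rho> (N x)"
  proof (rule dist_le_wdist[OF assms(1) y(1)])
    show "0 < 2 * CA\<^sup>2 * r / \<rho> (N x)" using assms(2) rx CA(1) by simp
    show "2 * CA\<^sup>2 * wdist x y < \<rho> (N x) * min (2 * CA\<^sup>2 * r / \<rho> (N x)) (N x)"
      using y rx CA(1) le by (simp add: min_absorb1)
  qed
  then show "y \<in> mball x (2 * CA\<^sup>2 * r / \<rho> (N x))" using assms(1) y by simp
qed

lemma ball_subset_sph:
  obtains C where "1 \<le> C" "\<And>x R. \<lbrakk>x \<in> X; 0 < R; R \<le> N x / 2\<rbrakk> \<Longrightarrow> mball x R \<subseteq> sph.mball x (C * \<rho> (N x) * R)"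
proof -
  obtain C where C: "1 \<le> C" "\<And>x y. \<lbrakk>x \<in> X; y \<in> X; d x y \<le> N x / 2\<rbrakk> \<Longrightarrow> wdist x y \<le> C * \<rho> (N x) * d x y"
    by (rule wdist_near) blast
  show ?thesis
  proof (rule that[OF C(1)], rule subsetI)
    fix x R y assume x: "x \<in> X" "0 < R" "R \<le> N x / 2" and "y \<in> mball x R"
    then have y: "y \<in> X" "d x y < R" by auto
    have "wdist x y \<le> C * \<rho> (N x) * d x y" using C(2)[of x y] x y by auto
    also have "\<dots> < C * \<rho> (N x) * R"
      using y C(1) rho_pos[of "N x"] N_gt1[OF x(1)] by (intro mult_strict_left_mono) auto
    finally show "y \<in> sph.mball x (C * \<rho> (N x) * R)" using x y by simp
  qed
qed

text \<open>The logarithmic decay of \<open>\<kappa>\<close> bounds \<open>ln (t / s)\<close>.\<close>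

lemma kappa_ratio:
  assumes "1 \<le> M"
  obtains K where "1 \<le> K" "\<And>s t. \<lbrakk>1 \<le> s; 1 \<le> t; \<kappa> s \<le> M * \<kappa> t\<rbrakk> \<Longrightarrow> t \<le> K * s"
proof -
  obtain C where C: "1 \<le> C" "\<And>s t. \<lbrakk>1 \<le> s; s \<le> t\<rbrakk> \<Longrightarrow> \<kappa> t * ln (t / s) \<le> C * \<kappa> s"
    by (rule kappa_log_decay) blast
  show ?thesis
  proof (rule that[of "exp (C * M)"])
    show "1 \<le> exp (C * M)" using C(1) assms by simp
    fix s t assume st: "1 \<le> s" "1 \<le> t" "\<kappa> s \<le> M * \<kappa> t"
    show "t \<le> exp (C * M) * s"
    proof (cases "t \<le> s")
      case True
      have "1 * s \<le> exp (C * M) * s" using C(1) assms st by (intro mult_right_mono) auto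
      then show ?thesis using True by simp
    next
      case False
      have "\<kappa> t * ln (t / s) \<le> C * \<kappa> s" using False st by (intro C(2)) auto
      also have "\<dots> \<le> C * (M * \<kappa> t)" using st C(1) by (intro mult_left_mono) auto
      also have "\<dots> = \<kappa> t * (C * M)" by simp
      finally have "ln (t / s) \<le> C * M" using kappa_pos[OF st(2)] by simp
      then have "t / s \<le> exp (C * M)" using st by (metis divide_pos_pos exp_le_cancel_iff exp_ln less_le_trans zero_less_one)
      then show ?thesis using st by (simp add: divide_le_eq)
    qed
  qed
qed

text \<open>
  Here \<open>d y x \<ge> N y\<close>, so that the lower bound for the distance, applied at \<open>y\<close>, yields all of
  \<open>\<kappa> (N y)\<close>.
\<close>

lemma kappa_le_wdist:
  assumes "x \<in> X" "y \<in> X" "N y \<le> N x / 2"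
  shows "\<kappa> (N y) \<le> 2 * CA\<^sup>2 * wdist x y"
proof -
  have "N y \<le> d y x" using N_lip[OF assms(1,2)] assms(3) commute[of x y] by simp
  then have "min (d y x) (N y) = N y" by simp
  then have "\<kappa> (N y) = \<rho> (N y) * min (d y x) (N y)" by (simp add: \<kappa>_def)
  also have "\<dots> \<le> 2 * CA\<^sup>2 * wdist y x" by (rule wdist_lower[OF assms(2,1)])
  finally show ?thesis by (simp add: sph.commute)
qed

text \<open>
  If the radius is comparable to \<open>\<kappa> (N x)\<close>, the centre serves as \<open>z\<close>. Otherwise the ball contains
  all points sufficiently far from \<open>b\<close>, and \<open>z\<close> is taken where \<open>\<kappa>\<close> is a small multiple of the
  radius. In both cases the points \<open>y\<close> of the ball cannot be much closer to \<open>b\<close> than \<open>z\<close>, since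
  then \<open>\<kappa> (N y)\<close> would be too large compared with the distance of \<open>y\<close> and \<open>z\<close>.
\<close>

lemma large_ball_corkscrew:
  assumes c0: "0 < c0"
  obtains \<epsilon> C where "0 < \<epsilon>" "\<epsilon> \<le> 1/2" "1 \<le> C"
    "\<And>x r. \<lbrakk>x \<in> X; 0 < r; c0 * \<kappa> (N x) \<le> r\<rbrakk> \<Longrightarrow> \<exists>z\<in>X. mball z (\<epsilon> * N z) \<subseteq> sph.mball x r \<and>
       (\<forall>y\<in>sph.mball x (2 * r). \<epsilon> * N z \<le> N y) \<and> \<kappa> (N z) \<le> C * r"
proof -
  obtain C1 where C1: "1 \<le> C1" "\<And>S x y. \<lbrakk>x \<in> X; y \<in> X; 1 \<le> S; S \<le> N x; S \<le> N y\<rbrakk> \<Longrightarrow> wdist x y \<le> C1 * \<kappa> S"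
    by (rule wdist_le_kappa) blast
  obtain Cm where Cm: "1 \<le> Cm" "\<And>s t. \<lbrakk>1 \<le> s; 1 \<le> t; s \<le> 2 * t\<rbrakk> \<Longrightarrow> \<kappa> t \<le> Cm * \<kappa> s"
    using kappa_almost_decreasing[of 2] by auto
  obtain C2 where C2: "1 \<le> C2" "\<And>x R. \<lbrakk>x \<in> X; 0 < R; R \<le> N x / 2\<rbrakk> \<Longrightarrow> mball x R \<subseteq> sph.mball x (C2 * \<rho> (N x) * R)"
    by (rule ball_subset_sph) blast
  \<comment> \<open>The factor is such that \<open>\<kappa> S \<le> Cm * (r / M)\<close> makes the bound \<open>C1 * \<kappa> S\<close> for distances at most \<open>r / 2\<close>.\<close>
  define M where "M = 2 * C1 * Cm"
  have CC: "1 * 1 \<le> C1 * Cm" using C1(1) Cm(1) by (intro mult_mono) auto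
  have M: "2 \<le> M" using CC by (simp add: M_def)
  have MC1: "C1 < M" using C1(1) Cm(1) mult_left_mono[of 1 Cm "2 * C1"] by (simp add: M_def)
  have MCm: "Cm \<le> M" using C1(1) Cm(1) mult_right_mono[of 1 "2 * C1" Cm] by (simp add: M_def)
  have CA2: "1 \<le> CA\<^sup>2" using CA(1) by simp
  have M6: "1 * (1 * 1) \<le> 6 * CA\<^sup>2 * (M * CA)" 
  proof (intro mult_mono)
    show "1 \<le> 6 * CA\<^sup>2" using CA2 by linarith
  qed (use M CA(1) in auto)
  then obtain K where K: "1 \<le> K" "\<And>s t. \<lbrakk>1 \<le> s; 1 \<le> t; \<kappa> s \<le> 6 * CA\<^sup>2 * (M * CA) * \<kappa> t\<rbrakk> \<Longrightarrow> t \<le> K * s"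
    using kappa_ratio[of "6 * CA\<^sup>2 * (M * CA)"] by auto
  define \<epsilon> where "\<epsilon> = min (1/2) (min (c0 / C2) (1 / K))"
  have e: "0 < \<epsilon>" "\<epsilon> \<le> 1/2" "\<epsilon> \<le> c0 / C2" "\<epsilon> \<le> 1 / K" 
  proof -
    show "\<epsilon> \<le> 1/2" unfolding \<epsilon>_def by (rule min.cobounded1)
  qed (use c0 C2(1) K(1) in \<open>auto simp: \<epsilon>_def\<close>)
  have far: "\<epsilon> * N z \<le> N y" if "y \<in> X" "z \<in> X" "N z \<le> K * N y" for y z
  proof -
    have "\<epsilon> * N z \<le> (1 / K) * (K * N y)"
      using e K(1) that N_gt1[OF that(2)] by (intro mult_mono) auto
    then show ?thesis using K(1) by simp
  qed
  have eh: "\<epsilon> * N z \<le> N z / 2" if "z \<in> X" for z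
  proof -
    have "\<epsilon> * N z \<le> (1/2) * N z" by (rule mult_right_mono[OF e(2)]) (use N_gt1[OF that] in simp)
    then show ?thesis by simp
  qed
  have half: "\<epsilon> * N z \<le> N y" if "z \<in> X" "N z / 2 \<le> N y" for y z
    using eh[OF that(1)] that(2) by linarith
  show ?thesis
  proof (rule that[of \<epsilon> "max 1 (1 / c0)"])
    show "0 < \<epsilon>" "\<epsilon> \<le> 1/2" "1 \<le> max 1 (1 / c0)" using e by auto
    fix x r assume x: "x \<in> X" and r: "0 < r" "c0 * \<kappa> (N x) \<le> r"
    have kx: "0 < \<kappa> (N x)" using kappa_pos N_gt1[OF x] by auto
    have Cr: "\<kappa> (N z) \<le> max 1 (1 / c0) * r" if "\<kappa> (N z) \<le> r \<or> \<kappa> (N z) \<le> (1 / c0) * r" for z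
    proof -
      have "1 * r \<le> max 1 (1 / c0) * r" "(1 / c0) * r \<le> max 1 (1 / c0) * r"
        by (intro mult_right_mono max.cobounded1 max.cobounded2; use r in simp)+
      then show ?thesis using that by linarith
    qed
    show "\<exists>z\<in>X. mball z (\<epsilon> * N z) \<subseteq> sph.mball x r \<and>
       (\<forall>y\<in>sph.mball x (2 * r). \<epsilon> * N z \<le> N y) \<and> \<kappa> (N z) \<le> max 1 (1 / c0) * r"
    proof (cases "r \<le> M * \<kappa> (N x)")
      case True
      have eN: "0 < \<epsilon> * N x" "\<epsilon> * N x \<le> N x / 2"
        using e(1) eh[OF x] N_gt1[OF x] by auto
      have "C2 * \<rho> (N x) * (\<epsilon> * N x) = C2 * \<epsilon> * \<kappa> (N x)" by (simp add: \<kappa>_def)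
      also have "\<dots> \<le> c0 * \<kappa> (N x)" using e(3) C2(1) kx by (intro mult_right_mono) (auto simp: le_divide_eq mult.commute)
      finally have "C2 * \<rho> (N x) * (\<epsilon> * N x) \<le> r" using r by simp
      then have 1: "mball x (\<epsilon> * N x) \<subseteq> sph.mball x r"
        using C2(2)[OF x eN] sph.mball_subset_concentric by blast
      have 2: "\<epsilon> * N x \<le> N y" if y: "y \<in> sph.mball x (2 * r)" for y
      proof (cases "N x / 2 \<le> N y")
        case False
        have yX: "y \<in> X" "wdist x y < 2 * r" using y by auto
        have "\<kappa> (N y) \<le> 2 * CA\<^sup>2 * wdist x y" by (rule kappa_le_wdist) (use x yX False in auto)
        also have "\<dots> \<le> 2 * CA\<^sup>2 * (3 * (M * \<kappa> (N x)))" using yX True CA2 r(1) by (intro mult_left_mono) auto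
        also have "\<dots> = 6 * CA\<^sup>2 * (M * 1) * \<kappa> (N x)" by simp
        also have "\<dots> \<le> 6 * CA\<^sup>2 * (M * CA) * \<kappa> (N x)"
          using kx M CA(1) by (intro mult_right_mono mult_left_mono) auto
        finally show ?thesis using N_gt1[OF x] N_gt1[OF yX(1)] by (intro far yX x K(2)) auto
      qed (use half x in auto)
      have "\<kappa> (N x) \<le> (1 / c0) * r" using r c0 by (simp add: le_divide_eq mult.commute)
      then show ?thesis using 1 2 Cr x by blast
    next
      case False
      then have xr: "\<kappa> (N x) < r / M" using M by (simp add: less_divide_eq mult.commute)
      have rM: "0 < r / M" "r / M \<le> r" using r M by (auto simp: divide_le_eq)
      obtain S where S: "1 \<le> S" "\<And>s. S \<le> s \<Longrightarrow> \<kappa> s < r / M" by (rule kappa_small[OF rM(1)]) blast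
      obtain k0 :: nat where "S \<le> 2 ^ k0" using real_arch_pow[of 2 S] by (auto intro: less_imp_le)
      then have ex: "\<kappa> (2 ^ k0) \<le> r / M" using S(2) by (auto intro: less_imp_le)
      \<comment> \<open>The first dyadic scale at which \<open>\<kappa>\<close> is small; at the preceding one it is not, so that the radius is also at most a multiple of \<open>\<kappa> (N z)\<close>.\<close>
      define k where "k = (LEAST k::nat. \<kappa> (2 ^ k) \<le> r / M)"
      have k: "\<kappa> (2 ^ k) \<le> r / M" unfolding k_def by (rule LeastI[of _ k0]) (rule ex)
      show ?thesis
      proof (cases "k = 0")
        case True
        \<comment> \<open>In this case the ball is the whole space.\<close>
        then have k1: "\<kappa> 1 \<le> r / M" using k by simp
        obtain z where z: "z \<in> X" "N z = 2" using N_attains[of 2] by auto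
        have all: "wdist x y < r" if "y \<in> X" for y
        proof -
          have "wdist x y \<le> C1 * \<kappa> 1" by (rule C1(2)) (use N_gt1[OF x] N_gt1[OF that] x that in auto)
          also have "\<dots> \<le> C1 * (r / M)" using k1 C1(1) by (intro mult_left_mono) auto
          also have "\<dots> < r" using MC1 r M by (simp add: divide_less_eq)
          finally show ?thesis .
        qed
        have "\<kappa> (N z) \<le> Cm * \<kappa> 1" unfolding z by (rule Cm(2)) auto
        also have "\<dots> \<le> Cm * (r / M)" using k1 Cm(1) by (intro mult_left_mono) auto
        also have "\<dots> \<le> r" using MCm r M by (simp add: divide_le_eq)
        finally have kz: "\<kappa> (N z) \<le> r" .
        have "\<epsilon> * N z \<le> N y" if "y \<in> X" for y using half[OF z(1), of y] N_gt1[OF that] z by simp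
        moreover have "\<kappa> (N z) \<le> max 1 (1 / c0) * r" by (rule Cr) (use kz in simp)
        moreover have "mball z (\<epsilon> * N z) \<subseteq> sph.mball x r" using all x by auto
        ultimately show ?thesis using z(1) sph.mball_subset_mspace by blast
      next
        case False
        then obtain j where j: "k = Suc j" by (cases k) auto
        have "\<not> \<kappa> (2 ^ j) \<le> r / M" using not_less_Least[of j "\<lambda>k. \<kappa> (2 ^ k) \<le> r / M"] j unfolding k_def by simp
        then have j': "r < M * \<kappa> (2 ^ j)" using M by (simp add: not_le divide_less_eq mult.commute)
        have one: "(1::real) \<le> 2 ^ j" by simp
        obtain z where z: "z \<in> X" "N z = 2 ^ k" using N_attains[of "2 ^ k"] False by (metis one_less_power one_less_numeral_iff semiring_norm(76) neq0_conv)
        have kz: "\<kappa> (N z) \<le> r / M" using k z by simp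
        have Nz: "N z = 2 * 2 ^ j" using z j by simp
        have "\<rho> (2 ^ j) \<le> CA * \<rho> (N z)" unfolding Nz by (rule rho_comp1) (use one in linarith)+
        moreover have "0 < \<rho> (2 ^ j)" using rho_pos by simp
        ultimately have "2 ^ j * \<rho> (2 ^ j) \<le> N z * (CA * \<rho> (N z))"
          unfolding Nz by (intro mult_mono) auto
        then have "\<kappa> (2 ^ j) \<le> CA * \<kappa> (N z)" by (simp add: \<kappa>_def mult.left_commute)
        then have "M * \<kappa> (2 ^ j) \<le> M * (CA * \<kappa> (N z))" using M by (intro mult_left_mono) auto
        then have rz: "r \<le> M * (CA * \<kappa> (N z))" using j' by simp
        have near: "wdist x y < r" if y: "y \<in> X" "N z / 2 \<le> N y" for y
        proof -
          have "1 \<le> min (N x) (N y)" using N_gt1[OF x] N_gt1[OF y(1)] by auto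
          then have "wdist x y \<le> C1 * \<kappa> (min (N x) (N y))" by (intro C1(2)) (use x y in auto)
          also have "\<kappa> (min (N x) (N y)) \<le> Cm * (r / M)"
          proof (cases "N x \<le> N y")
            case True
            have "1 * (r / M) \<le> Cm * (r / M)" using Cm(1) rM by (intro mult_right_mono) auto
            then show ?thesis using xr True by (simp add: min_absorb1)
          next
            case False
            have "\<kappa> (N y) \<le> Cm * \<kappa> (N z)" by (rule Cm(2)) (use N_gt1[OF y(1)] N_gt1[OF z(1)] y in auto)
            also have "\<dots> \<le> Cm * (r / M)" using kz Cm(1) by (intro mult_left_mono) auto
            finally show ?thesis using False by (simp add: min_absorb2)
          qed
          then have "C1 * \<kappa> (min (N x) (N y)) \<le> C1 * (Cm * (r / M))" using C1(1) by (intro mult_left_mono) auto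
          also have "\<dots> = r / 2" using C1(1) Cm(1) by (simp add: M_def)
          finally show ?thesis using r by simp
        qed
        have 1: "mball z (\<epsilon> * N z) \<subseteq> sph.mball x r"
        proof
          fix y assume "y \<in> mball z (\<epsilon> * N z)"
          then have y: "y \<in> X" "d z y < \<epsilon> * N z" by auto
          have "\<epsilon> * N z \<le> N z / 2" by (rule eh[OF z(1)])
          then have "N z / 2 \<le> N y" using N_lip[OF z(1) y(1)] y by simp
          then show "y \<in> sph.mball x r" using near x y by simp
        qed
        have 2: "\<epsilon> * N z \<le> N y" if y: "y \<in> sph.mball x (2 * r)" for y
        proof (cases "N z / 2 \<le> N y")
          case False
          have yX: "y \<in> X" "wdist x y < 2 * r" using y by auto
          have zr: "wdist x z < r" using near[OF z(1)] N_gt1[OF z(1)] by simp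
          have "\<kappa> (N y) \<le> 2 * CA\<^sup>2 * wdist z y" by (rule kappa_le_wdist) (use z yX False in auto)
          also have "\<dots> \<le> 2 * CA\<^sup>2 * (3 * r)"
            using sph.triangle''[OF z(1) x yX(1)] zr yX CA2 by (intro mult_left_mono) auto
          also have "\<dots> \<le> 2 * CA\<^sup>2 * (3 * (M * (CA * \<kappa> (N z))))" using rz CA2 by (intro mult_left_mono) auto
          also have "\<dots> = 6 * CA\<^sup>2 * (M * CA) * \<kappa> (N z)" by simp
          finally show ?thesis using N_gt1[OF z(1)] N_gt1[OF yX(1)] by (intro far yX z K(2)) auto
        next
          case True then show ?thesis by (rule half[OF z(1)])
        qed
        have "\<kappa> (N z) \<le> r" using kz rM by simp
        then show ?thesis using 1 2 Cr z by blast
      qed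
    qed
  qed
qed

end

section \<open>Doubling of the weighted measure\<close>

locale doubling_sphericalization = sphericalization X d b \<rho> CU CA CB
  for X :: "'a set" and d b \<rho> CU CA CB +
  fixes \<mu> :: "'a measure" and \<sigma> CD CT :: real
  assumes space_mu: "space \<mu> = X" and borel_sub: "sets (metric_borel X d) \<subseteq> sets \<mu>"
    and CD: "1 < CD" and mu_doubling: "\<And>x r. \<lbrakk>x \<in> X; 0 < r\<rbrakk> \<Longrightarrow> 0 < emeasure \<mu> (mball x (2 * r)) \<and>
     emeasure \<mu> (mball x (2 * r)) \<le> ennreal CD * emeasure \<mu> (mball x r) \<and>
     ennreal CD * emeasure \<mu> (mball x r) < \<infinity>"
    and sigma: "0 < \<sigma>" and CT: "0 < CT"
    and tail: "\<And>r. 0 < r \<Longrightarrow> (\<integral>\<^sup>+x\<in>X - base_ball X d b r. ennreal (\<rho> (base_norm X d b x) powr \<sigma>) \<partial>\<mu>)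
       \<le> ennreal (CT * \<rho> r powr \<sigma>) * emeasure \<mu> (base_ball X d b (r + 1))"
begin

definition m :: "'a \<Rightarrow> real \<Rightarrow> real" where "m x r = measure \<mu> (mball x r)"

abbreviation \<nu> where "\<nu> \<equiv> sph_measure X d b \<rho> \<sigma> \<mu>"

lemma borel_mu: "f \<in> borel_measurable (metric_borel X d) \<Longrightarrow> f \<in> borel_measurable \<mu>"
  by (rule borel_measurable_subalgebra[OF borel_sub]) (auto simp: space_metric_borel space_mu)

lemma open_mu: "openin mtopology U \<Longrightarrow> U \<in> sets \<mu>"
  using open_in_metric_borel borel_sub by auto

lemma mball_mu: "mball x r \<in> sets \<mu>" by (intro open_mu openin_mball)

lemma sph_mball_mu: "sph.mball x r \<in> sets \<mu>"
  using sph.openin_mball[of x r] unfolding sph_topology by (rule open_mu)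

lemma N_mu: "N \<in> borel_measurable \<mu>" by (rule borel_mu[OF N_borel])

lemma N_sets: "{x \<in> X. S \<le> N x} \<in> sets \<mu>" "{x \<in> X. N x < S} \<in> sets \<mu>" "{x \<in> X. S \<le> N x \<and> N x < T} \<in> sets \<mu>"
  "{x \<in> X. S \<le> N x \<and> N x \<le> T} \<in> sets \<mu>"
  using N_mu unfolding space_mu[symmetric] by measurable

lemma X_mu: "X \<in> sets \<mu>" using sets.top[of \<mu>] space_mu by simp

lemma emeasure_mball:
  assumes "x \<in> X" "0 < r" shows "emeasure \<mu> (mball x r) = ennreal (m x r)" "0 < m x r"
proof -
  have fin: "emeasure \<mu> (mball x r) < \<infinity>"
    using mu_doubling[OF assms] CD by (auto simp: ennreal_mult_less_top)
  then show e: "emeasure \<mu> (mball x r) = ennreal (m x r)"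
    unfolding m_def by (simp add: emeasure_eq_ennreal_measure)
  have "0 < emeasure \<mu> (mball x r)" using mu_doubling[of x "r/2"] assms by simp
  then show "0 < m x r" using e by simp
qed

lemma m_mono: "\<lbrakk>x \<in> X; y \<in> X; 0 < r; 0 < s; d x y + s \<le> r\<rbrakk> \<Longrightarrow> m y s \<le> m x r"
  using emeasure_mono[OF mball_subset[of y x s r] mball_mu[of x r]] emeasure_mball[of x r] emeasure_mball[of y s]
  by (auto simp: commute ennreal_le_iff)

lemma m_double: "\<lbrakk>x \<in> X; 0 < r\<rbrakk> \<Longrightarrow> m x (2 * r) \<le> CD * m x r"
  using mu_doubling[of x r] emeasure_mball[of x r] emeasure_mball[of x "2 * r"] CD
  by (auto simp: ennreal_mult[symmetric] ennreal_le_iff)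

text \<open>
  The ball of radius \<open>s\<close> around \<open>y\<close> lies in the ball of radius \<open>K * r\<close> around \<open>x\<close>; doubling is
  iterated.
\<close>

lemma m_compare:
  assumes "1 \<le> K"
  obtains C where "1 \<le> C" "\<And>x y r s. \<lbrakk>x \<in> X; y \<in> X; 0 < r; 0 < s; d x y + s \<le> K * r\<rbrakk> \<Longrightarrow> m y s \<le> C * m x r"
proof -
  obtain k where k: "K \<le> 2 ^ k" using real_arch_pow[of 2 K] by (auto intro: less_imp_le)
  have pow: "m x (2 ^ k * r) \<le> CD ^ k * m x r" if "x \<in> X" "0 < r" for x r k
  proof (induction k)
    case (Suc k)
    have "m x (2 * (2 ^ k * r)) \<le> CD * m x (2 ^ k * r)" by (rule m_double) (use that in auto)
    also have "\<dots> \<le> CD * (CD ^ k * m x r)" using Suc CD by (intro mult_left_mono) auto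
    finally show ?case by (simp add: mult_ac)
  qed simp
  show ?thesis
  proof (rule that[of "CD ^ k"])
    show "1 \<le> CD ^ k" using CD by simp
    fix x y r s assume a: "x \<in> X" "y \<in> X" "0 < r" "0 < s" "d x y + s \<le> K * r"
    have "K * r \<le> 2 ^ k * r" using k a by (intro mult_right_mono) auto
    then have "d x y + s \<le> 2 ^ k * r" using a by linarith
    then have "m y s \<le> m x (2 ^ k * r)" using a by (intro m_mono) auto
    also have "\<dots> \<le> CD ^ k * m x r" using pow a by blast
    finally show "m y s \<le> CD ^ k * m x r" .
  qed
qed

definition W :: "'a \<Rightarrow> real" where "W x = \<rho> (nrm x) powr \<sigma>"

lemma W_mu: "(\<lambda>x. ennreal (W x)) \<in> borel_measurable \<mu>"
proof -
  have "(\<lambda>x. ennreal (\<rho> (nrm x))) \<in> borel_measurable \<mu>" by (rule borel_mu[OF rho_nrm_borel])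
  then have "(\<lambda>x. ennreal (enn2real (ennreal (\<rho> (nrm x))) powr \<sigma>)) \<in> borel_measurable \<mu>" by measurable
  then show ?thesis
  proof (rule measurable_cong[THEN iffD1, rotated])
    fix x assume "x \<in> space \<mu>"
    then have "0 < \<rho> (nrm x)" by (simp add: space_mu rho_pos nrm_pos)
    then show "ennreal (enn2real (ennreal (\<rho> (nrm x))) powr \<sigma>) = ennreal (W x)" by (simp add: W_def)
  qed
qed

lemma nu_eq: "\<nu> = density \<mu> (\<lambda>x. ennreal (W x))"
  by (simp add: sph_measure_def W_def nrm_def)

lemma sets_nu[simp]: "sets \<nu> = sets \<mu>" "space \<nu> = X"
  by (simp_all add: nu_eq space_mu)

lemma nn_integral_nu:
  "f \<in> borel_measurable \<mu> \<Longrightarrow> (\<integral>\<^sup>+x. f x \<partial>\<nu>) = (\<integral>\<^sup>+x. ennreal (W x) * f x \<partial>\<mu>)"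
  unfolding nu_eq by (rule nn_integral_density[OF W_mu])

lemma W_pos: "x \<in> X \<Longrightarrow> 0 < W x" using rho_pos[OF nrm_pos, of x] by (simp add: W_def)

lemma W_compare:
  assumes K: "1 \<le> K"
  obtains C where "1 \<le> C" "\<And>s y. \<lbrakk>1 \<le> s; y \<in> X; N y \<le> K * s; s \<le> K * N y\<rbrakk> \<Longrightarrow>
    W y \<le> C * \<rho> s powr \<sigma> \<and> \<rho> s powr \<sigma> \<le> C * W y"
proof -
  obtain C where C: "1 \<le> C" "\<And>s t. \<lbrakk>1 \<le> s; 1 \<le> t; s \<le> K * t; t \<le> K * s\<rbrakk> \<Longrightarrow> \<rho> s \<le> C * \<rho> t"
    using rho_comp[OF K] by blast
  have c: "1 \<le> CA * C" using CA(1) C(1) mult_mono[of 1 CA 1 C] by simp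
  show ?thesis
  proof (rule that[of "(CA * C) powr \<sigma>"])
    show "1 \<le> (CA * C) powr \<sigma>" using c sigma by (simp add: ge_one_powr_ge_zero)
    fix s y assume a: "1 \<le> s" "y \<in> X" "N y \<le> K * s" "s \<le> K * N y"
    have r: "\<rho> (N y) \<le> C * \<rho> s" "\<rho> s \<le> C * \<rho> (N y)" using C(2) a N_gt1[OF a(2)] by auto
    have p: "0 < \<rho> s" "0 < \<rho> (nrm y)" using rho_pos a nrm_pos by auto
    have "\<rho> (nrm y) \<le> CA * (C * \<rho> s)"
      using order_trans[OF rho_nrm_comp(1)[OF a(2)] mult_left_mono[OF r(1)]] CA(1) by simp
    then have "\<rho> (nrm y) powr \<sigma> \<le> (CA * C * \<rho> s) powr \<sigma>" using p sigma by (intro powr_mono2) (auto simp: mult.assoc)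
    also have "\<dots> = (CA * C) powr \<sigma> * \<rho> s powr \<sigma>" using p c by (simp add: powr_mult)
    finally have 1: "W y \<le> (CA * C) powr \<sigma> * \<rho> s powr \<sigma>" by (simp add: W_def)
    have "\<rho> s \<le> C * (CA * \<rho> (nrm y))"
      using order_trans[OF r(2) mult_left_mono[OF rho_nrm_comp(2)[OF a(2)]]] C(1) by simp
    then have "\<rho> s powr \<sigma> \<le> (CA * C * \<rho> (nrm y)) powr \<sigma>" using p sigma by (intro powr_mono2) (auto simp: mult_ac)
    also have "\<dots> = (CA * C) powr \<sigma> * \<rho> (nrm y) powr \<sigma>" using p c by (simp add: powr_mult)
    finally show "W y \<le> (CA * C) powr \<sigma> * \<rho> s powr \<sigma> \<and> \<rho> s powr \<sigma> \<le> (CA * C) powr \<sigma> * W y"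
      using 1 by (simp add: W_def)
  qed
qed

text \<open>
  On sets where \<open>N\<close> is comparable to \<open>s\<close>, the density of \<open>\<nu>\<close> is comparable to the constant
  \<open>\<rho> s powr \<sigma>\<close>.
\<close>

lemma nu_compare:
  assumes K: "1 \<le> K"
  obtains C where "1 \<le> C" "\<And>s A f. \<lbrakk>1 \<le> s; A \<subseteq> X; \<And>y. y \<in> A \<Longrightarrow> N y \<le> K * s \<and> s \<le> K * N y;
      (\<lambda>x. f x * indicator A x) \<in> borel_measurable \<mu>\<rbrakk> \<Longrightarrow>
    (\<integral>\<^sup>+x\<in>A. f x \<partial>\<nu>) \<le> ennreal (C * \<rho> s powr \<sigma>) * (\<integral>\<^sup>+x\<in>A. f x \<partial>\<mu>) \<and>
    ennreal (\<rho> s powr \<sigma>) * (\<integral>\<^sup>+x\<in>A. f x \<partial>\<mu>) \<le> ennreal C * (\<integral>\<^sup>+x\<in>A. f x \<partial>\<nu>)"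
proof -
  obtain C where C: "1 \<le> C" "\<And>s y. \<lbrakk>1 \<le> s; y \<in> X; N y \<le> K * s; s \<le> K * N y\<rbrakk> \<Longrightarrow>
    W y \<le> C * \<rho> s powr \<sigma> \<and> \<rho> s powr \<sigma> \<le> C * W y"
    by (rule W_compare[OF K]) blast
  show ?thesis
  proof (rule that[OF C(1)])
    fix s A and f :: "'a \<Rightarrow> ennreal"
    assume s: "1 \<le> s" and A: "A \<subseteq> X" "\<And>y. y \<in> A \<Longrightarrow> N y \<le> K * s \<and> s \<le> K * N y"
      and f: "(\<lambda>x. f x * indicator A x) \<in> borel_measurable \<mu>"
    have W: "W y \<le> C * \<rho> s powr \<sigma>" "\<rho> s powr \<sigma> \<le> C * W y" if "y \<in> A" for y
      using C(2)[OF s, of y] A that by auto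
    have i: "(\<integral>\<^sup>+x\<in>A. f x \<partial>\<nu>) = (\<integral>\<^sup>+x. ennreal (W x) * (f x * indicator A x) \<partial>\<mu>)"
      by (rule nn_integral_nu[OF f])
    have "(\<integral>\<^sup>+x\<in>A. f x \<partial>\<nu>) \<le> (\<integral>\<^sup>+x. ennreal (C * \<rho> s powr \<sigma>) * (f x * indicator A x) \<partial>\<mu>)"
      unfolding i by (intro nn_integral_mono) (auto simp: indicator_def intro!: mult_right_mono ennreal_leI W)
    also have "\<dots> = ennreal (C * \<rho> s powr \<sigma>) * (\<integral>\<^sup>+x\<in>A. f x \<partial>\<mu>)" by (rule nn_integral_cmult[OF f])
    finally have 1: "(\<integral>\<^sup>+x\<in>A. f x \<partial>\<nu>) \<le> ennreal (C * \<rho> s powr \<sigma>) * (\<integral>\<^sup>+x\<in>A. f x \<partial>\<mu>)" .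
    have "ennreal (\<rho> s powr \<sigma>) * (\<integral>\<^sup>+x\<in>A. f x \<partial>\<mu>) = (\<integral>\<^sup>+x. ennreal (\<rho> s powr \<sigma>) * (f x * indicator A x) \<partial>\<mu>)"
      by (rule nn_integral_cmult[OF f, symmetric])
    also have "\<dots> \<le> (\<integral>\<^sup>+x. ennreal C * (ennreal (W x) * (f x * indicator A x)) \<partial>\<mu>)"
    proof (intro nn_integral_mono)
      fix x
      have "ennreal (\<rho> s powr \<sigma>) * f x \<le> ennreal C * (ennreal (W x) * f x)" if "x \<in> A"
      proof -
        have "x \<in> X" using A that by auto
        then have "ennreal (C * W x) = ennreal C * ennreal (W x)"
          using C(1) W_pos[of x] by (intro ennreal_mult) auto
        then have "ennreal (\<rho> s powr \<sigma>) \<le> ennreal C * ennreal (W x)" using ennreal_leI[OF W(2)[OF that]] by simp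
        from mult_right_mono[OF this, of "f x"] show ?thesis by (simp add: mult.assoc)
      qed
      then show "ennreal (\<rho> s powr \<sigma>) * (f x * indicator A x) \<le> ennreal C * (ennreal (W x) * (f x * indicator A x))"
        by (auto simp: indicator_def)
    qed
    also have "\<dots> = ennreal C * (\<integral>\<^sup>+x\<in>A. f x \<partial>\<nu>)"
      unfolding i by (rule nn_integral_cmult) (use f W_mu in measurable)
    finally show "(\<integral>\<^sup>+x\<in>A. f x \<partial>\<nu>) \<le> ennreal (C * \<rho> s powr \<sigma>) * (\<integral>\<^sup>+x\<in>A. f x \<partial>\<mu>) \<and>
      ennreal (\<rho> s powr \<sigma>) * (\<integral>\<^sup>+x\<in>A. f x \<partial>\<mu>) \<le> ennreal C * (\<integral>\<^sup>+x\<in>A. f x \<partial>\<nu>)"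
      using 1 by blast
  qed
qed

lemma nu_compare_sets:
  assumes K: "1 \<le> K"
  obtains C where "1 \<le> C" "\<And>s A. \<lbrakk>1 \<le> s; A \<in> sets \<mu>; \<And>y. y \<in> A \<Longrightarrow> N y \<le> K * s \<and> s \<le> K * N y\<rbrakk> \<Longrightarrow>
    emeasure \<nu> A \<le> ennreal (C * \<rho> s powr \<sigma>) * emeasure \<mu> A \<and>
    ennreal (\<rho> s powr \<sigma>) * emeasure \<mu> A \<le> ennreal C * emeasure \<nu> A"
proof -
  obtain C where C: "1 \<le> C" "\<And>s A f. \<lbrakk>1 \<le> s; A \<subseteq> X; \<And>y. y \<in> A \<Longrightarrow> N y \<le> K * s \<and> s \<le> K * N y;
      (\<lambda>x. f x * indicator A x) \<in> borel_measurable \<mu>\<rbrakk> \<Longrightarrow>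
    (\<integral>\<^sup>+x\<in>A. f x \<partial>\<nu>) \<le> ennreal (C * \<rho> s powr \<sigma>) * (\<integral>\<^sup>+x\<in>A. f x \<partial>\<mu>) \<and>
    ennreal (\<rho> s powr \<sigma>) * (\<integral>\<^sup>+x\<in>A. f x \<partial>\<mu>) \<le> ennreal C * (\<integral>\<^sup>+x\<in>A. f x \<partial>\<nu>)"
    by (rule nu_compare[OF K]) blast
  show ?thesis
  proof (rule that[OF C(1)])
    fix s A assume s: "1 \<le> s" and A: "A \<in> sets \<mu>" "\<And>y. y \<in> A \<Longrightarrow> N y \<le> K * s \<and> s \<le> K * N y"
    have sub: "A \<subseteq> X" using sets.sets_into_space[OF A(1)] space_mu by simp
    have "(\<integral>\<^sup>+x\<in>A. 1 \<partial>\<nu>) \<le> ennreal (C * \<rho> s powr \<sigma>) * (\<integral>\<^sup>+x\<in>A. 1 \<partial>\<mu>) \<and>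
      ennreal (\<rho> s powr \<sigma>) * (\<integral>\<^sup>+x\<in>A. 1 \<partial>\<mu>) \<le> ennreal C * (\<integral>\<^sup>+x\<in>A. 1 \<partial>\<nu>)"
      by (rule C(2)[OF s sub A(2)]) (use A(1) in simp_all)
    then show "emeasure \<nu> A \<le> ennreal (C * \<rho> s powr \<sigma>) * emeasure \<mu> A \<and>
      ennreal (\<rho> s powr \<sigma>) * emeasure \<mu> A \<le> ennreal C * emeasure \<nu> A"
      using A(1) by simp
  qed
qed

lemma base_ball_eq: "base_ball X d b r = {y \<in> X. N y < r + 1}"
  by (auto simp: base_ball_def N_def nrm_def)

text \<open>
  The tail condition bounds the part where \<open>N x \<ge> S + 1\<close>, and on the remaining shell the density
  is comparable to \<open>\<rho> S powr \<sigma>\<close>. By doubling, the ball around \<open>b\<close> that occurs in the tail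
  condition has measure at most a multiple of \<open>m z r\<close>.
\<close>

lemma nu_tail:
  assumes K: "1 \<le> K"
  obtains C where "1 \<le> C" "\<And>S z r. \<lbrakk>1 \<le> S; z \<in> X; N z \<le> K * S; 0 < r; S \<le> K * r\<rbrakk> \<Longrightarrow>
    emeasure \<nu> {y \<in> X. S \<le> N y} \<le> ennreal (C * \<rho> S powr \<sigma> * m z r)"
proof -
  have K3: "1 \<le> (2 + K) * K" using K mult_mono[of 1 "2 + K" 1 K] by simp
  obtain C1 where C1: "1 \<le> C1" "\<And>x y r s. \<lbrakk>x \<in> X; y \<in> X; 0 < r; 0 < s; d x y + s \<le> ((2 + K) * K) * r\<rbrakk> \<Longrightarrow> m y s \<le> C1 * m x r"
    by (rule m_compare[OF K3]) blast
  obtain C2 where C2: "1 \<le> C2" "\<And>s A. \<lbrakk>1 \<le> s; A \<in> sets \<mu>; \<And>y. y \<in> A \<Longrightarrow> N y \<le> 2 * s \<and> s \<le> 2 * N y\<rbrakk> \<Longrightarrow>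
    emeasure \<nu> A \<le> ennreal (C2 * \<rho> s powr \<sigma>) * emeasure \<mu> A \<and>
    ennreal (\<rho> s powr \<sigma>) * emeasure \<mu> A \<le> ennreal C2 * emeasure \<nu> A"
    by (rule nu_compare_sets[of 2]) auto
  have C: "1 * 1 \<le> (CT + C2) * C1" using CT C2(1) C1(1) by (intro mult_mono) auto
  show ?thesis
  proof (rule that[of "(CT + C2) * C1"])
    show "1 \<le> (CT + C2) * C1" using C by simp
    fix S z r assume a: "1 \<le> S" "z \<in> X" "N z \<le> K * S" "0 < r" "S \<le> K * r"
    define T where "T = (2 + K) * K * r"
    have T: "(2 + K) * S \<le> T" "0 < T"
      using mult_left_mono[OF a(5), of "2 + K"] K a mult_pos_pos[of "(2 + K) * K" r] K3 by (auto simp: T_def mult_ac)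
    have rS: "0 < \<rho> S" using rho_pos a by auto
    have bb: "{y \<in> X. N y < S + 1 + 1} \<subseteq> mball z T"
    proof
      fix y assume y: "y \<in> {y \<in> X. N y < S + 1 + 1}"
      have "d z y \<le> nrm z + nrm y" by (rule dist_le_nrm) (use a y in auto)
      also have "\<dots> < K * S + S" using a y by (auto simp: N_def)
      also have "\<dots> \<le> T" using T a by (simp add: distrib_right)
      finally show "y \<in> mball z T" using a y by simp
    qed
    have mT: "m z T \<le> C1 * m z r" using C1(2)[of z z r T] a T by (simp add: T_def)
    have e1: "emeasure \<mu> {y \<in> X. N y < S + 1 + 1} \<le> ennreal (C1 * m z r)"
      using emeasure_mono[OF bb mball_mu] emeasure_mball(1)[OF a(2) T(2)] ennreal_leI[OF mT] by (metis order_trans)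
    have s: "X - base_ball X d b S \<in> sets \<mu>"
      unfolding base_ball_eq by (intro sets.Diff X_mu N_sets)
    have "{y \<in> X. S \<le> N y} = (X - base_ball X d b S) \<union> {y \<in> X. S \<le> N y \<and> N y < S + 1}"
      by (auto simp: base_ball_eq)
    then have "emeasure \<nu> {y \<in> X. S \<le> N y} \<le> emeasure \<nu> (X - base_ball X d b S) + emeasure \<nu> {y \<in> X. S \<le> N y \<and> N y < S + 1}"
      using emeasure_subadditive[of "X - base_ball X d b S" \<nu> "{y \<in> X. S \<le> N y \<and> N y < S + 1}"] N_sets(3)[of S "S + 1"] s
      by simp
    also have "emeasure \<nu> (X - base_ball X d b S) \<le> ennreal (CT * \<rho> S powr \<sigma>) * ennreal (C1 * m z r)"
    proof -
      have "emeasure \<nu> (X - base_ball X d b S) = (\<integral>\<^sup>+x\<in>X - base_ball X d b S. ennreal (\<rho> (base_norm X d b x) powr \<sigma>) \<partial>\<mu>)"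
        unfolding nu_eq by (subst emeasure_density[OF W_mu s]) (simp add: W_def nrm_def)
      also have "\<dots> \<le> ennreal (CT * \<rho> S powr \<sigma>) * emeasure \<mu> (base_ball X d b (S + 1))"
        by (rule tail) (use a in auto)
      also have "\<dots> \<le> ennreal (CT * \<rho> S powr \<sigma>) * ennreal (C1 * m z r)"
        unfolding base_ball_eq by (intro mult_left_mono e1) auto
      finally show ?thesis .
    qed
    also have "emeasure \<nu> {y \<in> X. S \<le> N y \<and> N y < S + 1} \<le> ennreal (C2 * \<rho> S powr \<sigma>) * ennreal (C1 * m z r)"
    proof -
      have "emeasure \<nu> {y \<in> X. S \<le> N y \<and> N y < S + 1} \<le> ennreal (C2 * \<rho> S powr \<sigma>) * emeasure \<mu> {y \<in> X. S \<le> N y \<and> N y < S + 1}"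
        using C2(2)[of S "{y \<in> X. S \<le> N y \<and> N y < S + 1}"] a N_sets by auto
      also have "emeasure \<mu> {y \<in> X. S \<le> N y \<and> N y < S + 1} \<le> emeasure \<mu> {y \<in> X. N y < S + 1 + 1}"
        using N_sets by (intro emeasure_mono) auto
      also note e1
      finally show ?thesis by (simp add: mult_left_mono)
    qed
    also have "ennreal (CT * \<rho> S powr \<sigma>) * ennreal (C1 * m z r) + ennreal (C2 * \<rho> S powr \<sigma>) * ennreal (C1 * m z r) =
      ennreal ((CT + C2) * C1 * \<rho> S powr \<sigma> * m z r)"
      using CT C2(1) C1(1) emeasure_mball(2)[OF a(2,4)]
      by (simp add: ennreal_mult[symmetric] ennreal_plus[symmetric] algebra_simps del: ennreal_plus)
    finally show "emeasure \<nu> {y \<in> X. S \<le> N y} \<le> ennreal ((CT + C2) * C1 * \<rho> S powr \<sigma> * m z r)"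
      by (simp add: add_mono)
  qed
qed

lemma finite_nu: "emeasure \<nu> X < \<infinity>"
proof -
  obtain C where C: "1 \<le> C" "\<And>S z r. \<lbrakk>1 \<le> S; z \<in> X; N z \<le> 2 * S; 0 < r; S \<le> 2 * r\<rbrakk> \<Longrightarrow>
    emeasure \<nu> {y \<in> X. S \<le> N y} \<le> ennreal (C * \<rho> S powr \<sigma> * m z r)"
    by (rule nu_tail[of 2]) auto
  obtain z where z: "z \<in> X" "N z = 2" using N_attains[of 2] by auto
  have "{y \<in> X. 1 \<le> N y} = X" using N_gt1 by (auto intro: less_imp_le)
  then have "emeasure \<nu> X \<le> ennreal (C * \<rho> 1 powr \<sigma> * m z 1)" using C(2)[of 1 z 1] z by simp
  then show ?thesis by (rule le_less_trans) simp
qed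

lemma nu_mball:
  obtains C where "1 \<le> C" "\<And>x R. \<lbrakk>x \<in> X; 0 < R; R \<le> N x / 2\<rbrakk> \<Longrightarrow>
     emeasure \<nu> (mball x R) \<le> ennreal (C * (\<rho> (N x) powr \<sigma> * m x R)) \<and>
     ennreal (\<rho> (N x) powr \<sigma> * m x R) \<le> ennreal C * emeasure \<nu> (mball x R)"
proof -
  obtain C where C: "1 \<le> C" "\<And>s A. \<lbrakk>1 \<le> s; A \<in> sets \<mu>; \<And>y. y \<in> A \<Longrightarrow> N y \<le> 2 * s \<and> s \<le> 2 * N y\<rbrakk> \<Longrightarrow>
    emeasure \<nu> A \<le> ennreal (C * \<rho> s powr \<sigma>) * emeasure \<mu> A \<and>
    ennreal (\<rho> s powr \<sigma>) * emeasure \<mu> A \<le> ennreal C * emeasure \<nu> A"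
    by (rule nu_compare_sets[of 2]) auto
  show ?thesis
  proof (rule that[OF C(1)])
    fix x R assume x: "x \<in> X" "0 < R" "R \<le> N x / 2"
    have "emeasure \<nu> (mball x R) \<le> ennreal (C * \<rho> (N x) powr \<sigma>) * emeasure \<mu> (mball x R) \<and>
      ennreal (\<rho> (N x) powr \<sigma>) * emeasure \<mu> (mball x R) \<le> ennreal C * emeasure \<nu> (mball x R)"
    proof (rule C(2)[OF _ mball_mu])
      show "1 \<le> N x" using N_gt1[OF x(1)] by simp
      fix y assume "y \<in> mball x R"
      then show "N y \<le> 2 * N x \<and> N x \<le> 2 * N y"
        using N_lip[of x y] N_lip[of y x] x commute[of x y] by auto
    qed
    then show "emeasure \<nu> (mball x R) \<le> ennreal (C * (\<rho> (N x) powr \<sigma> * m x R)) \<and>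
      ennreal (\<rho> (N x) powr \<sigma> * m x R) \<le> ennreal C * emeasure \<nu> (mball x R)"
      using emeasure_mball[OF x(1,2)] C(1) by (simp add: ennreal_mult[symmetric] mult.assoc)
  qed
qed

text \<open>
  A small ball lies between two \<open>d\<close>-balls of comparable radii around the same centre, on which
  the weight is essentially constant.
\<close>

lemma nu_small_sph_ball:
  obtains C where "1 \<le> C" "\<And>x r. \<lbrakk>x \<in> X; 0 < r; 4 * CA\<^sup>2 * r \<le> \<kappa> (N x)\<rbrakk> \<Longrightarrow>
     emeasure \<nu> (sph.mball x r) \<le> ennreal (C * (\<rho> (N x) powr \<sigma> * m x (2 * CA\<^sup>2 * r / \<rho> (N x)))) \<and>
     ennreal (\<rho> (N x) powr \<sigma> * m x (2 * CA\<^sup>2 * r / \<rho> (N x))) \<le> ennreal C * emeasure \<nu> (sph.mball x r)"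
proof -
  obtain C1 where C1: "1 \<le> C1" "\<And>x R. \<lbrakk>x \<in> X; 0 < R; R \<le> N x / 2\<rbrakk> \<Longrightarrow>
     emeasure \<nu> (mball x R) \<le> ennreal (C1 * (\<rho> (N x) powr \<sigma> * m x R)) \<and>
     ennreal (\<rho> (N x) powr \<sigma> * m x R) \<le> ennreal C1 * emeasure \<nu> (mball x R)"
    by (rule nu_mball) blast
  obtain C2 where C2: "1 \<le> C2" "\<And>x R. \<lbrakk>x \<in> X; 0 < R; R \<le> N x / 2\<rbrakk> \<Longrightarrow> mball x R \<subseteq> sph.mball x (C2 * \<rho> (N x) * R)"
    by (rule ball_subset_sph) blast
  have CA2: "1 \<le> CA\<^sup>2" using CA(1) by simp
  have K: "1 \<le> 2 * CA\<^sup>2 * C2" using CA2 C2(1) mult_mono[of 1 "2 * CA\<^sup>2" 1 C2] by simp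
  obtain C3 where C3: "1 \<le> C3" "\<And>x y r s. \<lbrakk>x \<in> X; y \<in> X; 0 < r; 0 < s; d x y + s \<le> (2 * CA\<^sup>2 * C2) * r\<rbrakk> \<Longrightarrow> m y s \<le> C3 * m x r"
    by (rule m_compare[OF K]) blast
  have C31: "1 * 1 \<le> C3 * C1" using C1(1) C3(1) by (intro mult_mono) auto
  show ?thesis
  proof (rule that[of "C3 * C1"])
    show "1 \<le> C3 * C1" using C31 by simp
    fix x r assume x: "x \<in> X" "0 < r" "4 * CA\<^sup>2 * r \<le> \<kappa> (N x)"
    define R where "R = 2 * CA\<^sup>2 * r / \<rho> (N x)"
    define R' where "R' = r / (C2 * \<rho> (N x))"
    have rx: "0 < \<rho> (N x)" using rho_pos N_gt1[OF x(1)] by auto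
    have "0 < 2 * CA\<^sup>2 * r" using CA2 x(2) by (intro mult_pos_pos) auto
    then have R: "0 < R" "R \<le> N x / 2" using x rx by (auto simp: R_def \<kappa>_def divide_le_eq mult_ac)
    have RR: "R = (2 * CA\<^sup>2 * C2) * R'" using C2(1) rx by (simp add: R_def R'_def)
    have R'0: "0 < R'" using x C2(1) rx by (simp add: R'_def)
    have "1 * R' \<le> R" unfolding RR using K R'0 by (intro mult_right_mono) auto
    then have R': "0 < R'" "R' \<le> N x / 2" using R R'0 by auto
    have nn: "0 \<le> \<rho> (N x) powr \<sigma>" by simp
    have rk: "2 * CA\<^sup>2 * r \<le> \<kappa> (N x)"
    proof -
      have "0 < CA\<^sup>2 * r" using CA2 x(2) by (intro mult_pos_pos) auto
      then show ?thesis using x(3) by simp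
    qed
    have "emeasure \<nu> (sph.mball x r) \<le> emeasure \<nu> (mball x R)"
      unfolding R_def by (intro emeasure_mono sph_ball_subset x rk) (simp add: mball_mu)
    also have "\<dots> \<le> ennreal (C1 * (\<rho> (N x) powr \<sigma> * m x R))" using C1(2)[OF x(1) R] by simp
    also have "\<dots> \<le> ennreal (C3 * C1 * (\<rho> (N x) powr \<sigma> * m x R))"
    proof (rule ennreal_leI, rule mult_right_mono)
      show "C1 \<le> C3 * C1" using C1(1) C3(1) mult_right_mono[of 1 C3 C1] by simp
    qed (use emeasure_mball(2)[OF x(1) R(1)] in auto)
    finally have 1: "emeasure \<nu> (sph.mball x r) \<le> ennreal (C3 * C1 * (\<rho> (N x) powr \<sigma> * m x R))" .
    have sub: "mball x R' \<subseteq> sph.mball x r" using C2(2)[OF x(1) R'] rx C2(1) by (simp add: R'_def)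
    have "m x R \<le> C3 * m x R'" using C3(2)[of x x R' R] x R R' RR by simp
    then have "\<rho> (N x) powr \<sigma> * m x R \<le> C3 * (\<rho> (N x) powr \<sigma> * m x R')"
      using mult_left_mono[OF _ nn] by (metis mult.left_commute)
    then have "ennreal (\<rho> (N x) powr \<sigma> * m x R) \<le> ennreal (C3 * (\<rho> (N x) powr \<sigma> * m x R'))" by (rule ennreal_leI)
    also have "\<dots> = ennreal C3 * ennreal (\<rho> (N x) powr \<sigma> * m x R')"
      using C3(1) emeasure_mball(2)[OF x(1) R'(1)] by (intro ennreal_mult) auto
    also have "\<dots> \<le> ennreal C3 * (ennreal C1 * emeasure \<nu> (mball x R'))"
      using C1(2)[OF x(1) R'] by (intro mult_left_mono) auto
    also have "\<dots> \<le> ennreal C3 * (ennreal C1 * emeasure \<nu> (sph.mball x r))"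
      using sub by (intro mult_left_mono emeasure_mono) (auto simp: sph_mball_mu)
    also have "\<dots> = ennreal (C3 * C1) * emeasure \<nu> (sph.mball x r)"
      using C3(1) C1(1) by (simp add: ennreal_mult mult.assoc)
    finally show "emeasure \<nu> (sph.mball x r) \<le> ennreal (C3 * C1 * (\<rho> (N x) powr \<sigma> * m x (2 * CA\<^sup>2 * r / \<rho> (N x)))) \<and>
      ennreal (\<rho> (N x) powr \<sigma> * m x (2 * CA\<^sup>2 * r / \<rho> (N x))) \<le> ennreal (C3 * C1) * emeasure \<nu> (sph.mball x r)"
      using 1 by (simp add: R_def)
  qed
qed

text \<open>
  By the tail estimate, the \<open>d\<close>-ball around the corkscrew point has measure comparable to that of
  the set of all points that are, up to a constant, at least as far out. This set contains the
  doubled ball.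
\<close>

lemma nu_large_sph_ball:
  assumes c0: "0 < c0"
  obtains \<epsilon> C where "0 < \<epsilon>" "\<epsilon> \<le> 1/2" "1 \<le> C"
    "\<And>x r. \<lbrakk>x \<in> X; 0 < r; c0 * \<kappa> (N x) \<le> r\<rbrakk> \<Longrightarrow> \<exists>z\<in>X. mball z (\<epsilon> * N z) \<subseteq> sph.mball x r \<and>
       sph.mball x (2 * r) \<subseteq> {y \<in> X. max 1 (\<epsilon> * N z) \<le> N y} \<and> \<kappa> (N z) \<le> C * r \<and>
       emeasure \<nu> {y \<in> X. max 1 (\<epsilon> * N z) \<le> N y} \<le> ennreal C * emeasure \<nu> (sph.mball x r)"
proof -
  obtain \<epsilon> C1 where e: "0 < \<epsilon>" "\<epsilon> \<le> 1/2" "1 \<le> C1" and ck: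
    "\<And>x r. \<lbrakk>x \<in> X; 0 < r; c0 * \<kappa> (N x) \<le> r\<rbrakk> \<Longrightarrow> \<exists>z\<in>X. mball z (\<epsilon> * N z) \<subseteq> sph.mball x r \<and>
       (\<forall>y\<in>sph.mball x (2 * r). \<epsilon> * N z \<le> N y) \<and> \<kappa> (N z) \<le> C1 * r"
    by (rule large_ball_corkscrew[OF c0]) blast
  have e1: "1 \<le> 1 / \<epsilon>" using e by simp
  obtain C2 where C2: "1 \<le> C2" "\<And>S z r. \<lbrakk>1 \<le> S; z \<in> X; N z \<le> (1 / \<epsilon>) * S; 0 < r; S \<le> (1 / \<epsilon>) * r\<rbrakk> \<Longrightarrow>
    emeasure \<nu> {y \<in> X. S \<le> N y} \<le> ennreal (C2 * \<rho> S powr \<sigma> * m z r)"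
    by (rule nu_tail[OF e1]) blast
  obtain C3 where C3: "1 \<le> C3" "\<And>x R. \<lbrakk>x \<in> X; 0 < R; R \<le> N x / 2\<rbrakk> \<Longrightarrow>
     emeasure \<nu> (mball x R) \<le> ennreal (C3 * (\<rho> (N x) powr \<sigma> * m x R)) \<and>
     ennreal (\<rho> (N x) powr \<sigma> * m x R) \<le> ennreal C3 * emeasure \<nu> (mball x R)"
    by (rule nu_mball) blast
  obtain C4 where C4: "1 \<le> C4" "\<And>s t. \<lbrakk>1 \<le> s; 1 \<le> t; s \<le> (1 / \<epsilon>) * t; t \<le> (1 / \<epsilon>) * s\<rbrakk> \<Longrightarrow> \<rho> s \<le> C4 * \<rho> t"
    by (rule rho_comp[OF e1]) blast
  define C where "C = max C1 (C2 * C4 powr \<sigma> * C3)"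
  show ?thesis
  proof (rule that[OF e(1,2), of C])
    show "1 \<le> C" using e(3) by (simp add: C_def)
    fix x r assume x: "x \<in> X" "0 < r" "c0 * \<kappa> (N x) \<le> r"
    obtain z where z: "z \<in> X" "mball z (\<epsilon> * N z) \<subseteq> sph.mball x r"
      "\<And>y. y \<in> sph.mball x (2 * r) \<Longrightarrow> \<epsilon> * N z \<le> N y" "\<kappa> (N z) \<le> C1 * r" using ck[OF x] by blast
    have Nz: "1 < N z" by (rule N_gt1[OF z(1)])
    define S where "S = max 1 (\<epsilon> * N z)"
    have eN: "0 < \<epsilon> * N z" "\<epsilon> * N z \<le> N z / 2"
      using e(1) Nz mult_right_mono[OF e(2), of "N z"] by auto
    have S: "1 \<le> S" "S \<le> N z" "\<epsilon> * N z \<le> S" using eN Nz by (auto simp: S_def)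
    have S2: "N z \<le> (1 / \<epsilon>) * S" using S(3) e(1) by (simp add: le_divide_eq mult.commute)
    have S3: "S \<le> (1 / \<epsilon>) * (\<epsilon> * N z)" using S(2) e(1) by simp
    have "1 * S \<le> (1 / \<epsilon>) * S" "1 * N z \<le> (1 / \<epsilon>) * N z" using e1 S Nz by (intro mult_right_mono; simp)+
    then have rS: "\<rho> S \<le> C4 * \<rho> (N z)" using S S2 Nz by (intro C4(2)) auto
    have rp: "0 < \<rho> S" "0 < \<rho> (N z)" using rho_pos S Nz by auto
    have "\<rho> S powr \<sigma> \<le> (C4 * \<rho> (N z)) powr \<sigma>" using rS rp sigma by (intro powr_mono2) auto
    also have "\<dots> = C4 powr \<sigma> * \<rho> (N z) powr \<sigma>" using C4(1) rp by (simp add: powr_mult)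
    finally have pS: "\<rho> S powr \<sigma> \<le> C4 powr \<sigma> * \<rho> (N z) powr \<sigma>" .
    have mp: "0 < m z (\<epsilon> * N z)" using emeasure_mball(2)[OF z(1) eN(1)] .
    have "emeasure \<nu> {y \<in> X. S \<le> N y} \<le> ennreal (C2 * \<rho> S powr \<sigma> * m z (\<epsilon> * N z))"
      by (rule C2(2)[OF S(1) z(1) S2 eN(1) S3])
    also have "\<dots> \<le> ennreal (C2 * C4 powr \<sigma> * (\<rho> (N z) powr \<sigma> * m z (\<epsilon> * N z)))"
    proof (rule ennreal_leI)
      have "C2 * \<rho> S powr \<sigma> * m z (\<epsilon> * N z) \<le> C2 * (C4 powr \<sigma> * \<rho> (N z) powr \<sigma>) * m z (\<epsilon> * N z)"
        using pS mp C2(1) by (intro mult_right_mono mult_left_mono) auto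
      then show "C2 * \<rho> S powr \<sigma> * m z (\<epsilon> * N z) \<le> C2 * C4 powr \<sigma> * (\<rho> (N z) powr \<sigma> * m z (\<epsilon> * N z))"
        by (simp add: mult.assoc)
    qed
    also have "\<dots> = ennreal (C2 * C4 powr \<sigma>) * ennreal (\<rho> (N z) powr \<sigma> * m z (\<epsilon> * N z))"
      using C2(1) mp by (intro ennreal_mult) auto
    also have "\<dots> \<le> ennreal (C2 * C4 powr \<sigma>) * (ennreal C3 * emeasure \<nu> (mball z (\<epsilon> * N z)))"
      using C3(2)[OF z(1) eN] by (intro mult_left_mono) auto
    also have "\<dots> = ennreal (C2 * C4 powr \<sigma> * C3) * emeasure \<nu> (mball z (\<epsilon> * N z))"
      using C2(1) C3(1) by (simp add: ennreal_mult mult.assoc)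
    also have "\<dots> \<le> ennreal C * emeasure \<nu> (sph.mball x r)"
      using z(2) by (intro mult_mono ennreal_leI emeasure_mono) (auto simp: C_def sph_mball_mu)
    finally have 1: "emeasure \<nu> {y \<in> X. S \<le> N y} \<le> ennreal C * emeasure \<nu> (sph.mball x r)" .
    have 2: "sph.mball x (2 * r) \<subseteq> {y \<in> X. S \<le> N y}"
    proof
      fix y assume y: "y \<in> sph.mball x (2 * r)"
      then have yX: "y \<in> X" by auto
      show "y \<in> {y \<in> X. S \<le> N y}" using z(3)[OF y] N_gt1[OF yX] yX by (simp add: S_def)
    qed
    have "C1 * r \<le> C * r" using x(2) by (intro mult_right_mono) (auto simp: C_def)
    then have "\<kappa> (N z) \<le> C * r" using z(4) by simp
    then show "\<exists>z\<in>X. mball z (\<epsilon> * N z) \<subseteq> sph.mball x r \<and>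
       sph.mball x (2 * r) \<subseteq> {y \<in> X. max 1 (\<epsilon> * N z) \<le> N y} \<and> \<kappa> (N z) \<le> C * r \<and>
       emeasure \<nu> {y \<in> X. max 1 (\<epsilon> * N z) \<le> N y} \<le> ennreal C * emeasure \<nu> (sph.mball x r)"
      using z(1,2) 1 2 unfolding S_def by blast
  qed
qed

lemma nu_finite_sets: "emeasure \<nu> A < \<infinity>"
proof (cases "A \<in> sets \<mu>")
  case True
  then have "emeasure \<nu> A \<le> emeasure \<nu> X"
    using sets.sets_into_space[OF True] X_mu by (intro emeasure_mono) (auto simp: space_mu)
  then show ?thesis using finite_nu by (rule le_less_trans)
qed (simp add: emeasure_notin_sets)

lemma nu_sph_ball_pos:
  assumes "x \<in> X" "0 < r" shows "0 < emeasure \<nu> (sph.mball x r)"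
proof -
  obtain C where C: "1 \<le> C" "\<And>x r. \<lbrakk>x \<in> X; 0 < r; 4 * CA\<^sup>2 * r \<le> \<kappa> (N x)\<rbrakk> \<Longrightarrow>
     emeasure \<nu> (sph.mball x r) \<le> ennreal (C * (\<rho> (N x) powr \<sigma> * m x (2 * CA\<^sup>2 * r / \<rho> (N x)))) \<and>
     ennreal (\<rho> (N x) powr \<sigma> * m x (2 * CA\<^sup>2 * r / \<rho> (N x))) \<le> ennreal C * emeasure \<nu> (sph.mball x r)"
    by (rule nu_small_sph_ball) blast
  define q where "q = min r (\<kappa> (N x) / (4 * CA\<^sup>2))"
  have CA2: "1 \<le> CA\<^sup>2" using CA(1) by simp
  have kx: "0 < \<kappa> (N x)" using kappa_pos N_gt1[OF assms(1)] by auto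
  have c4: "0 < 4 * CA\<^sup>2" using CA2 by linarith
  have q: "0 < q" "q \<le> r" using assms kx c4 by (auto simp: q_def)
  have "q \<le> \<kappa> (N x) / (4 * CA\<^sup>2)" unfolding q_def by (rule min.cobounded2)
  then have q3: "4 * CA\<^sup>2 * q \<le> \<kappa> (N x)" using c4 by (simp add: le_divide_eq mult.commute)
  have rx: "0 < \<rho> (N x)" using rho_pos N_gt1[OF assms(1)] by auto
  have R: "0 < 2 * CA\<^sup>2 * q / \<rho> (N x)" using rx q c4 by simp
  have "0 < ennreal (\<rho> (N x) powr \<sigma> * m x (2 * CA\<^sup>2 * q / \<rho> (N x)))"
    using rx emeasure_mball(2)[OF assms(1) R] by simp
  also have "\<dots> \<le> ennreal C * emeasure \<nu> (sph.mball x q)" using C(2)[OF assms(1) q(1) q3] by simp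
  finally have "0 < emeasure \<nu> (sph.mball x q)" by (auto simp: zero_less_iff_neq_zero)
  also have "\<dots> \<le> emeasure \<nu> (sph.mball x r)"
    using q by (intro emeasure_mono sph.mball_subset_concentric) (auto simp: sph_mball_mu)
  finally show ?thesis .
qed

text \<open>
  A small ball is comparable to a \<open>d\<close>-ball on which the weight is essentially constant. A large
  ball has at least a fixed portion of the measure of a set that contains the doubled ball.
\<close>

lemma nu_doubling_const:
  obtains C where "1 < C" "\<And>x r. \<lbrakk>x \<in> X; 0 < (r::real)\<rbrakk> \<Longrightarrow>
    emeasure \<nu> (sph.mball x (2 * r)) \<le> ennreal C * emeasure \<nu> (sph.mball x r)"
proof -
  obtain C1 where C1: "1 \<le> C1" "\<And>x r. \<lbrakk>x \<in> X; 0 < r; 4 * CA\<^sup>2 * r \<le> \<kappa> (N x)\<rbrakk> \<Longrightarrow>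
     emeasure \<nu> (sph.mball x r) \<le> ennreal (C1 * (\<rho> (N x) powr \<sigma> * m x (2 * CA\<^sup>2 * r / \<rho> (N x)))) \<and>
     ennreal (\<rho> (N x) powr \<sigma> * m x (2 * CA\<^sup>2 * r / \<rho> (N x))) \<le> ennreal C1 * emeasure \<nu> (sph.mball x r)"
    by (rule nu_small_sph_ball) blast
  have CA2: "1 \<le> CA\<^sup>2" using CA(1) by simp
  have c8: "0 < 1 / (8 * CA\<^sup>2)" using CA(1) by simp
  obtain \<epsilon> C2 where C2: "1 \<le> C2" and lb:
    "\<And>x r. \<lbrakk>x \<in> X; 0 < r; 1 / (8 * CA\<^sup>2) * \<kappa> (N x) \<le> r\<rbrakk> \<Longrightarrow> \<exists>z\<in>X. mball z (\<epsilon> * N z) \<subseteq> sph.mball x r \<and>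
       sph.mball x (2 * r) \<subseteq> {y \<in> X. max 1 (\<epsilon> * N z) \<le> N y} \<and> \<kappa> (N z) \<le> C2 * r \<and>
       emeasure \<nu> {y \<in> X. max 1 (\<epsilon> * N z) \<le> N y} \<le> ennreal C2 * emeasure \<nu> (sph.mball x r)"
    by (rule nu_large_sph_ball[OF c8]) blast
  define C where "C = max 2 (max (C1 * CD * C1) C2)"
  show ?thesis
  proof (rule that[of C])
    show "1 < C" by (simp add: C_def)
    fix x and r :: real assume x: "x \<in> X" "0 < r"
    have rx: "0 < \<rho> (N x)" using rho_pos N_gt1[OF x(1)] by auto
    show "emeasure \<nu> (sph.mball x (2 * r)) \<le> ennreal C * emeasure \<nu> (sph.mball x r)"
    proof (cases "4 * CA\<^sup>2 * (2 * r) \<le> \<kappa> (N x)")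
      case True
      have c: "0 < CA\<^sup>2 * r" using CA2 x by (intro mult_pos_pos) auto
      have T2: "4 * CA\<^sup>2 * r \<le> \<kappa> (N x)" using True c by simp
      define R where "R = 2 * CA\<^sup>2 * r / \<rho> (N x)"
      have R: "0 < R" unfolding R_def by (intro divide_pos_pos rx) (use c in linarith)
      have R2: "2 * CA\<^sup>2 * (2 * r) / \<rho> (N x) = 2 * R" by (simp add: R_def)
      have r2: "0 < 2 * r" using x by simp
      have "emeasure \<nu> (sph.mball x (2 * r)) \<le> ennreal (C1 * (\<rho> (N x) powr \<sigma> * m x (2 * R)))"
        using C1(2)[OF x(1) r2 True] unfolding R2 by blast
      also have "\<dots> \<le> ennreal (C1 * CD * (\<rho> (N x) powr \<sigma> * m x R))"
      proof (rule ennreal_leI)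
        have "C1 * (\<rho> (N x) powr \<sigma> * m x (2 * R)) \<le> C1 * (\<rho> (N x) powr \<sigma> * (CD * m x R))"
          using C1(1) m_double[OF x(1) R] by (intro mult_left_mono) auto
        then show "C1 * (\<rho> (N x) powr \<sigma> * m x (2 * R)) \<le> C1 * CD * (\<rho> (N x) powr \<sigma> * m x R)" by (simp add: mult_ac)
      qed
      also have "\<dots> = ennreal (C1 * CD) * ennreal (\<rho> (N x) powr \<sigma> * m x R)"
        using C1(1) CD emeasure_mball(2)[OF x(1) R] by (intro ennreal_mult) auto
      also have "\<dots> \<le> ennreal (C1 * CD) * (ennreal C1 * emeasure \<nu> (sph.mball x r))"
        using C1(2)[OF x T2] unfolding R_def by (intro mult_left_mono) auto
      also have "\<dots> = ennreal (C1 * CD * C1) * emeasure \<nu> (sph.mball x r)"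
        using C1(1) CD by (simp add: ennreal_mult mult.assoc)
      also have "\<dots> \<le> ennreal C * emeasure \<nu> (sph.mball x r)"
        by (intro mult_right_mono ennreal_leI) (auto simp: C_def)
      finally show ?thesis .
    next
      case False
      then have "1 / (8 * CA\<^sup>2) * \<kappa> (N x) \<le> r" using CA(1) by (auto simp: divide_le_eq mult_ac)
      from lb[OF x this] obtain z where z: "sph.mball x (2 * r) \<subseteq> {y \<in> X. max 1 (\<epsilon> * N z) \<le> N y}"
        "emeasure \<nu> {y \<in> X. max 1 (\<epsilon> * N z) \<le> N y} \<le> ennreal C2 * emeasure \<nu> (sph.mball x r)" by blast
      have "emeasure \<nu> (sph.mball x (2 * r)) \<le> emeasure \<nu> {y \<in> X. max 1 (\<epsilon> * N z) \<le> N y}"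
        by (rule emeasure_mono[OF z(1)]) (simp only: sets_nu N_sets(1))
      also note z(2)
      also have "ennreal C2 * emeasure \<nu> (sph.mball x r) \<le> ennreal C * emeasure \<nu> (sph.mball x r)"
        by (intro mult_right_mono ennreal_leI) (auto simp: C_def)
      finally show ?thesis .
    qed
  qed
qed

lemma nu_doubling: "doubling X wdist \<nu>"
proof -
  obtain C where C: "1 < C" "\<And>x r. \<lbrakk>x \<in> X; 0 < (r::real)\<rbrakk> \<Longrightarrow>
    emeasure \<nu> (sph.mball x (2 * r)) \<le> ennreal C * emeasure \<nu> (sph.mball x r)"
    by (rule nu_doubling_const) blast
  have "0 < emeasure \<nu> (sph.mball x (2 * r)) \<and>
     emeasure \<nu> (sph.mball x (2 * r)) \<le> ennreal C * emeasure \<nu> (sph.mball x r) \<and>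
     ennreal C * emeasure \<nu> (sph.mball x r) < \<infinity>" if "x \<in> X" "0 < r" for x r
    using C(2)[OF that] nu_sph_ball_pos[of x "2 * r"] nu_finite_sets[of "sph.mball x r"] that
    by (auto simp: ennreal_mult_less_top)
  then show ?thesis unfolding doubling_def using C(1) by blast
qed

end

section \<open>Mean oscillation\<close>

lemma ennreal_divide_mult_cancel:
  fixes x b :: ennreal
  assumes "b \<noteq> 0" "b \<noteq> top" shows "x / b * b = x"
proof -
  have "x / b * b = (x * b) / b" unfolding mult.commute[of "x / b"] ennreal_times_divide mult.commute[of b] ..
  then show ?thesis using mult_divide_eq_ennreal[OF assms] by simp
qed

lemma ennreal_divide_leI:
  fixes x b c :: ennreal
  assumes "x \<le> c * b" "b \<noteq> 0" "b \<noteq> top" shows "x / b \<le> c"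
  using divide_right_mono_ennreal[OF assms(1), of b] mult_divide_eq_ennreal[OF assms(2,3)] by simp

lemma enn_powr_mono: "x \<le> y \<Longrightarrow> 0 < a \<Longrightarrow> enn_powr x a \<le> enn_powr y a"
  unfolding enn_powr_def
  by (auto simp: top_unique less_top[symmetric] intro!: ennreal_leI powr_mono2 enn2real_mono)

lemma enn_powr_ennreal: "0 \<le> x \<Longrightarrow> enn_powr (ennreal x) a = ennreal (x powr a)"
  by (simp add: enn_powr_def)

lemma enn_powr_cmult:
  assumes "0 < c" "0 < a" shows "enn_powr (ennreal c * x) a = ennreal (c powr a) * enn_powr x a"
proof (cases x)
  case (real r)
  then show ?thesis using assms by (simp add: ennreal_mult[symmetric] enn_powr_ennreal powr_mult)
next
  case top
  then show ?thesis using assms by (simp add: enn_powr_def ennreal_mult_top)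
qed

lemma enn_powr_measurable[measurable]:
  "f \<in> borel_measurable M \<Longrightarrow> (\<lambda>x. enn_powr (f x) a) \<in> borel_measurable M"
proof -
  assume f[measurable]: "f \<in> borel_measurable M"
  have "{x \<in> space M. f x = \<infinity>} = f -` {\<infinity>} \<inter> space M" by auto
  also have "\<dots> \<in> sets M" by (rule measurable_sets[OF f]) simp
  finally show ?thesis unfolding enn_powr_def by (intro measurable_If) auto
qed

text \<open>
  The integrand of the mean oscillation, with an arbitrary constant in place of the mean value.
\<close>

definition dev :: "('a \<Rightarrow> ereal) \<Rightarrow> real \<Rightarrow> 'a \<Rightarrow> ennreal" where
  "dev u c x = e2ennreal \<bar>u x - ereal c\<bar>"

lemma dev_triangle: "dev u c x \<le> dev u c' x + ennreal \<bar>c - c'\<bar>"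
proof (cases "u x")
  case (real r)
  have "ennreal \<bar>r - c\<bar> \<le> ennreal (\<bar>r - c'\<bar> + \<bar>c - c'\<bar>)" by (rule ennreal_leI) simp
  then show ?thesis using real by (simp add: dev_def)
qed (simp_all add: dev_def)

lemma dev_const_le: "ennreal \<bar>c - c'\<bar> \<le> dev u c x + dev u c' x"
proof (cases "u x")
  case (real r)
  have "ennreal \<bar>c - c'\<bar> \<le> ennreal (\<bar>r - c\<bar> + \<bar>r - c'\<bar>)" by (rule ennreal_leI) simp
  then show ?thesis using real by (simp add: dev_def)
qed (simp_all add: dev_def)

lemma dev_measurable:
  assumes "u \<in> borel_measurable (restrict_space M A)" "B \<subseteq> A" "B \<in> sets M"
  shows "(\<lambda>x. dev u c x * indicator B x) \<in> borel_measurable M"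
proof -
  have [measurable]: "u \<in> borel_measurable (restrict_space M B)"
    using measurable_restrict_mono[OF assms(1,2)] .
  have "dev u c \<in> borel_measurable (restrict_space M B)"
    unfolding dev_def[abs_def] by measurable
  then show ?thesis using assms(3) sets.sets_into_space[OF assms(3)]
    by (subst (asm) borel_measurable_restrict_space_iff_ennreal) (auto simp: Int_absorb2)
qed

text \<open>
  On the common part, the difference of the two constants is at most the sum of the two
  deviations.
\<close>

lemma const_diff_le:
  assumes A: "u \<in> borel_measurable (restrict_space M A)" and sets: "B \<in> sets M" "B1 \<in> sets M" "B2 \<in> sets M"
    and sub: "B \<subseteq> B1" "B \<subseteq> B2" "B1 \<subseteq> A" "B2 \<subseteq> A"
  shows "ennreal \<bar>c1 - c2\<bar> * emeasure M B \<le> (\<integral>\<^sup>+x\<in>B1. dev u c1 x \<partial>M) + (\<integral>\<^sup>+x\<in>B2. dev u c2 x \<partial>M)"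
proof -
  have [measurable]: "(\<lambda>x. dev u c1 x * indicator B1 x) \<in> borel_measurable M" "(\<lambda>x. dev u c2 x * indicator B2 x) \<in> borel_measurable M"
    using dev_measurable[OF A] sets sub by auto
  have "ennreal \<bar>c1 - c2\<bar> * emeasure M B = (\<integral>\<^sup>+x. ennreal \<bar>c1 - c2\<bar> * indicator B x \<partial>M)"
    using sets by (simp add: nn_integral_cmult)
  also have "\<dots> \<le> (\<integral>\<^sup>+x. dev u c1 x * indicator B1 x + dev u c2 x * indicator B2 x \<partial>M)"
    using sub dev_const_le[of c1 c2 u] by (intro nn_integral_mono) (auto simp: indicator_def)
  also have "\<dots> = (\<integral>\<^sup>+x\<in>B1. dev u c1 x \<partial>M) + (\<integral>\<^sup>+x\<in>B2. dev u c2 x \<partial>M)"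
    by (rule nn_integral_add) auto
  finally show ?thesis .
qed

lemma dev_shift:
  assumes A: "u \<in> borel_measurable (restrict_space M A)" and B: "B \<in> sets M" "B \<subseteq> A"
  shows "(\<integral>\<^sup>+x\<in>B. dev u c x \<partial>M) \<le> (\<integral>\<^sup>+x\<in>B. dev u c' x \<partial>M) + ennreal \<bar>c - c'\<bar> * emeasure M B"
proof -
  have [measurable]: "(\<lambda>x. dev u c' x * indicator B x) \<in> borel_measurable M"
    using dev_measurable[OF A B(2,1)] .
  have "(\<integral>\<^sup>+x\<in>B. dev u c x \<partial>M) \<le> (\<integral>\<^sup>+x. dev u c' x * indicator B x + ennreal \<bar>c - c'\<bar> * indicator B x \<partial>M)"
    using dev_triangle[of u c] by (intro nn_integral_mono) (auto simp: indicator_def)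
  also have "\<dots> = (\<integral>\<^sup>+x\<in>B. dev u c' x \<partial>M) + (\<integral>\<^sup>+x. ennreal \<bar>c - c'\<bar> * indicator B x \<partial>M)"
    by (rule nn_integral_add) (use B in auto)
  also have "(\<integral>\<^sup>+x. ennreal \<bar>c - c'\<bar> * indicator B x \<partial>M) = ennreal \<bar>c - c'\<bar> * emeasure M B"
    using B by (simp add: nn_integral_cmult)
  finally show ?thesis .
qed

text \<open>
  The mean value differs from \<open>c\<close> by at most the mean of the deviation from \<open>c\<close>.
\<close>

lemma dev_mean_le:
  assumes L1: "L1_on M A u" and B: "B \<in> sets M" "B \<subseteq> A" and fin: "0 < emeasure M B" "emeasure M B < \<infinity>"
  shows "(\<integral>\<^sup>+x\<in>B. dev u (mean_value M B u) x \<partial>M) \<le> 2 * (\<integral>\<^sup>+x\<in>B. dev u c x \<partial>M)"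
proof -
  have u: "u \<in> borel_measurable (restrict_space M A)" and uf: "(\<integral>\<^sup>+x\<in>A. e2ennreal \<bar>u x\<bar> \<partial>M) < \<infinity>"
    using L1 by (auto simp: L1_on_def)
  define v where "v x = real_of_ereal (u x)" for x
  have uB: "u \<in> borel_measurable (restrict_space M B)" using measurable_restrict_mono[OF u B(2)] .
  then have "v \<in> borel_measurable (restrict_space M B)" unfolding v_def[abs_def] by measurable
  then have vB: "(\<lambda>x. indicator B x *\<^sub>R v x) \<in> borel_measurable M"
    using B sets.sets_into_space[OF B(1)] by (subst (asm) borel_measurable_restrict_space_iff) (auto simp: Int_absorb2)
  have mB2: "emeasure M B = ennreal (measure M B)"
    by (rule emeasure_eq_ennreal_measure) (use fin in simp)
  have mB1: "0 < measure M B" using fin(1) unfolding mB2 by simp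
  note mB = mB1 mB2
  have uBf: "(\<integral>\<^sup>+x\<in>B. e2ennreal \<bar>u x\<bar> \<partial>M) < \<infinity>"
    by (rule le_less_trans[OF _ uf], intro nn_integral_mono) (use B in \<open>auto simp: indicator_def\<close>)
  have vle: "ennreal \<bar>v x - c\<bar> \<le> dev u c x" if "\<bar>u x\<bar> \<noteq> \<infinity>" for x c
    using that by (cases "u x") (auto simp: v_def dev_def)
  have vle2: "ennreal \<bar>v x\<bar> \<le> e2ennreal \<bar>u x\<bar>" for x
    by (cases "u x") (auto simp: v_def)
  have [measurable]: "(\<lambda>x. e2ennreal \<bar>u x\<bar> * indicator B x) \<in> borel_measurable M"
    using dev_measurable[OF u B(2,1), of 0] by (simp add: dev_def zero_ereal_def[symmetric])
  have "AE x in M. e2ennreal \<bar>u x\<bar> * indicator B x \<noteq> \<infinity>"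
    by (rule nn_integral_PInf_AE) (use uBf in auto)
  then have ae: "AE x in M. x \<in> B \<longrightarrow> \<bar>u x\<bar> \<noteq> \<infinity>"
  proof (rule eventually_mono)
    fix x assume "e2ennreal \<bar>u x\<bar> * indicator B x \<noteq> \<infinity>"
    then show "x \<in> B \<longrightarrow> \<bar>u x\<bar> \<noteq> \<infinity>" by (auto simp: indicator_def)
  qed
  have vi: "set_integrable M B v"
    unfolding set_integrable_def
  proof (rule integrableI_bounded[OF vB])
    have "(\<integral>\<^sup>+x. ennreal (norm (indicator B x *\<^sub>R v x)) \<partial>M) \<le> (\<integral>\<^sup>+x\<in>B. e2ennreal \<bar>u x\<bar> \<partial>M)"
      using vle2 by (intro nn_integral_mono) (auto simp: indicator_def)
    then show "(\<integral>\<^sup>+x. ennreal (norm (indicator B x *\<^sub>R v x)) \<partial>M) < \<infinity>" using uBf by (rule le_less_trans)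
  qed
  have ci: "set_integrable M B (\<lambda>_. c)" unfolding set_integrable_def using B fin by simp
  define a where "a = mean_value M B u"
  have "a * measure M B = (LINT x:B|M. v x)" using mB by (simp add: a_def mean_value_def v_def)
  moreover have "(LINT x:B|M. c) = c * measure M B"
    using B fin by (simp add: set_lebesgue_integral_def mult.commute)
  ultimately have "(a - c) * measure M B = (LINT x:B|M. v x - c)"
    using set_integral_diff(2)[OF vi ci] by (simp add: left_diff_distrib)
  then have "\<bar>a - c\<bar> * measure M B \<le> (LINT x:B|M. \<bar>v x - c\<bar>)"
    using set_integral_norm_bound[OF set_integral_diff(1)[OF vi ci]] mB by (simp add: abs_mult)
  then have "ennreal (\<bar>a - c\<bar> * measure M B) \<le> ennreal (LINT x:B|M. \<bar>v x - c\<bar>)" by (rule ennreal_leI)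
  also have "\<dots> = (\<integral>\<^sup>+x. ennreal (indicator B x *\<^sub>R \<bar>v x - c\<bar>) \<partial>M)"
    unfolding set_lebesgue_integral_def
    using set_integrable_abs[OF set_integral_diff(1)[OF vi ci]]
    by (intro nn_integral_eq_integral[symmetric]) (auto simp: set_integrable_def)
  also have "\<dots> \<le> (\<integral>\<^sup>+x\<in>B. dev u c x \<partial>M)"
    using ae by (intro nn_integral_mono_AE) (auto elim!: eventually_mono simp: indicator_def intro!: vle)
  finally have le: "ennreal \<bar>a - c\<bar> * emeasure M B \<le> (\<integral>\<^sup>+x\<in>B. dev u c x \<partial>M)"
    using mB by (simp add: ennreal_mult)
  have "(\<integral>\<^sup>+x\<in>B. dev u a x \<partial>M) \<le> (\<integral>\<^sup>+x\<in>B. dev u c x \<partial>M) + ennreal \<bar>a - c\<bar> * emeasure M B"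
    by (rule dev_shift[OF u B])
  also have "\<dots> \<le> (\<integral>\<^sup>+x\<in>B. dev u c x \<partial>M) + (\<integral>\<^sup>+x\<in>B. dev u c x \<partial>M)" by (intro add_left_mono le)
  finally show ?thesis by (simp add: a_def mult_2)
qed

text \<open>
  The upper bounds \<open>T\<close> for the mean of \<open>g powr p\<close> are finite and positive, which avoids a special
  treatment of integrals that vanish or are infinite: in the latter case the claim is trivial,
  otherwise \<open>T\<close> is chosen arbitrarily close to the root of the mean.
\<close>

lemma poincare_from_constants:
  assumes L1: "L1_on M A u" and B: "B \<in> sets M" "B \<subseteq> A" and fin: "0 < emeasure M B" "emeasure M B < \<infinity>"
    and A: "0 < emeasure M A" "emeasure M A < \<infinity>" and Cr: "0 < C" and p: "1 \<le> p"
    and const: "\<And>T. \<lbrakk>0 < T; (\<integral>\<^sup>+x\<in>A. enn_powr (g x) p \<partial>M) \<le> ennreal (T powr p) * emeasure M A\<rbrakk> \<Longrightarrow>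
      \<exists>c. (\<integral>\<^sup>+x\<in>B. dev u c x \<partial>M) \<le> ennreal (C * T) * emeasure M B"
  shows "(\<integral>\<^sup>+x\<in>B. e2ennreal \<bar>u x - ereal (mean_value M B u)\<bar> \<partial>M) / emeasure M B
     \<le> ennreal (2 * C) * enn_powr ((\<integral>\<^sup>+x\<in>A. enn_powr (g x) p \<partial>M) / emeasure M A) (1 / p)"
proof -
  define I where "I = (\<integral>\<^sup>+x\<in>A. enn_powr (g x) p \<partial>M)"
  define L where "L = (\<integral>\<^sup>+x\<in>B. dev u (mean_value M B u) x \<partial>M) / emeasure M B"
  have "L \<le> ennreal (2 * C) * enn_powr (I / emeasure M A) (1 / p)"
  proof (cases "I / emeasure M A")
    case top
    then show ?thesis using Cr by (simp add: enn_powr_def ennreal_mult_top)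
  next
    case (real \<alpha>)
    have IA: "I = ennreal \<alpha> * emeasure M A"
    proof -
      have "emeasure M A \<noteq> 0" "emeasure M A \<noteq> top" using A by auto
      then have "I / emeasure M A * emeasure M A = I"
        by (rule ennreal_divide_mult_cancel)
      then show ?thesis using real by simp
    qed
    have eps: "L \<le> ennreal (2 * C * \<alpha> powr (1/p)) + ennreal e" if e: "0 < e" for e
    proof -
      define T where "T = \<alpha> powr (1/p) + e / (2 * C)"
      have T: "0 < T" "\<alpha> powr (1/p) \<le> T" using e Cr by (auto simp: T_def intro!: add_nonneg_pos)
      have "\<alpha> = (\<alpha> powr (1/p)) powr p" using real p by (simp add: powr_powr)
      also have "\<dots> \<le> T powr p" using T p by (intro powr_mono2) auto
      finally have "I \<le> ennreal (T powr p) * emeasure M A" unfolding IA by (intro mult_right_mono ennreal_leI) auto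
      then obtain c where c: "(\<integral>\<^sup>+x\<in>B. dev u c x \<partial>M) \<le> ennreal (C * T) * emeasure M B"
        using const[OF T(1)] unfolding I_def by blast
      have "(\<integral>\<^sup>+x\<in>B. dev u (mean_value M B u) x \<partial>M) \<le> 2 * (\<integral>\<^sup>+x\<in>B. dev u c x \<partial>M)"
        by (rule dev_mean_le[OF L1 B fin])
      also have "\<dots> \<le> 2 * (ennreal (C * T) * emeasure M B)" by (intro mult_left_mono c) auto
      also have "\<dots> = ennreal (2 * C * T) * emeasure M B"
        using Cr T by (simp add: ennreal_mult mult.assoc)
      finally have "L \<le> ennreal (2 * C * T)"
        unfolding L_def by (rule ennreal_divide_leI) (use fin in auto)
      also have "2 * C * T = 2 * C * \<alpha> powr (1/p) + e" using Cr by (simp add: T_def field_simps)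
      also have "ennreal \<dots> = ennreal (2 * C * \<alpha> powr (1/p)) + ennreal e"
        using e Cr by (intro ennreal_plus) auto
      finally show ?thesis .
    qed
    have "L \<le> ennreal (2 * C * \<alpha> powr (1/p))"
    proof (rule ennreal_le_epsilon)
      fix e :: real assume "0 < e"
      then show "L \<le> ennreal (2 * C * \<alpha> powr (1/p)) + ennreal e" by (rule eps)
    qed
    also have "\<dots> = ennreal (2 * C) * enn_powr (I / emeasure M A) (1 / p)"
      unfolding real using real(1) Cr by (simp add: enn_powr_ennreal ennreal_mult)
    finally show ?thesis .
  qed
  then show ?thesis by (simp add: L_def I_def dev_def)
qed

section \<open>Transfer of upper gradients and of the local Poincare inequality\<close>

lemma (in Metric_space) id_measurable_metric_borel:
  assumes "A \<subseteq> G" "G \<subseteq> M"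
  shows "(\<lambda>x. x) \<in> measurable (metric_borel A d) (metric_borel G d)"
proof -
  interpret A: Submetric M d A using assms by unfold_locales auto
  interpret G: Submetric M d G using assms by unfold_locales auto
  have subA: "{U. openin A.sub.mtopology U} \<subseteq> Pow A" using openin_subset by fastforce
  have subG: "{U. openin G.sub.mtopology U} \<subseteq> Pow G" using openin_subset by fastforce
  have spA: "space (metric_borel A d) = A" unfolding metric_borel_def by (rule space_measure_of[OF subA])
  show ?thesis
    unfolding metric_borel_def[of G]
  proof (rule measurable_measure_of[OF subG])
    show "(\<lambda>x. x) \<in> space (metric_borel A d) \<rightarrow> G" using assms by (auto simp: spA)
    fix U assume "U \<in> {U. openin G.sub.mtopology U}"
    then obtain V where V: "openin mtopology V" "U = V \<inter> G"
      by (auto simp: G.mtopology_submetric openin_subtopology)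
    have "(\<lambda>x. x) -` U \<inter> space (metric_borel A d) = V \<inter> A" using V assms by (auto simp: spA)
    moreover have "openin A.sub.mtopology (V \<inter> A)" using V by (auto simp: A.mtopology_submetric openin_subtopology)
    ultimately show "(\<lambda>x. x) -` U \<inter> space (metric_borel A d) \<in> sets (metric_borel A d)"
      unfolding metric_borel_def by (subst sets_measure_of[OF subA]) auto
  qed
qed

text \<open>
  Open subsets of an open set are open in the whole space, so Borel functions on it extend by
  \<open>0\<close>.
\<close>

lemma (in Metric_space) metric_borel_indicator:
  fixes f :: "'a \<Rightarrow> ennreal"
  assumes f: "f \<in> borel_measurable (metric_borel A d)" and A: "openin mtopology A"
  shows "(\<lambda>x. f x * indicator A x) \<in> borel_measurable (metric_borel M d)"
proof -
  have AM: "A \<subseteq> M" using openin_subset[OF A] by simp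
  interpret A: Submetric M d A using AM by unfold_locales auto
  have subA: "{U. openin A.sub.mtopology U} \<subseteq> Pow A" using openin_subset by fastforce
  have subM: "{U. openin mtopology U} \<subseteq> Pow M" using openin_subset by fastforce
  have spM: "space (metric_borel M d) = M" unfolding metric_borel_def by (rule space_measure_of[OF subM])
  have basic: "U \<in> sets (metric_borel M d)" if "openin mtopology U" for U
    unfolding metric_borel_def using that by (subst sets_measure_of[OF subM]) auto
  have "(\<lambda>x. x) \<in> measurable (restrict_space (metric_borel M d) A) (metric_borel A d)"
    unfolding metric_borel_def[of A]
  proof (rule measurable_measure_of[OF subA])
    show "(\<lambda>x. x) \<in> space (restrict_space (metric_borel M d) A) \<rightarrow> A" by (auto simp: space_restrict_space)
    fix U assume "U \<in> {U. openin A.sub.mtopology U}"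
    then obtain V where V: "openin mtopology V" "U = V \<inter> A"
      by (auto simp: A.mtopology_submetric openin_subtopology)
    have "(\<lambda>x. x) -` U \<inter> space (restrict_space (metric_borel M d) A) = A \<inter> V"
      using V AM by (auto simp: space_restrict_space spM)
    then show "(\<lambda>x. x) -` U \<inter> space (restrict_space (metric_borel M d) A) \<in> sets (restrict_space (metric_borel M d) A)"
      using basic[OF V(1)] by (auto simp: sets_restrict_space)
  qed
  from measurable_compose[OF this f]
  show ?thesis using basic[OF A] AM spM
    by (subst (asm) borel_measurable_restrict_space_iff_ennreal) (auto simp: Int_absorb2)
qed

context sphericalization
begin

lemma metric_borel_sub_eq:
  assumes "G \<subseteq> X" shows "metric_borel G wdist = metric_borel G d"
proof -
  interpret A: Submetric X d G using assms by unfold_locales auto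
  interpret B: Submetric X wdist G using assms by unfold_locales auto
  show ?thesis unfolding metric_borel_def A.mtopology_submetric B.mtopology_submetric sph_topology ..
qed

lemma curve_sub_iff:
  assumes "A \<subseteq> X" shows "curve A wdist a e \<gamma> \<longleftrightarrow> curve A d a e \<gamma>"
proof -
  interpret A: Submetric X d A using assms by unfold_locales auto
  interpret B: Submetric X wdist A using assms by unfold_locales auto
  show ?thesis unfolding curve_def A.mtopology_submetric B.mtopology_submetric sph_topology ..
qed

lemma curve_mono:
  assumes "A \<subseteq> G" "G \<subseteq> X" "curve A d a e \<gamma>" shows "curve G d a e \<gamma>"
proof -
  interpret A: Submetric X d A using assms by unfold_locales auto
  interpret B: Submetric X d G using assms by unfold_locales auto
  show ?thesis using assms unfolding curve_def A.mtopology_submetric B.mtopology_submetric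
    by (auto simp: continuous_map_in_subtopology)
qed

text \<open>
  Path integrals with respect to the sphericalized metric do not exceed those with respect to \<open>d\<close> of
  the function multiplied by the weight. Hence upper gradients are turned into upper gradients
  by multiplication with the weight.
\<close>

lemma upper_gradient_transfer:
  assumes AG: "A \<subseteq> G" "G \<subseteq> X" and ug: "upper_gradient G wdist u g"
  shows "upper_gradient A d u (\<lambda>x. g x * ennreal (\<rho> (nrm x)))"
  unfolding upper_gradient_def
proof (intro conjI allI impI)
  have AX: "A \<subseteq> X" using AG by auto
  have MA: "Metric_space A d" by (rule subspace[OF AX])
  have MA': "Metric_space A wdist" by (rule sph.subspace[OF AX])
  have g: "g \<in> borel_measurable (metric_borel G d)"
    using ug metric_borel_sub_eq[OF AG(2)] by (simp add: upper_gradient_def)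
  have gA: "g \<in> borel_measurable (metric_borel A d)"
    using measurable_compose[OF id_measurable_metric_borel[OF AG] g] .
  have wA: "(\<lambda>x. ennreal (\<rho> (nrm x))) \<in> borel_measurable (metric_borel A d)"
    using measurable_compose[OF id_measurable_metric_borel[OF AX order_refl] rho_nrm_borel] .
  show "(\<lambda>x. g x * ennreal (\<rho> (nrm x))) \<in> borel_measurable (metric_borel A d)"
    using gA wA by measurable
  fix a e \<gamma> assume r: "rectifiable_curve A d a e \<gamma> \<and> \<not> \<gamma> constant_on {a..e}"
  have cA: "curve A d a e \<gamma>" using r by (simp add: rectifiable_curve_def)
  have ae: "a \<le> e" using cA by (simp add: curve_def)
  have rX: "rectifiable_curve X d a e \<gamma>"
    using r curve_mono[OF AX order_refl cA] by (simp add: rectifiable_curve_def)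
  have le: "curve_length wdist \<gamma> s t \<le> (\<integral>\<^sup>+x\<in>{enn2real (curve_length d \<gamma> a s)..enn2real (curve_length d \<gamma> a t)}.
      ennreal (\<rho> (nrm (arc_length_param d \<gamma> a e x))) \<partial>lborel)" if "a \<le> s" "s \<le> t" "t \<le> e" for s t
    using curve_length_wdist_le[OF rX that] by (simp add: wint_def)
  have "curve_length wdist \<gamma> a e \<le> wint (arc_length_param d \<gamma> a e)
      (enn2real (curve_length d \<gamma> a a)) (enn2real (curve_length d \<gamma> a e))"
    by (rule curve_length_wdist_le[OF rX]) (use ae in auto)
  also have "\<dots> \<le> wint (arc_length_param d \<gamma> a e) 0 (enn2real (curve_length d \<gamma> a e))"
    by (rule wint_mono) auto
  also have "\<dots> \<le> ennreal (Kw * (enn2real (curve_length d \<gamma> a e) - 0))"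
    by (rule wint_le[OF arc_length_param(4)[OF rX]]) auto
  finally have fin: "curve_length wdist \<gamma> a e < \<infinity>" by (rule le_less_trans) simp
  have rA': "rectifiable_curve A wdist a e \<gamma>"
    using fin cA curve_sub_iff[OF AX] by (simp add: rectifiable_curve_def)
  have rG': "rectifiable_curve G wdist a e \<gamma>"
    using fin curve_mono[OF AG cA] curve_sub_iff[OF AG(2)] by (simp add: rectifiable_curve_def)
  have le2: "path_integral wdist \<gamma> a e g \<le> path_integral d \<gamma> a e (\<lambda>x. g x * ennreal (\<rho> (nrm x)))"
  proof (rule path_integral_density_le[OF MA MA' _ rA' wA, of Kw])
    show "rectifiable_curve A d a e \<gamma>" using r by simp
    show "g \<in> borel_measurable (metric_borel A wdist)" using gA metric_borel_sub_eq[OF AX] by simp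
    show "ennreal (\<rho> (nrm x)) \<le> ennreal Kw" if "x \<in> A" for x using Kw(2) AX that by (intro ennreal_leI) auto
    show "0 \<le> Kw" using Kw(1) by simp
  qed (rule le)
  have "if \<bar>u (\<gamma> a)\<bar> = \<infinity> \<or> \<bar>u (\<gamma> e)\<bar> = \<infinity> then path_integral wdist \<gamma> a e g = \<infinity>
     else e2ennreal \<bar>u (\<gamma> e) - u (\<gamma> a)\<bar> \<le> path_integral wdist \<gamma> a e g"
    using ug rG' r unfolding upper_gradient_def by blast
  then show "if \<bar>u (\<gamma> a)\<bar> = \<infinity> \<or> \<bar>u (\<gamma> e)\<bar> = \<infinity> then path_integral d \<gamma> a e (\<lambda>x. g x * ennreal (\<rho> (nrm x))) = \<infinity>
     else e2ennreal \<bar>u (\<gamma> e) - u (\<gamma> a)\<bar> \<le> path_integral d \<gamma> a e (\<lambda>x. g x * ennreal (\<rho> (nrm x)))"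
    using le2 by (auto split: if_splits simp: top_unique intro: order_trans)
qed

end

locale poincare_sphericalization = doubling_sphericalization X d b \<rho> CU CA CB \<mu> \<sigma> CD CT
  for X :: "'a set" and d b \<rho> CU CA CB \<mu> \<sigma> CD CT +
  fixes p CP \<Lambda> :: real
  assumes p: "1 \<le> p" and CP: "0 < CP" and Lambda: "1 \<le> \<Lambda>"
    and poincare: "\<And>z r u g. \<lbrakk>z \<in> X; 0 < r; L1_on \<mu> (mball z (\<Lambda> * r)) u; upper_gradient (mball z (\<Lambda> * r)) d u g\<rbrakk> \<Longrightarrow>
      (\<integral>\<^sup>+x\<in>mball z r. e2ennreal \<bar>u x - ereal (mean_value \<mu> (mball z r) u)\<bar> \<partial>\<mu>) / emeasure \<mu> (mball z r)
          \<le> ennreal (CP * r) *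
             enn_powr ((\<integral>\<^sup>+x\<in>mball z (\<Lambda> * r). enn_powr (g x) p \<partial>\<mu>) / emeasure \<mu> (mball z (\<Lambda> * r))) (1 / p)"
begin

lemma poincare_const:
  assumes z: "z \<in> X" "0 < r" and L1: "L1_on \<mu> (mball z (\<Lambda> * r)) u" and ug: "upper_gradient (mball z (\<Lambda> * r)) d u g"
    and T: "0 < T" and I: "(\<integral>\<^sup>+x\<in>mball z (\<Lambda> * r). enn_powr (g x) p \<partial>\<mu>) \<le> ennreal (T powr p) * emeasure \<mu> (mball z (\<Lambda> * r))"
  shows "\<exists>c. (\<integral>\<^sup>+x\<in>mball z r. dev u c x \<partial>\<mu>) \<le> ennreal (CP * r * T * m z r)"
proof -
  have Lr: "0 < \<Lambda> * r" using Lambda z by simp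
  note e1 = emeasure_mball[OF z] and e2 = emeasure_mball[OF z(1) Lr]
  define c where "c = mean_value \<mu> (mball z r) u"
  have "(\<integral>\<^sup>+x\<in>mball z (\<Lambda> * r). enn_powr (g x) p \<partial>\<mu>) / emeasure \<mu> (mball z (\<Lambda> * r)) \<le> ennreal (T powr p)"
    by (rule ennreal_divide_leI[OF I]) (use e2 in simp_all)
  then have "enn_powr ((\<integral>\<^sup>+x\<in>mball z (\<Lambda> * r). enn_powr (g x) p \<partial>\<mu>) / emeasure \<mu> (mball z (\<Lambda> * r))) (1 / p)
      \<le> enn_powr (ennreal (T powr p)) (1 / p)" using p by (intro enn_powr_mono) auto
  also have "\<dots> = ennreal T" using T p by (simp add: enn_powr_ennreal powr_powr)
  finally have "ennreal (CP * r) * enn_powr ((\<integral>\<^sup>+x\<in>mball z (\<Lambda> * r). enn_powr (g x) p \<partial>\<mu>) / emeasure \<mu> (mball z (\<Lambda> * r))) (1 / p)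
     \<le> ennreal (CP * r) * ennreal T" by (intro mult_left_mono) auto
  with poincare[OF z L1 ug]
  have le: "(\<integral>\<^sup>+x\<in>mball z r. dev u c x \<partial>\<mu>) / emeasure \<mu> (mball z r) \<le> ennreal (CP * r) * ennreal T"
    unfolding dev_def c_def by (rule order_trans)
  have "(\<integral>\<^sup>+x\<in>mball z r. dev u c x \<partial>\<mu>) = (\<integral>\<^sup>+x\<in>mball z r. dev u c x \<partial>\<mu>) / emeasure \<mu> (mball z r) * emeasure \<mu> (mball z r)"
    by (rule ennreal_divide_mult_cancel[symmetric]) (use e1 in simp_all)
  also have "\<dots> \<le> (ennreal (CP * r) * ennreal T) * emeasure \<mu> (mball z r)" by (intro mult_right_mono le) auto
  also have "\<dots> = ennreal (CP * r * T * m z r)" using e1 CP z T by (simp add: ennreal_mult)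
  finally show ?thesis by blast
qed

text \<open>
  The hypotheses of a Poincare inequality for the sphericalized space. They are stated on open
  sets, since the inequality is deduced from inequalities on sets other than balls.
\<close>

definition admissible :: "'a set \<Rightarrow> ('a \<Rightarrow> ereal) \<Rightarrow> ('a \<Rightarrow> ennreal) \<Rightarrow> bool" where
  "admissible G u g \<longleftrightarrow> openin mtopology G \<and> L1_on \<nu> G u \<and> upper_gradient G wdist u g"

lemma admissible_subset: "admissible G u g \<Longrightarrow> G \<subseteq> X"
  using openin_subset[of mtopology G] by (simp add: admissible_def)

lemma admissible_measurable:
  assumes "admissible G u g"
  shows "u \<in> borel_measurable (restrict_space \<mu> G)" "u \<in> borel_measurable (restrict_space \<nu> G)"
    "(\<lambda>x. enn_powr (g x) p * indicator G x) \<in> borel_measurable \<mu>"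
proof -
  show u: "u \<in> borel_measurable (restrict_space \<nu> G)" using assms by (simp add: admissible_def L1_on_def)
  have "sets (restrict_space \<nu> G) = sets (restrict_space \<mu> G)" by (simp add: sets_restrict_space)
  then show "u \<in> borel_measurable (restrict_space \<mu> G)" using u measurable_cong_sets by blast
  have "g \<in> borel_measurable (metric_borel G d)"
    using assms metric_borel_sub_eq[OF admissible_subset[OF assms]] by (simp add: admissible_def upper_gradient_def)
  then have "(\<lambda>x. enn_powr (g x) p) \<in> borel_measurable (metric_borel G d)" by measurable
  from metric_borel_indicator[OF this] assms
  show "(\<lambda>x. enn_powr (g x) p * indicator G x) \<in> borel_measurable \<mu>"
    by (intro borel_mu) (simp add: admissible_def)
qed

lemma admissible_g_measurable:
  assumes "admissible G u g" "A \<subseteq> G" "A \<in> sets \<mu>"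
  shows "(\<lambda>x. enn_powr (g x) p * indicator A x) \<in> borel_measurable \<mu>"
proof -
  have "(\<lambda>x. (enn_powr (g x) p * indicator G x) * indicator A x) \<in> borel_measurable \<mu>"
    using admissible_measurable(3)[OF assms(1)] assms(3) by measurable
  also have "(\<lambda>x. (enn_powr (g x) p * indicator G x) * indicator A x) = (\<lambda>x. enn_powr (g x) p * indicator A x)"
    by (intro ext) (use assms(2) in \<open>auto simp: indicator_def\<close>)
  finally show ?thesis .
qed

text \<open>
  On \<open>mball y (\<Lambda> * s)\<close> the weight is at most a multiple of \<open>\<rho> (N y)\<close>. Hence the
  transferred upper gradient is at most a multiple of \<open>\<rho> (N y)\<close> times \<open>g\<close>, and \<open>s * \<rho> (N y)\<close> is
  comparable to the radius of the ball for the new metric.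
\<close>

lemma local_poincare:
  obtains C where "1 \<le> C" "\<And>G u g y s t. \<lbrakk>admissible G u g; y \<in> X; 0 < s; \<Lambda> * s \<le> N y / 2; mball y (\<Lambda> * s) \<subseteq> G; 0 < t;
    (\<integral>\<^sup>+x\<in>mball y (\<Lambda> * s). enn_powr (g x) p \<partial>\<mu>) \<le> ennreal (t powr p) * emeasure \<mu> (mball y (\<Lambda> * s))\<rbrakk> \<Longrightarrow>
    \<exists>c. (\<integral>\<^sup>+x\<in>mball y s. dev u c x \<partial>\<mu>) \<le> ennreal (C * (s * \<rho> (N y)) * t * m y s)"
proof -
  have CA2: "1 \<le> CA\<^sup>2" using CA(1) by simp
  obtain C1 where C1: "1 \<le> C1" "\<And>s A f. \<lbrakk>1 \<le> s; A \<subseteq> X; \<And>y. y \<in> A \<Longrightarrow> N y \<le> 2 * s \<and> s \<le> 2 * N y;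
      (\<lambda>x. f x * indicator A x) \<in> borel_measurable \<mu>\<rbrakk> \<Longrightarrow>
    (\<integral>\<^sup>+x\<in>A. f x \<partial>\<nu>) \<le> ennreal (C1 * \<rho> s powr \<sigma>) * (\<integral>\<^sup>+x\<in>A. f x \<partial>\<mu>) \<and>
    ennreal (\<rho> s powr \<sigma>) * (\<integral>\<^sup>+x\<in>A. f x \<partial>\<mu>) \<le> ennreal C1 * (\<integral>\<^sup>+x\<in>A. f x \<partial>\<nu>)"
    by (rule nu_compare[of 2]) auto
  show ?thesis
  proof (rule that[of "max 1 (CP * CA\<^sup>2)"])
    show "1 \<le> max 1 (CP * CA\<^sup>2)" by simp
    fix G u g y s t assume ad: "admissible G u g" and y: "y \<in> X" "0 < s" "\<Lambda> * s \<le> N y / 2" "mball y (\<Lambda> * s) \<subseteq> G"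
      and t: "0 < t" "(\<integral>\<^sup>+x\<in>mball y (\<Lambda> * s). enn_powr (g x) p \<partial>\<mu>) \<le> ennreal (t powr p) * emeasure \<mu> (mball y (\<Lambda> * s))"
    let ?B = "mball y (\<Lambda> * s)"
    have Ny: "1 < N y" by (rule N_gt1[OF y(1)])
    have Np: "0 < \<rho> (N y)" using rho_pos Ny by auto
    have comp: "N x \<le> 2 * N y \<and> N y \<le> 2 * N x" if "x \<in> ?B" for x
      using N_lip[of x y] N_lip[of y x] y that commute[of x y] by auto
    define k where "k = CA\<^sup>2 * \<rho> (N y)"
    have k: "0 < k" using Np CA(1) by (auto simp: k_def)
    have w: "\<rho> (nrm x) \<le> k" if "x \<in> ?B" for x
    proof -
      have x: "x \<in> X" using that by auto
      have "\<rho> (N x) \<le> CA * \<rho> (N y)" using comp[OF that] Ny N_gt1[OF x] by (intro rho_comp1) auto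
      then have "CA * \<rho> (N x) \<le> CA * (CA * \<rho> (N y))" using CA(1) by (intro mult_left_mono) auto
      then show ?thesis using rho_nrm_comp(1)[OF x] by (simp add: k_def power2_eq_square mult.assoc)
    qed
    have gm: "(\<lambda>x. enn_powr (g x) p * indicator ?B x) \<in> borel_measurable \<mu>"
      by (rule admissible_g_measurable[OF ad y(4) mball_mu])
    have "(\<integral>\<^sup>+x\<in>?B. enn_powr (g x * ennreal (\<rho> (nrm x))) p \<partial>\<mu>) \<le>
       (\<integral>\<^sup>+x. ennreal (k powr p) * (enn_powr (g x) p * indicator ?B x) \<partial>\<mu>)"
    proof (rule nn_integral_mono)
      fix x
      have "enn_powr (g x * ennreal (\<rho> (nrm x))) p \<le> ennreal (k powr p) * enn_powr (g x) p" if "x \<in> ?B"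
      proof -
        have "g x * ennreal (\<rho> (nrm x)) \<le> ennreal k * g x"
          unfolding mult.commute[of "g x"] by (intro mult_right_mono ennreal_leI w that) auto
        then have "enn_powr (g x * ennreal (\<rho> (nrm x))) p \<le> enn_powr (ennreal k * g x) p"
          using p by (intro enn_powr_mono) auto
        then show ?thesis using k p by (simp add: enn_powr_cmult)
      qed
      then show "enn_powr (g x * ennreal (\<rho> (nrm x))) p * indicator ?B x \<le> ennreal (k powr p) * (enn_powr (g x) p * indicator ?B x)"
        by (auto simp: indicator_def)
    qed
    also have "\<dots> = ennreal (k powr p) * (\<integral>\<^sup>+x\<in>?B. enn_powr (g x) p \<partial>\<mu>)" by (rule nn_integral_cmult[OF gm])
    also have "\<dots> \<le> ennreal (k powr p) * (ennreal (t powr p) * emeasure \<mu> ?B)" by (intro mult_left_mono t) auto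
    also have "\<dots> = ennreal ((k * t) powr p) * emeasure \<mu> ?B"
      using k t by (simp add: powr_mult ennreal_mult mult.assoc)
    finally have I: "(\<integral>\<^sup>+x\<in>?B. enn_powr (g x * ennreal (\<rho> (nrm x))) p \<partial>\<mu>) \<le> ennreal ((k * t) powr p) * emeasure \<mu> ?B" .
    have L1: "L1_on \<mu> ?B u"
    proof -
      have uB: "u \<in> borel_measurable (restrict_space \<mu> ?B)"
        using measurable_restrict_mono[OF admissible_measurable(1)[OF ad] y(4)] .
      have um: "(\<lambda>x. e2ennreal \<bar>u x\<bar> * indicator ?B x) \<in> borel_measurable \<mu>"
        using dev_measurable[OF admissible_measurable(1)[OF ad] y(4) mball_mu, of 0] by (simp add: dev_def zero_ereal_def[symmetric])
      have "ennreal (\<rho> (N y) powr \<sigma>) * (\<integral>\<^sup>+x\<in>?B. e2ennreal \<bar>u x\<bar> \<partial>\<mu>) \<le> ennreal C1 * (\<integral>\<^sup>+x\<in>?B. e2ennreal \<bar>u x\<bar> \<partial>\<nu>)"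
        using C1(2)[of "N y" ?B "\<lambda>x. e2ennreal \<bar>u x\<bar>"] comp Ny um mball_subset_mspace by auto
      also have "\<dots> \<le> ennreal C1 * (\<integral>\<^sup>+x\<in>G. e2ennreal \<bar>u x\<bar> \<partial>\<nu>)"
        using y(4) by (intro mult_left_mono nn_integral_mono) (auto simp: indicator_def)
      also have "\<dots> < \<infinity>" using ad by (auto simp: admissible_def L1_on_def ennreal_mult_less_top)
      finally have "(\<integral>\<^sup>+x\<in>?B. e2ennreal \<bar>u x\<bar> \<partial>\<mu>) < \<infinity>" using Np by (auto simp: ennreal_mult_less_top)
      then show ?thesis using uB by (simp add: L1_on_def)
    qed
    have ug: "upper_gradient ?B d u (\<lambda>x. g x * ennreal (\<rho> (nrm x)))"
      using upper_gradient_transfer[OF y(4) admissible_subset[OF ad]] ad by (simp add: admissible_def)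
    have kt: "0 < k * t" using k t by simp
    obtain c where c: "(\<integral>\<^sup>+x\<in>mball y s. dev u c x \<partial>\<mu>) \<le> ennreal (CP * s * (k * t) * m y s)"
      using poincare_const[OF y(1,2) L1 ug kt I] by blast
    have "CP * s * (k * t) * m y s = (CP * CA\<^sup>2) * ((s * \<rho> (N y)) * t * m y s)" by (simp add: k_def)
    also have "\<dots> \<le> max 1 (CP * CA\<^sup>2) * ((s * \<rho> (N y)) * t * m y s)"
      using y(2) Np t emeasure_mball(2)[OF y(1,2)] by (intro mult_right_mono) auto
    finally have "CP * s * (k * t) * m y s \<le> max 1 (CP * CA\<^sup>2) * (s * \<rho> (N y)) * t * m y s" by (simp add: mult.assoc)
    from order_trans[OF c ennreal_leI[OF this]]
    show "\<exists>c. (\<integral>\<^sup>+x\<in>mball y s. dev u c x \<partial>\<mu>) \<le> ennreal (max 1 (CP * CA\<^sup>2) * (s * \<rho> (N y)) * t * m y s)" by blast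
  qed
qed

end

section \<open>Chains of balls in an annulus\<close>

text \<open>A separated subset of maximal cardinality has this property.\<close>

lemma (in Metric_space) separated_cover:
  assumes "0 < s" "A \<subseteq> M"
    and bound: "\<And>F. \<lbrakk>finite F; F \<subseteq> A; \<And>x y. \<lbrakk>x \<in> F; y \<in> F; x \<noteq> y\<rbrakk> \<Longrightarrow> s \<le> d x y\<rbrakk> \<Longrightarrow> card F \<le> n"
  obtains F where "finite F" "F \<subseteq> A" "card F \<le> n" "A \<subseteq> (\<Union>y\<in>F. mball y s)"
proof -
  define sep where "sep F \<longleftrightarrow> finite F \<and> F \<subseteq> A \<and> (\<forall>x\<in>F. \<forall>y\<in>F. x \<noteq> y \<longrightarrow> s \<le> d x y)" for F
  have sb: "card F \<le> n" if "sep F" for F using that by (intro bound) (auto simp: sep_def)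
  have "sep {}" by (simp add: sep_def)
  then obtain F where F: "sep F" "\<And>F'. sep F' \<Longrightarrow> card F' \<le> card F"
    using ex_has_greatest_nat[of sep "{}" card "Suc n"] sb by (metis le_imp_less_Suc)
  have "A \<subseteq> (\<Union>y\<in>F. mball y s)"
  proof
    fix x assume x: "x \<in> A"
    show "x \<in> (\<Union>y\<in>F. mball y s)"
    proof (rule ccontr)
      assume nx: "x \<notin> (\<Union>y\<in>F. mball y s)"
      have far: "s \<le> d y x" if "y \<in> F" for y
      proof (rule ccontr)
        assume "\<not> s \<le> d y x"
        moreover have "y \<in> M" "x \<in> M" using that F(1) x assms(2) by (auto simp: sep_def)
        ultimately have "x \<in> mball y s" by simp
        then show False using nx that by blast
      qed
      have xF: "x \<notin> F"
      proof
        assume xF: "x \<in> F"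
        then have "s \<le> d x x" by (rule far)
        then show False using assms x by auto
      qed
      have "sep (insert x F)" using F(1) x far commute unfolding sep_def by auto
      then have "card (insert x F) \<le> card F" by (rule F(2))
      then show False using xF F(1) by (auto simp: sep_def)
    qed
  qed
  then show ?thesis using that F(1) sb[OF F(1)] by (auto simp: sep_def)
qed

context poincare_sphericalization
begin

text \<open>
  Each ball of radius comparable to \<open>S\<close> centred in the annulus satisfies the local Poincare
  inequality with some constant \<open>cc y\<close>. Any two such balls are joined by a bounded number of balls
  along a uniform curve, which does not leave a larger annulus. Consecutive balls share a large
  part, so that their constants differ by a controlled amount. Finally, by doubling, a bounded
  number of balls covers the annulus, and \<open>cc z\<close> can be used on all of them. The measure \<open>m z S\<close>
  serves as the common unit for the measures of all balls.
\<close>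

lemma annulus_poincare:
  obtains q Q C where "0 < q" "q \<le> 1" "4 \<le> Q" "1 \<le> C"
    "\<And>G u g S t z. \<lbrakk>admissible G u g; 1 \<le> S; z \<in> X; N z = 2 * S; {x \<in> X. q * S \<le> N x \<and> N x \<le> Q * S} \<subseteq> G; 0 < t;
      (\<integral>\<^sup>+x\<in>{x \<in> X. q * S \<le> N x \<and> N x \<le> Q * S}. enn_powr (g x) p \<partial>\<mu>) \<le> ennreal (t powr p * m z S)\<rbrakk> \<Longrightarrow>
      \<exists>c. (\<integral>\<^sup>+x\<in>{x \<in> X. S \<le> N x \<and> N x \<le> 4 * S}. dev u c x \<partial>\<mu>) \<le> ennreal (C * \<kappa> S * t * m z S)"
proof -
  \<comment> \<open>By \<open>ucurve_N\<close>, uniform curves between points with \<open>S \<le> N x \<le> 4 * S\<close> stay where \<open>c * S \<le> N x \<le> Q0 * S\<close>.\<close>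
  define c where "c = 1 / (1 + 2 * CU)"
  have c: "0 < c" "c \<le> 1" using CU by (auto simp: c_def)
  define Q0 where "Q0 = 4 + 8 * CU"
  have Q0: "12 \<le> Q0" using CU by (simp add: Q0_def)
  \<comment> \<open>The balls of the chain have radius \<open>\<epsilon> * S\<close>; on the balls enlarged by \<open>\<Lambda>\<close>, \<open>N\<close> differs from its value at the centre by at most \<open>c / 2 * S\<close>.\<close>
  define \<epsilon> where "\<epsilon> = c / (2 * \<Lambda>)"
  have eL: "\<Lambda> * \<epsilon> = c / 2" using Lambda by (simp add: \<epsilon>_def)
  have e: "0 < \<epsilon>" using c Lambda by (simp add: \<epsilon>_def)
  have "1 * \<epsilon> \<le> \<Lambda> * \<epsilon>" using e Lambda by (intro mult_right_mono) auto
  then have e1: "\<epsilon> \<le> 1" using eL c by linarith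
  obtain C1 where C1: "1 \<le> C1" "\<And>G u g y s t. \<lbrakk>admissible G u g; y \<in> X; 0 < s; \<Lambda> * s \<le> N y / 2; mball y (\<Lambda> * s) \<subseteq> G; 0 < t;
    (\<integral>\<^sup>+x\<in>mball y (\<Lambda> * s). enn_powr (g x) p \<partial>\<mu>) \<le> ennreal (t powr p) * emeasure \<mu> (mball y (\<Lambda> * s))\<rbrakk> \<Longrightarrow>
    \<exists>c. (\<integral>\<^sup>+x\<in>mball y s. dev u c x \<partial>\<mu>) \<le> ennreal (C1 * (s * \<rho> (N y)) * t * m y s)"
    by (rule local_poincare) blast
  define K where "K = max (1 / c) Q0"
  have K: "1 \<le> K" "Q0 \<le> K" "1 / c \<le> K" using Q0 by (auto simp: K_def)
  obtain C2 where C2: "1 \<le> C2" "\<And>s t. \<lbrakk>1 \<le> s; 1 \<le> t; s \<le> K * t; t \<le> K * s\<rbrakk> \<Longrightarrow> \<rho> s \<le> C2 * \<rho> t"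
    by (rule rho_comp[OF K(1)]) blast
  define K0 where "K0 = 2 * (5 + 2 * Q0) / \<epsilon>"
  have K0e: "K0 * \<epsilon> = 2 * (5 + 2 * Q0)" using e by (simp add: K0_def)
  have "(5 + 2 * Q0) * \<epsilon> \<le> (5 + 2 * Q0) * 1" by (rule mult_left_mono[OF e1]) (use Q0 in simp)
  then have "(5 + 2 * Q0) * \<epsilon> \<le> 2 * (5 + 2 * Q0)" by (rule order_trans) (use Q0 in simp)
  then have K0: "5 + 2 * Q0 \<le> K0" unfolding K0_def pos_le_divide_eq[OF e] .
  have K01: "1 \<le> K0" using K0 Q0 by simp
  obtain Cm where Cm: "1 \<le> Cm" "\<And>x y r s. \<lbrakk>x \<in> X; y \<in> X; 0 < r; 0 < s; d x y + s \<le> K0 * r\<rbrakk> \<Longrightarrow> m y s \<le> Cm * m x r"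
    by (rule m_compare[OF K01]) blast
  \<comment> \<open>A uniform curve in question has length at most \<open>8 * CU * S\<close>, so \<open>n\<close> pieces have length at most half a radius.\<close>
  define n where "n = nat \<lceil>16 * CU / \<epsilon>\<rceil> + 1"
  have n: "16 * CU / \<epsilon> \<le> real n" "0 < n" by (auto simp: n_def) linarith
  define D1 where "D1 = C1 * C2 * Cm * Cm"
  define D2 where "D2 = 2 * D1 * Cm"
  define D where "D = Cm * (D1 + real n * D2 * Cm)"
  have D1: "1 \<le> D1" unfolding D1_def using C1(1) C2(1) Cm(1) mult_mono[of 1 C1 1 C2] mult_mono[of 1 "C1 * C2" 1 Cm]
    mult_mono[of 1 "C1 * C2 * Cm" 1 Cm] by simp
  have D2: "0 \<le> D2" unfolding D2_def using D1 Cm(1) by simp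
  have Dge: "1 \<le> D"
  proof -
    have "0 \<le> real n * D2 * Cm" using D2 Cm(1) by simp
    then have "1 * 1 \<le> Cm * (D1 + real n * D2 * Cm)" using D1 Cm(1) by (intro mult_mono) auto
    then show ?thesis by (simp add: D_def)
  qed
  show ?thesis
  proof (rule that[of "c / 2" "2 * Q0" D])
    show "0 < c / 2" "c / 2 \<le> 1" "4 \<le> 2 * Q0" "1 \<le> D" using c Q0 Dge by auto
    fix G u g S t z
    assume ad: "admissible G u g" and S: "1 \<le> S" and z: "z \<in> X" "N z = 2 * S"
      and sub: "{x \<in> X. c / 2 * S \<le> N x \<and> N x \<le> 2 * Q0 * S} \<subseteq> G" and t: "0 < t"
      and I: "(\<integral>\<^sup>+x\<in>{x \<in> X. c / 2 * S \<le> N x \<and> N x \<le> 2 * Q0 * S}. enn_powr (g x) p \<partial>\<mu>) \<le> ennreal (t powr p * m z S)"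
    define s where "s = \<epsilon> * S"
    have s: "0 < s" "s \<le> S" "\<Lambda> * s = c / 2 * S"
      using e S mult_right_mono[OF e1, of S] eL by (auto simp: s_def mult.assoc[symmetric])
    have Ls1: "s \<le> \<Lambda> * s" using mult_right_mono[OF Lambda, of s] s(1) by linarith
    then have Ls2: "0 < \<Lambda> * s" using s(1) by linarith
    note Ls = Ls1 Ls2
    define P where "P = {y \<in> X. c * S \<le> N y \<and> N y \<le> Q0 * S}"
    have PX: "P \<subseteq> X" by (auto simp: P_def)
    have M0: "0 < m z S" using emeasure_mball(2)[OF z(1)] S by simp
    have dz: "d z y \<le> (2 + Q0) * S" "d y z \<le> (2 + Q0) * S" if "y \<in> P" for y
      using dist_le_N[OF z(1), of y] that z commute[of y z] by (auto simp: P_def distrib_right)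
    have K0s: "K0 * s = (10 + 4 * Q0) * S" using K0e by (simp add: s_def mult.assoc[symmetric])
    have K0S: "(5 + 2 * Q0) * S \<le> K0 * S" using K0 S by (intro mult_right_mono) auto
    have K0L: "K0 * s \<le> K0 * (\<Lambda> * s)" using Ls K01 by (intro mult_left_mono) auto
    have K1: "0 < (3 + Q0) * S" using Q0 S by simp
    have QS: "0 \<le> Q0 * S" using Q0 S by simp
    have m1: "m z S \<le> Cm * m y (\<Lambda> * s)" if "y \<in> P" for y
      using that PX z S Ls dz[OF that] K0s K0L QS by (intro Cm(2)) (auto simp: distrib_right)
    have m2: "m y s \<le> Cm * m z S" if "y \<in> P" for y
      using that PX z S s dz[OF that] K0S QS by (intro Cm(2)) (auto simp: distrib_right)
    have m3: "m z S \<le> Cm * m y (s / 2)" if "y \<in> P" for y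
      using that PX z S s dz[OF that] K0s QS by (intro Cm(2)) (auto simp: distrib_right)
    have m4: "m z ((3 + Q0) * S) \<le> Cm * m y (s / 2)" if "y \<in> P" for y
      using that PX z S s dz[OF that] K0s QS Q0 K1 by (intro Cm(2)) (auto simp: distrib_right)
    have kp: "0 < \<kappa> S" by (rule kappa_pos[OF S])
    define E where "E = D1 * \<kappa> S * t * m z S"
    have E0: "0 \<le> E" using D1 kp t M0 by (simp add: E_def)
    have "\<exists>a. (\<integral>\<^sup>+x\<in>mball y s. dev u a x \<partial>\<mu>) \<le> ennreal E" if y: "y \<in> P" for y
    proof -
      have yX: "y \<in> X" using y PX by auto
      have half: "\<Lambda> * s \<le> N y / 2" using y s by (simp add: P_def)
      have Bsub: "mball y (\<Lambda> * s) \<subseteq> {x \<in> X. c / 2 * S \<le> N x \<and> N x \<le> 2 * Q0 * S}"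
      proof
        fix x assume "x \<in> mball y (\<Lambda> * s)"
        then have x: "x \<in> X" "d y x < c / 2 * S" using s by auto
        have "c / 2 * S \<le> Q0 * S" using c Q0 S by (intro mult_right_mono) auto
        then show "x \<in> {x \<in> X. c / 2 * S \<le> N x \<and> N x \<le> 2 * Q0 * S}"
          using N_lip[OF yX x(1)] N_lip[OF x(1) yX] x y commute[of x y] by (auto simp: P_def)
      qed
      have ct: "0 < Cm * t" using Cm(1) t by simp
      have "(\<integral>\<^sup>+x\<in>mball y (\<Lambda> * s). enn_powr (g x) p \<partial>\<mu>) \<le> (\<integral>\<^sup>+x\<in>{x \<in> X. c / 2 * S \<le> N x \<and> N x \<le> 2 * Q0 * S}. enn_powr (g x) p \<partial>\<mu>)"
        using Bsub by (intro nn_integral_mono) (auto simp: indicator_def)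
      also note I
      also have "ennreal (t powr p * m z S) \<le> ennreal ((Cm * t) powr p * m y (\<Lambda> * s))"
      proof (rule ennreal_leI)
        have mp: "0 < m y (\<Lambda> * s)" using emeasure_mball(2)[OF yX Ls(2)] .
        have "Cm powr 1 \<le> Cm powr p" using Cm(1) p by (intro powr_mono) auto
        then have cp: "Cm \<le> Cm powr p" using Cm(1) by simp
        have "t powr p * m z S \<le> t powr p * (Cm * m y (\<Lambda> * s))" by (intro mult_left_mono m1[OF y]) auto
        also have "\<dots> \<le> t powr p * (Cm powr p * m y (\<Lambda> * s))"
          using cp mp by (intro mult_left_mono mult_right_mono) auto
        also have "\<dots> = (Cm * t) powr p * m y (\<Lambda> * s)" using Cm(1) t by (simp add: powr_mult)
        finally show "t powr p * m z S \<le> (Cm * t) powr p * m y (\<Lambda> * s)" .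
      qed
      also have "\<dots> = ennreal ((Cm * t) powr p) * emeasure \<mu> (mball y (\<Lambda> * s))"
        using emeasure_mball[OF yX Ls(2)] by (simp add: ennreal_mult)
      finally obtain a where a: "(\<integral>\<^sup>+x\<in>mball y s. dev u a x \<partial>\<mu>) \<le> ennreal (C1 * (s * \<rho> (N y)) * (Cm * t) * m y s)"
        using C1(2)[OF ad yX s(1) half order_trans[OF Bsub sub] ct] by blast
      have rho: "\<rho> (N y) \<le> C2 * \<rho> S"
      proof (rule C2(2))
        show "1 \<le> N y" using N_gt1[OF yX] by simp
        have "Q0 * S \<le> K * S" using K S by (intro mult_right_mono) auto
        then show "N y \<le> K * S" using y by (simp add: P_def)
        have "S = (1 / c) * (c * S)" using c by simp
        also have "\<dots> \<le> K * N y" using y K c S by (intro mult_mono) (auto simp: P_def)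
        finally show "S \<le> K * N y" .
      qed (rule S)
      have "s * \<rho> (N y) \<le> S * (C2 * \<rho> S)"
        using s rho rho_pos[of "N y"] N_gt1[OF yX] S by (intro mult_mono) auto
      then have "C1 * (s * \<rho> (N y)) * (Cm * t) * m y s \<le> C1 * (S * (C2 * \<rho> S)) * (Cm * t) * (Cm * m z S)"
        using C1(1) Cm(1) t m2[OF y] emeasure_mball(2)[OF yX s(1)] rho_pos[of S] S C2(1)
          s rho rho_pos[of "N y"] N_gt1[OF yX]
        by (intro mult_mono) auto
      also have "\<dots> = E" by (simp add: E_def D1_def \<kappa>_def mult_ac)
      finally show ?thesis using order_trans[OF a ennreal_leI] by blast
    qed
    then obtain cc where cc: "\<And>y. y \<in> P \<Longrightarrow> (\<integral>\<^sup>+x\<in>mball y s. dev u (cc y) x \<partial>\<mu>) \<le> ennreal E" by metis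
    note um = admissible_measurable(1)[OF ad]
    have PG: "mball y s \<subseteq> G" if y: "y \<in> P" for y
    proof
      fix x assume "x \<in> mball y s"
      then have "x \<in> X" "d y x < s" by auto
      then have x: "x \<in> X" "d y x < c / 2 * S" using s(3) Ls1 by linarith+
      have yX: "y \<in> X" using y PX by auto
      have "c / 2 * S \<le> Q0 * S" using c Q0 S by (intro mult_right_mono) auto
      then have "x \<in> {x \<in> X. c / 2 * S \<le> N x \<and> N x \<le> 2 * Q0 * S}"
        using N_lip[OF yX x(1)] N_lip[OF x(1) yX] x y commute[of x y] by (auto simp: P_def)
      then show "x \<in> G" using sub by blast
    qed
    have step: "\<bar>cc y - cc y'\<bar> \<le> D2 * \<kappa> S * t" if y: "y \<in> P" "y' \<in> P" "d y y' \<le> s / 2" for y y'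
    proof -
      have yX: "y \<in> X" "y' \<in> X" using y PX by auto
      have s2: "0 < s / 2" using s by simp
      have B: "mball y' (s / 2) \<subseteq> mball y s" "mball y' (s / 2) \<subseteq> mball y' s"
      proof -
        show "mball y' (s / 2) \<subseteq> mball y s"
          by (rule mball_subset) (use y yX commute[of y y'] in auto)
        show "mball y' (s / 2) \<subseteq> mball y' s" by (rule mball_subset_concentric) (use s in simp)
      qed
      have "ennreal (\<bar>cc y - cc y'\<bar> * m y' (s / 2)) = ennreal \<bar>cc y - cc y'\<bar> * emeasure \<mu> (mball y' (s / 2))"
        using emeasure_mball[OF yX(2) s2] by (simp add: ennreal_mult)
      also have "\<dots> \<le> (\<integral>\<^sup>+x\<in>mball y s. dev u (cc y) x \<partial>\<mu>) + (\<integral>\<^sup>+x\<in>mball y' s. dev u (cc y') x \<partial>\<mu>)"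
        by (rule const_diff_le[OF um mball_mu mball_mu mball_mu B PG[OF y(1)] PG[OF y(2)]])
      also have "\<dots> \<le> ennreal E + ennreal E" by (intro add_mono cc y)
      also have "\<dots> = ennreal (2 * E)" using E0 by (simp add: ennreal_plus[symmetric] del: ennreal_plus)
      finally have "\<bar>cc y - cc y'\<bar> * m y' (s / 2) \<le> 2 * E" using E0 by (subst (asm) ennreal_le_iff) auto
      then have "\<bar>cc y - cc y'\<bar> * (Cm * m y' (s / 2)) \<le> Cm * (2 * E)"
        using mult_left_mono[of "\<bar>cc y - cc y'\<bar> * m y' (s / 2)" "2 * E" Cm] Cm(1) by (simp add: mult_ac)
      moreover have "\<bar>cc y - cc y'\<bar> * m z S \<le> \<bar>cc y - cc y'\<bar> * (Cm * m y' (s / 2))"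
        by (intro mult_left_mono m3 y) auto
      ultimately have "\<bar>cc y - cc y'\<bar> * m z S \<le> (D2 * \<kappa> S * t) * m z S" by (simp add: E_def D2_def mult_ac)
      then show ?thesis using M0 by simp
    qed
    define A where "A = {x \<in> X. S \<le> N x \<and> N x \<le> 4 * S}"
    have AP: "A \<subseteq> P"
    proof
      fix x assume x: "x \<in> A"
      have "c * S \<le> 1 * S" "4 * S \<le> Q0 * S" using c Q0 S by (intro mult_right_mono; simp)+
      then show "x \<in> P" using x by (auto simp: A_def P_def)
    qed
    have chain: "\<bar>cc x - cc y\<bar> \<le> real n * (D2 * \<kappa> S * t)" if xy: "x \<in> A" "y \<in> A" for x y
    proof -
      have xyX: "x \<in> X" "y \<in> X" using xy by (auto simp: A_def)
      obtain l \<eta> where \<eta>: "ucurve l \<eta>" "\<eta> 0 = x" "\<eta> l = y" using ucurve_exists[OF xyX] .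
      note lip = ucurve_lip[OF \<eta>(1)]
      have l0: "0 \<le> l" using lip by (simp add: lip_curve_def)
      have "l \<le> CU * d x y" using \<eta> by (simp add: ucurve_def)
      also have "\<dots> \<le> CU * (8 * S)" using dist_le_N[OF xyX] xy CU by (intro mult_left_mono) (auto simp: A_def)
      finally have l: "l \<le> 8 * CU * S" by simp
      have halfP: "\<zeta> v \<in> P" if \<zeta>: "ucurve l \<zeta>" "\<zeta> 0 \<in> A" and v: "0 \<le> v" "v \<le> l / 2" for \<zeta> v
      proof -
        note nn = ucurve_N(1,2)[OF \<zeta>(1) v]
        have "S \<le> (1 + 2 * CU) * N (\<zeta> v)" using nn(1) \<zeta>(2) v by (auto simp: A_def)
        then have "c * S \<le> N (\<zeta> v)" using CU by (simp add: c_def divide_le_eq mult.commute)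
        moreover have "N (\<zeta> v) \<le> Q0 * S"
        proof -
          have "N (\<zeta> v) \<le> 4 * S + 8 * CU * S" using nn(2) \<zeta>(2) v l l0 by (auto simp: A_def)
          then show ?thesis by (simp add: Q0_def distrib_right)
        qed
        moreover have "\<zeta> v \<in> X" using lip_curveD(1)[OF ucurve_lip[OF \<zeta>(1)], of v] v by auto
        ultimately show ?thesis by (simp add: P_def)
      qed
      have inP: "\<eta> v \<in> P" if v: "0 \<le> v" "v \<le> l" for v
      proof (cases "v \<le> l / 2")
        case True then show ?thesis using halfP[OF \<eta>(1)] \<eta>(2) xy v by simp
      next
        case False then show ?thesis using halfP[OF ucurve_rev[OF \<eta>(1)], of "l - v"] \<eta>(3) xy v by simp
      qed
      have ln: "l / real n \<le> s / 2"
      proof -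
        have "l * 2 \<le> (16 * CU / \<epsilon>) * (\<epsilon> * S)" using l e by simp
        also have "\<dots> \<le> real n * s" unfolding s_def using n e S by (intro mult_right_mono) auto
        finally show ?thesis using n(2) by (simp add: divide_le_eq mult.commute)
      qed
      have "\<bar>cc (\<eta> 0) - cc (\<eta> (real i * (l / real n)))\<bar> \<le> real i * (D2 * \<kappa> S * t)" if "i \<le> n" for i
        using that
      proof (induction i)
        case (Suc i)
        have o: "0 \<le> real i * (l / real n)" "real i * (l / real n) \<le> l" "real (Suc i) * (l / real n) \<le> l" "0 \<le> real (Suc i) * (l / real n)"
        proof -
          have "real j * (l / real n) \<le> l" if "j \<le> n" for j
            using mult_right_mono[of "real j" "real n" "l / real n"] that l0 n(2) by simp
          then show "real i * (l / real n) \<le> l" "real (Suc i) * (l / real n) \<le> l" using Suc.prems by (metis Suc_leD, metis)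
        qed (use l0 in auto)
        have "d (\<eta> (real i * (l / real n))) (\<eta> (real (Suc i) * (l / real n))) \<le> \<bar>real i * (l / real n) - real (Suc i) * (l / real n)\<bar>"
          by (rule lip_curveD(2)[OF lip]) (use o in auto)
        also have "\<dots> = l / real n"
        proof -
          have e: "real (Suc i) * (l / real n) = real i * (l / real n) + l / real n"
            by (simp only: of_nat_Suc distrib_right mult_1 add.commute)
          have "0 \<le> l / real n" using l0 by simp
          then show ?thesis unfolding e by linarith
        qed
        finally have "d (\<eta> (real i * (l / real n))) (\<eta> (real (Suc i) * (l / real n))) \<le> s / 2" using ln by linarith
        from step[OF inP[OF o(1,2)] inP[OF o(4,3)] this] Suc.IH Suc.prems
        show ?case by (simp add: distrib_right)
      qed simp
      from this[of n] show ?thesis using \<eta> n(2) by simp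
    qed
    have zA: "z \<in> A" using z S by (simp add: A_def)
    have packing: "card F \<le> nat \<lfloor>Cm\<rfloor>" if F: "finite F" "F \<subseteq> A" "\<And>x y. \<lbrakk>x \<in> F; y \<in> F; x \<noteq> y\<rbrakk> \<Longrightarrow> s \<le> d x y" for F
    proof -
      have s2: "0 < s / 2" using s by simp
      have FX: "y \<in> X" "y \<in> P" if "y \<in> F" for y using that F(2) AP PX by auto
      have dis: "disjoint_family_on (\<lambda>y. mball y (s / 2)) F"
        unfolding disjoint_family_on_def
      proof (intro ballI impI)
        fix x y assume "x \<in> F" "y \<in> F" "x \<noteq> y"
        then have "s / 2 + s / 2 \<le> d x y" using F(3) by simp
        then show "mball x (s / 2) \<inter> mball y (s / 2) = {}" using disjoint_mball by (simp add: disjnt_def)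
      qed
      have "ennreal (\<Sum>y\<in>F. m y (s / 2)) = (\<Sum>y\<in>F. emeasure \<mu> (mball y (s / 2)))"
        using emeasure_mball[OF FX(1) s2] by (subst sum_ennreal[symmetric]) (auto intro: less_imp_le)
      also have "\<dots> = emeasure \<mu> (\<Union>y\<in>F. mball y (s / 2))"
        by (rule sum_emeasure) (use F(1) dis mball_mu in auto)
      also have "\<dots> \<le> emeasure \<mu> (mball z ((3 + Q0) * S))"
      proof (rule emeasure_mono[OF UN_least mball_mu])
        fix y assume yF: "y \<in> F"
        show "mball y (s / 2) \<subseteq> mball z ((3 + Q0) * S)"
          using dz(2)[OF FX(2)[OF yF]] s z S by (intro mball_subset) (auto simp: distrib_right)
      qed
      also have "\<dots> = ennreal (m z ((3 + Q0) * S))" using emeasure_mball[OF z(1) K1] by simp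
      finally have le: "(\<Sum>y\<in>F. m y (s / 2)) \<le> m z ((3 + Q0) * S)"
        using emeasure_mball(2)[OF z(1) K1] by (subst (asm) ennreal_le_iff) auto
      have "real (card F) * m z ((3 + Q0) * S) = (\<Sum>y\<in>F. m z ((3 + Q0) * S))" by simp
      also have "\<dots> \<le> (\<Sum>y\<in>F. Cm * m y (s / 2))" by (intro sum_mono m4 FX)
      also have "\<dots> = Cm * (\<Sum>y\<in>F. m y (s / 2))" by (simp add: sum_distrib_left)
      also have "\<dots> \<le> Cm * m z ((3 + Q0) * S)" using le Cm(1) by (intro mult_left_mono) auto
      finally have "real (card F) \<le> Cm" using emeasure_mball(2)[OF z(1) K1] by simp
      then show ?thesis by (simp add: le_nat_floor)
    qed
    have AX: "A \<subseteq> X" by (auto simp: A_def)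
    obtain F where F: "finite F" "F \<subseteq> A" "card F \<le> nat \<lfloor>Cm\<rfloor>" "A \<subseteq> (\<Union>y\<in>F. mball y s)"
      by (rule separated_cover[OF s(1) AX packing]) blast
    have FP: "y \<in> P" "y \<in> X" if "y \<in> F" for y using that F(2) AP PX by auto
    have dm: "(\<lambda>x. dev u (cc z) x * indicator (mball y s) x) \<in> borel_measurable \<mu>" if "y \<in> F" for y
      by (rule dev_measurable[OF um PG[OF FP(1)[OF that]] mball_mu])
    have "(\<integral>\<^sup>+x\<in>A. dev u (cc z) x \<partial>\<mu>) \<le> (\<integral>\<^sup>+x. (\<Sum>y\<in>F. dev u (cc z) x * indicator (mball y s) x) \<partial>\<mu>)"
    proof (rule nn_integral_mono)
      fix x
      show "dev u (cc z) x * indicator A x \<le> (\<Sum>y\<in>F. dev u (cc z) x * indicator (mball y s) x)"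
      proof (cases "x \<in> A")
        case True
        then obtain y where y: "y \<in> F" "x \<in> mball y s" using F(4) by blast
        have "dev u (cc z) x * indicator (mball y s) x \<le> (\<Sum>y\<in>F. dev u (cc z) x * indicator (mball y s) x)"
          by (rule member_le_sum) (use y F(1) in auto)
        then show ?thesis using y True by (simp add: indicator_def)
      qed simp
    qed
    also have "\<dots> = (\<Sum>y\<in>F. \<integral>\<^sup>+x\<in>mball y s. dev u (cc z) x \<partial>\<mu>)" by (rule nn_integral_sum[OF dm])
    also have "\<dots> \<le> (\<Sum>y\<in>F. ennreal ((D1 + real n * D2 * Cm) * \<kappa> S * t * m z S))"
    proof (rule sum_mono)
      fix y assume y: "y \<in> F"
      have "(\<integral>\<^sup>+x\<in>mball y s. dev u (cc z) x \<partial>\<mu>) \<le> (\<integral>\<^sup>+x\<in>mball y s. dev u (cc y) x \<partial>\<mu>) + ennreal \<bar>cc z - cc y\<bar> * emeasure \<mu> (mball y s)"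
        by (rule dev_shift[OF um mball_mu PG[OF FP(1)[OF y]]])
      also have "\<dots> \<le> ennreal E + ennreal (real n * (D2 * \<kappa> S * t) * (Cm * m z S))"
      proof (rule add_mono[OF cc[OF FP(1)[OF y]]])
        have "ennreal \<bar>cc z - cc y\<bar> * emeasure \<mu> (mball y s) = ennreal (\<bar>cc z - cc y\<bar> * m y s)"
          using emeasure_mball[OF FP(2)[OF y] s(1)] by (simp add: ennreal_mult)
        also have "\<dots> \<le> ennreal (real n * (D2 * \<kappa> S * t) * (Cm * m z S))"
          using chain[OF zA, of y] y F(2) m2[OF FP(1)[OF y]] emeasure_mball(2)[OF FP(2)[OF y] s(1)] D2 kp t
          by (intro ennreal_leI mult_mono) (auto intro!: mult_nonneg_nonneg)
        finally show "ennreal \<bar>cc z - cc y\<bar> * emeasure \<mu> (mball y s) \<le> ennreal (real n * (D2 * \<kappa> S * t) * (Cm * m z S))" .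
      qed
      also have "\<dots> = ennreal ((D1 + real n * D2 * Cm) * \<kappa> S * t * m z S)"
        using E0 D2 kp t Cm(1) M0 by (subst ennreal_plus[symmetric]) (auto simp: E_def algebra_simps intro!: mult_nonneg_nonneg)
      finally show "(\<integral>\<^sup>+x\<in>mball y s. dev u (cc z) x \<partial>\<mu>) \<le> ennreal ((D1 + real n * D2 * Cm) * \<kappa> S * t * m z S)" .
    qed
    also have "\<dots> = ennreal (real (card F) * ((D1 + real n * D2 * Cm) * \<kappa> S * t * m z S))"
      by (simp add: ennreal_mult' ennreal_of_nat_eq_real_of_nat)
    also have "\<dots> \<le> ennreal (D * \<kappa> S * t * m z S)"
    proof (rule ennreal_leI)
      have "real (card F) \<le> Cm" using F(3) Cm(1) by linarith
      moreover have "0 \<le> (D1 + real n * D2 * Cm) * \<kappa> S * t * m z S" using D1 D2 Cm(1) kp t M0 by auto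
      ultimately have "real (card F) * ((D1 + real n * D2 * Cm) * \<kappa> S * t * m z S) \<le> Cm * ((D1 + real n * D2 * Cm) * \<kappa> S * t * m z S)"
        by (intro mult_right_mono)
      then show "real (card F) * ((D1 + real n * D2 * Cm) * \<kappa> S * t * m z S) \<le> D * \<kappa> S * t * m z S"
        by (simp add: D_def mult.assoc)
    qed
    finally show "\<exists>c. (\<integral>\<^sup>+x\<in>{x \<in> X. S \<le> N x \<and> N x \<le> 4 * S}. dev u c x \<partial>\<mu>) \<le> ennreal (D * \<kappa> S * t * m z S)"
      unfolding A_def by blast
  qed
qed

end

section \<open>Summation over annuli\<close>

text \<open>
  The right-hand side is a power of an affine function of \<open>a\<close>. If \<open>a > T powr p\<close>, then
  \<open>b = a powr (1 / p)\<close> exceeds \<open>T\<close>, and \<open>b = b powr (1 - p) * a \<le> T powr (1 - p) * a\<close>.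
\<close>

lemma weak_young:
  fixes a T p :: real
  assumes "0 < T" "0 \<le> a" "1 \<le> p"
  shows "a \<le> (T + T powr (1 - p) * a) powr p"
proof (cases "a \<le> T powr p")
  case True
  have "T powr p \<le> (T + T powr (1 - p) * a) powr p" using assms by (intro powr_mono2) auto
  then show ?thesis using True by simp
next
  case False
  have T: "0 < T powr p" using assms by simp
  then have a: "0 < a" using False by linarith
  define b where "b = a powr (1 / p)"
  have b: "0 < b" "b powr p = a" using a assms by (auto simp: b_def powr_powr)
  have "T < b"
  proof (rule ccontr)
    assume "\<not> T < b"
    then have "b powr p \<le> T powr p" using b assms by (intro powr_mono2) auto
    then show False using False b by simp
  qed
  then have "b powr (1 - p) \<le> T powr (1 - p)" using assms by (intro powr_mono2') auto
  then have "b powr (1 - p) * b powr p \<le> T powr (1 - p) * a" unfolding b(2) using a by (intro mult_right_mono) auto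
  moreover have "b powr (1 - p) * b powr p = b powr ((1 - p) + p)" by (rule powr_add[symmetric])
  then have "b powr (1 - p) * b powr p = b" using b(1) by simp
  ultimately have "b \<le> T + T powr (1 - p) * a" using assms by simp
  then have "b powr p \<le> (T + T powr (1 - p) * a) powr p" using b assms by (intro powr_mono2) auto
  then show ?thesis using b by simp
qed

lemma dyadic_overlap:
  fixes q Q :: real
  assumes "0 < q" "0 < Q"
  obtains L :: nat where "\<And>S n J. 0 < S \<Longrightarrow> card {j. j < J \<and> q * (2 ^ j * S) \<le> n \<and> n \<le> Q * (2 ^ j * S)} \<le> L"
proof -
  obtain L :: nat where L: "Q / q < 2 ^ L" using real_arch_pow[of 2 "Q / q"] by auto
  show ?thesis
  proof (rule that[of L])
    fix S n :: real and J :: nat assume S: "0 < S"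
    let ?A = "{j. j < J \<and> q * (2 ^ j * S) \<le> n \<and> n \<le> Q * (2 ^ j * S)}"
    show "card ?A \<le> L"
    proof (cases "?A = {}")
      case False
      have fin: "finite ?A" by (rule finite_subset[of _ "{..<J}"]) auto
      define i where "i = Min ?A"
      have i: "i \<in> ?A" unfolding i_def by (rule Min_in[OF fin False])
      have "?A \<subseteq> {i..<i + L}"
      proof
        fix j assume j: "j \<in> ?A"
        have ij: "i \<le> j" unfolding i_def by (rule Min_le[OF fin j])
        have "q * (2 ^ j * S) \<le> Q * (2 ^ i * S)" using i j by auto
        then have "q * 2 ^ j * S \<le> Q * 2 ^ i * S" by (simp add: mult.assoc)
        then have "q * 2 ^ j \<le> Q * 2 ^ i" using S by (rule mult_right_le_imp_le)
        then have "2 ^ j \<le> (Q / q) * 2 ^ i" using assms by (simp add: field_simps)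
        also have "\<dots> < 2 ^ L * 2 ^ i" using L by (intro mult_strict_right_mono) auto
        finally have "(2::real) ^ j < 2 ^ (L + i)" by (simp add: power_add)
        then have "j < L + i" by simp
        then show "j \<in> {i..<i + L}" using ij by auto
      qed
      then have "card ?A \<le> card {i..<i + L}" by (rule card_mono[rotated]) simp
      then show ?thesis by simp
    next
      case True
      show ?thesis unfolding True by simp
    qed
  qed
qed

lemma dyadic_floor:
  fixes n S :: real
  assumes "0 < S" "S \<le> n" obtains k where "2 ^ k * S \<le> n" "n < 2 ^ Suc k * S"
proof -
  obtain j :: nat where "n / S < 2 ^ j" using real_arch_pow[of 2 "n / S"] by auto
  then have ex: "n < 2 ^ j * S" using assms by (simp add: divide_less_eq)
  define i where "i = (LEAST j. n < 2 ^ j * S)"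
  have i: "n < 2 ^ i * S" unfolding i_def by (rule LeastI[of "\<lambda>j. n < 2 ^ j * S", OF ex])
  have "i \<noteq> 0" using i assms by (cases i) auto
  then obtain k where k: "i = Suc k" by (cases i) auto
  have "\<not> n < 2 ^ k * S" using not_less_Least[of k "\<lambda>j. n < 2 ^ j * S"] k unfolding i_def by simp
  then show ?thesis using i k by (intro that[of k]) (simp_all add: not_less)
qed

context poincare_sphericalization
begin

text \<open>
  The oscillation over \<open>{x. S \<le> N x}\<close> is bounded by telescoping over the dyadic annuli at the
  scales \<open>S\<^sub>k = 2 ^ k * S\<close>. The oscillation over the \<open>k\<close>-th annulus and the jump to the next
  one are at most multiples of \<open>\<kappa> S\<^sub>k * t k\<close>, where \<open>t k\<close> is affine in the average \<open>a k\<close> of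
  \<open>g powr p\<close>. Since \<open>\<kappa>\<close> is almost decreasing and the measure of \<open>{x. S\<^sub>k \<le> N x}\<close> is
  comparable to that of its first annulus, everything is summed up by bounded overlap. The affine
  upper bound \<open>t k\<close> for \<open>a k powr (1/p)\<close> replaces Hoelder's inequality: it makes the sum linear in
  the integrals of \<open>g powr p\<close> over the annuli.
\<close>

lemma tail_poincare:
  obtains q C where "0 < q" "q \<le> 1" "1 \<le> C"
    "\<And>G u g S T. \<lbrakk>admissible G u g; 1 \<le> S; {x \<in> X. q * S \<le> N x} \<subseteq> G; 0 < T;
      (\<integral>\<^sup>+x\<in>G. enn_powr (g x) p \<partial>\<nu>) \<le> ennreal (T powr p) * emeasure \<nu> G\<rbrakk> \<Longrightarrow>
      \<exists>c. (\<integral>\<^sup>+x\<in>{x \<in> X. S \<le> N x}. dev u c x \<partial>\<nu>) \<le> ennreal (C * \<kappa> S * T) * emeasure \<nu> G"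
proof -
  obtain q Q C1 where q: "0 < q" "q \<le> 1" "4 \<le> Q" "1 \<le> C1" and ann:
    "\<And>G u g S t z. \<lbrakk>admissible G u g; 1 \<le> S; z \<in> X; N z = 2 * S; {x \<in> X. q * S \<le> N x \<and> N x \<le> Q * S} \<subseteq> G; 0 < t;
      (\<integral>\<^sup>+x\<in>{x \<in> X. q * S \<le> N x \<and> N x \<le> Q * S}. enn_powr (g x) p \<partial>\<mu>) \<le> ennreal (t powr p * m z S)\<rbrakk> \<Longrightarrow>
      \<exists>c. (\<integral>\<^sup>+x\<in>{x \<in> X. S \<le> N x \<and> N x \<le> 4 * S}. dev u c x \<partial>\<mu>) \<le> ennreal (C1 * \<kappa> S * t * m z S)"
    by (rule annulus_poincare) blast
  define K where "K = max (1 / q) Q"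
  have K: "1 \<le> K" "Q \<le> K" "1 / q \<le> K" "4 \<le> K" using q by (auto simp: K_def)
  obtain C2 where C2: "1 \<le> C2" "\<And>s A f. \<lbrakk>1 \<le> s; A \<subseteq> X; \<And>y. y \<in> A \<Longrightarrow> N y \<le> K * s \<and> s \<le> K * N y;
      (\<lambda>x. f x * indicator A x) \<in> borel_measurable \<mu>\<rbrakk> \<Longrightarrow>
    (\<integral>\<^sup>+x\<in>A. f x \<partial>\<nu>) \<le> ennreal (C2 * \<rho> s powr \<sigma>) * (\<integral>\<^sup>+x\<in>A. f x \<partial>\<mu>) \<and>
    ennreal (\<rho> s powr \<sigma>) * (\<integral>\<^sup>+x\<in>A. f x \<partial>\<mu>) \<le> ennreal C2 * (\<integral>\<^sup>+x\<in>A. f x \<partial>\<nu>)"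
    by (rule nu_compare[OF K(1)]) blast
  obtain C3 where C3: "1 \<le> C3" "\<And>S z r. \<lbrakk>1 \<le> S; z \<in> X; N z \<le> 2 * S; 0 < r; S \<le> 2 * r\<rbrakk> \<Longrightarrow>
    emeasure \<nu> {y \<in> X. S \<le> N y} \<le> ennreal (C3 * \<rho> S powr \<sigma> * m z r)"
    by (rule nu_tail[of 2]) auto
  obtain C4 where C4: "1 \<le> C4" "\<And>s t. \<lbrakk>1 \<le> s; 1 \<le> t; s \<le> 1 * t\<rbrakk> \<Longrightarrow> \<kappa> t \<le> C4 * \<kappa> s"
    using kappa_almost_decreasing[of 1] by auto
  obtain Cm where Cm: "1 \<le> Cm" "\<And>x y r s. \<lbrakk>x \<in> X; y \<in> X; 0 < r; 0 < s; d x y + s \<le> 20 * r\<rbrakk> \<Longrightarrow> m y s \<le> Cm * m x r"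
    by (rule m_compare[of 20]) auto
  obtain L where L: "\<And>S n J. 0 < S \<Longrightarrow> card {j. j < J \<and> q * (2 ^ j * S) \<le> n \<and> n \<le> Q * (2 ^ j * S)} \<le> L"
    using dyadic_overlap[of q Q] q by auto
  define D where "D = C1 * Cm"
  have D: "0 \<le> D" using q(4) Cm(1) by (simp add: D_def)
  define D' where "D' = C2 * C1 + 2 * D * C3"
  have D': "0 \<le> D'" using C2(1) q(4) D C3(1) by (simp add: D'_def)
  define H where "H = D' * C4 * C2"
  have H: "0 \<le> H" using D' C4(1) C2(1) by (simp add: H_def)
  show ?thesis
  proof (rule that[OF q(1,2), of "max 1 (2 * H * real L)"])
    show "1 \<le> max 1 (2 * H * real L)" by simp
    fix G u g S T
    assume ad: "admissible G u g" and S: "1 \<le> S" and sub: "{x \<in> X. q * S \<le> N x} \<subseteq> G" and T: "0 < T"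
      and I: "(\<integral>\<^sup>+x\<in>G. enn_powr (g x) p \<partial>\<nu>) \<le> ennreal (T powr p) * emeasure \<nu> G"
    have G: "G \<in> sets \<mu>" "G \<subseteq> X" using ad admissible_subset[OF ad] by (auto simp: admissible_def open_mu)
    define Sk where "Sk k = 2 ^ k * S" for k :: nat
    have Sk: "S \<le> Sk k" "1 \<le> Sk k" for k
    proof -
      have "1 * S \<le> 2 ^ k * S" using S by (intro mult_right_mono) auto
      then show "S \<le> Sk k" "1 \<le> Sk k" unfolding Sk_def using S by linarith+
    qed
    have SkS: "Sk (Suc k) = 2 * Sk k" for k by (simp add: Sk_def)
    have Skm: "Sk j \<le> Sk k" if "j \<le> k" for j k
      unfolding Sk_def using that S by (intro mult_right_mono power_increasing) auto
    define B where "B k = {x \<in> X. q * Sk k \<le> N x \<and> N x \<le> Q * Sk k}" for k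
    define A where "A k = {x \<in> X. Sk k \<le> N x \<and> N x \<le> 4 * Sk k}" for k
    define E where "E k = {x \<in> X. Sk k \<le> N x}" for k
    have setsB: "B k \<in> sets \<mu>" "A k \<in> sets \<mu>" "E k \<in> sets \<mu>" for k
      unfolding B_def A_def E_def by (rule N_sets)+
    have BG: "B k \<subseteq> G" for k
    proof
      fix x assume x: "x \<in> B k"
      have "q * S \<le> q * Sk k" using q Sk by (intro mult_left_mono) auto
      then show "x \<in> G" using x sub by (auto simp: B_def)
    qed
    have EG: "E k \<subseteq> G" for k
    proof
      fix x assume x: "x \<in> E k"
      have "q * S \<le> 1 * S" using q S by (intro mult_right_mono) auto
      then show "x \<in> G" using x sub Sk(1)[of k] by (auto simp: E_def)
    qed
    have AE: "A k \<subseteq> E k" for k by (auto simp: A_def E_def)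
    have AB: "A k \<subseteq> B k" for k
    proof
      fix x assume x: "x \<in> A k"
      have "q * Sk k \<le> 1 * Sk k" "4 * Sk k \<le> Q * Sk k" using q Sk(2)[of k] by (intro mult_right_mono; simp)+
      then show "x \<in> B k" using x by (auto simp: A_def B_def)
    qed
    have comp: "N y \<le> K * Sk k \<and> Sk k \<le> K * N y" if "y \<in> B k" for y k
    proof
      have "Q * Sk k \<le> K * Sk k" using K Sk(2)[of k] by (intro mult_right_mono) auto
      then show "N y \<le> K * Sk k" using that by (auto simp: B_def)
      have "Sk k = (1 / q) * (q * Sk k)" using q by simp
      also have "\<dots> \<le> K * N y" using that K q Sk(2)[of k] by (intro mult_mono) (auto simp: B_def)
      finally show "Sk k \<le> K * N y" .
    qed
    have BX: "B k \<subseteq> X" "A k \<subseteq> X" for k by (auto simp: B_def A_def)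
    have "\<forall>k. \<exists>z. z \<in> X \<and> N z = 2 * Sk k"
    proof
      fix k
      obtain z where "z \<in> X" "N z = 2 * Sk k" by (rule N_attains[of "2 * Sk k"]) (use Sk(2)[of k] in auto)
      then show "\<exists>z. z \<in> X \<and> N z = 2 * Sk k" by blast
    qed
    then obtain z where z: "\<And>k. z k \<in> X" "\<And>k. N (z k) = 2 * Sk k" by metis
    define M where "M k = m (z k) (Sk k)" for k
    have Sk0: "0 < Sk k" for k using Sk(2)[of k] by linarith
    have M: "0 < M k" "emeasure \<mu> (mball (z k) (Sk k)) = ennreal (M k)" for k
      using emeasure_mball[OF z(1) Sk0] by (auto simp: M_def)
    define r where "r k = \<rho> (Sk k) powr \<sigma>" for k
    have r: "0 < r k" for k using rho_pos[OF Sk0, of k] by (simp add: r_def)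
    define h where "h k = (\<integral>\<^sup>+x\<in>B k. enn_powr (g x) p \<partial>\<mu>)" for k
    define J where "J k = (\<integral>\<^sup>+x\<in>B k. enn_powr (g x) p \<partial>\<nu>)" for k
    have gm: "(\<lambda>x. enn_powr (g x) p * indicator (B k) x) \<in> borel_measurable \<mu>" for k
      by (rule admissible_g_measurable[OF ad BG setsB(1)])
    have hJ: "ennreal (r k) * h k \<le> ennreal C2 * J k" for k
      using C2(2)[OF Sk(2) BX(1) comp gm] unfolding r_def h_def J_def by blast
    have nuG: "emeasure \<nu> G < \<infinity>" by (rule nu_finite_sets)
    have JG: "J k \<le> (\<integral>\<^sup>+x\<in>G. enn_powr (g x) p \<partial>\<nu>)" for k
      unfolding J_def using BG[of k] by (intro nn_integral_mono) (auto simp: indicator_def)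
    have "(\<integral>\<^sup>+x\<in>G. enn_powr (g x) p \<partial>\<nu>) < \<infinity>"
      using nuG by (intro le_less_trans[OF I]) (auto simp: ennreal_mult_less_top)
    then have Jf: "J k < \<infinity>" for k using JG le_less_trans by blast
    have hf: "h k < \<infinity>" for k
    proof -
      have "ennreal (r k) * h k < \<infinity>" using Jf[of k] by (intro le_less_trans[OF hJ]) (auto simp: ennreal_mult_less_top)
      then show ?thesis using r[of k] by (auto simp: ennreal_mult_less_top)
    qed
    define a where "a k = enn2real (h k) / M k" for k
    have a: "0 \<le> a k" "h k = ennreal (a k * M k)" for k
      using M(1)[of k] hf[of k] by (auto simp: a_def)
    define t where "t k = T + T powr (1 - p) * a k" for k
    have t: "0 < t k" "a k \<le> t k powr p" for k
      using T a(1)[of k] weak_young[OF T a(1) p] by (auto simp: t_def intro!: add_pos_nonneg)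
    have "\<exists>c. (\<integral>\<^sup>+x\<in>A k. dev u c x \<partial>\<mu>) \<le> ennreal (C1 * \<kappa> (Sk k) * t k * M k)" for k
    proof -
      have "(\<integral>\<^sup>+x\<in>B k. enn_powr (g x) p \<partial>\<mu>) \<le> ennreal (t k powr p * m (z k) (Sk k))"
        using a(2)[of k] ennreal_leI[OF mult_right_mono[OF t(2)[of k], of "M k"]] M(1)[of k]
        by (simp add: h_def M_def)
      from ann[OF ad Sk(2) z BG[unfolded B_def] t(1) this[unfolded B_def]]
      show ?thesis by (simp add: A_def M_def)
    qed
    then obtain c where c: "\<And>k. (\<integral>\<^sup>+x\<in>A k. dev u (c k) x \<partial>\<mu>) \<le> ennreal (C1 * \<kappa> (Sk k) * t k * M k)" by metis
    define Qk where "Qk k = \<kappa> (Sk k) * t k" for k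
    have Qk: "0 \<le> Qk k" for k using kappa_pos[OF Sk(2)[of k]] t(1)[of k] by (simp add: Qk_def)
    have cQ: "(\<integral>\<^sup>+x\<in>A k. dev u (c k) x \<partial>\<mu>) \<le> ennreal (C1 * Qk k * M k)" for k
      using c[of k] by (simp add: Qk_def mult.assoc)
    note um = admissible_measurable(1)[OF ad]
    have AG: "A k \<subseteq> G" for k using AB BG by blast
    have jump: "\<bar>c k - c (Suc k)\<bar> \<le> D * (Qk k + Qk (Suc k))" for k
    proof -
      obtain y where y: "y \<in> X" "N y = 3 * Sk k" by (rule N_attains[of "3 * Sk k"]) (use Sk(2)[of k] in auto)
      have s2: "0 < Sk k / 2" using Sk0[of k] by simp
      have near: "5/2 * Sk k \<le> N x \<and> N x \<le> 7/2 * Sk k \<and> x \<in> X" if "x \<in> mball y (Sk k / 2)" for x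
        using that N_lip[of x y] N_lip[of y x] y commute[of x y] by auto
      have sub1: "mball y (Sk k / 2) \<subseteq> A k" "mball y (Sk k / 2) \<subseteq> A (Suc k)"
        using near Sk0[of k] by (fastforce simp: A_def SkS)+
      have dz: "d y (z k) \<le> 5 * Sk k" "d y (z (Suc k)) \<le> 7 * Sk k"
        using dist_le_N[OF y(1) z(1), of k] dist_le_N[OF y(1) z(1), of "Suc k"] y z(2)[of k] z(2)[of "Suc k"]
        by (auto simp: SkS)
      have M1: "M k \<le> Cm * m y (Sk k / 2)"
        unfolding M_def by (rule Cm(2)) (use y z dz s2 in auto)
      have M2: "M (Suc k) \<le> Cm * m y (Sk k / 2)"
        unfolding M_def by (rule Cm(2)) (use y z dz s2 in \<open>auto simp: SkS\<close>)
      have my: "0 < m y (Sk k / 2)" "emeasure \<mu> (mball y (Sk k / 2)) = ennreal (m y (Sk k / 2))"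
        using emeasure_mball[OF y(1) s2] by auto
      have "ennreal (\<bar>c k - c (Suc k)\<bar> * m y (Sk k / 2)) = ennreal \<bar>c k - c (Suc k)\<bar> * emeasure \<mu> (mball y (Sk k / 2))"
        using my by (simp add: ennreal_mult)
      also have "\<dots> \<le> (\<integral>\<^sup>+x\<in>A k. dev u (c k) x \<partial>\<mu>) + (\<integral>\<^sup>+x\<in>A (Suc k). dev u (c (Suc k)) x \<partial>\<mu>)"
        by (rule const_diff_le[OF um mball_mu setsB(2) setsB(2) sub1 AG AG])
      also have "\<dots> \<le> ennreal (C1 * Qk k * M k) + ennreal (C1 * Qk (Suc k) * M (Suc k))" by (intro add_mono cQ)
      also have "\<dots> = ennreal (C1 * Qk k * M k + C1 * Qk (Suc k) * M (Suc k))"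
        using q(4) Qk M(1)[of k] M(1)[of "Suc k"] by (intro ennreal_plus[symmetric] mult_nonneg_nonneg) (auto intro: less_imp_le)
      finally have "\<bar>c k - c (Suc k)\<bar> * m y (Sk k / 2) \<le> C1 * Qk k * M k + C1 * Qk (Suc k) * M (Suc k)"
        using q(4) Qk M(1)[of k] M(1)[of "Suc k"]
        by (subst (asm) ennreal_le_iff) (auto intro!: add_nonneg_nonneg mult_nonneg_nonneg intro: less_imp_le)
      also have "\<dots> \<le> C1 * Qk k * (Cm * m y (Sk k / 2)) + C1 * Qk (Suc k) * (Cm * m y (Sk k / 2))"
        using q(4) Qk M1 M2 by (intro add_mono mult_left_mono) auto
      also have "\<dots> = D * (Qk k + Qk (Suc k)) * m y (Sk k / 2)" by (simp add: D_def algebra_simps)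
      finally show ?thesis using my by simp
    qed
    have tele: "\<bar>c 0 - c k\<bar> \<le> 2 * D * (\<Sum>j<Suc k. Qk j)" for k
    proof -
      have "\<bar>c 0 - c k\<bar> \<le> D * (\<Sum>j<k. Qk j + Qk (Suc j))"
      proof (induction k)
        case (Suc k)
        then show ?case using jump[of k] by (simp add: distrib_left)
      qed simp
      also have "(\<Sum>j<k. Qk j + Qk (Suc j)) = (\<Sum>j<k. Qk j) + (\<Sum>j<k. Qk (Suc j))" by (rule sum.distrib)
      also have "D * ((\<Sum>j<k. Qk j) + (\<Sum>j<k. Qk (Suc j))) \<le> D * ((\<Sum>j<Suc k. Qk j) + (\<Sum>j<Suc k. Qk j))"
      proof (intro mult_left_mono[OF add_mono D])
        show "(\<Sum>j<k. Qk j) \<le> (\<Sum>j<Suc k. Qk j)" using Qk[of k] by simp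
        show "(\<Sum>j<k. Qk (Suc j)) \<le> (\<Sum>j<Suc k. Qk j)" using Qk[of 0] by (simp only: sum.lessThan_Suc_shift)
      qed
      finally show ?thesis by (simp add: algebra_simps)
    qed
    \<comment> \<open>The oscillation over each annulus, and the jump at scale \<open>k\<close>, which is felt by all points beyond this scale.\<close>
    define F1 where "F1 k x = dev u (c k) x * indicator (A k) x" for k x
    define F2 where "F2 k x = ennreal (2 * D * Qk k) * indicator (E k) x" for k x
    have F1m: "F1 k \<in> borel_measurable \<mu>" for k
      unfolding F1_def[abs_def] by (rule dev_measurable[OF um AG setsB(2)])
    have F2m: "F2 k \<in> borel_measurable \<mu>" for k
      unfolding F2_def[abs_def] using setsB(3)[of k] by simp
    have F1n[measurable]: "F1 k \<in> borel_measurable \<nu>" and F2n[measurable]: "F2 k \<in> borel_measurable \<nu>" for k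
      using F1m[of k] F2m[of k] unfolding measurable_cong_sets[OF sets_nu(1) refl] by auto
    have pw: "dev u (c 0) x * indicator {x \<in> X. S \<le> N x} x \<le> (\<Sum>k. F1 k x) + (\<Sum>k. F2 k x)" for x
    proof (cases "x \<in> X \<and> S \<le> N x")
      case True
      have S0: "0 < S" using S by simp
      obtain k where k: "2 ^ k * S \<le> N x" "N x < 2 ^ Suc k * S"
        by (rule dyadic_floor[OF S0, of "N x"]) (use True in auto)
      have xA: "x \<in> A k" using k True Sk0[of k] by (auto simp: A_def Sk_def)
      have xE: "x \<in> E j" if "j \<le> k" for j
        using Skm[OF that] k(1) True by (auto simp: E_def Sk_def)
      have "dev u (c 0) x \<le> dev u (c k) x + ennreal \<bar>c 0 - c k\<bar>" by (rule dev_triangle)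
      also have "dev u (c k) x = F1 k x" using xA by (simp add: F1_def)
      also have "F1 k x \<le> (\<Sum>k. F1 k x)" using sum_le_suminf[of "\<lambda>k. F1 k x" "{k}"] by simp
      also have "ennreal \<bar>c 0 - c k\<bar> \<le> ennreal (2 * D * (\<Sum>j<Suc k. Qk j))" by (rule ennreal_leI[OF tele])
      also have "\<dots> = (\<Sum>j<Suc k. ennreal (2 * D * Qk j))"
        unfolding sum_distrib_left using D Qk by (intro sum_ennreal[symmetric]) auto
      also have "\<dots> = (\<Sum>j<Suc k. F2 j x)"
        by (intro sum.cong) (auto simp: F2_def xE)
      also have "\<dots> \<le> (\<Sum>k. F2 k x)" by (rule sum_le_suminf) auto
      finally show ?thesis using True by (simp add: add_mono)
    qed simp
    have "(\<integral>\<^sup>+x\<in>{x \<in> X. S \<le> N x}. dev u (c 0) x \<partial>\<nu>) \<le> (\<integral>\<^sup>+x. (\<Sum>k. F1 k x) + (\<Sum>k. F2 k x) \<partial>\<nu>)"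
      by (intro nn_integral_mono pw)
    also have "\<dots> = (\<integral>\<^sup>+x. (\<Sum>k. F1 k x) \<partial>\<nu>) + (\<integral>\<^sup>+x. (\<Sum>k. F2 k x) \<partial>\<nu>)"
      by (rule nn_integral_add) measurable
    also have "\<dots> = (\<Sum>k. \<integral>\<^sup>+x. F1 k x \<partial>\<nu>) + (\<Sum>k. \<integral>\<^sup>+x. F2 k x \<partial>\<nu>)"
      by (intro arg_cong2[of _ _ _ _ "(+)"] nn_integral_suminf F1n F2n)
    also have "\<dots> = (\<Sum>k. (\<integral>\<^sup>+x. F1 k x \<partial>\<nu>) + (\<integral>\<^sup>+x. F2 k x \<partial>\<nu>))" by (rule suminf_add) auto
    also have "\<dots> \<le> (\<Sum>k. ennreal (H * \<kappa> S) * (ennreal T * emeasure \<nu> (B k) + ennreal (T powr (1 - p)) * J k))"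
    proof (rule suminf_le)
      fix k
      have i1: "(\<integral>\<^sup>+x. F1 k x \<partial>\<nu>) \<le> ennreal (C2 * C1 * (Qk k * (r k * M k)))"
      proof -
        have "(\<integral>\<^sup>+x. F1 k x \<partial>\<nu>) \<le> ennreal (C2 * r k) * (\<integral>\<^sup>+x\<in>A k. dev u (c k) x \<partial>\<mu>)"
          using C2(2)[of "Sk k" "A k" "dev u (c k)"] Sk(2) BX(2) comp AB[of k] F1m[of k] unfolding F1_def[abs_def] r_def by blast
        also have "\<dots> \<le> ennreal (C2 * r k) * ennreal (C1 * Qk k * M k)" by (intro mult_left_mono cQ) auto
        also have "\<dots> = ennreal (C2 * C1 * (Qk k * (r k * M k)))"
          using C2(1) r[of k] q(4) Qk[of k] M(1)[of k] by (subst ennreal_mult[symmetric]) (auto simp: mult_ac)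
        finally show ?thesis .
      qed
      have i2: "(\<integral>\<^sup>+x. F2 k x \<partial>\<nu>) \<le> ennreal (2 * D * C3 * (Qk k * (r k * M k)))"
      proof -
        have "(\<integral>\<^sup>+x. F2 k x \<partial>\<nu>) = ennreal (2 * D * Qk k) * emeasure \<nu> (E k)"
          unfolding F2_def by (rule nn_integral_cmult_indicator) (simp add: setsB)
        also have "\<dots> \<le> ennreal (2 * D * Qk k) * ennreal (C3 * r k * M k)"
          unfolding E_def r_def M_def using Sk(2)[of k] z Sk0[of k] by (intro mult_left_mono C3(2)) auto
        also have "\<dots> = ennreal (2 * D * C3 * (Qk k * (r k * M k)))"
          using D Qk[of k] C3(1) r[of k] M(1)[of k] by (subst ennreal_mult[symmetric]) (auto simp: mult_ac)
        finally show ?thesis .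
      qed
      have rM: "ennreal (r k * M k) \<le> ennreal C2 * emeasure \<nu> (B k)"
      proof -
        have Bk: "mball (z k) (Sk k) \<subseteq> B k"
        proof
          fix x assume x: "x \<in> mball (z k) (Sk k)"
          then have "Sk k \<le> N x" "N x \<le> 4 * Sk k" "x \<in> X"
            using N_lip[of x "z k"] N_lip[of "z k" x] z[of k] commute[of x "z k"] by auto
          then show "x \<in> B k" using AB by (auto simp: A_def)
        qed
        have cb: "N y \<le> K * Sk k \<and> Sk k \<le> K * N y" if "y \<in> mball (z k) (Sk k)" for y
          using comp Bk that by blast
        have im: "(\<lambda>x. 1 * indicator (mball (z k) (Sk k)) x :: ennreal) \<in> borel_measurable \<mu>"
          using mball_mu by simp
        have "ennreal (r k * M k) = ennreal (r k) * (\<integral>\<^sup>+x\<in>mball (z k) (Sk k). 1 \<partial>\<mu>)"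
          using M[of k] r[of k] mball_mu by (simp add: ennreal_mult)
        also have "\<dots> \<le> ennreal C2 * (\<integral>\<^sup>+x\<in>mball (z k) (Sk k). 1 \<partial>\<nu>)"
          using C2(2)[OF Sk(2) mball_subset_mspace cb im] unfolding r_def by blast
        also have "\<dots> \<le> ennreal C2 * emeasure \<nu> (B k)"
          using Bk setsB(1)[of k] mball_mu by (intro mult_left_mono) (auto intro!: emeasure_mono)
        finally show ?thesis .
      qed
      have kS: "\<kappa> (Sk k) \<le> C4 * \<kappa> S" by (rule C4(2)) (use S Sk[of k] in auto)
      have kp: "0 < \<kappa> S" by (rule kappa_pos[OF S])
      have "Qk k * (r k * M k) = \<kappa> (Sk k) * (t k * (r k * M k))" by (simp add: Qk_def)
      also have "\<dots> \<le> (C4 * \<kappa> S) * (t k * (r k * M k))"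
        using kS t(1)[of k] r[of k] M(1)[of k] by (intro mult_right_mono) (auto intro!: mult_nonneg_nonneg intro: less_imp_le)
      also have "t k * (r k * M k) = T * (r k * M k) + T powr (1 - p) * (r k * (a k * M k))"
        by (simp add: t_def algebra_simps)
      finally have Qb: "Qk k * (r k * M k) \<le> C4 * \<kappa> S * (T * (r k * M k) + T powr (1 - p) * (r k * (a k * M k)))" .
      have nn: "0 \<le> r k * M k" "0 \<le> r k * (a k * M k)" using r[of k] M(1)[of k] a(1)[of k] by auto
      have "(\<integral>\<^sup>+x. F1 k x \<partial>\<nu>) + (\<integral>\<^sup>+x. F2 k x \<partial>\<nu>) \<le> ennreal (C2 * C1 * (Qk k * (r k * M k))) + ennreal (2 * D * C3 * (Qk k * (r k * M k)))"
        by (intro add_mono i1 i2)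
      also have "\<dots> = ennreal (D' * (Qk k * (r k * M k)))"
        using C2(1) q(4) Qk[of k] nn(1) D C3(1) r[of k] M(1)[of k]
        by (subst ennreal_plus[symmetric]) (auto simp: D'_def algebra_simps intro!: mult_nonneg_nonneg)
      also have "\<dots> \<le> ennreal (D' * (C4 * \<kappa> S * (T * (r k * M k) + T powr (1 - p) * (r k * (a k * M k)))))"
        by (intro ennreal_leI mult_left_mono Qb D')
      also have "\<dots> = ennreal (D' * C4 * \<kappa> S) * (ennreal T * ennreal (r k * M k) + ennreal (T powr (1 - p)) * ennreal (r k * (a k * M k)))"
        using D' C4(1) kp T nn by (simp add: ennreal_mult[symmetric] ennreal_plus[symmetric] mult.assoc del: ennreal_plus)
      also have "ennreal (r k * (a k * M k)) = ennreal (r k) * h k"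
        using r[of k] a[of k] M(1)[of k] by (simp add: ennreal_mult)
      also have "ennreal (D' * C4 * \<kappa> S) * (ennreal T * ennreal (r k * M k) + ennreal (T powr (1 - p)) * (ennreal (r k) * h k))
        \<le> ennreal (D' * C4 * \<kappa> S) * (ennreal T * (ennreal C2 * emeasure \<nu> (B k)) + ennreal (T powr (1 - p)) * (ennreal C2 * J k))"
        by (intro mult_left_mono add_mono rM hJ) auto
      also have "\<dots> = ennreal (D' * C4 * \<kappa> S) * (ennreal C2 * (ennreal T * emeasure \<nu> (B k) + ennreal (T powr (1 - p)) * J k))"
        by (simp add: distrib_left mult.left_commute)
      also have "\<dots> = ennreal (H * \<kappa> S) * (ennreal T * emeasure \<nu> (B k) + ennreal (T powr (1 - p)) * J k)"
      proof -
        have "ennreal (H * \<kappa> S) = ennreal (D' * C4 * \<kappa> S) * ennreal C2"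
          using D' C4(1) kp C2(1) by (simp add: H_def ennreal_mult[symmetric] mult_ac)
        then show ?thesis by (simp add: mult.assoc)
      qed
      finally show "(\<integral>\<^sup>+x. F1 k x \<partial>\<nu>) + (\<integral>\<^sup>+x. F2 k x \<partial>\<nu>) \<le> ennreal (H * \<kappa> S) * (ennreal T * emeasure \<nu> (B k) + ennreal (T powr (1 - p)) * J k)" .
    qed auto
    also have "\<dots> = ennreal (H * \<kappa> S) * (ennreal T * (\<Sum>k. emeasure \<nu> (B k)) + ennreal (T powr (1 - p)) * (\<Sum>k. J k))"
      by (simp add: ennreal_suminf_cmult suminf_add[symmetric])
    also have "\<dots> \<le> ennreal (H * \<kappa> S) * (ennreal T * (ennreal (real L) * emeasure \<nu> G) + ennreal (T powr (1 - p)) * (ennreal (real L) * (ennreal (T powr p) * emeasure \<nu> G)))"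
    proof -
      have cnt: "(\<Sum>k. indicator (B k) x :: ennreal) \<le> ennreal (real L)" for x
      proof (rule suminf_le_const)
        fix n
        have "(\<Sum>k<n. indicator (B k) x :: ennreal) \<le> of_nat (card {j. j < n \<and> q * (2 ^ j * S) \<le> N x \<and> N x \<le> Q * (2 ^ j * S)})"
        proof -
          have "(\<Sum>k<n. indicator (B k) x :: ennreal) \<le> (\<Sum>k<n. indicator {j. j < n \<and> q * (2 ^ j * S) \<le> N x \<and> N x \<le> Q * (2 ^ j * S)} k)"
            by (intro sum_mono) (auto simp: indicator_def B_def Sk_def)
          also have "\<dots> = of_nat (card ({..<n} \<inter> {j. j < n \<and> q * (2 ^ j * S) \<le> N x \<and> N x \<le> Q * (2 ^ j * S)}))"
            by (simp add: indicator_def sum.If_cases of_bool_def) (rule arg_cong[of _ _ card], auto)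
          also have "{..<n} \<inter> {j. j < n \<and> q * (2 ^ j * S) \<le> N x \<and> N x \<le> Q * (2 ^ j * S)} = {j. j < n \<and> q * (2 ^ j * S) \<le> N x \<and> N x \<le> Q * (2 ^ j * S)}" by auto
          finally show ?thesis .
        qed
        also have "\<dots> \<le> of_nat L" using L[of S n "N x"] S by (intro of_nat_mono) auto
        finally show "(\<Sum>k<n. indicator (B k) x :: ennreal) \<le> ennreal (real L)" by (simp add: ennreal_of_nat_eq_real_of_nat)
      qed auto
      have ov: "(\<Sum>k. \<integral>\<^sup>+x\<in>B k. f x \<partial>\<nu>) \<le> ennreal (real L) * (\<integral>\<^sup>+x\<in>G. f x \<partial>\<nu>)"
        if fm: "\<And>k. (\<lambda>x. f x * indicator (B k) x) \<in> borel_measurable \<mu>" and fG: "(\<lambda>x. f x * indicator G x) \<in> borel_measurable \<mu>" for f :: "'a \<Rightarrow> ennreal"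
      proof -
        have "(\<Sum>k. \<integral>\<^sup>+x\<in>B k. f x \<partial>\<nu>) = (\<integral>\<^sup>+x. (\<Sum>k. f x * indicator (B k) x) \<partial>\<nu>)"
          by (intro nn_integral_suminf[symmetric]) (simp only: measurable_cong_sets[OF sets_nu(1) refl] fm)
        also have "\<dots> \<le> (\<integral>\<^sup>+x. ennreal (real L) * (f x * indicator G x) \<partial>\<nu>)"
        proof (rule nn_integral_mono)
          fix x
          show "(\<Sum>k. f x * indicator (B k) x) \<le> ennreal (real L) * (f x * indicator G x)"
          proof (cases "x \<in> G")
            case True
            then show ?thesis using mult_left_mono[OF cnt[of x], of "f x"] by (simp add: ennreal_suminf_cmult mult.commute)
          next
            case False
            then have "indicator (B k) x = (0::ennreal)" for k using BG[of k] by (auto simp: indicator_def)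
            then show ?thesis by simp
          qed
        qed
        also have "\<dots> = ennreal (real L) * (\<integral>\<^sup>+x\<in>G. f x \<partial>\<nu>)"
          by (intro nn_integral_cmult) (simp only: measurable_cong_sets[OF sets_nu(1) refl] fG)
        finally show ?thesis .
      qed
      have "(\<Sum>k. \<integral>\<^sup>+x\<in>B k. 1 \<partial>\<nu>) \<le> ennreal (real L) * (\<integral>\<^sup>+x\<in>G. 1 \<partial>\<nu>)"
        by (rule ov) (use setsB(1) G(1) in simp_all)
      then have o1: "(\<Sum>k. emeasure \<nu> (B k)) \<le> ennreal (real L) * emeasure \<nu> G"
        using setsB(1) G(1) by simp
      have "(\<Sum>k. J k) \<le> ennreal (real L) * (\<integral>\<^sup>+x\<in>G. enn_powr (g x) p \<partial>\<nu>)"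
        unfolding J_def by (rule ov[OF gm admissible_measurable(3)[OF ad]])
      also have "\<dots> \<le> ennreal (real L) * (ennreal (T powr p) * emeasure \<nu> G)" by (intro mult_left_mono I) auto
      finally show ?thesis using o1 by (intro mult_left_mono add_mono) auto
    qed
    also have "\<dots> = ennreal (2 * H * real L * \<kappa> S * T) * emeasure \<nu> G"
    proof -
      have kp: "0 < \<kappa> S" by (rule kappa_pos[OF S])
      have TT: "T powr (1 - p) * T powr p = T" using T by (simp flip: powr_add)
      have "ennreal (T powr (1 - p)) * (ennreal (real L) * (ennreal (T powr p) * emeasure \<nu> G)) =
         (ennreal (T powr (1 - p)) * ennreal (T powr p)) * (ennreal (real L) * emeasure \<nu> G)" by (simp add: mult_ac)
      also have "ennreal (T powr (1 - p)) * ennreal (T powr p) = ennreal T" using TT by (simp add: ennreal_mult[symmetric])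
      finally have e: "ennreal (T powr (1 - p)) * (ennreal (real L) * (ennreal (T powr p) * emeasure \<nu> G)) = ennreal T * (ennreal (real L) * emeasure \<nu> G)" .
      have "ennreal (2 * H * real L * \<kappa> S * T) = ennreal (H * \<kappa> S) * (2 * (ennreal T * ennreal (real L)))"
        using H kp T by (simp add: ennreal_mult mult_ac)
      then show ?thesis unfolding e by (simp add: mult_2[symmetric] mult.assoc)
    qed
    also have "\<dots> \<le> ennreal (max 1 (2 * H * real L) * \<kappa> S * T) * emeasure \<nu> G"
      using kappa_pos[OF S] T by (intro mult_right_mono ennreal_leI) auto
    finally show "\<exists>c. (\<integral>\<^sup>+x\<in>{x \<in> X. S \<le> N x}. dev u c x \<partial>\<nu>) \<le> ennreal (max 1 (2 * H * real L) * \<kappa> S * T) * emeasure \<nu> G" by blast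
  qed
qed

section \<open>The Poincare inequality for the sphericalized space\<close>

lemma nu_ball_scale:
  assumes "1 \<le> K"
  obtains C where "1 \<le> C" "\<And>x r. \<lbrakk>x \<in> X; 0 < (r::real)\<rbrakk> \<Longrightarrow>
    emeasure \<nu> (sph.mball x (K * r)) \<le> ennreal C * emeasure \<nu> (sph.mball x r)"
proof -
  obtain C where C: "1 < C" "\<And>x r. \<lbrakk>x \<in> X; 0 < (r::real)\<rbrakk> \<Longrightarrow>
    emeasure \<nu> (sph.mball x (2 * r)) \<le> ennreal C * emeasure \<nu> (sph.mball x r)"
    by (rule nu_doubling_const) blast
  obtain k where k: "K \<le> 2 ^ k" using real_arch_pow[of 2 K] by (auto intro: less_imp_le)
  have pow: "emeasure \<nu> (sph.mball x (2 ^ k * r)) \<le> ennreal (C ^ k) * emeasure \<nu> (sph.mball x r)"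
    if "x \<in> X" "0 < r" for x r k
  proof (induction k)
    case (Suc k)
    have "emeasure \<nu> (sph.mball x (2 * (2 ^ k * r))) \<le> ennreal C * emeasure \<nu> (sph.mball x (2 ^ k * r))"
      by (rule C(2)) (use that in auto)
    also have "\<dots> \<le> ennreal C * (ennreal (C ^ k) * emeasure \<nu> (sph.mball x r))" by (intro mult_left_mono Suc) auto
    also have "\<dots> = ennreal (C ^ Suc k) * emeasure \<nu> (sph.mball x r)" using C(1) by (simp add: ennreal_mult mult.assoc)
    finally show ?case by (simp add: mult.assoc)
  qed simp
  show ?thesis
  proof (rule that[of "C ^ k"])
    show "1 \<le> C ^ k" using C(1) by simp
    fix x and r :: real assume x: "x \<in> X" "0 < r"
    have "K * r \<le> 2 ^ k * r" using k x by (intro mult_right_mono) auto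
    then have "emeasure \<nu> (sph.mball x (K * r)) \<le> emeasure \<nu> (sph.mball x (2 ^ k * r))"
      by (intro emeasure_mono sph.mball_subset_concentric) (simp_all add: sph_mball_mu)
    also note pow[OF x]
    finally show "emeasure \<nu> (sph.mball x (K * r)) \<le> ennreal (C ^ k) * emeasure \<nu> (sph.mball x r)" .
  qed
qed

text \<open>
  A ball whose radius is small compared with \<open>\<kappa> (N x)\<close> lies between comparable \<open>d\<close>-balls on which
  the weight is essentially constant.
\<close>

lemma small_ball_poincare:
  obtains \<Lambda>' C where "1 \<le> \<Lambda>'" "1 \<le> C"
    "\<And>x r u g G T. \<lbrakk>x \<in> X; 0 < r; 4 * CA\<^sup>2 * \<Lambda> * r \<le> \<kappa> (N x); admissible G u g; sph.mball x (\<Lambda>' * r) \<subseteq> G; 0 < T;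
      (\<integral>\<^sup>+y\<in>G. enn_powr (g y) p \<partial>\<nu>) \<le> ennreal (T powr p) * emeasure \<nu> (sph.mball x r)\<rbrakk> \<Longrightarrow>
      \<exists>c. (\<integral>\<^sup>+y\<in>sph.mball x r. dev u c y \<partial>\<nu>) \<le> ennreal (C * r * T) * emeasure \<nu> (sph.mball x r)"
proof -
  obtain C1 where C1: "1 \<le> C1" "\<And>x R. \<lbrakk>x \<in> X; 0 < R; R \<le> N x / 2\<rbrakk> \<Longrightarrow> mball x R \<subseteq> sph.mball x (C1 * \<rho> (N x) * R)"
    by (rule ball_subset_sph) blast
  obtain C2 where C2: "1 \<le> C2" "\<And>s A f. \<lbrakk>1 \<le> s; A \<subseteq> X; \<And>y. y \<in> A \<Longrightarrow> N y \<le> 2 * s \<and> s \<le> 2 * N y;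
      (\<lambda>x. f x * indicator A x) \<in> borel_measurable \<mu>\<rbrakk> \<Longrightarrow>
    (\<integral>\<^sup>+x\<in>A. f x \<partial>\<nu>) \<le> ennreal (C2 * \<rho> s powr \<sigma>) * (\<integral>\<^sup>+x\<in>A. f x \<partial>\<mu>) \<and>
    ennreal (\<rho> s powr \<sigma>) * (\<integral>\<^sup>+x\<in>A. f x \<partial>\<mu>) \<le> ennreal C2 * (\<integral>\<^sup>+x\<in>A. f x \<partial>\<nu>)"
    by (rule nu_compare[of 2]) auto
  obtain C3 where C3: "1 \<le> C3" "\<And>x r. \<lbrakk>x \<in> X; 0 < r; 4 * CA\<^sup>2 * r \<le> \<kappa> (N x)\<rbrakk> \<Longrightarrow>
     emeasure \<nu> (sph.mball x r) \<le> ennreal (C3 * (\<rho> (N x) powr \<sigma> * m x (2 * CA\<^sup>2 * r / \<rho> (N x)))) \<and>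
     ennreal (\<rho> (N x) powr \<sigma> * m x (2 * CA\<^sup>2 * r / \<rho> (N x))) \<le> ennreal C3 * emeasure \<nu> (sph.mball x r)"
    by (rule nu_small_sph_ball) blast
  obtain C4 where C4: "1 \<le> C4" "\<And>G u g y s t. \<lbrakk>admissible G u g; y \<in> X; 0 < s; \<Lambda> * s \<le> N y / 2; mball y (\<Lambda> * s) \<subseteq> G; 0 < t;
    (\<integral>\<^sup>+x\<in>mball y (\<Lambda> * s). enn_powr (g x) p \<partial>\<mu>) \<le> ennreal (t powr p) * emeasure \<mu> (mball y (\<Lambda> * s))\<rbrakk> \<Longrightarrow>
    \<exists>c. (\<integral>\<^sup>+x\<in>mball y s. dev u c x \<partial>\<mu>) \<le> ennreal (C4 * (s * \<rho> (N y)) * t * m y s)"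
    by (rule local_poincare) blast
  have CA2: "1 \<le> CA\<^sup>2" using CA(1) by simp
  define K1 where "K1 = C2 * C3"
  have "1 * 1 \<le> K1" unfolding K1_def using C2(1) C3(1) by (intro mult_mono) auto
  then have K1: "1 \<le> K1" by simp
  define \<Lambda>' where "\<Lambda>' = 2 * CA\<^sup>2 * C1 * \<Lambda>"
  have "1 * 1 * 1 \<le> (2 * CA\<^sup>2) * C1 * \<Lambda>"
  proof (intro mult_mono)
    show "1 \<le> 2 * CA\<^sup>2" using CA2 by linarith
  qed (use C1(1) Lambda in auto)
  then have L1: "1 \<le> \<Lambda>'" by (simp add: \<Lambda>'_def)
  define D where "D = C2 * C4 * (2 * CA\<^sup>2) * K1 * C3"
  have D: "0 \<le> D" using C2(1) C4(1) K1 C3(1) by (simp add: D_def)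
  show ?thesis
  proof (rule that[OF L1, of "max 1 D"])
    show "1 \<le> max 1 D" by simp
    fix x r u g G T
    assume x: "x \<in> X" "0 < r" and small: "4 * CA\<^sup>2 * \<Lambda> * r \<le> \<kappa> (N x)" and ad: "admissible G u g"
      and sub: "sph.mball x (\<Lambda>' * r) \<subseteq> G" and T: "0 < T"
      and I: "(\<integral>\<^sup>+y\<in>G. enn_powr (g y) p \<partial>\<nu>) \<le> ennreal (T powr p) * emeasure \<nu> (sph.mball x r)"
    have Nx: "1 < N x" by (rule N_gt1[OF x(1)])
    have rx: "0 < \<rho> (N x)" using rho_pos Nx by auto
    have CAr: "0 < CA\<^sup>2 * r" using CA2 x(2) by (intro mult_pos_pos) auto
    have "1 * (4 * (CA\<^sup>2 * r)) \<le> \<Lambda> * (4 * (CA\<^sup>2 * r))" using Lambda CAr by (intro mult_right_mono) auto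
    then have small1: "4 * CA\<^sup>2 * r \<le> \<kappa> (N x)" using small by (simp add: mult_ac)
    have small2: "2 * CA\<^sup>2 * r \<le> \<kappa> (N x)" using small1 CAr by linarith
    define s where "s = 2 * CA\<^sup>2 * r / \<rho> (N x)"
    have s: "0 < s" unfolding s_def by (intro divide_pos_pos rx) (use CAr in linarith)
    have srho: "s * \<rho> (N x) = 2 * CA\<^sup>2 * r" using rx by (simp add: s_def)
    have "\<Lambda> * s * 2 * \<rho> (N x) \<le> N x * \<rho> (N x)"
    proof -
      have "\<Lambda> * s * 2 * \<rho> (N x) = 2 * \<Lambda> * (s * \<rho> (N x))" by simp
      also have "\<dots> = 4 * CA\<^sup>2 * \<Lambda> * r" unfolding srho by simp
      also have "\<dots> \<le> \<kappa> (N x)" by (rule small)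
      finally show ?thesis unfolding \<kappa>_def .
    qed
    then have Ls: "\<Lambda> * s \<le> N x / 2" using rx by simp
    have "1 * s \<le> \<Lambda> * s" using Lambda s by (intro mult_right_mono) auto
    then have sL: "s \<le> \<Lambda> * s" "0 < \<Lambda> * s" using s by linarith+
    let ?b = "mball x (\<Lambda> * s)"
    have bG: "?b \<subseteq> G"
    proof -
      have "?b \<subseteq> sph.mball x (C1 * \<rho> (N x) * (\<Lambda> * s))" by (rule C1(2)[OF x(1) sL(2) Ls])
      also have "C1 * \<rho> (N x) * (\<Lambda> * s) = \<Lambda>' * r" using srho by (simp add: \<Lambda>'_def mult_ac)
      finally show ?thesis using sub by blast
    qed
    have comp: "N y \<le> 2 * N x \<and> N x \<le> 2 * N y" if "y \<in> ?b" for y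
      using N_lip[of x y] N_lip[of y x] Ls that commute[of x y] by auto
    have N1: "1 \<le> N x" using Nx by simp
    have ms: "0 < m x s" using emeasure_mball(2)[OF x(1) s] .
    have msL: "m x s \<le> m x (\<Lambda> * s)" by (rule m_mono) (use x s sL in auto)
    define R where "R = \<rho> (N x) powr \<sigma>"
    have R: "0 < R" using rx by (simp add: R_def)
    have nub: "emeasure \<nu> (sph.mball x r) \<le> ennreal (C3 * (R * m x s))" "ennreal (R * m x s) \<le> ennreal C3 * emeasure \<nu> (sph.mball x r)"
      using C3(2)[OF x small1] unfolding R_def s_def by auto
    have gm: "(\<lambda>y. enn_powr (g y) p * indicator ?b y) \<in> borel_measurable \<mu>"
      by (rule admissible_g_measurable[OF ad bG mball_mu])
    have "ennreal R * (\<integral>\<^sup>+y\<in>?b. enn_powr (g y) p \<partial>\<mu>) \<le> ennreal C2 * (\<integral>\<^sup>+y\<in>?b. enn_powr (g y) p \<partial>\<nu>)"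
      using C2(2)[OF N1 mball_subset_mspace comp gm] unfolding R_def by blast
    also have "\<dots> \<le> ennreal C2 * (\<integral>\<^sup>+y\<in>G. enn_powr (g y) p \<partial>\<nu>)"
      using bG by (intro mult_left_mono nn_integral_mono) (auto simp: indicator_def)
    also have "\<dots> \<le> ennreal C2 * (ennreal (T powr p) * ennreal (C3 * (R * m x s)))"
      by (intro mult_left_mono order_trans[OF I] nub) auto
    also have "\<dots> = ennreal R * ennreal (K1 * T powr p * m x s)"
      using C2(1) C3(1) R ms K1 by (simp add: ennreal_mult[symmetric] K1_def mult_ac)
    finally have "(\<integral>\<^sup>+y\<in>?b. enn_powr (g y) p \<partial>\<mu>) \<le> ennreal (K1 * T powr p * m x s)"
      using R by (subst (asm) ennreal_mult_le_mult_iff) auto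
    also have "\<dots> \<le> ennreal ((K1 * T) powr p * m x (\<Lambda> * s))"
    proof (rule ennreal_leI)
      have "K1 powr 1 \<le> K1 powr p" using K1 p by (intro powr_mono) auto
      then have kp: "K1 \<le> K1 powr p" using K1 by simp
      then have "K1 * T powr p \<le> K1 powr p * T powr p" by (intro mult_right_mono) auto
      then have "K1 * T powr p * m x s \<le> (K1 powr p * T powr p) * m x (\<Lambda> * s)"
        using ms msL kp by (intro mult_mono) auto
      then show "K1 * T powr p * m x s \<le> (K1 * T) powr p * m x (\<Lambda> * s)" using K1 T by (simp add: powr_mult)
    qed
    also have "\<dots> = ennreal ((K1 * T) powr p) * emeasure \<mu> ?b"
      using emeasure_mball[OF x(1) sL(2)] by (simp add: ennreal_mult)
    finally have I2: "(\<integral>\<^sup>+y\<in>?b. enn_powr (g y) p \<partial>\<mu>) \<le> ennreal ((K1 * T) powr p) * emeasure \<mu> ?b" .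
    have KT: "0 < K1 * T" using K1 T by simp
    obtain c where c: "(\<integral>\<^sup>+y\<in>mball x s. dev u c y \<partial>\<mu>) \<le> ennreal (C4 * (s * \<rho> (N x)) * (K1 * T) * m x s)"
      using C4(2)[OF ad x(1) s Ls bG KT I2] by blast
    have ssub: "mball x s \<subseteq> ?b" by (rule mball_subset_concentric[OF sL(1)])
    have dm: "(\<lambda>y. dev u c y * indicator (mball x s) y) \<in> borel_measurable \<mu>"
      by (rule dev_measurable[OF admissible_measurable(1)[OF ad] _ mball_mu]) (use ssub bG in blast)
    have comp': "N y \<le> 2 * N x \<and> N x \<le> 2 * N y" if "y \<in> mball x s" for y
      using comp ssub that by blast
    have "sph.mball x r \<subseteq> mball x s" unfolding s_def by (rule sph_ball_subset[OF x small2])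
    then have "(\<integral>\<^sup>+y\<in>sph.mball x r. dev u c y \<partial>\<nu>) \<le> (\<integral>\<^sup>+y\<in>mball x s. dev u c y \<partial>\<nu>)"
      by (intro nn_integral_mono) (auto simp: indicator_def)
    also have "\<dots> \<le> ennreal (C2 * R) * (\<integral>\<^sup>+y\<in>mball x s. dev u c y \<partial>\<mu>)"
      using C2(2)[OF N1 mball_subset_mspace comp' dm] unfolding R_def by blast
    also have "\<dots> \<le> ennreal (C2 * R) * ennreal (C4 * (s * \<rho> (N x)) * (K1 * T) * m x s)"
      by (intro mult_left_mono c) auto
    also have "\<dots> = ennreal (C2 * C4 * (2 * CA\<^sup>2) * K1 * r * T) * ennreal (R * m x s)"
      unfolding srho using C2(1) R C4(1) x(2) K1 T ms by (simp add: ennreal_mult[symmetric] mult_ac)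
    also have "\<dots> \<le> ennreal (C2 * C4 * (2 * CA\<^sup>2) * K1 * r * T) * (ennreal C3 * emeasure \<nu> (sph.mball x r))"
      by (intro mult_left_mono nub) auto
    also have "\<dots> = ennreal (D * r * T) * emeasure \<nu> (sph.mball x r)"
    proof -
      have "ennreal (D * r * T) = ennreal (C2 * C4 * (2 * CA\<^sup>2) * K1 * r * T) * ennreal C3"
        using C2(1) C4(1) x(2) K1 T C3(1) by (simp add: ennreal_mult[symmetric] D_def mult_ac)
      then show ?thesis by (simp add: mult.assoc)
    qed
    also have "\<dots> \<le> ennreal (max 1 D * r * T) * emeasure \<nu> (sph.mball x r)"
      using x(2) T by (intro mult_right_mono ennreal_leI) auto
    finally show "\<exists>c. (\<integral>\<^sup>+y\<in>sph.mball x r. dev u c y \<partial>\<nu>) \<le> ennreal (max 1 D * r * T) * emeasure \<nu> (sph.mball x r)" by blast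
  qed
qed

text \<open>
  The ball is contained in a set \<open>{y. S \<le> N y}\<close> such that \<open>\<kappa> S\<close> is at most a multiple of the
  radius. The larger set \<open>{y. q * S \<le> N y}\<close> that is needed for the inequality there lies in an
  enlarged ball, since its points are within a multiple of the radius of the corkscrew point.
\<close>

lemma large_ball_poincare:
  assumes c0: "0 < c0"
  obtains \<Lambda>' C where "1 \<le> \<Lambda>'" "1 \<le> C"
    "\<And>x r u g G T. \<lbrakk>x \<in> X; 0 < r; c0 * \<kappa> (N x) \<le> r; admissible G u g; sph.mball x (\<Lambda>' * r) \<subseteq> G; 0 < T;
      (\<integral>\<^sup>+y\<in>G. enn_powr (g y) p \<partial>\<nu>) \<le> ennreal (T powr p) * emeasure \<nu> G\<rbrakk> \<Longrightarrow>
      \<exists>c. (\<integral>\<^sup>+y\<in>sph.mball x r. dev u c y \<partial>\<nu>) \<le> ennreal (C * r * T) * emeasure \<nu> G"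
proof -
  obtain q C1 where q: "0 < q" "q \<le> 1" "1 \<le> C1" and tl:
    "\<And>G u g S T. \<lbrakk>admissible G u g; 1 \<le> S; {x \<in> X. q * S \<le> N x} \<subseteq> G; 0 < T;
      (\<integral>\<^sup>+x\<in>G. enn_powr (g x) p \<partial>\<nu>) \<le> ennreal (T powr p) * emeasure \<nu> G\<rbrakk> \<Longrightarrow>
      \<exists>c. (\<integral>\<^sup>+x\<in>{x \<in> X. S \<le> N x}. dev u c x \<partial>\<nu>) \<le> ennreal (C1 * \<kappa> S * T) * emeasure \<nu> G"
    by (rule tail_poincare) blast
  obtain \<epsilon> C2 where e: "0 < \<epsilon>" "\<epsilon> \<le> 1/2" "1 \<le> C2" and lb:
    "\<And>x r. \<lbrakk>x \<in> X; 0 < r; c0 * \<kappa> (N x) \<le> r\<rbrakk> \<Longrightarrow> \<exists>z\<in>X. mball z (\<epsilon> * N z) \<subseteq> sph.mball x r \<and>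
       sph.mball x (2 * r) \<subseteq> {y \<in> X. max 1 (\<epsilon> * N z) \<le> N y} \<and> \<kappa> (N z) \<le> C2 * r \<and>
       emeasure \<nu> {y \<in> X. max 1 (\<epsilon> * N z) \<le> N y} \<le> ennreal C2 * emeasure \<nu> (sph.mball x r)"
    by (rule nu_large_sph_ball[OF c0]) blast
  obtain C3 where C3: "1 \<le> C3" "\<And>S x y. \<lbrakk>x \<in> X; y \<in> X; 1 \<le> S; S \<le> N x; S \<le> N y\<rbrakk> \<Longrightarrow> wdist x y \<le> C3 * \<kappa> S"
    by (rule wdist_le_kappa) blast
  define K where "K = 1 / (\<epsilon> * q)"
  have eq: "0 < \<epsilon> * q" "\<epsilon> * q \<le> 1" using e q mult_mono[of \<epsilon> 1 q 1] by auto
  have K: "1 \<le> K" using eq by (simp add: K_def)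
  obtain C4 where C4: "1 \<le> C4" "\<And>s t. \<lbrakk>1 \<le> s; 1 \<le> t; s \<le> K * t\<rbrakk> \<Longrightarrow> \<kappa> t \<le> C4 * \<kappa> s"
    using kappa_almost_decreasing[OF K] by blast
  define \<Lambda>' where "\<Lambda>' = 1 + C3 * C4 * C2"
  have L1: "1 \<le> \<Lambda>'" using C3(1) C4(1) e(3) by (simp add: \<Lambda>'_def)
  show ?thesis
  proof (rule that[OF L1, of "max 1 (C1 * C4 * C2)"])
    show "1 \<le> max 1 (C1 * C4 * C2)" by simp
    fix x r u g G T
    assume x: "x \<in> X" "0 < r" "c0 * \<kappa> (N x) \<le> r" and ad: "admissible G u g"
      and sub: "sph.mball x (\<Lambda>' * r) \<subseteq> G" and T: "0 < T"
      and I: "(\<integral>\<^sup>+y\<in>G. enn_powr (g y) p \<partial>\<nu>) \<le> ennreal (T powr p) * emeasure \<nu> G"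
    obtain z where z: "z \<in> X" "mball z (\<epsilon> * N z) \<subseteq> sph.mball x r"
      "sph.mball x (2 * r) \<subseteq> {y \<in> X. max 1 (\<epsilon> * N z) \<le> N y}" "\<kappa> (N z) \<le> C2 * r" using lb[OF x] by blast
    have Nz: "1 < N z" by (rule N_gt1[OF z(1)])
    define S where "S = max 1 (\<epsilon> * N z)"
    have S: "1 \<le> S" "\<epsilon> * N z \<le> S" by (auto simp: S_def)
    have "z \<in> mball z (\<epsilon> * N z)" using z(1) e(1) Nz by simp
    then have "z \<in> sph.mball x r" by (rule subsetD[OF z(2)])
    then have xz: "wdist x z < r" by simp
    have NzK: "N z \<le> K * t" if "q * S \<le> t" for t
    proof -
      have "q * (\<epsilon> * N z) \<le> q * S" using S(2) q(1) by (intro mult_left_mono) auto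
      then have "N z * (\<epsilon> * q) \<le> t" using that by (simp add: mult_ac)
      then show ?thesis using eq by (simp add: K_def le_divide_eq)
    qed
    have "{y \<in> X. q * S \<le> N y} \<subseteq> sph.mball x (\<Lambda>' * r)"
    proof
      fix y assume "y \<in> {y \<in> X. q * S \<le> N y}"
      then have y: "y \<in> X" "q * S \<le> N y" by auto
      have m1: "1 \<le> min (N z) (N y)" using Nz N_gt1[OF y(1)] by auto
      have "1 * N z \<le> K * N z" using K Nz by (intro mult_right_mono) auto
      then have "N z \<le> K * min (N z) (N y)" using NzK[OF y(2)] by (auto simp: min_def)
      then have "\<kappa> (min (N z) (N y)) \<le> C4 * \<kappa> (N z)" using Nz m1 by (intro C4(2)) auto
      also have "\<dots> \<le> C4 * (C2 * r)" using z(4) C4(1) by (intro mult_left_mono) auto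
      finally have km: "\<kappa> (min (N z) (N y)) \<le> C4 * (C2 * r)" .
      have "wdist z y \<le> C3 * \<kappa> (min (N z) (N y))" by (rule C3(2)[OF z(1) y(1) m1]) auto
      also have "\<dots> \<le> C3 * (C4 * (C2 * r))" using km C3(1) by (intro mult_left_mono) auto
      finally have "wdist x y < r + C3 * (C4 * (C2 * r))" using sph.triangle[OF x(1) z(1) y(1)] xz by linarith
      then show "y \<in> sph.mball x (\<Lambda>' * r)" using x(1) y(1) by (simp add: \<Lambda>'_def algebra_simps)
    qed
    then have subG: "{y \<in> X. q * S \<le> N y} \<subseteq> G" using sub by blast
    obtain c where c: "(\<integral>\<^sup>+y\<in>{y \<in> X. S \<le> N y}. dev u c y \<partial>\<nu>) \<le> ennreal (C1 * \<kappa> S * T) * emeasure \<nu> G"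
      using tl[OF ad S(1) subG T I] by blast
    have "q * S \<le> S" using q(2) S(1) by simp
    then have "\<kappa> S \<le> C4 * \<kappa> (N z)" using Nz S(1) NzK by (intro C4(2)) auto
    also have "\<dots> \<le> C4 * (C2 * r)" using z(4) C4(1) by (intro mult_left_mono) auto
    finally have kS: "\<kappa> S \<le> C4 * (C2 * r)" .
    have "sph.mball x r \<subseteq> {y \<in> X. S \<le> N y}"
      using z(3) sph.mball_subset_concentric[of r "2 * r" x] x(2) unfolding S_def by (auto simp del: sph.in_mball)
    then have "(\<integral>\<^sup>+y\<in>sph.mball x r. dev u c y \<partial>\<nu>) \<le> (\<integral>\<^sup>+y\<in>{y \<in> X. S \<le> N y}. dev u c y \<partial>\<nu>)"
      by (intro nn_integral_mono) (auto simp: indicator_def)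
    also note c
    also have "ennreal (C1 * \<kappa> S * T) * emeasure \<nu> G \<le> ennreal (max 1 (C1 * C4 * C2) * r * T) * emeasure \<nu> G"
    proof (intro mult_right_mono ennreal_leI)
      have "C1 * \<kappa> S \<le> C1 * (C4 * (C2 * r))" using kS q(3) by (intro mult_left_mono) auto
      also have "\<dots> = (C1 * C4 * C2) * r" by simp
      also have "\<dots> \<le> max 1 (C1 * C4 * C2) * r" using x(2) by (intro mult_right_mono) auto
      finally show "C1 * \<kappa> S \<le> max 1 (C1 * C4 * C2) * r" .
    qed (use T in auto)
    finally show "\<exists>c. (\<integral>\<^sup>+y\<in>sph.mball x r. dev u c y \<partial>\<nu>) \<le> ennreal (max 1 (C1 * C4 * C2) * r * T) * emeasure \<nu> G" by blast
  qed
qed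

text \<open>
  Every ball is small or large. In the estimate for large balls the enlarged ball is compared
  with the ball by doubling.
\<close>

lemma sph_poincare: "supports_poincare X wdist \<nu> p"
proof -
  obtain \<Lambda>1 C1 where s1: "1 \<le> \<Lambda>1" "1 \<le> C1" and small:
    "\<And>x r u g G T. \<lbrakk>x \<in> X; 0 < r; 4 * CA\<^sup>2 * \<Lambda> * r \<le> \<kappa> (N x); admissible G u g; sph.mball x (\<Lambda>1 * r) \<subseteq> G; 0 < T;
      (\<integral>\<^sup>+y\<in>G. enn_powr (g y) p \<partial>\<nu>) \<le> ennreal (T powr p) * emeasure \<nu> (sph.mball x r)\<rbrakk> \<Longrightarrow>
      \<exists>c. (\<integral>\<^sup>+y\<in>sph.mball x r. dev u c y \<partial>\<nu>) \<le> ennreal (C1 * r * T) * emeasure \<nu> (sph.mball x r)"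
    by (rule small_ball_poincare) blast
  have CA4: "0 < 4 * CA\<^sup>2 * \<Lambda>" using CA(1) Lambda by auto
  then have c0: "0 < 1 / (4 * CA\<^sup>2 * \<Lambda>)" by simp
  obtain \<Lambda>2 C2 where s2: "1 \<le> \<Lambda>2" "1 \<le> C2" and large:
    "\<And>x r u g G T. \<lbrakk>x \<in> X; 0 < r; 1 / (4 * CA\<^sup>2 * \<Lambda>) * \<kappa> (N x) \<le> r; admissible G u g; sph.mball x (\<Lambda>2 * r) \<subseteq> G; 0 < T;
      (\<integral>\<^sup>+y\<in>G. enn_powr (g y) p \<partial>\<nu>) \<le> ennreal (T powr p) * emeasure \<nu> G\<rbrakk> \<Longrightarrow>
      \<exists>c. (\<integral>\<^sup>+y\<in>sph.mball x r. dev u c y \<partial>\<nu>) \<le> ennreal (C2 * r * T) * emeasure \<nu> G"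
    by (rule large_ball_poincare[OF c0]) blast
  define \<Lambda>' where "\<Lambda>' = max \<Lambda>1 \<Lambda>2"
  have L: "1 \<le> \<Lambda>'" "\<Lambda>1 \<le> \<Lambda>'" "\<Lambda>2 \<le> \<Lambda>'" using s1 by (auto simp: \<Lambda>'_def)
  obtain C3 where C3: "1 \<le> C3" "\<And>x r. \<lbrakk>x \<in> X; 0 < (r::real)\<rbrakk> \<Longrightarrow>
    emeasure \<nu> (sph.mball x (\<Lambda>' * r)) \<le> ennreal C3 * emeasure \<nu> (sph.mball x r)"
    by (rule nu_ball_scale[OF L(1)]) blast
  define C where "C = max (C1 * C3) (C2 * C3)"
  have "1 * 1 \<le> C1 * C3" using s1(2) C3(1) by (intro mult_mono) auto
  then have C: "0 < C" unfolding C_def by linarith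
  have main: "(\<integral>\<^sup>+x\<in>sph.mball z r. e2ennreal \<bar>u x - ereal (mean_value \<nu> (sph.mball z r) u)\<bar> \<partial>\<nu>) / emeasure \<nu> (sph.mball z r)
     \<le> ennreal (2 * C * r) * enn_powr ((\<integral>\<^sup>+x\<in>sph.mball z (\<Lambda>' * r). enn_powr (g x) p \<partial>\<nu>) / emeasure \<nu> (sph.mball z (\<Lambda>' * r))) (1 / p)"
    if z: "z \<in> X" "0 < r" and L1: "L1_on \<nu> (sph.mball z (\<Lambda>' * r)) u" and ug: "upper_gradient (sph.mball z (\<Lambda>' * r)) wdist u g"
    for z u g and r :: real
  proof -
    let ?G = "sph.mball z (\<Lambda>' * r)" and ?B = "sph.mball z r"
    have ad: "admissible ?G u g"
      using L1 ug sph.openin_mball[of z "\<Lambda>' * r"] unfolding admissible_def sph_topology by simp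
    have "1 * r \<le> \<Lambda>' * r" "\<Lambda>1 * r \<le> \<Lambda>' * r" "\<Lambda>2 * r \<le> \<Lambda>' * r"
      by (intro mult_right_mono; use L z in simp)+
    then have sub: "?B \<subseteq> ?G" "sph.mball z (\<Lambda>1 * r) \<subseteq> ?G" "sph.mball z (\<Lambda>2 * r) \<subseteq> ?G" and Lr: "0 < \<Lambda>' * r"
      using z by (auto intro!: sph.mball_subset_concentric simp del: sph.in_mball)
    have sc: "emeasure \<nu> ?G \<le> ennreal C3 * emeasure \<nu> ?B" by (rule C3(2)[OF z])
    have "(\<integral>\<^sup>+x\<in>?B. e2ennreal \<bar>u x - ereal (mean_value \<nu> ?B u)\<bar> \<partial>\<nu>) / emeasure \<nu> ?B
     \<le> ennreal (2 * (C * r)) * enn_powr ((\<integral>\<^sup>+x\<in>?G. enn_powr (g x) p \<partial>\<nu>) / emeasure \<nu> ?G) (1 / p)"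
    proof (rule poincare_from_constants[OF L1 _ sub(1) nu_sph_ball_pos[OF z] nu_finite_sets nu_sph_ball_pos[OF z(1) Lr] nu_finite_sets _ p])
      show "?B \<in> sets \<nu>" by (simp add: sph_mball_mu)
      show "0 < C * r" using C z by simp
      fix T assume T: "0 < T" and I: "(\<integral>\<^sup>+x\<in>?G. enn_powr (g x) p \<partial>\<nu>) \<le> ennreal (T powr p) * emeasure \<nu> ?G"
      show "\<exists>c. (\<integral>\<^sup>+x\<in>?B. dev u c x \<partial>\<nu>) \<le> ennreal (C * r * T) * emeasure \<nu> ?B"
      proof (cases "4 * CA\<^sup>2 * \<Lambda> * r \<le> \<kappa> (N z)")
        case True
        have CT: "0 < C3 * T" using C3(1) T by simp
        have "C3 powr 1 \<le> C3 powr p" using C3(1) p by (intro powr_mono) auto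
        then have C3p: "T powr p * C3 \<le> (C3 * T) powr p" using C3(1) T by (simp add: powr_mult mult.commute)
        have "(\<integral>\<^sup>+x\<in>?G. enn_powr (g x) p \<partial>\<nu>) \<le> ennreal (T powr p) * (ennreal C3 * emeasure \<nu> ?B)"
          by (intro order_trans[OF I] mult_left_mono sc) auto
        also have "\<dots> = ennreal (T powr p * C3) * emeasure \<nu> ?B" using C3(1) by (simp add: ennreal_mult mult.assoc)
        also have "\<dots> \<le> ennreal ((C3 * T) powr p) * emeasure \<nu> ?B" by (intro mult_right_mono ennreal_leI C3p) auto
        finally obtain c where c: "(\<integral>\<^sup>+x\<in>?B. dev u c x \<partial>\<nu>) \<le> ennreal (C1 * r * (C3 * T)) * emeasure \<nu> ?B"
          using small[OF z True ad sub(2) CT] by blast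
        also have "\<dots> \<le> ennreal (C * r * T) * emeasure \<nu> ?B"
        proof (intro mult_right_mono ennreal_leI)
          have "(C1 * C3) * (r * T) \<le> C * (r * T)" using z(2) T by (intro mult_right_mono) (auto simp: C_def)
          then show "C1 * r * (C3 * T) \<le> C * r * T" by (simp add: mult_ac)
        qed auto
        finally show ?thesis by blast
      next
        case False
        then have "1 / (4 * CA\<^sup>2 * \<Lambda>) * \<kappa> (N z) \<le> r" using CA4 by (simp add: divide_le_eq mult.commute)
        then obtain c where c: "(\<integral>\<^sup>+x\<in>?B. dev u c x \<partial>\<nu>) \<le> ennreal (C2 * r * T) * emeasure \<nu> ?G"
          using large[OF z _ ad sub(3) T I] by blast
        also have "\<dots> \<le> ennreal (C2 * r * T) * (ennreal C3 * emeasure \<nu> ?B)" by (intro mult_left_mono sc) auto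
        also have "\<dots> = ennreal (C2 * r * T * C3) * emeasure \<nu> ?B"
          using s2(2) z(2) T C3(1) by (simp add: ennreal_mult mult.assoc)
        also have "\<dots> \<le> ennreal (C * r * T) * emeasure \<nu> ?B"
        proof (intro mult_right_mono ennreal_leI)
          have "(C2 * C3) * (r * T) \<le> C * (r * T)" using z(2) T by (intro mult_right_mono) (auto simp: C_def)
          then show "C2 * r * T * C3 \<le> C * r * T" by (simp add: mult_ac)
        qed auto
        finally show ?thesis by blast
      qed
    qed
    then show ?thesis by (simp add: mult.assoc)
  qed
  have "\<exists>\<Lambda>\<ge>1. \<forall>z\<in>X. \<forall>r>0. \<forall>u g. L1_on \<nu> (sph.mball z (\<Lambda> * r)) u \<and> upper_gradient (sph.mball z (\<Lambda> * r)) wdist u g \<longrightarrow>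
      (\<integral>\<^sup>+x\<in>sph.mball z r. e2ennreal \<bar>u x - ereal (mean_value \<nu> (sph.mball z r) u)\<bar> \<partial>\<nu>) / emeasure \<nu> (sph.mball z r)
     \<le> ennreal (2 * C * r) * enn_powr ((\<integral>\<^sup>+x\<in>sph.mball z (\<Lambda> * r). enn_powr (g x) p \<partial>\<nu>) / emeasure \<nu> (sph.mball z (\<Lambda> * r))) (1 / p)"
    using L(1) main by blast
  moreover have "0 < 2 * C" using C by simp
  ultimately show ?thesis
    unfolding supports_poincare_def Let_def by blast
qed

end

section \<open>The theorem\<close>

theorem theorem1p1:
  fixes X :: "'a set" and d :: "'a \<Rightarrow> 'a \<Rightarrow> real"
    and b :: "(nat \<Rightarrow> 'a) set" and \<rho> :: "real \<Rightarrow> real"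
  assumes uniform: "uniform_space X d"
    and unbounded: "\<not> Metric_space.mbounded X d X"
    and base: "b \<in> boundary X d"
    and rho_pos: "\<And>t. t > 0 \<Longrightarrow> \<rho> t > 0"
    and rho_borel: "\<rho> \<in> borel_measurable (restrict_space borel {0<..})"
    and rho_int: "set_integrable lborel {0<..} \<rho>"
    and A: "\<exists>C\<^sub>A. \<forall>r s. 0 < r \<and> r \<le> 2 * s + 1 \<and> 0 < s \<and> s \<le> 2 * r + 1 \<longrightarrow> \<rho> r \<le> C\<^sub>A * \<rho> s"
    and B: "\<exists>C\<^sub>B>0. \<forall>r>0. (LBINT t:{r<..}. \<rho> t) \<le> C\<^sub>B * (r + 1) * \<rho> r"
  shows "(Metric_space.mbounded X (sph_dist X d b \<rho>) X \<and>
          completion_adds_one_point X d (sph_dist X d b \<rho>) \<and>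
          uniform_space X (sph_dist X d b \<rho>))
    \<and> (\<forall>\<mu> \<sigma>. borel_regular_measure X d \<mu> \<and> doubling X d \<mu> \<and> \<sigma> > 0 \<and>
          tail_condition X d b \<rho> \<sigma> \<mu> \<longrightarrow>
          doubling X (sph_dist X d b \<rho>) (sph_measure X d b \<rho> \<sigma> \<mu>))
    \<and> (\<forall>p \<mu> \<sigma>. 1 \<le> p \<and> borel_regular_measure X d \<mu> \<and> doubling X d \<mu> \<and>
          supports_poincare X d \<mu> p \<and> \<sigma> > 0 \<and>
          lower_semicontinuous_on {0<..} \<rho> \<and> tail_condition X d b \<rho> \<sigma> \<mu> \<longrightarrow>
          supports_poincare X (sph_dist X d b \<rho>) (sph_measure X d b \<rho> \<sigma> \<mu>) p)"
proof -
  obtain CU where CU: "1 \<le> CU" "\<And>x y. x \<in> X \<Longrightarrow> y \<in> X \<Longrightarrow> \<exists>a b \<gamma>. uniform_curve X d CU a b \<gamma> \<and> \<gamma> a = x \<and> \<gamma> b = y"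
    using uniform by (auto simp: uniform_space_def)
  obtain C where C: "\<And>r s. \<lbrakk>0 < r; r \<le> 2 * s + 1; 0 < s; s \<le> 2 * r + 1\<rbrakk> \<Longrightarrow> \<rho> r \<le> C * \<rho> s"
    using A by blast
  obtain CB where CB: "0 < CB" "\<And>r. r > 0 \<Longrightarrow> (LBINT t:{r<..}. \<rho> t) \<le> CB * (r + 1) * \<rho> r"
    using B by blast
  have CA: "\<rho> r \<le> max 1 C * \<rho> s" if "0 < r" "r \<le> 2 * s + 1" "0 < s" "s \<le> 2 * r + 1" for r s
  proof -
    have "C * \<rho> s \<le> max 1 C * \<rho> s" by (rule mult_right_mono) (use rho_pos[OF that(3)] in auto)
    then show ?thesis using C[OF that] by linarith
  qed
  have M: "Metric_space X d" using uniform by (simp add: uniform_space_def)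
  have S: "sphericalization X d b \<rho> CU (max 1 C) CB"
    using M uniform by (intro sphericalization.intro sphericalization_axioms.intro CU unbounded base rho_pos rho_borel rho_int CA CB)
      (auto simp: uniform_space_def)
  interpret sphericalization X d b \<rho> CU "max 1 C" CB by (rule S)
  have D: "\<exists>CD CT. doubling_sphericalization X d b \<rho> CU (max 1 C) CB \<mu> \<sigma> CD CT"
    if mu: "borel_regular_measure X d \<mu>" "doubling X d \<mu>" "0 < \<sigma>" "tail_condition X d b \<rho> \<sigma> \<mu>" for \<mu> \<sigma>
  proof -
    obtain CD where CD: "1 < CD" "\<And>x r. \<lbrakk>x \<in> X; 0 < r\<rbrakk> \<Longrightarrow> 0 < emeasure \<mu> (mball x (2 * r)) \<and>
       emeasure \<mu> (mball x (2 * r)) \<le> ennreal CD * emeasure \<mu> (mball x r) \<and>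
       ennreal CD * emeasure \<mu> (mball x r) < \<infinity>"
      using mu(2) unfolding doubling_def by blast
    obtain CT where CT: "0 < CT" "\<And>r. 0 < r \<Longrightarrow>
       (\<integral>\<^sup>+x\<in>X - base_ball X d b r. ennreal (\<rho> (base_norm X d b x) powr \<sigma>) \<partial>\<mu>)
       \<le> ennreal (CT * \<rho> r powr \<sigma>) * emeasure \<mu> (base_ball X d b (r + 1))"
      using mu(4) unfolding tail_condition_def by blast
    have "doubling_sphericalization X d b \<rho> CU (max 1 C) CB \<mu> \<sigma> CD CT"
      by (intro doubling_sphericalization.intro doubling_sphericalization_axioms.intro S CD CT)
        (use mu in \<open>auto simp: borel_regular_measure_def\<close>)
    then show ?thesis by blast
  qed
  have P: "supports_poincare X wdist (sph_measure X d b \<rho> \<sigma> \<mu>) p"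
    if mu: "borel_regular_measure X d \<mu>" "doubling X d \<mu>" "0 < \<sigma>" "tail_condition X d b \<rho> \<sigma> \<mu>"
      and p: "1 \<le> p" "supports_poincare X d \<mu> p" for \<mu> \<sigma> p
  proof -
    obtain CD CT where DS: "doubling_sphericalization X d b \<rho> CU (max 1 C) CB \<mu> \<sigma> CD CT" using D[OF mu] by blast
    obtain CP \<Lambda> where CP: "0 < CP" "1 \<le> \<Lambda>" and pi: "\<And>z r u g. \<lbrakk>z \<in> X; 0 < r; L1_on \<mu> (mball z (\<Lambda> * r)) u; upper_gradient (mball z (\<Lambda> * r)) d u g\<rbrakk> \<Longrightarrow>
      (\<integral>\<^sup>+x\<in>mball z r. e2ennreal \<bar>u x - ereal (mean_value \<mu> (mball z r) u)\<bar> \<partial>\<mu>) / emeasure \<mu> (mball z r)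
          \<le> ennreal (CP * r) *
             enn_powr ((\<integral>\<^sup>+x\<in>mball z (\<Lambda> * r). enn_powr (g x) p \<partial>\<mu>) / emeasure \<mu> (mball z (\<Lambda> * r))) (1 / p)"
      using p(2) unfolding supports_poincare_def Let_def by blast
    interpret poincare_sphericalization X d b \<rho> CU "max 1 C" CB \<mu> \<sigma> CD CT p CP \<Lambda>
      by (intro poincare_sphericalization.intro poincare_sphericalization_axioms.intro DS p(1) CP pi)
    show ?thesis by (rule sph_poincare)
  qed
  show ?thesis
    unfolding sph_dist_eq
  proof (intro conjI allI impI)
    show "sph.mbounded X" by (rule sph_bounded)
    show "completion_adds_one_point X d wdist" by (rule completion_sph)
    show "uniform_space X wdist" by (rule sph_uniform)
  next
    fix \<mu> \<sigma> assume "borel_regular_measure X d \<mu> \<and> doubling X d \<mu> \<and> 0 < \<sigma> \<and> tail_condition X d b \<rho> \<sigma> \<mu>"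
    then obtain CD CT where DS: "doubling_sphericalization X d b \<rho> CU (max 1 C) CB \<mu> \<sigma> CD CT" using D by blast
    show "doubling X wdist (sph_measure X d b \<rho> \<sigma> \<mu>)" by (rule doubling_sphericalization.nu_doubling[OF DS])
  next
    fix p \<mu> \<sigma> assume "1 \<le> p \<and> borel_regular_measure X d \<mu> \<and> doubling X d \<mu> \<and> supports_poincare X d \<mu> p \<and> 0 < \<sigma> \<and>
      lower_semicontinuous_on {0<..} \<rho> \<and> tail_condition X d b \<rho> \<sigma> \<mu>"
    then show "supports_poincare X wdist (sph_measure X d b \<rho> \<sigma> \<mu>) p" using P by blast
  qed
qed

end
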